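(* Let $k\geq 2$ be a fixed integer and let $\tau_k(n)$ denote the number of representations of $n$ as an ordered product of $k$ natural numbers. For every $\varepsilon>0$, as $x\to\infty$, \[ S_{\tau_k}(x)=\sum_{1\leq n\leq x}\tau_k\left(\left[\frac{x}{n}\right]\right)=\left(\sum_{n=1}^{\infty}\frac{\tau_k(n)}{n(n+1)}\right)x+O\left(x^{7/15+1/195+\varepsilon}\right), \] where the implied constant may depend on $k$ and $\varepsilon$.
   Context: $[t]$ denotes the integer part of the real number $t$. $\tau_k(n)=\#\{(n_1,\dots,n_k)\in\mathbb{N}^k: n_1n_2\cdots n_k=n\}$. *)

theory Defs
  imports "HOL-Analysis.Analysis" "HOL-Library.Landau_Symbols"
begin

text \<open>Natural numbers start at 1 here, hence the positivity condition on the factors;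
  in particular \<open>tau k 0 = 0\<close>. Ordered \<open>k\<close>-tuples are lists of length \<open>k\<close>.\<close>

definition tau :: "nat \<Rightarrow> nat \<Rightarrow> nat" where
  "tau k n = card {ns :: nat list. length ns = k \<and> (\<forall>m\<in>set ns. 1 \<le> m) \<and> prod_list ns = n}"

definition floor_sum :: "(nat \<Rightarrow> real) \<Rightarrow> real \<Rightarrow> real" where
  "floor_sum f x = (\<Sum>n | 1 \<le> n \<and> real n \<le> x. f (nat \<lfloor>x / real n\<rfloor>))"

end

theory Submission
  imports Defs "HOL-Computational_Algebra.Primes"
begin

text \<open>Write \<open>y = x\<^bsup>1/195\<^esup>\<close> and \<open>\<psi>(t) = {t} - 1/2\<close>. The values \<open>[x/n] > y\<^bsup>103\<^esup>\<close>
  come from \<open>n < y\<^bsup>92\<^esup>\<close> only; counting the \<open>n\<close> with \<open>[x/n] = d\<close> for the other \<open>d\<close> leaves the series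
  and the sums of \<open>\<tau>\<^sub>k(d) \<psi>(x/(d + \<delta>))\<close>, \<open>\<delta> = 0, 1\<close>. The tuples with
  product \<open>d\<close> are split into dyadic boxes, of size \<open>D\<close>, and boxes with \<open>D < y\<^bsup>92\<^esup>\<close> are bounded
  trivially. By Erdos--Turan it remains to bound the sums over a box of
  \<open>e(h x/(n\<^sub>1 \<dots> n\<^sub>k + \<delta>))\<close> for \<open>h \<le> D / y\<^bsup>92\<^esup>\<close>. Either the variables can be grouped into two
  factors of size at least \<open>y\<^bsup>22\<^esup>\<close> each (type II), or a single variable has size at least
  \<open>y\<^bsup>70\<^esup>\<close> (type I). Type I sums are bounded by van der Corput's second derivative test. A type II
  sum with \<open>D \<le> y\<^bsup>102\<^esup>\<close> or with one factor at least \<open>y\<^bsup>55\<^esup>\<close> is treated by Cauchy-Schwarz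
  over the pairs \<open>(h, m)\<close> with nearly equal \<open>h/m\<close>; otherwise both factors have size at least
  \<open>y\<^bsup>47\<^esup>\<close>, and the method of Fouvry and Iwaniec, based on the double large sieve, applies.\<close>

section \<open>Exponential sums\<close>

text \<open>As 7/15 + 1/195 = 92/195, the target error is y^92 up to powers of divisor functions.
  For a box of size D put \<sigma> = D/y^92. Erdos-Turan needs about \<sigma> frequencies, and each
  exponential sum must beat the trivial bound by a factor \<sigma>, which is at most y^11.
  Cauchy-Schwarz squares this, so the diagonal asks for a parameter Q of size \<sigma>^2; hence both
  factors of a type II sum should reach y^22, and 70 = 92 - 22 is what remains for a type I
  variable. With this Q the main condition of the clustering method is x \<sigma>^6 \<le> D^2 N,
  that is D^4 \<le> y^357 N, where N is the larger factor. As N^2 \<ge> D, it holds up to D = y^102,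
  with equality at D = N^2; at D = y^103 it needs N \<ge> y^55, again with equality. The obstacle is
  thus the range y^102 < D \<le> y^103 with balanced factors: there the saving must come from the
  spacing of the differences 1/m - 1/m', which becomes a quadratic counting problem. The shift
  \<delta> spoils the monomial form of the phase, and in both type II methods its effect is bounded
  separately.\<close>

definition ee :: "real \<Rightarrow> complex" where
  "ee t = cis (2 * pi * t)"

lemma ee_add: "ee (s + t) = ee s * ee t"
  by (simp add: ee_def cis_mult ring_distribs)

lemma ee_diff: "ee (s - t) = ee s * cnj (ee t)"
  by (simp add: ee_def cis_cnj cis_mult ring_distribs)

lemma ee_0 [simp]: "ee 0 = 1"
  by (simp add: ee_def)

lemma norm_ee [simp]: "norm (ee t) = 1"
  by (simp add: ee_def)

lemma ee_nonzero [simp]: "ee t \<noteq> 0"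
  by (metis norm_ee norm_zero zero_neq_one)

lemma ee_Ints: "t \<in> \<int> \<Longrightarrow> ee t = 1"
  by (simp add: ee_def)

lemma ee_minus: "ee (- t) = cnj (ee t)"
  by (simp add: ee_def cis_cnj)

lemma ee_of_nat_mult: "ee (real n * t) = ee t ^ n"
  by (simp add: ee_def Complex.DeMoivre algebra_simps)

lemma norm_ee_minus_1: "norm (ee t - 1) = 2 * \<bar>sin (pi * t)\<bar>"
proof -
  have "(norm (ee t - 1))\<^sup>2 = (cos (2 * pi * t) - 1)\<^sup>2 + (sin (2 * pi * t))\<^sup>2"
    by (simp add: ee_def cmod_power2)
  also have "\<dots> = 2 - 2 * cos (2 * (pi * t))"
    using sin_cos_squared_add[of "2 * pi * t"] by (simp add: power2_eq_square algebra_simps)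
  also have "\<dots> = (2 * \<bar>sin (pi * t)\<bar>)\<^sup>2"
    by (simp add: cos_double_sin power_mult_distrib)
  finally show ?thesis
    by (rule power2_eq_imp_eq) auto
qed

lemma norm_ee_diff: "norm (ee s - ee t) \<le> 2 * pi * \<bar>s - t\<bar>"
proof -
  have "ee s - ee t = ee t * (ee (s - t) - 1)"
    using ee_add[of t "s - t"] by (simp add: algebra_simps)
  hence "norm (ee s - ee t) = 2 * \<bar>sin (pi * (s - t))\<bar>"
    by (simp add: norm_mult norm_ee_minus_1)
  also have "\<dots> \<le> 2 * \<bar>pi * (s - t)\<bar>"
    using abs_sin_x_le_abs_x[of "pi * (s - t)"] by simp
  finally show ?thesis by (simp add: abs_mult)
qed

text \<open>The cubic Taylor bound gives sin t \<ge> t - t^3/6, which is at least t/3 for t = pi z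
  \<le> 2; then pi > 3 finishes.\<close>

lemma sin_pi_ge:
  assumes "0 \<le> z" "z \<le> 1/2"
  shows "z \<le> sin (pi * z)"
proof -
  define t where "t = pi * z"
  have t: "0 \<le> t" "t \<le> pi / 2"
    using assms by (auto simp: t_def)
  have pi4: "pi < 4" by (rule pi_less_4)
  have "t \<le> 2" using t pi4 by simp
  have "\<bar>sin t - (\<Sum>m<3. sin_coeff m * t ^ m)\<bar> \<le> inverse (fact 3) * \<bar>t\<bar> ^ 3"
    by (rule Maclaurin_sin_bound)
  hence "\<bar>sin t - t\<bar> \<le> t ^ 3 / 6"
    using t by (simp add: eval_nat_numeral sin_coeff_def fact_numeral)
  hence "sin t \<ge> t - t ^ 3 / 6" by linarith
  moreover have "t ^ 3 \<le> 4 * t"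
    using mult_mono[of t 2 t 2] \<open>t \<le> 2\<close> t by (simp add: power3_eq_cube mult_right_mono)
  moreover have "z \<le> t / 3"
    unfolding t_def using mult_right_mono[of 3 pi z] pi_gt3 assms by simp
  ultimately show ?thesis by (simp add: t_def)
qed

lemma norm_ee_minus_1_ge:
  assumes "\<bar>z\<bar> \<le> 1/2"
  shows "2 * \<bar>z\<bar> \<le> norm (ee z - 1)"
proof -
  have "\<bar>z\<bar> \<le> \<bar>sin (pi * z)\<bar>"
    using sin_pi_ge[of "\<bar>z\<bar>"] assms by (cases "z \<ge> 0") auto
  thus ?thesis by (simp add: norm_ee_minus_1)
qed

text \<open>Since \<open>1 / (1 - ee t) = 1/2 + (\<i>/2) cot (\<pi> t)\<close>, the sequence of these
  numbers runs monotonically along a vertical line.\<close>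

lemma inverse_one_minus_ee:
  assumes "sin (pi * t) \<noteq> 0"
  shows "1 / (1 - ee t) = Complex (1/2) (cos (pi * t) / (2 * sin (pi * t)))"
proof -
  have e: "1 - ee t = Complex (2 * (sin (pi * t))\<^sup>2) (- 2 * sin (pi * t) * cos (pi * t))"
    by (simp add: complex_eq_iff ee_def cos_double_sin[of "pi * t", simplified]
        sin_double[of "pi * t", simplified] mult.assoc)
  have "(1 - ee t) * Complex (1/2) (cos (pi * t) / (2 * sin (pi * t))) = 1"
    unfolding e using assms sin_cos_squared_add[of "pi * t"]
    by (simp add: complex_eq_iff field_simps power2_eq_square)
  thus ?thesis
    by (metis mult_zero_left nonzero_mult_div_cancel_left zero_neq_one)
qed

text \<open>Partial summation with \<open>w n = 1 / (1 - ee (g n))\<close>, where \<open>g n\<close>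
  is the first difference of \<open>f\<close> less the integer \<open>k\<close>. The real part of
  \<open>w\<close> is constant and its imaginary part is monotone because the differences increase,
  so the total variation of \<open>w\<close> telescopes to two boundary values, each O(1/\<theta>).
  The differences are controlled for all n < b, so the value \<open>f b\<close> just beyond the
  summation range enters as well.\<close>

lemma Kusmin_Landau:
  fixes f :: "nat \<Rightarrow> real" and k :: int
  assumes \<theta>: "0 < \<theta>" "\<theta> \<le> 1/2" and "a < b"
    and mono: "\<And>n. a \<le> n \<Longrightarrow> Suc n < b \<Longrightarrow> f (Suc n) - f n \<le> f (n + 2) - f (Suc n)"
    and lo: "\<And>n. a \<le> n \<Longrightarrow> n < b \<Longrightarrow> of_int k + \<theta> \<le> f (Suc n) - f n"
    and hi: "\<And>n. a \<le> n \<Longrightarrow> n < b \<Longrightarrow> f (Suc n) - f n \<le> of_int k + 1 - \<theta>"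
  shows "norm (\<Sum>n=a..<b. ee (f n)) \<le> 3 / \<theta>"
proof -
  define g where "g = (\<lambda>n. f (Suc n) - f n - of_int k)"
  define c where "c = (\<lambda>n. cos (pi * g n) / (2 * sin (pi * g n)))"
  define w where "w = (\<lambda>n. Complex (1/2) (c n))"
  have g: "\<theta> \<le> g n" "g n \<le> 1 - \<theta>" if "a \<le> n" "n < b" for n
    using lo[OF that] hi[OF that] by (auto simp: g_def)
  have sin_g: "\<theta> \<le> sin (pi * g n)" if "a \<le> n" "n < b" for n
  proof (cases "g n \<le> 1/2")
    case True
    thus ?thesis using sin_pi_ge[of "g n"] g[OF that] \<theta> by simp
  next
    case False
    have "sin (pi * g n) = sin (pi * (1 - g n))"
      by (metis mult.right_neutral right_diff_distrib sin_pi_minus)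
    moreover have "1 - g n \<le> sin (pi * (1 - g n))"
      using sin_pi_ge[of "1 - g n"] g[OF that] False \<theta> by simp
    ultimately show ?thesis using g[OF that] by linarith
  qed
  have c_bound: "\<bar>c n\<bar> \<le> 1 / (2 * \<theta>)" if "a \<le> n" "n < b" for n
  proof -
    have "\<bar>c n\<bar> = \<bar>cos (pi * g n)\<bar> / (2 * sin (pi * g n))"
      using sin_g[OF that] \<theta> by (simp add: c_def abs_mult)
    also have "\<dots> \<le> 1 / (2 * \<theta>)"
      using sin_g[OF that] \<theta> by (intro frac_le) auto
    finally show ?thesis .
  qed
  \<comment> \<open>The cotangent decreases: cross-multiplied, the claim is
    \<open>sin (?t - ?s) \<ge> 0\<close>.\<close>
  have c_mono: "c (Suc n) \<le> c n" if "a \<le> n" "Suc n < b" for n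
  proof -
    let ?s = "pi * g n" and ?t = "pi * g (Suc n)"
    have pos: "sin ?s > 0" "sin ?t > 0"
      using sin_g[of n] sin_g[of "Suc n"] that \<theta> by auto
    have "g n \<le> g (Suc n)" using mono[of n] that by (simp add: g_def)
    moreover have "g (Suc n) \<le> 1" "g n \<ge> 0"
      using g[of n] g[of "Suc n"] that \<theta> by auto
    ultimately have "0 \<le> ?t - ?s" "?t - ?s \<le> pi"
      using mult_left_mono[of "g n" "g (Suc n)" pi] mult_left_mono[of "g (Suc n) - g n" 1 pi]
      by (auto simp: algebra_simps)
    hence "0 \<le> sin (?t - ?s)" by (rule sin_ge_zero)
    hence "cos ?t * sin ?s \<le> cos ?s * sin ?t" by (simp add: sin_diff mult.commute)
    thus ?thesis unfolding c_def using pos by (simp add: divide_simps mult.commute)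
  qed
  have ee_w: "ee (f n) = (ee (f n) - ee (f (Suc n))) * w n" if "a \<le> n" "n < b" for n
  proof -
    have s: "sin (pi * g n) \<noteq> 0" using sin_g[OF that] \<theta> by auto
    hence "w n = 1 / (1 - ee (g n))"
      by (simp add: w_def c_def inverse_one_minus_ee)
    moreover have "1 - ee (g n) \<noteq> 0"
      using s norm_ee_minus_1[of "g n"] by (auto simp: norm_minus_commute)
    moreover have "ee (f (Suc n)) = ee (f n) * ee (g n)"
    proof -
      have "ee (f (Suc n)) = ee (f n + g n + of_int k)" by (simp add: g_def)
      thus ?thesis by (simp add: ee_add ee_Ints)
    qed
    ultimately have w1: "w n * (1 - ee (g n)) = 1"
      and f1: "ee (f (Suc n)) = ee (f n) * ee (g n)" by auto
    have "(ee (f n) - ee (f (Suc n))) * w n = ee (f n) * (w n * (1 - ee (g n)))"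
      by (simp add: f1 algebra_simps)
    thus ?thesis by (simp add: w1)
  qed
  have abel: "(\<Sum>n=a..<a+m. (ee (f n) - ee (f (Suc n))) * w n)
      = ee (f a) * w a - ee (f (a+m)) * w (a+m-1)
        + (\<Sum>n=a..<a+m-1. ee (f (Suc n)) * (w (Suc n) - w n))" if "m \<ge> 1" for m
    using that
  proof (induction m rule: dec_induct)
    case (step m)
    then obtain j where j: "m = Suc j" by (cases m) auto
    show ?case using step.IH by (simp add: j algebra_simps)
  qed (simp add: algebra_simps)
  obtain m where m: "b = a + m" "m \<ge> 1"
    using \<open>a < b\<close> by (metis less_imp_Suc_add add_Suc_right le_add1 plus_1_eq_Suc)
  have w_bound: "norm (w n) \<le> 1/2 + 1/(2*\<theta>)" if "a \<le> n" "n < b" for n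
    using c_bound[OF that] cmod_le[of "w n"] by (simp add: w_def)
  have "(\<Sum>n=a..<b. ee (f n)) = (\<Sum>n=a..<b. (ee (f n) - ee (f (Suc n))) * w n)"
    by (intro sum.cong) (use ee_w in auto)
  also have "\<dots> = ee (f a) * w a - ee (f b) * w (b-1)
        + (\<Sum>n=a..<b-1. ee (f (Suc n)) * (w (Suc n) - w n))"
    using abel[OF m(2)] m by simp
  also have "norm \<dots> \<le> norm (w a) + norm (w (b-1)) + (\<Sum>n=a..<b-1. norm (w (Suc n) - w n))"
    by (intro norm_triangle_mono norm_triangle_ineq4[THEN order_trans] sum_norm_le)
       (auto simp: norm_mult)
  also have "(\<Sum>n=a..<b-1. norm (w (Suc n) - w n)) = (\<Sum>n=a..<b-1. c n - c (Suc n))"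
  proof (intro sum.cong refl)
    fix n assume "n \<in> {a..<b-1}"
    hence "c (Suc n) \<le> c n" by (intro c_mono) auto
    moreover have "w (Suc n) - w n = \<i> * of_real (c (Suc n) - c n)"
      by (simp add: w_def complex_eq_iff)
    ultimately show "norm (w (Suc n) - w n) = c n - c (Suc n)"
      by (simp add: norm_mult del: of_real_diff)
  qed
  also have "\<dots> = c a - c (b-1)"
    using sum_Suc_diff'[of a "b-1" "\<lambda>n. - c n"] \<open>a < b\<close> by simp
  also have "\<dots> \<le> 1 / \<theta>"
  proof -
    have "c a \<le> 1 / (2 * \<theta>)" "- c (b-1) \<le> 1 / (2 * \<theta>)"
      using c_bound[of a] c_bound[of "b-1"] \<open>a < b\<close> by (auto simp: abs_le_iff)
    moreover have "1 / \<theta> = 1 / (2 * \<theta>) + 1 / (2 * \<theta>)" using \<theta> by simp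
    ultimately show ?thesis by linarith
  qed
  also have "norm (w a) + norm (w (b-1)) + 1/\<theta> \<le> 1 + 2 / \<theta>"
  proof -
    have "norm (w a) \<le> 1/2 + 1/(2*\<theta>)" "norm (w (b-1)) \<le> 1/2 + 1/(2*\<theta>)"
      using w_bound[of a] w_bound[of "b-1"] \<open>a < b\<close> by auto
    moreover have "1 / \<theta> = 1 / (2 * \<theta>) + 1 / (2 * \<theta>)" "2 / \<theta> = 2 * (1 / \<theta>)" using \<theta> by auto
    ultimately show ?thesis by linarith
  qed
  finally have "norm (\<Sum>n=a..<b. ee (f n)) \<le> 1 + 2 / \<theta>" by simp
  also have "\<dots> \<le> 3 / \<theta>"
    using \<theta> by (simp add: field_simps)
  finally show ?thesis .
qed

text \<open>Sort the n by the integer part of the first difference g. Since g grows by at least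
  \<mu> per step, only O(\<theta>/\<mu>) indices of a block have g within \<theta> of an integer; on
  the remaining stretch Kusmin-Landau gives 3/\<theta>. The choice \<theta> = sqrt \<mu> equalises
  the two, and the upper bound C \<mu> limits the number of blocks.\<close>

lemma vdC_second_difference:
  fixes f :: "nat \<Rightarrow> real"
  assumes \<mu>: "0 < \<mu>" and C: "1 \<le> C" and "a \<le> b"
    and lo: "\<And>n. a \<le> n \<Longrightarrow> n < b \<Longrightarrow> \<mu> \<le> f (n + 2) - 2 * f (n + 1) + f n"
    and hi: "\<And>n. a \<le> n \<Longrightarrow> n < b \<Longrightarrow> f (n + 2) - 2 * f (n + 1) + f n \<le> C * \<mu>"
  shows "norm (\<Sum>n=a..<b. ee (f n)) \<le> 20 * C * (real (b - a) * sqrt \<mu> + 1 / sqrt \<mu>)"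
proof (cases "\<mu> \<le> 1/4 \<and> a < b")
  \<comment> \<open>Either the range is empty or \<mu> > 1/4, and then the claimed bound exceeds the
    number of terms.\<close>
  case False
  have "norm (\<Sum>n=a..<b. ee (f n)) \<le> (\<Sum>n=a..<b. 1)"
    by (intro sum_norm_le) simp
  also have "\<dots> = real (b - a)" by simp
  also have "\<dots> \<le> 20 * C * (real (b - a) * sqrt \<mu> + 1 / sqrt \<mu>)"
  proof (cases "a < b")
    case True
    hence "sqrt \<mu> \<ge> 1/2" using False real_sqrt_le_mono[of "1/4" \<mu>] by (simp add: real_sqrt_divide)
    hence "real (b - a) * (1/2) \<le> real (b - a) * sqrt \<mu>"
      by (intro mult_left_mono) auto
    moreover have "20 * 1 * (real (b - a) * sqrt \<mu> + 1 / sqrt \<mu>)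
        \<le> 20 * C * (real (b - a) * sqrt \<mu> + 1 / sqrt \<mu>)"
      using C \<mu> by (intro mult_right_mono) auto
    moreover have "0 \<le> 1 / sqrt \<mu>" "0 \<le> real (b - a)" using \<mu> by auto
    hence "real (b - a) \<le> 20 * 1 * (real (b - a) * sqrt \<mu> + 1 / sqrt \<mu>)"
      using calculation(1) unfolding distrib_left by linarith
    ultimately show ?thesis by linarith
  qed (use \<mu> C in auto)
  finally show ?thesis .
next
  case True
  define \<theta> where "\<theta> = sqrt \<mu>"
  have \<theta>: "0 < \<theta>" "\<theta> \<le> 1/2" "\<theta> * \<theta> = \<mu>"
    using True \<mu> real_sqrt_le_mono[of \<mu> "1/4"] by (auto simp: \<theta>_def real_sqrt_divide)
  define g where "g = (\<lambda>n. f (Suc n) - f n)"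
  have g_step: "g n + \<mu> \<le> g (Suc n)" "g (Suc n) \<le> g n + C * \<mu>" if "a \<le> n" "n < b" for n
    using lo[OF that] hi[OF that] by (auto simp: g_def)
  have g_lo: "real (n - m) * \<mu> \<le> g n - g m" if "a \<le> m" "m \<le> n" "n \<le> b" for m n
    using that(2,3)
  proof (induction n rule: dec_induct)
    case (step n)
    have "real (Suc n - m) * \<mu> = real (n - m) * \<mu> + \<mu>"
      using step by (simp add: Suc_diff_le algebra_simps)
    thus ?case using step g_step(1)[of n] that by auto
  qed simp
  have g_hi: "g n - g a \<le> real (n - a) * (C * \<mu>)" if "a \<le> n" "n \<le> b" for n
    using that
  proof (induction n rule: dec_induct)
    case (step n)
    have "real (Suc n - a) * (C * \<mu>) = real (n - a) * (C * \<mu>) + C * \<mu>"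
      using step by (simp add: Suc_diff_le algebra_simps)
    thus ?case using step g_step(2)[of n] by auto
  qed simp
  have g_mono: "g m \<le> g n" if "a \<le> m" "m \<le> n" "n \<le> b" for m n
    using g_lo[OF that] \<mu> by (smt (verit) mult_nonneg_nonneg of_nat_0_le_iff)
  have few: "real (card S) \<le> l / \<mu> + 1"
    if S: "S \<subseteq> {a..<b}" "S \<subseteq> {n. z \<le> g n \<and> g n \<le> z + l}" and "l \<ge> 0" for S z l
  proof (cases "S = {}")
    case False
    have fin: "finite S" using S(1) finite_subset by blast
    have M: "Min S \<in> S" "Max S \<in> S" "Min S \<le> Max S"
      using fin False by auto
    have "real (Max S - Min S) * \<mu> \<le> g (Max S) - g (Min S)"
      using M S(1) by (intro g_lo) auto
    also have "\<dots> \<le> l" using subsetD[OF S(2) M(1)] subsetD[OF S(2) M(2)] by simp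
    finally have "real (Max S - Min S) \<le> l / \<mu>" using \<mu> by (simp add: field_simps)
    moreover have "card S \<le> card {Min S..Max S}"
      using fin by (intro card_mono) auto
    hence "real (card S) \<le> real (Max S - Min S) + 1"
      using M(3) by simp
    ultimately show ?thesis by linarith
  qed (use \<mu> \<open>l \<ge> 0\<close> in auto)
  have block: "norm (\<Sum>n | n \<in> {a..<b} \<and> \<lfloor>g n\<rfloor> = k. ee (f n)) \<le> 7 / \<theta>" for k
  proof -
    define S where "S = {n. n \<in> {a..<b} \<and> \<lfloor>g n\<rfloor> = k}"
    define S1 where "S1 = {n\<in>S. g n < of_int k + \<theta>}"
    define S2 where "S2 = {n\<in>S. of_int k + \<theta> \<le> g n \<and> g n \<le> of_int k + 1 - \<theta>}"
    define S3 where "S3 = {n\<in>S. \<not> g n < of_int k + \<theta> \<and> \<not> g n \<le> of_int k + 1 - \<theta>}"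
    have fin: "finite S" by (simp add: S_def)
    have k: "of_int k \<le> g n \<and> g n < of_int k + 1" if "n \<in> S" for n
      using that unfolding S_def by (auto simp: floor_eq_iff)
    have split: "(\<Sum>n\<in>S. ee (f n)) = (\<Sum>n\<in>S1. ee (f n)) + (\<Sum>n\<in>S2. ee (f n)) + (\<Sum>n\<in>S3. ee (f n))"
    proof -
      have "S = S1 \<union> S2 \<union> S3" "S1 \<inter> S2 = {}" "(S1 \<union> S2) \<inter> S3 = {}"
        unfolding S1_def S2_def S3_def by auto
      moreover have "finite S1" "finite S2" "finite S3"
        using fin unfolding S1_def S2_def S3_def by auto
      ultimately show ?thesis by (simp add: sum.union_disjoint)
    qed
    have triv: "norm (\<Sum>n\<in>T. ee (f n)) \<le> real (card T)" for T
      using sum_norm_le[of T "\<lambda>n. ee (f n)" "\<lambda>_. 1"] by simp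
    have \<theta>\<mu>: "\<theta> / \<mu> = 1 / \<theta>" "1 \<le> 1 / \<theta>"
      using \<theta> by (auto simp: \<theta>(3)[symmetric] field_simps)
    have "S1 \<subseteq> {a..<b}" "S1 \<subseteq> {n. of_int k \<le> g n \<and> g n \<le> of_int k + \<theta>}"
      using k unfolding S1_def S_def by force+
    from few[OF this] have "real (card S1) \<le> \<theta> / \<mu> + 1" using \<theta> by simp
    hence 1: "norm (\<Sum>n\<in>S1. ee (f n)) \<le> 2 / \<theta>"
      using triv[of S1] \<theta>\<mu> by (simp add: field_simps)
    have "S3 \<subseteq> {a..<b}" "S3 \<subseteq> {n. of_int k + 1 - \<theta> \<le> g n \<and> g n \<le> of_int k + 1 - \<theta> + \<theta>}"
      using k unfolding S3_def S_def by force+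
    from few[OF this] have "real (card S3) \<le> \<theta> / \<mu> + 1" using \<theta> by simp
    hence 3: "norm (\<Sum>n\<in>S3. ee (f n)) \<le> 2 / \<theta>"
      using triv[of S3] \<theta>\<mu> by (simp add: field_simps)
    have 2: "norm (\<Sum>n\<in>S2. ee (f n)) \<le> 3 / \<theta>"
    proof (cases "S2 = {}")
      case False
      have fin2: "finite S2" using fin by (simp add: S2_def)
      let ?l = "Min S2" and ?r = "Max S2"
      have lr: "?l \<in> S2" "?r \<in> S2" "?l \<le> ?r" using fin2 False by auto
      have lrab: "a \<le> ?l" "?r < b" using lr unfolding S2_def S_def by auto
      \<comment> \<open>By monotonicity of \<open>g\<close> the set \<open>S2\<close> has no gaps,
        so Kusmin-Landau applies to it as an interval.\<close>
      have in_S2: "n \<in> S2" if "?l \<le> n" "n \<le> ?r" for n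
      proof -
        have gg: "g ?l \<le> g n" "g n \<le> g ?r" using that lrab by (auto intro!: g_mono)
        hence b: "of_int k + \<theta> \<le> g n" "g n \<le> of_int k + 1 - \<theta>"
          using lr unfolding S2_def by auto
        moreover from b \<theta> have "\<lfloor>g n\<rfloor> = k" by (simp add: floor_eq_iff)
        ultimately show ?thesis using that lrab unfolding S2_def S_def by auto
      qed
      have "S2 = {?l..<Suc ?r}" using in_S2 fin2 by (auto simp: less_Suc_eq_le)
      moreover have "norm (\<Sum>n=?l..<Suc ?r. ee (f n)) \<le> 3 / \<theta>"
      proof (rule Kusmin_Landau[where k = k])
        fix n assume n: "?l \<le> n" "Suc n < Suc ?r"
        show "f (Suc n) - f n \<le> f (n + 2) - f (Suc n)"
          using g_mono[of n "Suc n"] n lrab by (simp add: g_def)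
      next
        fix n assume n: "?l \<le> n" "n < Suc ?r"
        hence "n \<in> S2" using in_S2 by auto
        thus "of_int k + \<theta> \<le> f (Suc n) - f n" "f (Suc n) - f n \<le> of_int k + 1 - \<theta>"
          by (auto simp: S2_def g_def)
      qed (use \<theta> lr in auto)
      ultimately show ?thesis by simp
    qed (use \<theta> in auto)
    have "norm (\<Sum>n\<in>S. ee (f n)) \<le> 2/\<theta> + 3/\<theta> + 2/\<theta>"
      unfolding split using 1 2 3 by (intro norm_triangle_mono) auto
    thus ?thesis by (simp add: S_def field_simps)
  qed
  define Ks where "Ks = {\<lfloor>g a\<rfloor>..\<lfloor>g b\<rfloor>}"
  have "(\<Sum>n=a..<b. ee (f n)) = (\<Sum>k\<in>Ks. \<Sum>n | n \<in> {a..<b} \<and> \<lfloor>g n\<rfloor> = k. ee (f n))"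
    unfolding Ks_def
    by (rule sum.group[symmetric]) (auto intro!: floor_mono g_mono)
  also have "norm \<dots> \<le> (\<Sum>k\<in>Ks. 7 / \<theta>)"
    by (intro sum_norm_le block)
  also have "\<dots> = real (card Ks) * (7 / \<theta>)" by simp
  also have "real (card Ks) \<le> C * \<mu> * real (b - a) + 2"
  proof -
    have "real (card Ks) = of_int (\<lfloor>g b\<rfloor> + 1 - \<lfloor>g a\<rfloor>)"
      using floor_mono[OF g_mono[of a b]] True unfolding Ks_def by simp
    also have "\<dots> \<le> g b - g a + 2" by linarith
    finally show ?thesis using g_hi[of b] True by (simp add: mult.commute mult.left_commute)
  qed
  hence "real (card Ks) * (7 / \<theta>) \<le> (C * \<mu> * real (b - a) + 2) * (7 / \<theta>)"
    using \<theta> by (intro mult_right_mono) auto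
  also have "\<dots> = 7 * C * real (b - a) * \<theta> + 14 / \<theta>"
    using \<theta> by (simp add: \<theta>(3)[symmetric] field_simps)
  also have "\<dots> \<le> 20 * C * (real (b - a) * \<theta>) + 20 * C * (1 / \<theta>)"
  proof (intro add_mono)
    show "14 / \<theta> \<le> 20 * C * (1 / \<theta>)"
      using C \<theta> by (simp add: field_simps)
    show "7 * C * real (b - a) * \<theta> \<le> 20 * C * (real (b - a) * \<theta>)"
      using C \<theta> by (simp add: mult.assoc mult_right_mono)
  qed
  finally show ?thesis by (simp add: \<theta>_def ring_distribs)
qed

section \<open>The double large sieve\<close>

lemma ee_eq_1_iff: "ee t = 1 \<longleftrightarrow> t \<in> \<int>"
proof
  assume "ee t = 1"
  hence "sin (pi * t) = 0" using norm_ee_minus_1[of t] by simp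
  then obtain i where "pi * t = of_int i * pi" by (auto simp: sin_zero_iff_int2)
  hence "t = of_int i" by simp
  thus "t \<in> \<int>" by simp
qed (rule ee_Ints)

text \<open>Shifting the complete residue system by one multiplies the sum by
  \<open>ee (k / G)\<close>, which differs from 1 unless \<open>G\<close> divides
  \<open>k\<close>.\<close>

lemma ee_orthogonality:
  fixes lo k :: int
  assumes "G > 0"
  shows "(\<Sum>c\<in>{lo..<lo + int G}. ee (of_int (c * k) / real G)) = (if int G dvd k then of_nat G else 0)"
proof (cases "int G dvd k")
  case True
  then obtain q where "k = int G * q" by blast
  hence "ee (of_int (c * k) / real G) = 1" for c
    using assms by (intro ee_Ints) (simp add: Ints_mult)
  thus ?thesis using True by simp
next
  case False
  define F where "F = (\<lambda>c::int. ee (of_int (c * k) / real G))"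
  have F: "F (c + 1) = ee (of_int k / real G) * F c" for c
    using assms by (simp add: F_def flip: ee_add) (simp add: field_simps)
  have per: "F (c + int G) = F c" for c
  proof -
    have "of_int ((c + int G) * k) / real G = of_int (c * k) / real G + of_int k"
      using assms by (simp add: field_simps)
    thus ?thesis by (simp add: F_def ee_add ee_Ints)
  qed
  let ?S = "\<Sum>c\<in>{lo..<lo + int G}. F c"
  have "ee (of_int k / real G) * ?S = (\<Sum>c\<in>{lo..<lo + int G}. F (c + 1))"
    by (simp add: F sum_distrib_left)
  also have "\<dots> = (\<Sum>c\<in>{lo+1..<lo + int G + 1}. F c)"
    by (rule sum.reindex_bij_witness[of _ "\<lambda>c. c - 1" "\<lambda>c. c + 1"]) auto
  also have "{lo+1..<lo + int G + 1} = insert (lo + int G) ({lo..<lo + int G} - {lo})"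
    using assms by auto
  also have "sum F \<dots> = ?S"
    using assms by (simp add: sum_diff1 per)
  finally have "(ee (of_int k / real G) - 1) * ?S = 0" by (simp add: algebra_simps)
  moreover have "ee (of_int k / real G) \<noteq> 1"
  proof
    assume "ee (of_int k / real G) = 1"
    then obtain q where "of_int k / real G = of_int q" by (auto simp: ee_eq_1_iff elim: Ints_cases)
    hence "real_of_int k = of_int (int G * q)" using assms by (simp add: field_simps)
    hence "k = int G * q" by linarith
    with False show False by simp
  qed
  ultimately show ?thesis using False by (simp add: F_def)
qed

lemma norm_sum_power2:
  fixes z :: "'a \<Rightarrow> complex"
  shows "of_real ((norm (\<Sum>j\<in>J. z j))\<^sup>2) = (\<Sum>j\<in>J. \<Sum>j'\<in>J. z j * cnj (z j'))"
  by (simp only: complex_norm_square) (simp add: sum_product)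

lemma sum_card_fibre_squared:
  assumes "finite I" "finite R" "c ` I \<subseteq> R"
  shows "(\<Sum>r\<in>R. (real (card {i\<in>I. c i = r}))\<^sup>2) = real (card {(i, i') \<in> I \<times> I. c i = c i'})"
proof -
  have "{(i, i') \<in> I \<times> I. c i = c i'} = (\<Union>r\<in>R. {i\<in>I. c i = r} \<times> {i\<in>I. c i = r})"
    using assms(3) by auto
  also have "card \<dots> = (\<Sum>r\<in>R. card ({i\<in>I. c i = r} \<times> {i\<in>I. c i = r}))"
    using assms by (intro card_UN_disjoint) auto
  finally show ?thesis by (simp add: card_cartesian_product power2_eq_square)
qed

lemma norm_sum_le_card:
  fixes a :: "'a \<Rightarrow> complex"
  assumes "\<And>i. i \<in> I \<Longrightarrow> norm (a i) \<le> 1"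
  shows "norm (\<Sum>i\<in>I. a i) \<le> real (card I)"
  using sum_norm_le[of I a "\<lambda>_. 1"] assms by simp

lemma sum_mult_le_sqrt:
  fixes f g :: "'a \<Rightarrow> real"
  shows "(\<Sum>i\<in>I. f i * g i) \<le> sqrt (\<Sum>i\<in>I. (f i)\<^sup>2) * sqrt (\<Sum>i\<in>I. (g i)\<^sup>2)"
  unfolding real_sqrt_mult[symmetric] by (intro real_le_rsqrt Cauchy_Schwarz_ineq_sum)

text \<open>The arithmetic model of the double large sieve. Group the i by the value r =
  \<open>c i\<close>, apply Cauchy-Schwarz over r, and let r run over a full residue system modulo
  \<open>G\<close>; orthogonality leaves only the pairs with \<open>d j\<close> congruent to
  \<open>d j'\<close>. The size conditions place \<open>c\<close> and \<open>d\<close> in one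
  residue system, so there congruence means equality.\<close>

lemma bilinear_character_sum:
  fixes c :: "'a \<Rightarrow> int" and d :: "'b \<Rightarrow> int"
  assumes fin: "finite I" "finite J" and "G > 0"
    and c: "\<And>i. i \<in> I \<Longrightarrow> 2 * \<bar>c i\<bar> < int G" and d: "\<And>j. j \<in> J \<Longrightarrow> 2 * \<bar>d j\<bar> < int G"
    and a: "\<And>i. i \<in> I \<Longrightarrow> norm (a i) \<le> 1" and b: "\<And>j. j \<in> J \<Longrightarrow> norm (b j) \<le> 1"
  shows "norm (\<Sum>i\<in>I. \<Sum>j\<in>J. a i * b j * ee (of_int (c i * d j) / real G))
    \<le> sqrt (real G * real (card {(i, i') \<in> I \<times> I. c i = c i'}) * real (card {(j, j') \<in> J \<times> J. d j = d j'}))"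
proof -
  define R where "R = {- (int G div 2)..<- (int G div 2) + int G}"
  have cR: "c ` I \<subseteq> R"
  proof
    fix r assume "r \<in> c ` I"
    hence "2 * \<bar>r\<bar> < int G" using c by auto
    thus "r \<in> R" unfolding R_def by auto
  qed
  define A where "A = (\<lambda>r. \<Sum>i | i \<in> I \<and> c i = r. a i)"
  define T where "T = (\<lambda>r. \<Sum>j\<in>J. b j * ee (of_int (r * d j) / real G))"
  have "(\<Sum>i\<in>I. \<Sum>j\<in>J. a i * b j * ee (of_int (c i * d j) / real G)) = (\<Sum>i\<in>I. a i * T (c i))"
    by (simp add: T_def sum_distrib_left mult.assoc)
  also have "\<dots> = (\<Sum>r\<in>R. \<Sum>i | i \<in> I \<and> c i = r. a i * T (c i))"
    by (rule sum.group[symmetric]) (use fin cR in \<open>auto simp: R_def\<close>)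
  also have "\<dots> = (\<Sum>r\<in>R. A r * T r)"
    by (simp add: A_def sum_distrib_right)
  also have "norm \<dots> \<le> (\<Sum>r\<in>R. norm (A r) * norm (T r))"
    by (metis (no_types, lifting) norm_mult sum_norm_le order_refl)
  also have "\<dots> \<le> sqrt (\<Sum>r\<in>R. (norm (A r))\<^sup>2) * sqrt (\<Sum>r\<in>R. (norm (T r))\<^sup>2)"
    by (rule sum_mult_le_sqrt)
  also have "\<dots> \<le> sqrt (real (card {(i, i') \<in> I \<times> I. c i = c i'}))
      * sqrt (real G * real (card {(j, j') \<in> J \<times> J. d j = d j'}))"
  proof (intro mult_mono real_sqrt_le_mono)
    have "(\<Sum>r\<in>R. (norm (A r))\<^sup>2) \<le> (\<Sum>r\<in>R. (real (card {i\<in>I. c i = r}))\<^sup>2)"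
      unfolding A_def using a by (intro sum_mono power_mono norm_sum_le_card) auto
    also have "\<dots> = real (card {(i, i') \<in> I \<times> I. c i = c i'})"
      using fin cR by (intro sum_card_fibre_squared) (auto simp: R_def)
    finally show "(\<Sum>r\<in>R. (norm (A r))\<^sup>2) \<le> real (card {(i, i') \<in> I \<times> I. c i = c i'})" .
  next
    have orth: "(\<Sum>r\<in>R. ee (of_int (r * (d j - d j')) / real G)) = (if d j = d j' then of_nat G else 0)"
      if "j \<in> J" "j' \<in> J" for j j'
    proof -
      have "int G dvd d j - d j' \<longleftrightarrow> d j = d j'"
      proof
        assume "int G dvd d j - d j'"
        moreover have "\<bar>d j - d j'\<bar> < int G" using d[OF that(1)] d[OF that(2)] by linarith
        ultimately have "d j - d j' = 0" using dvd_imp_le_int[of "d j - d j'" "int G"] by force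
        thus "d j = d j'" by simp
      qed auto
      thus ?thesis unfolding R_def ee_orthogonality[OF \<open>G > 0\<close>] by simp
    qed
    have "of_real (\<Sum>r\<in>R. (norm (T r))\<^sup>2) = (\<Sum>r\<in>R. \<Sum>j\<in>J. \<Sum>j'\<in>J.
        b j * cnj (b j') * ee (of_int (r * (d j - d j')) / real G))"
      unfolding of_real_sum T_def norm_sum_power2
      by (intro sum.cong refl) (simp add: diff_divide_distrib right_diff_distrib ee_diff mult_ac)
    also have "\<dots> = (\<Sum>j\<in>J. \<Sum>j'\<in>J. \<Sum>r\<in>R. b j * cnj (b j') * ee (of_int (r * (d j - d j')) / real G))"
      by (subst sum.swap, intro sum.cong refl, rule sum.swap)
    also have "\<dots> = (\<Sum>j\<in>J. \<Sum>j'\<in>J. b j * cnj (b j') * (if d j = d j' then of_nat G else 0))"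
      by (intro sum.cong refl) (simp only: sum_distrib_left[symmetric] orth)
    also have "\<dots> = (\<Sum>p\<in>J\<times>J. b (fst p) * cnj (b (snd p)) * (if d (fst p) = d (snd p) then of_nat G else 0))"
      by (simp add: sum.cartesian_product case_prod_unfold)
    finally have eq: "of_real (\<Sum>r\<in>R. (norm (T r))\<^sup>2) = \<dots>" .
    have "(\<Sum>r\<in>R. (norm (T r))\<^sup>2) = norm (of_real (\<Sum>r\<in>R. (norm (T r))\<^sup>2) :: complex)"
      unfolding norm_of_real by (simp add: sum_nonneg)
    also have "\<dots> \<le> (\<Sum>p\<in>J\<times>J. if d (fst p) = d (snd p) then real G else 0)"
      unfolding eq
    proof (intro sum_norm_le)
      fix p assume "p \<in> J \<times> J"
      hence "norm (b (fst p)) * norm (b (snd p)) \<le> 1 * 1"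
        using b by (intro mult_mono) auto
      thus "norm (b (fst p) * cnj (b (snd p)) * (if d (fst p) = d (snd p) then of_nat G else 0))
          \<le> (if d (fst p) = d (snd p) then real G else 0)"
        using mult_right_mono[of "norm (b (fst p)) * norm (b (snd p))" 1 "real G"]
        by (auto simp: norm_mult)
    qed
    also have "\<dots> = real G * real (card {(j, j') \<in> J \<times> J. d j = d j'})"
    proof -
      have "(J \<times> J) \<inter> {p. d (fst p) = d (snd p)} = {(j, j') \<in> J \<times> J. d j = d j'}" by auto
      thus ?thesis using fin by (simp add: sum.If_cases mult.commute)
    qed
    finally show "(\<Sum>r\<in>R. (norm (T r))\<^sup>2) \<le> \<dots>" .
  qed (auto intro: sum_nonneg)
  finally show ?thesis by (simp add: real_sqrt_mult mult_ac)
qed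

text \<open>Expanding the twist in its power series separates the variables of \<open>\<xi> i * z j\<close>.\<close>

lemma bilinear_twist:
  fixes K :: "'a \<Rightarrow> 'b \<Rightarrow> complex"
  assumes fin: "finite I" "finite J"
    and \<Phi>: "\<And>a b. (\<And>i. i \<in> I \<Longrightarrow> norm (a i) \<le> 1) \<Longrightarrow> (\<And>j. j \<in> J \<Longrightarrow> norm (b j) \<le> 1) \<Longrightarrow>
           norm (\<Sum>i\<in>I. \<Sum>j\<in>J. a i * b j * K i j) \<le> \<Phi>"
    and \<xi>: "\<And>i. i \<in> I \<Longrightarrow> \<bar>\<xi> i\<bar> \<le> 1" and z: "\<And>j. j \<in> J \<Longrightarrow> \<bar>z j\<bar> \<le> 1"
    and a: "\<And>i. i \<in> I \<Longrightarrow> norm (a i) \<le> 1" and b: "\<And>j. j \<in> J \<Longrightarrow> norm (b j) \<le> 1"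
  shows "norm (\<Sum>i\<in>I. \<Sum>j\<in>J. a i * b j * (K i j * ee (\<xi> i * z j))) \<le> exp (2 * pi) * \<Phi>"
proof -
  define t where "t = (\<lambda>r. (2 * pi) ^ r /\<^sub>R fact r)"
  define F where "F = (\<lambda>r. \<Sum>i\<in>I. \<Sum>j\<in>J. (a i * of_real (\<xi> i) ^ r) * (b j * of_real (z j) ^ r) * K i j)"
  have t: "t sums exp (2 * pi)"
    unfolding t_def by (rule exp_converges)
  have ser: "(\<lambda>r. of_real (t r) * \<i> ^ r * (of_real (\<xi> i) ^ r * of_real (z j) ^ r)) sums ee (\<xi> i * z j)" for i j
  proof -
    have "(\<lambda>r. (\<i> * of_real (2 * pi * (\<xi> i * z j))) ^ r /\<^sub>R fact r) sums exp (\<i> * of_real (2 * pi * (\<xi> i * z j)))"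
      by (rule exp_converges)
    thus ?thesis
      by (simp add: ee_def cis_conv_exp t_def power_mult_distrib scaleR_conv_of_real mult_ac)
  qed
  have "(\<lambda>r. \<Sum>i\<in>I. \<Sum>j\<in>J. a i * b j * (K i j * (of_real (t r) * \<i> ^ r * (of_real (\<xi> i) ^ r * of_real (z j) ^ r))))
      sums (\<Sum>i\<in>I. \<Sum>j\<in>J. a i * b j * (K i j * ee (\<xi> i * z j)))"
    by (intro sums_sum sums_mult ser)
  also have "(\<lambda>r. \<Sum>i\<in>I. \<Sum>j\<in>J. a i * b j * (K i j * (of_real (t r) * \<i> ^ r * (of_real (\<xi> i) ^ r * of_real (z j) ^ r))))
      = (\<lambda>r. of_real (t r) * \<i> ^ r * F r)"
    by (simp add: F_def sum_distrib_left mult_ac)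
  finally have S: "(\<lambda>r. of_real (t r) * \<i> ^ r * F r) sums (\<Sum>i\<in>I. \<Sum>j\<in>J. a i * b j * (K i j * ee (\<xi> i * z j)))" .
  have "norm (F r) \<le> \<Phi>" for r
    unfolding F_def
  proof (rule \<Phi>)
    show "norm (a i * of_real (\<xi> i) ^ r) \<le> 1" if "i \<in> I" for i
      using a[OF that] \<xi>[OF that] by (simp add: norm_mult norm_power mult_le_one power_le_one)
    show "norm (b j * of_real (z j) ^ r) \<le> 1" if "j \<in> J" for j
      using b[OF that] z[OF that] by (simp add: norm_mult norm_power mult_le_one power_le_one)
  qed
  moreover have "0 \<le> t r" for r by (simp add: t_def)
  ultimately have bd: "norm (of_real (t r) * \<i> ^ r * F r) \<le> t r * \<Phi>" for r
    unfolding norm_mult norm_power by (simp add: mult_left_mono)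
  have t': "(\<lambda>r. t r * \<Phi>) sums (exp (2 * pi) * \<Phi>)"
    using t by (rule sums_mult2)
  have "norm (suminf (\<lambda>r. of_real (t r) * \<i> ^ r * F r)) \<le> suminf (\<lambda>r. t r * \<Phi>)"
    by (rule norm_suminf_le) (use bd t' in \<open>auto simp: sums_iff\<close>)
  thus ?thesis
    using S t' by (simp add: sums_iff)
qed

text \<open>Rounding both sequences to lattices reduces to \<open>bilinear_character_sum\<close>.
  The rounding errors enter the phase as two products of factors bounded by 1, and each is removed
  by \<open>bilinear_twist\<close> at the price of a factor \<open>exp (2 * pi)\<close>.\<close>

lemma double_large_sieve:
  fixes X :: "'a \<Rightarrow> real" and Z :: "'b \<Rightarrow> real"
  assumes fin: "finite I" "finite J" and pos: "0 < X0" "0 < Z0" and "1 \<le> X0 * Z0"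
    and X: "\<And>i. i \<in> I \<Longrightarrow> \<bar>X i\<bar> \<le> X0" and Z: "\<And>j. j \<in> J \<Longrightarrow> \<bar>Z j\<bar> \<le> Z0"
    and a: "\<And>i. i \<in> I \<Longrightarrow> norm (a i) \<le> 1" and b: "\<And>j. j \<in> J \<Longrightarrow> norm (b j) \<le> 1"
  shows "norm (\<Sum>i\<in>I. \<Sum>j\<in>J. a i * b j * ee (X i * Z j))
    \<le> exp (4 * pi) * sqrt (32 * (X0 * Z0) * real (card {(i, i') \<in> I \<times> I. \<bar>X i - X i'\<bar> \<le> 1 / Z0})
        * real (card {(j, j') \<in> J \<times> J. \<bar>Z j - Z j'\<bar> \<le> 1 / X0}))"
proof -
  \<comment> \<open>The factor 16 keeps \<open>4 * Z0 * X i\<close> and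
    \<open>G * Z j / (4 * Z0)\<close> at most \<open>G / 4\<close> in modulus, so that their integer
    parts stay within half the modulus \<open>G\<close> even after rounding.\<close>
  define G where "G = 16 * nat \<lceil>X0 * Z0\<rceil>"
  have G: "16 * (X0 * Z0) \<le> real G" "real G \<le> 32 * (X0 * Z0)" "16 \<le> real G" "G > 0"
    using assms(5) unfolding G_def by (auto, linarith+)
  define c where "c = (\<lambda>i. \<lfloor>4 * Z0 * X i\<rfloor>)"
  define d where "d = (\<lambda>j. \<lfloor>real G * Z j / (4 * Z0)\<rfloor>)"
  define \<xi> where "\<xi> = (\<lambda>i. 4 * Z0 * X i - of_int (c i))"
  define \<upsilon> where "\<upsilon> = (\<lambda>j. real G * Z j / (4 * Z0) - of_int (d j))"
  define z where "z = (\<lambda>j. Z j / (4 * Z0))"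
  define y where "y = (\<lambda>i. of_int (c i) / real G)"
  have X': "\<bar>4 * Z0 * X i\<bar> \<le> real G / 4" if "i \<in> I" for i
  proof -
    have "\<bar>4 * Z0 * X i\<bar> = 4 * Z0 * \<bar>X i\<bar>" using pos by (simp add: abs_mult)
    also have "\<dots> \<le> 4 * Z0 * X0" using X[OF that] pos by (intro mult_left_mono) auto
    also have "\<dots> \<le> real G / 4" using G by (simp add: mult_ac)
    finally show ?thesis .
  qed
  have z: "\<bar>z j\<bar> \<le> 1/4" if "j \<in> J" for j
    using Z[OF that] pos by (simp add: z_def field_simps)
  have Z': "\<bar>real G * Z j / (4 * Z0)\<bar> \<le> real G / 4" if "j \<in> J" for j
    using mult_left_mono[OF z[OF that], of "real G"] by (simp add: z_def abs_mult)
  have \<xi>: "0 \<le> \<xi> i" "\<xi> i \<le> 1" for i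
    unfolding \<xi>_def c_def by linarith+
  have \<upsilon>: "0 \<le> \<upsilon> j" "\<upsilon> j \<le> 1" for j
    unfolding \<upsilon>_def d_def by linarith+
  have c2: "2 * \<bar>c i\<bar> < int G" if "i \<in> I" for i
    using X'[OF that] G(3) unfolding c_def by linarith
  have d2: "2 * \<bar>d j\<bar> < int G" if "j \<in> J" for j
    using Z'[OF that] G(3) unfolding d_def by linarith
  have y: "\<bar>y i\<bar> \<le> 1" if "i \<in> I" for i
  proof -
    have "\<bar>of_int (c i) :: real\<bar> \<le> real G" using c2[OF that] by linarith
    thus ?thesis using G(4) by (simp add: y_def)
  qed
  \<comment> \<open>The two rescaled factors are c + \<xi> and d + \<upsilon>; their product is
    expanded as c d + c \<upsilon> + \<xi> (d + \<upsilon>) and divided by \<open>G\<close>.\<close>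
  have ee: "ee (X i * Z j) = ee (of_int (c i * d j) / real G) * ee (y i * \<upsilon> j) * ee (\<xi> i * z j)" for i j
  proof -
    have "4 * Z0 * X i = of_int (c i) + \<xi> i" "real G * Z j / (4 * Z0) = of_int (d j) + \<upsilon> j"
      by (auto simp: \<xi>_def \<upsilon>_def)
    moreover have "X i * Z j = (4 * Z0 * X i) * (real G * Z j / (4 * Z0)) / real G"
      using pos G(4) by (simp add: field_simps)
    moreover have "z j = (of_int (d j) + \<upsilon> j) / real G"
      using G(4) by (simp add: z_def \<upsilon>_def field_simps)
    ultimately have "X i * Z j = of_int (c i * d j) / real G + y i * \<upsilon> j + \<xi> i * z j"
      using G(4) by (simp add: y_def add_divide_distrib ring_distribs mult_ac)
    thus ?thesis by (simp add: ee_add)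
  qed
  let ?\<Phi> = "sqrt (real G * real (card {(i, i') \<in> I \<times> I. c i = c i'}) * real (card {(j, j') \<in> J \<times> J. d j = d j'}))"
  have 1: "norm (\<Sum>i\<in>I. \<Sum>j\<in>J. a i * b j * ee (of_int (c i * d j) / real G)) \<le> ?\<Phi>"
    if "\<And>i. i \<in> I \<Longrightarrow> norm (a i) \<le> 1" "\<And>j. j \<in> J \<Longrightarrow> norm (b j) \<le> 1" for a b
    by (rule bilinear_character_sum) (use fin G c2 d2 that in auto)
  have 2: "norm (\<Sum>i\<in>I. \<Sum>j\<in>J. a i * b j * (ee (of_int (c i * d j) / real G) * ee (y i * \<upsilon> j))) \<le> exp (2 * pi) * ?\<Phi>"
    if "\<And>i. i \<in> I \<Longrightarrow> norm (a i) \<le> 1" "\<And>j. j \<in> J \<Longrightarrow> norm (b j) \<le> 1" for a b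
    by (rule bilinear_twist[OF fin 1]) (use y \<upsilon> that in \<open>auto simp: abs_le_iff\<close>)
  have "norm (\<Sum>i\<in>I. \<Sum>j\<in>J. a i * b j * ee (X i * Z j)) \<le> exp (2 * pi) * (exp (2 * pi) * ?\<Phi>)"
    unfolding ee
    by (rule bilinear_twist[OF fin 2]) (use z \<xi> a b in \<open>force simp: abs_le_iff\<close>)+
  also have "exp (2 * pi) * (exp (2 * pi) * ?\<Phi>) = exp (4 * pi) * ?\<Phi>"
    by (simp flip: exp_add mult.assoc)
  also have "\<dots> \<le> exp (4 * pi) * sqrt (32 * (X0 * Z0) * real (card {(i, i') \<in> I \<times> I. \<bar>X i - X i'\<bar> \<le> 1 / Z0})
        * real (card {(j, j') \<in> J \<times> J. \<bar>Z j - Z j'\<bar> \<le> 1 / X0}))"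
  proof (intro mult_left_mono real_sqrt_le_mono mult_mono of_nat_mono card_mono)
    show "{(i, i') \<in> I \<times> I. c i = c i'} \<subseteq> {(i, i') \<in> I \<times> I. \<bar>X i - X i'\<bar> \<le> 1 / Z0}"
    proof safe
      fix i i' assume "c i = c i'"
      hence "4 * Z0 * X i - 4 * Z0 * X i' = \<xi> i - \<xi> i'" by (simp add: \<xi>_def)
      hence "\<bar>4 * Z0 * (X i - X i')\<bar> \<le> 1"
        using \<xi>[of i] \<xi>[of i'] by (simp add: algebra_simps)
      hence "4 * (Z0 * \<bar>X i - X i'\<bar>) \<le> 1" using pos by (simp add: abs_mult)
      hence "Z0 * \<bar>X i - X i'\<bar> \<le> 1" using pos by simp
      thus "\<bar>X i - X i'\<bar> \<le> 1 / Z0" using pos by (simp add: field_simps)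
    qed
    show "{(j, j') \<in> J \<times> J. d j = d j'} \<subseteq> {(j, j') \<in> J \<times> J. \<bar>Z j - Z j'\<bar> \<le> 1 / X0}"
    proof safe
      fix j j' assume "d j = d j'"
      hence "real G * Z j / (4 * Z0) - real G * Z j' / (4 * Z0) = \<upsilon> j - \<upsilon> j'" by (simp add: \<upsilon>_def)
      hence "\<bar>real G * (Z j - Z j') / (4 * Z0)\<bar> \<le> 1"
        using \<upsilon>[of j] \<upsilon>[of j'] by (simp add: diff_divide_distrib right_diff_distrib)
      hence "real G * \<bar>Z j - Z j'\<bar> \<le> 4 * Z0"
        using pos unfolding abs_divide abs_mult by (simp add: pos_divide_le_eq)
      hence "16 * (X0 * Z0) * \<bar>Z j - Z j'\<bar> \<le> 4 * Z0"
        using G(1) by (smt (verit) abs_ge_zero mult_right_mono)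
      hence "Z0 * (4 * (X0 * \<bar>Z j - Z j'\<bar>)) \<le> Z0 * 1" by (simp add: mult_ac)
      hence "4 * (X0 * \<bar>Z j - Z j'\<bar>) \<le> 1" using pos by (simp only: mult_le_cancel_left_pos)
      hence "X0 * \<bar>Z j - Z j'\<bar> \<le> 1" using pos by simp
      thus "\<bar>Z j - Z j'\<bar> \<le> 1 / X0" using pos by (simp add: field_simps)
    qed
  qed (use fin pos G in \<open>auto intro: finite_subset[of _ "I \<times> I"] finite_subset[of _ "J \<times> J"]\<close>)
  finally show ?thesis .
qed

section \<open>The Erdos--Turan inequality\<close>

definition psi :: "real \<Rightarrow> real" where
  "psi t = frac t - 1/2"

lemma abs_psi_le: "\<bar>psi t\<bar> \<le> 1/2"
  using frac_ge_0[of t] frac_lt_1[of t] unfolding psi_def by linarith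

lemma psi_add_of_int: "psi (t + of_int k) = psi t"
  by (simp add: psi_def frac_def)

text \<open>The sawtooth rises with slope 1 and jumps only downwards. This one-sided bound is what
  lets a large value persist on one side of a point.\<close>

lemma psi_add_le: "0 \<le> u \<Longrightarrow> psi (t + u) \<le> psi t + u"
  using floor_mono[of t "t + u"] by (simp add: psi_def frac_def)

text \<open>The number of integers in the interval from s + a/G (excluded) to s + (a+1)/G
  (included), as a real: the mass of the jump of the sawtooth in this grid cell.\<close>

definition grid_jump :: "nat \<Rightarrow> real \<Rightarrow> nat \<Rightarrow> real" where
  "grid_jump G s a = real_of_int (\<lfloor>s + real (Suc a) / real G\<rfloor> - \<lfloor>s + real a / real G\<rfloor>)"

text \<open>A half-open period contains exactly one integer, here \<lfloor>s\<rfloor> + 1, so the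
  jumps form a unit point mass on the grid whose position is known up to one step.\<close>

lemma grid_jump:
  assumes "G > 0"
  shows grid_jump_nonneg: "0 \<le> grid_jump G s a"
    and sum_grid_jump: "(\<Sum>a<G. grid_jump G s a) = 1"
    and grid_jump_position: "a < G \<Longrightarrow> grid_jump G s a \<noteq> 0 \<Longrightarrow>
          \<bar>real a / real G - (of_int \<lfloor>s\<rfloor> + 1 - s)\<bar> \<le> 1 / real G"
proof -
  show j0: "0 \<le> grid_jump G s a" for a
    unfolding grid_jump_def using assms(1) by (auto intro!: floor_mono divide_right_mono)
  have "(\<Sum>a<G. grid_jump G s a) = real_of_int \<lfloor>s + real G / real G\<rfloor> - real_of_int \<lfloor>s + real 0 / real G\<rfloor>"
    unfolding grid_jump_def of_int_diff by (rule sum_lessThan_telescope)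
  thus "(\<Sum>a<G. grid_jump G s a) = 1" using assms(1) by simp
  show "\<bar>real a / real G - (of_int \<lfloor>s\<rfloor> + 1 - s)\<bar> \<le> 1 / real G" if "a < G" "grid_jump G s a \<noteq> 0"
  proof -
    let ?p = "\<lfloor>s + real (Suc a) / real G\<rfloor>"
    have lt: "s + real a / real G < of_int ?p"
    proof -
      have "\<lfloor>s + real a / real G\<rfloor> < ?p"
        using j0[of a] that(2) unfolding grid_jump_def by (simp only: of_int_0_le_iff of_int_eq_0_iff)
      thus ?thesis by (simp only: floor_less_iff)
    qed
    have le: "of_int ?p \<le> s + real (Suc a) / real G" by simp
    have "0 \<le> real a / real G" by simp
    moreover have "real (Suc a) / real G \<le> 1" using that(1) by simp
    ultimately have "?p = \<lfloor>s\<rfloor> + 1" using lt le by linarith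
    moreover have "real (Suc a) / real G = real a / real G + 1 / real G" by (simp add: add_divide_distrib)
    ultimately show ?thesis using lt le by linarith
  qed
qed

lemma psi_grid_step:
  fixes s :: real
  shows "psi (s + real (Suc a) / real G) - psi (s + real a / real G)
    = 1 / real G - grid_jump G s a"
  by (simp add: grid_jump_def psi_def frac_def add_divide_distrib)

text \<open>Summation by parts against the weights a turns the increments 1/G - jump into explicit
  terms: the constant part gives (G - 1)/2, the jump gives G times its position. Together they match
  \<open>G * psi s\<close> up to a bounded amount.\<close>

lemma psi_grid_mean:
  fixes s :: real
  assumes "G > 0"
  shows "\<bar>\<Sum>a<G. psi (s + real a / real G)\<bar> \<le> 2"
proof -
  let ?j = "grid_jump G s"
  note jumps = grid_jump[OF assms, where s = s]
  define P where "P = (\<Sum>a<G. psi (s + real a / real G))"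
  have abel: "(\<Sum>a<n. real a * (F (Suc a) - F a)) = real n * F n - (\<Sum>a<n. F (Suc a))"
    for F :: "nat \<Rightarrow> real" and n
    by (induction n) (auto simp: algebra_simps)
  have shift: "(\<Sum>a<G. psi (s + real (Suc a) / real G)) = P"
  proof -
    have "(\<Sum>a<G. psi (s + real (Suc a) / real G)) + psi (s + real 0 / real G) = P + psi (s + real G / real G)"
      unfolding P_def using sum.lessThan_Suc_shift[of "\<lambda>a. psi (s + real a / real G)" G] by simp
    thus ?thesis using assms psi_add_of_int[of s 1] by simp
  qed
  have "(\<Sum>a<G. real a * (1 / real G - ?j a)) = real G * psi s - P"
    using abel[of "\<lambda>a. psi (s + real a / real G)" G] assms psi_add_of_int[of s 1]
    unfolding psi_grid_step by (simp add: shift[simplified])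
  moreover have "(\<Sum>a<G. real a * (1 / real G - ?j a)) = (\<Sum>a<G. real a) / real G - (\<Sum>a<G. real a * ?j a)"
    by (simp add: right_diff_distrib sum_subtractf sum_divide_distrib)
  moreover have "(\<Sum>a<G. real a) / real G = (real G - 1) / 2"
  proof -
    have "(\<Sum>a<n. real a) = real n * (real n - 1) / 2" for n
      by (induction n) (auto simp: field_simps)
    thus ?thesis using assms by simp
  qed
  moreover have "\<bar>(\<Sum>a<G. real a * ?j a) - real G * (of_int \<lfloor>s\<rfloor> + 1 - s)\<bar> \<le> 1"
  proof -
    have "(\<Sum>a<G. real a * ?j a) - real G * (of_int \<lfloor>s\<rfloor> + 1 - s)
        = (\<Sum>a<G. (real a - real G * (of_int \<lfloor>s\<rfloor> + 1 - s)) * ?j a)"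
      using jumps(2) by (simp add: left_diff_distrib sum_subtractf flip: sum_distrib_left)
    also have "\<bar>\<dots>\<bar> \<le> (\<Sum>a<G. 1 * ?j a)"
    proof (rule order.trans[OF sum_abs], rule sum_mono)
      fix a assume "a \<in> {..<G}"
      show "\<bar>(real a - real G * (of_int \<lfloor>s\<rfloor> + 1 - s)) * ?j a\<bar> \<le> 1 * ?j a"
      proof (cases "?j a = 0")
        case False
        with \<open>a \<in> {..<G}\<close> jumps(3) have "\<bar>real a / real G - (of_int \<lfloor>s\<rfloor> + 1 - s)\<bar> \<le> 1 / real G" by simp
        hence "real G * \<bar>real a / real G - (of_int \<lfloor>s\<rfloor> + 1 - s)\<bar> \<le> 1"
          using assms by (simp add: field_simps)
        moreover have "\<bar>real a - real G * (of_int \<lfloor>s\<rfloor> + 1 - s)\<bar> = real G * \<bar>real a / real G - (of_int \<lfloor>s\<rfloor> + 1 - s)\<bar>"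
        proof -
          have "real a - real G * (of_int \<lfloor>s\<rfloor> + 1 - s) = real G * (real a / real G - (of_int \<lfloor>s\<rfloor> + 1 - s))"
            using assms by (simp add: right_diff_distrib)
          thus ?thesis by (simp add: abs_mult)
        qed
        ultimately have "\<bar>real a - real G * (of_int \<lfloor>s\<rfloor> + 1 - s)\<bar> \<le> 1" by simp
        from mult_right_mono[OF this jumps(1)[of a]] show ?thesis
          unfolding abs_mult using jumps(1)[of a] by simp
      qed simp
    qed
    finally show ?thesis using jumps(2) by simp
  qed
  moreover have "real G * psi s = real G * (s - of_int \<lfloor>s\<rfloor>) - real G / 2"
    by (simp add: psi_def frac_def algebra_simps)
  ultimately show ?thesis unfolding P_def[symmetric] by (simp add: algebra_simps abs_le_iff)
qed

text \<open>Discrete analogue of the Fourier coefficient of the sawtooth, of order 1/h.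
  Multiplication by \<open>w - 1\<close> is a summation by parts: the constant increment 1/G is
  killed by orthogonality, and the unit jump leaves \<open>ee (- h * s)\<close> up to the
  uncertainty 1/G in its position. Division by \<open>w - 1\<close>, of modulus at least 2|h|/G,
  gives the factor in front.\<close>

lemma psi_grid_coeff:
  fixes t :: "'a \<Rightarrow> real" and h :: int
  assumes "G > 0" "h \<noteq> 0" "2 * \<bar>h\<bar> \<le> int G" and fin: "finite J"
  shows "norm (\<Sum>a<G. of_real (\<Sum>j\<in>J. psi (t j + real a / real G)) * ee (of_int h * real a / real G))
    \<le> real G / (2 * of_int \<bar>h\<bar>) * (norm (\<Sum>j\<in>J. ee (of_int h * t j)) + 2 * pi * of_int \<bar>h\<bar> / real G * real (card J))"
proof -
  define w where "w = ee (- of_int h / real G)"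
  define E where "E = (\<lambda>a. ee (of_int h * real a / real G))"
  have E_Suc: "E (Suc a) * w = E a" for a
    unfolding E_def w_def ee_add[symmetric] by (simp add: algebra_simps add_divide_distrib)
  have E_G: "E G = 1" using assms(1) by (simp add: E_def ee_Ints)
  have E0: "E 0 = 1" by (simp add: E_def)
  have hG: "\<bar>- real_of_int h / real G\<bar> \<le> 1/2"
  proof -
    have "2 * \<bar>real_of_int h\<bar> \<le> real G" using assms(3) by linarith
    thus ?thesis using assms(1) by (simp add: field_simps)
  qed
  have w_ge: "2 * (of_int \<bar>h\<bar> / real G) \<le> norm (w - 1)"
    using norm_ee_minus_1_ge[OF hG] by (simp add: w_def)
  have w1: "w - 1 \<noteq> 0"
    using w_ge assms(1,2) by (smt (verit) norm_zero divide_pos_pos of_int_0_less_iff of_nat_0_less_iff zero_less_abs_iff)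
  have sumE: "(\<Sum>a<G. E a) = 0"
  proof -
    have "(\<Sum>a<G. E (Suc a)) = (\<Sum>a<G. E a)"
      using sum.lessThan_Suc_shift[of E G] by (simp add: E0 E_G)
    moreover have "(\<Sum>a<G. E (Suc a)) * w = (\<Sum>a<G. E a)"
      by (simp add: sum_distrib_right E_Suc)
    ultimately have "(\<Sum>a<G. E a) * (w - 1) = 0" by (simp add: right_diff_distrib)
    thus ?thesis using w1 by simp
  qed
  \<comment> \<open>The estimate is made for one shift s with its main term kept exact, and summed
    over \<open>J\<close> only afterwards, so that the cancellation among the \<open>t j\<close>
    survives.\<close>
  have one: "norm ((\<Sum>a<G. of_real (psi (s + real a / real G)) * E a) * (w - 1) + ee (- of_int h * s))
      \<le> 2 * pi * of_int \<bar>h\<bar> / real G" for s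
  proof -
    let ?F = "\<lambda>a. complex_of_real (psi (s + real a / real G))"
    have "(\<Sum>a<G. ?F a * E a) * w = (\<Sum>a<G. ?F (Suc a) * E a)"
    proof -
      have "(\<Sum>a<Suc G. ?F a * E a * w) = ?F 0 * E 0 * w + (\<Sum>a<G. ?F (Suc a) * E (Suc a) * w)"
        by (rule sum.lessThan_Suc_shift)
      moreover have "?F (Suc a) * E (Suc a) * w = ?F (Suc a) * E a" for a
        by (simp only: mult.assoc E_Suc)
      moreover have "?F G = ?F 0" using assms(1) psi_add_of_int[of s 1] by simp
      ultimately show ?thesis
        unfolding sum_distrib_right by (simp only: sum.lessThan_Suc E0 E_G) simp
    qed
    hence "(\<Sum>a<G. ?F a * E a) * (w - 1) = (\<Sum>a<G. (?F (Suc a) - ?F a) * E a)"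
      by (simp add: right_diff_distrib left_diff_distrib sum_subtractf)
    also have "\<dots> = (\<Sum>a<G. of_real (1 / real G - grid_jump G s a) * E a)"
      unfolding of_real_diff[symmetric] psi_grid_step ..
    also have "\<dots> = of_real (1 / real G) * (\<Sum>a<G. E a) - (\<Sum>a<G. of_real (grid_jump G s a) * E a)"
      unfolding of_real_diff left_diff_distrib sum_subtractf sum_distrib_left ..
    finally have "(\<Sum>a<G. ?F a * E a) * (w - 1) + ee (- of_int h * s)
        = ee (- of_int h * s) - (\<Sum>a<G. of_real (grid_jump G s a) * E a)"
      by (simp add: sumE)
    also have "\<dots> = (\<Sum>a<G. of_real (grid_jump G s a) * (ee (- of_int h * s) - E a))"
    proof -
      have "(\<Sum>a<G. of_real (grid_jump G s a) * ee (- of_int h * s)) = of_real (\<Sum>a<G. grid_jump G s a) * ee (- of_int h * s)"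
        by (simp add: sum_distrib_right)
      hence "(\<Sum>a<G. of_real (grid_jump G s a) * ee (- of_int h * s)) = ee (- of_int h * s)"
        using sum_grid_jump[OF assms(1)] by simp
      thus ?thesis by (simp only: right_diff_distrib sum_subtractf)
    qed
    also have "norm \<dots> \<le> (\<Sum>a<G. grid_jump G s a * (2 * pi * of_int \<bar>h\<bar> / real G))"
    proof (intro sum_norm_le)
      fix a assume a: "a \<in> {..<G}"
      show "norm (of_real (grid_jump G s a) * (ee (- of_int h * s) - E a)) \<le> grid_jump G s a * (2 * pi * of_int \<bar>h\<bar> / real G)"
      proof (cases "grid_jump G s a = 0")
        case False
        let ?q = "real_of_int \<lfloor>s\<rfloor> + 1 - s"
        have close: "\<bar>real a / real G - ?q\<bar> \<le> 1 / real G"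
          using grid_jump_position[OF assms(1)] a False by simp
        have "ee (- of_int h * s) = ee (of_int h * ?q)"
        proof -
          have "of_int h * ?q = - of_int h * s + of_int (h * (\<lfloor>s\<rfloor> + 1))" by (simp add: algebra_simps)
          thus ?thesis by (simp only: ee_add) (simp add: ee_Ints)
        qed
        hence "norm (ee (- of_int h * s) - E a) \<le> 2 * pi * \<bar>of_int h * ?q - of_int h * real a / real G\<bar>"
          unfolding E_def using norm_ee_diff[of "of_int h * ?q" "of_int h * real a / real G"] by simp
        also have "of_int h * ?q - of_int h * real a / real G = of_int h * (?q - real a / real G)"
          by (simp add: right_diff_distrib)
        also have "\<bar>\<dots>\<bar> = of_int \<bar>h\<bar> * \<bar>real a / real G - ?q\<bar>" by (simp add: abs_mult abs_minus_commute)
        also have "2 * pi * \<dots> \<le> 2 * pi * (of_int \<bar>h\<bar> * (1 / real G))"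
          using close by (intro mult_left_mono) auto
        finally have "norm (ee (- of_int h * s) - E a) \<le> 2 * pi * of_int \<bar>h\<bar> / real G" by simp
        from mult_left_mono[OF this grid_jump_nonneg[OF assms(1)]] show ?thesis
          using grid_jump_nonneg[OF assms(1)] by (simp add: norm_mult)
      qed simp
    qed
    also have "\<dots> = 2 * pi * of_int \<bar>h\<bar> / real G"
      using sum_grid_jump[OF assms(1)] by (simp flip: sum_distrib_right sum_divide_distrib)
    finally show ?thesis .
  qed
  let ?L = "\<Sum>a<G. of_real (\<Sum>j\<in>J. psi (t j + real a / real G)) * E a"
  let ?P = "\<lambda>s. (\<Sum>a<G. of_real (psi (s + real a / real G)) * E a) * (w - 1)"
  have "?L * (w - 1) = (\<Sum>j\<in>J. ?P (t j))"
    unfolding of_real_sum sum_distrib_right by (rule sum.swap)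
  also have "\<dots> = (\<Sum>j\<in>J. ?P (t j) + ee (- of_int h * t j)) - (\<Sum>j\<in>J. ee (- of_int h * t j))"
    by (simp add: sum.distrib)
  also have "norm \<dots> \<le> real (card J) * (2 * pi * of_int \<bar>h\<bar> / real G) + norm (\<Sum>j\<in>J. ee (of_int h * t j))"
  proof (rule order.trans[OF norm_triangle_ineq4], intro add_mono)
    show "norm (\<Sum>j\<in>J. ?P (t j) + ee (- of_int h * t j)) \<le> real (card J) * (2 * pi * of_int \<bar>h\<bar> / real G)"
      using sum_norm_le[of J "\<lambda>j. ?P (t j) + ee (- of_int h * t j)" "\<lambda>_. 2 * pi * of_int \<bar>h\<bar> / real G"] one
      by simp
    have "(\<Sum>j\<in>J. ee (- of_int h * t j)) = cnj (\<Sum>j\<in>J. ee (of_int h * t j))"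
      by (simp add: ee_minus[symmetric])
    thus "norm (\<Sum>j\<in>J. ee (- of_int h * t j)) \<le> norm (\<Sum>j\<in>J. ee (of_int h * t j))"
      by (simp only: complex_mod_cnj order_refl)
  qed
  finally have "norm ?L * norm (w - 1) \<le> norm (\<Sum>j\<in>J. ee (of_int h * t j)) + 2 * pi * of_int \<bar>h\<bar> / real G * real (card J)"
    (is "_ \<le> ?B") by (simp add: norm_mult mult_ac)
  hence "norm ?L * (2 * (of_int \<bar>h\<bar> / real G)) \<le> ?B"
    using mult_left_mono[OF w_ge, of "norm ?L"] by simp
  moreover have "0 < 2 * (real_of_int \<bar>h\<bar> / real G)" using assms(1,2) by simp
  ultimately have "norm ?L \<le> ?B / (2 * (of_int \<bar>h\<bar> / real G))" by (simp only: pos_le_divide_eq)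
  thus ?thesis unfolding E_def by (simp add: mult.commute)
qed

section \<open>The Fejer kernel and its mass away from the integers\<close>

lemma sum_rotate3:
  "(\<Sum>a\<in>A. \<Sum>b\<in>B. \<Sum>c\<in>C. f a b c) = (\<Sum>b\<in>B. \<Sum>c\<in>C. \<Sum>a\<in>A. f a b c)"
  by (rule trans[OF sum.swap], rule sum.cong[OF refl], rule sum.swap)

lemma sum_inverse_squares_tail:
  assumes "0 < c"
  shows "(\<Sum>b=Suc c..n. 1 / (real b)\<^sup>2) \<le> 1 / real c"
proof (cases "c \<le> n")
  case True
  hence "(\<Sum>b=Suc c..n. 1 / (real b)\<^sup>2) \<le> 1 / real c - 1 / real n"
  proof (induction n rule: dec_induct)
    case (step n)
    have "1 / (real (Suc n))\<^sup>2 \<le> 1 / real n - 1 / real (Suc n)"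
    proof -
      have n: "0 < real n" using step assms by simp
      have "1 / (real (Suc n))\<^sup>2 \<le> 1 / (real n * real (Suc n))"
        unfolding power2_eq_square using n by (intro frac_le mult_mono mult_pos_pos) auto
      also have "\<dots> = 1 / real n - 1 / real (Suc n)" using n by (simp add: field_simps)
      finally show ?thesis .
    qed
    thus ?case using step by simp
  qed (use assms in simp)
  moreover have "0 \<le> 1 / real n" by simp
  ultimately show ?thesis by linarith
qed simp

text \<open>The Fejer kernel, the sum of (1 - |k|/H) e(k z) over |k| < H, written as a normalised
  square so that positivity is visible.\<close>

definition fejer :: "nat \<Rightarrow> real \<Rightarrow> real" where
  "fejer H z = (norm (\<Sum>h<H. ee (real h * z)))\<^sup>2 / real H"

lemma fejer_nonneg: "0 \<le> fejer H z"
  by (simp add: fejer_def)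

text \<open>The geometric sum is at most 1/m, where m is the distance of z to the nearest integer.
  Adding the contributions of both endpoints replaces the minimum by terms that can be summed
  separately.\<close>

lemma fejer_le:
  assumes "0 < z" "z < 1"
  shows "fejer H z \<le> (1 / z\<^sup>2 + 1 / (1 - z)\<^sup>2) / real H"
proof -
  define m where "m = min z (1 - z)"
  have m: "0 < m" using assms by (simp add: m_def)
  have ge: "2 * m \<le> norm (ee z - 1)"
  proof (cases "z \<le> 1/2")
    case True
    thus ?thesis using norm_ee_minus_1_ge[of z] assms by (simp add: m_def)
  next
    case False
    have "ee z = ee (z - 1)" using ee_add[of "z - 1" 1] by (simp add: ee_Ints)
    thus ?thesis using norm_ee_minus_1_ge[of "z - 1"] assms False by (simp add: m_def)
  qed
  have "(\<Sum>h<H. ee (real h * z)) = (ee z ^ H - 1) / (ee z - 1)"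
  proof -
    have "ee z \<noteq> 1" using ge m by auto
    thus ?thesis by (simp add: ee_of_nat_mult geometric_sum)
  qed
  hence "norm (\<Sum>h<H. ee (real h * z)) = norm (ee z ^ H - 1) / norm (ee z - 1)"
    by (simp add: norm_divide)
  also have "\<dots> \<le> 2 / (2 * m)"
  proof (intro frac_le)
    have "norm (ee z ^ H - 1) \<le> norm (ee z ^ H) + norm (1 :: complex)" by (rule norm_triangle_ineq4)
    thus "norm (ee z ^ H - 1) \<le> 2" by (simp add: norm_power)
  qed (use ge m in auto)
  also have "\<dots> = 1 / m" by simp
  finally have "(norm (\<Sum>h<H. ee (real h * z)))\<^sup>2 \<le> (1 / m)\<^sup>2"
    by (intro power_mono) auto
  also have "\<dots> \<le> 1 / z\<^sup>2 + 1 / (1 - z)\<^sup>2"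
    unfolding m_def min_def by (auto simp: power_divide)
  finally show ?thesis unfolding fejer_def by (intro divide_right_mono) auto
qed

lemma fejer_expand:
  "of_real (fejer H z) = (\<Sum>h<H. \<Sum>h'<H. ee (of_int (int h - int h') * z)) / of_nat H"
  unfolding fejer_def of_real_divide norm_sum_power2
  by (simp add: ee_diff left_diff_distrib)

text \<open>A positive difference k arises from at most two values of h', namely h - k and h +
  k.\<close>

lemma sum_abs_difference_le:
  fixes B :: "nat \<Rightarrow> real"
  assumes B: "\<And>h. 0 \<le> B h" and "h < H"
  shows "(\<Sum>h'<H. B (nat \<bar>int h - int h'\<bar>)) \<le> B 0 + 2 * (\<Sum>k=1..<H. B k)"
proof -
  have "{..<H} = {..<h} \<union> {h} \<union> {Suc h..<H}" using assms(2) by auto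
  hence "(\<Sum>h'<H. B (nat \<bar>int h - int h'\<bar>))
     = (\<Sum>h'<h. B (nat \<bar>int h - int h'\<bar>)) + B 0 + (\<Sum>h'=Suc h..<H. B (nat \<bar>int h - int h'\<bar>))"
    by (simp add: sum.union_disjoint disjoint_iff add_ac)
  also have "(\<Sum>h'<h. B (nat \<bar>int h - int h'\<bar>)) = (\<Sum>k=1..<Suc h. B k)"
    by (rule sum.reindex_bij_witness[of _ "\<lambda>k. h - k" "\<lambda>k. h - k"]) (auto simp: nat_diff_distrib)
  also have "(\<Sum>h'=Suc h..<H. B (nat \<bar>int h - int h'\<bar>)) = (\<Sum>k=1..<H - h. B k)"
    by (rule sum.reindex_bij_witness[of _ "\<lambda>k. h + k" "\<lambda>k. k - h"])
       (auto simp: nat_eq_iff of_nat_diff intro!: arg_cong[where f = B])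
  also have "(\<Sum>k=1..<Suc h. B k) + B 0 + (\<Sum>k=1..<H - h. B k) \<le> (\<Sum>k=1..<H. B k) + B 0 + (\<Sum>k=1..<H. B k)"
    using assms by (intro add_mono sum_mono2) auto
  finally show ?thesis by simp
qed

text \<open>A one-sided Lipschitz function that is large at one point stays large on an interval;
  convolution with the Fejer kernel concentrated there, carried out on the grid of
  step \<open>1 / G\<close>, detects this.\<close>

lemma Erdos_Turan_psi:
  fixes t :: "'a \<Rightarrow> real"
  assumes fin: "finite J" and "1 \<le> H"
  shows "\<bar>\<Sum>j\<in>J. psi (t j)\<bar>
    \<le> 60 * (real (card J) / real H + (\<Sum>h=1..H. norm (\<Sum>j\<in>J. ee (real h * t j)) / real h))"
proof (cases "H \<le> 32")
  case True
  have "\<bar>\<Sum>j\<in>J. psi (t j)\<bar> \<le> (\<Sum>j\<in>J. 1/2)"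
    by (rule order.trans[OF sum_abs], rule sum_mono, rule abs_psi_le)
  also have "\<dots> = real (card J) / 2" by simp
  also have "\<dots> \<le> 60 * (real (card J) / real H)"
  proof -
    have "real (card J) * real H \<le> real (card J) * 120" using True by (intro mult_left_mono) auto
    thus ?thesis using assms(2) by (simp add: field_simps)
  qed
  also have "\<dots> \<le> 60 * (real (card J) / real H + (\<Sum>h=1..H. norm (\<Sum>j\<in>J. ee (real h * t j)) / real h))"
    by (intro mult_left_mono) (auto intro!: sum_nonneg)
  finally show ?thesis .
next
  case False
  define W where "W = real (card J)"
  define \<Sigma> where "\<Sigma> = (\<Sum>h=1..H. norm (\<Sum>j\<in>J. ee (real h * t j)) / real h)"
  \<comment> \<open>With grid step 1/H^2 the position errors of the jumps cost only O(card J / H) in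
    total. The window below has half-width \<open>c\<close> grid steps, that is 8/H, and 8 is chosen
    so that the kernel has mass at most 1/4 outside it.\<close>
  define G where "G = H * H"
  define c where "c = 8 * H"
  have HG: "H > 32" "G > 0" "2 * c < G" "0 < c" "real G = real H * real H" "real c = 8 * real H"
    using False by (auto simp: G_def c_def)
  define D where "D = (\<lambda>u. \<Sum>j\<in>J. psi (t j + u))"
  have D_per: "D (u + of_int k) = D u" for u k
    unfolding D_def by (simp add: add.assoc[symmetric] psi_add_of_int)
  have D_lip: "D (u + v) \<le> D u + W * v" if "0 \<le> v" for u v
  proof -
    have "D (u + v) \<le> (\<Sum>j\<in>J. psi (t j + u) + v)"
      unfolding D_def add.assoc[symmetric] by (intro sum_mono psi_add_le that)
    thus ?thesis by (simp add: D_def W_def sum.distrib)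
  qed
  \<comment> \<open>A maximum over the grid suffices: the point 0 of interest is a grid point, and
    periodicity covers the points b/G for all integers b.\<close>
  define A where "A = Max ((\<lambda>a. \<bar>D (real a / real G)\<bar>) ` {..<G})"
  have A_ge: "\<bar>D (of_int b / real G)\<bar> \<le> A" for b
  proof -
    have "of_int b / real G = real (nat (b mod int G)) / real G + of_int (b div int G)"
    proof -
      have "real_of_int b = of_int (b div int G) * real G + real (nat (b mod int G))"
      proof -
        have "real_of_int (b div int G * int G + b mod int G) = of_int (b div int G) * real G + of_int (b mod int G)"
          by (simp only: of_int_add of_int_mult of_int_of_nat_eq)
        moreover have "real (nat (b mod int G)) = of_int (b mod int G)"
          using HG(2) by (intro of_nat_nat) simp
        ultimately show ?thesis by (simp only: div_mult_mod_eq)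
      qed
      thus ?thesis using HG(2) by (simp add: field_simps)
    qed
    hence "D (of_int b / real G) = D (real (nat (b mod int G)) / real G)" by (simp only: D_per)
    moreover have "nat (b mod int G) \<in> {..<G}" using HG(2) by (simp add: nat_less_iff)
    ultimately show ?thesis unfolding A_def
      by (intro Max_ge finite_imageI finite_lessThan) (auto simp only: intro: imageI)
  qed
  have A0: "0 \<le> A" using A_ge[of 0] by linarith
  have "A \<in> (\<lambda>a. \<bar>D (real a / real G)\<bar>) ` {..<G}"
    unfolding A_def using HG(2) by (intro Max_in) auto
  then obtain a0 where a0: "A = \<bar>D (real a0 / real G)\<bar>" by auto
  define x where "x = W * (2 * real c / real G)"
  have x0: "0 \<le> x" by (simp add: x_def W_def)
  \<comment> \<open>A large positive value of \<open>D\<close> persists on the window that ends at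
    the extremal point, a large negative one on the window that begins there. The loss over 2c grid
    steps is at most \<open>x\<close>.\<close>
  obtain \<sigma> :: real and b :: int where \<sigma>: "\<bar>\<sigma>\<bar> = 1"
    and near: "\<And>a. a \<le> 2 * c \<Longrightarrow> A - x \<le> \<sigma> * D (of_int b / real G + real a / real G)"
  proof (cases "0 \<le> D (real a0 / real G)")
    case True
    show thesis
    proof (rule that[of 1 "int a0 - int (2 * c)"])
      fix a assume a: "a \<le> 2 * c"
      let ?u = "of_int (int a0 - int (2 * c)) / real G + real a / real G"
      have e: "real a0 / real G = ?u + real (2 * c - a) / real G"
      proof -
        have r: "real (2 * c - a) = real (2 * c) - real a" using a by (simp add: of_nat_diff)
        show ?thesis
          unfolding r of_int_diff of_int_of_nat_eq by (simp only: add_divide_distrib[symmetric]) simp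
      qed
      have "A \<le> D ?u + W * (real (2 * c - a) / real G)"
      proof -
        have "D (?u + real (2 * c - a) / real G) \<le> D ?u + W * (real (2 * c - a) / real G)"
          by (rule D_lip) simp
        thus ?thesis using True a0 by (simp only: e[symmetric])
      qed
      moreover have "W * (real (2 * c - a) / real G) \<le> x"
        unfolding x_def W_def by (intro mult_left_mono divide_right_mono) auto
      ultimately show "A - x \<le> 1 * D ?u" by linarith
    qed simp
  next
    case False
    show thesis
    proof (rule that[of "-1" "int a0"])
      fix a assume a: "a \<le> 2 * c"
      have "D (real a0 / real G + real a / real G) \<le> - A + W * (real a / real G)"
        using D_lip[of "real a / real G" "real a0 / real G"] False a0 by simp
      moreover have "W * (real a / real G) \<le> x"
        unfolding x_def W_def using a by (intro mult_left_mono divide_right_mono) auto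
      ultimately show "A - x \<le> - 1 * D (of_int (int a0) / real G + real a / real G)" by simp
    qed simp
  qed
  define u where "u = real_of_int b / real G"
  have bound: "\<bar>D (u + real a / real G)\<bar> \<le> A" for a
    using A_ge[of "b + int a"] by (simp add: u_def add_divide_distrib)
  define F where "F = (\<lambda>a. fejer H ((real a - real c) / real G) / real G)"
  have F0: "0 \<le> F a" for a by (simp add: F_def fejer_nonneg)
  have F_expand: "of_real (F a) = (\<Sum>h<H. \<Sum>h'<H. ee (- of_int (int h - int h') * real c / real G)
      * ee (of_int (int h - int h') * real a / real G)) / of_nat (H * G)" for a
  proof -
    have k: "ee (of_int k * ((real a - real c) / real G))
        = ee (- of_int k * real c / real G) * ee (of_int k * real a / real G)" for k :: int
      unfolding ee_add[symmetric] by (simp add: algebra_simps diff_divide_distrib)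
    show ?thesis unfolding F_def of_real_divide fejer_expand k by simp
  qed
  \<comment> \<open>Only frequencies of modulus below H \<le> G occur, so on the grid the kernel has
    total mass exactly 1.\<close>
  have Fsum: "(\<Sum>a<G. F a) = 1"
  proof -
    have orth: "(\<Sum>a<G. ee (of_int (int h - int h') * real a / real G)) = (if h = h' then of_nat G else 0)"
      if "h < H" "h' < H" for h h'
    proof -
      have "(\<Sum>a<G. ee (of_int (int h - int h') * real a / real G))
          = (\<Sum>a\<in>{0..<0 + int G}. ee (of_int (a * (int h - int h')) / real G))"
        by (rule sum.reindex_bij_witness[of _ nat int]) (auto simp: mult.commute)
      also have "\<dots> = (if int G dvd int h - int h' then of_nat G else 0)"
        using HG(2) by (rule ee_orthogonality)
      also have "int G dvd int h - int h' \<longleftrightarrow> h = h'"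
      proof
        assume "int G dvd int h - int h'"
        moreover have "H \<le> G" by (simp add: G_def)
        hence "\<bar>int h - int h'\<bar> < int G" using that by linarith
        ultimately have "int h - int h' = 0"
          using dvd_imp_le_int[of "int h - int h'" "int G"] by force
        thus "h = h'" by simp
      qed auto
      finally show ?thesis .
    qed
    have "of_real (\<Sum>a<G. F a) = (\<Sum>a<G. \<Sum>h<H. \<Sum>h'<H. ee (- of_int (int h - int h') * real c / real G)
        * ee (of_int (int h - int h') * real a / real G)) / of_nat (H * G)"
      unfolding of_real_sum F_expand sum_divide_distrib ..
    also have "(\<Sum>a<G. \<Sum>h<H. \<Sum>h'<H. ee (- of_int (int h - int h') * real c / real G)
        * ee (of_int (int h - int h') * real a / real G))
      = (\<Sum>h<H. \<Sum>h'<H. \<Sum>a<G. ee (- of_int (int h - int h') * real c / real G)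
        * ee (of_int (int h - int h') * real a / real G))"
      by (rule sum_rotate3)
    also have "\<dots> = (\<Sum>h<H. \<Sum>h'<H. if h = h' then of_nat G else 0)"
      unfolding sum_distrib_left[symmetric] by (intro sum.cong refl) (simp only: orth lessThan_iff, simp)
    also have "\<dots> = of_nat (H * G)" by simp
    finally have "complex_of_real (\<Sum>a<G. F a) = 1" using HG by simp
    thus ?thesis by (metis of_real_eq_1_iff)
  qed
  \<comment> \<open>Outside the window the argument keeps distance at least 8/H from both ends of
    the period, and each of the two inverse-square tails contributes at most 1/8.\<close>
  have Fout: "(\<Sum>a=Suc (2*c)..<G. F a) \<le> 1/4"
  proof -
    have "(\<Sum>a=Suc (2*c)..<G. F a)
        \<le> (\<Sum>a=Suc (2*c)..<G. (1 / (real (a - c))\<^sup>2 + 1 / (real (G + c - a))\<^sup>2) * (real G / real H))"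
    proof (rule sum_mono)
      fix a assume a: "a \<in> {Suc (2*c)..<G}"
      let ?z = "(real a - real c) / real G"
      have z: "0 < ?z" "?z < 1" using a HG by (auto simp: field_simps)
      have e: "?z = real (a - c) / real G" "1 - ?z = real (G + c - a) / real G"
      proof -
        have r: "real (a - c) = real a - real c" "real (G + c - a) = real G + real c - real a"
          using a by (simp_all add: of_nat_diff)
        show "?z = real (a - c) / real G" "1 - ?z = real (G + c - a) / real G"
          unfolding r using HG(2) by (simp_all add: field_simps)
      qed
      have "F a \<le> (1 / ?z\<^sup>2 + 1 / (1 - ?z)\<^sup>2) / real H / real G"
        unfolding F_def by (intro divide_right_mono fejer_le z) auto
      also have "\<dots> = (1 / (real (a - c))\<^sup>2 + 1 / (real (G + c - a))\<^sup>2) * (real G / real H)"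
        unfolding e(2) unfolding e(1) using HG by (simp add: power_divide field_simps power2_eq_square)
      finally show "F a \<le> \<dots>" .
    qed
    also have "\<dots> = ((\<Sum>a=Suc (2*c)..<G. 1 / (real (a - c))\<^sup>2) + (\<Sum>a=Suc (2*c)..<G. 1 / (real (G + c - a))\<^sup>2)) * (real G / real H)"
      unfolding sum_distrib_right[symmetric] sum.distrib ..
    also have "\<dots> \<le> (1 / real c + 1 / real c) * (real G / real H)"
    proof (intro mult_right_mono add_mono)
      have "(\<Sum>a=Suc (2*c)..<G. 1 / (real (a - c))\<^sup>2) = (\<Sum>b=Suc c..G - Suc c. 1 / (real b)\<^sup>2)"
        by (rule sum.reindex_bij_witness[of _ "\<lambda>b. b + c" "\<lambda>a. a - c"]) auto
      thus "(\<Sum>a=Suc (2*c)..<G. 1 / (real (a - c))\<^sup>2) \<le> 1 / real c"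
        using sum_inverse_squares_tail[OF HG(4)] by simp
      have "(\<Sum>a=Suc (2*c)..<G. 1 / (real (G + c - a))\<^sup>2) = (\<Sum>b=Suc c..G - Suc c. 1 / (real b)\<^sup>2)"
        by (rule sum.reindex_bij_witness[of _ "\<lambda>b. G + c - b" "\<lambda>a. G + c - a"]) auto
      thus "(\<Sum>a=Suc (2*c)..<G. 1 / (real (G + c - a))\<^sup>2) \<le> 1 / real c"
        using sum_inverse_squares_tail[OF HG(4)] by simp
    qed auto
    also have "\<dots> = 1/4" using HG by (simp add: field_simps)
    finally show ?thesis .
  qed
  define L where "L = (\<Sum>a<G. \<sigma> * D (u + real a / real G) * F a)"
  \<comment> \<open>The window carries mass 1 - p with p at most 1/4 and contributes at least
    \<open>(A - x) * (1 - p)\<close>; outside it the lower bound -A costs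
    \<open>A * p\<close>.\<close>
  have "A / 2 - x \<le> L"
  proof -
    have split: "{..<G} = {..2*c} \<union> {Suc (2*c)..<G}" "{..2*c} \<inter> {Suc (2*c)..<G} = {}"
      using HG(3) by auto
    have "(\<Sum>a\<le>2*c. F a) = 1 - (\<Sum>a=Suc (2*c)..<G. F a)"
      using Fsum unfolding split(1) by (subst (asm) sum.union_disjoint) auto
    hence "(A - x) * (1 - (\<Sum>a=Suc (2*c)..<G. F a)) = (\<Sum>a\<le>2*c. (A - x) * F a)"
      by (simp only: sum_distrib_left[symmetric])
    also have "\<dots> \<le> (\<Sum>a\<le>2*c. \<sigma> * D (u + real a / real G) * F a)"
      using near F0 unfolding u_def by (intro sum_mono mult_right_mono) auto
    finally have 1: "(A - x) * (1 - (\<Sum>a=Suc (2*c)..<G. F a)) \<le> \<dots>" .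
    have "(\<Sum>a=Suc (2*c)..<G. - A * F a) \<le> (\<Sum>a=Suc (2*c)..<G. \<sigma> * D (u + real a / real G) * F a)"
    proof (intro sum_mono mult_right_mono F0)
      fix a
      have "\<bar>\<sigma> * D (u + real a / real G)\<bar> \<le> A" using bound[of a] \<sigma> by (simp add: abs_mult)
      thus "- A \<le> \<sigma> * D (u + real a / real G)" by linarith
    qed
    hence 2: "- A * (\<Sum>a=Suc (2*c)..<G. F a) \<le> (\<Sum>a=Suc (2*c)..<G. \<sigma> * D (u + real a / real G) * F a)"
      by (simp only: sum_distrib_left[symmetric])
    have L: "L = (\<Sum>a\<le>2*c. \<sigma> * D (u + real a / real G) * F a) + (\<Sum>a=Suc (2*c)..<G. \<sigma> * D (u + real a / real G) * F a)"
      unfolding L_def split(1) by (subst sum.union_disjoint) auto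
    define p where "p = (\<Sum>a=Suc (2*c)..<G. F a)"
    have p: "0 \<le> p" "p \<le> 1/4" using Fout F0 by (auto simp: p_def intro: sum_nonneg)
    have "A * p \<le> A * (1/4)" "0 \<le> x * p"
      using p A0 x0 by (intro mult_left_mono mult_nonneg_nonneg; simp)+
    hence "A / 2 - x \<le> (A - x) * (1 - p) + - A * p" by (simp add: algebra_simps)
    thus ?thesis using 1 2 unfolding L p_def by linarith
  qed
  also have "L \<le> norm (\<Sum>a<G. of_real (D (u + real a / real G)) * complex_of_real (F a))"
  proof -
    have "L = \<sigma> * (\<Sum>a<G. D (u + real a / real G) * F a)"
      by (simp add: L_def sum_distrib_left mult.assoc)
    hence "L \<le> \<bar>\<Sum>a<G. D (u + real a / real G) * F a\<bar>"
      using \<sigma> by (metis abs_ge_self abs_mult mult_1)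
    also have "\<dots> = norm (complex_of_real (\<Sum>a<G. D (u + real a / real G) * F a))"
      by (simp only: norm_of_real)
    finally show ?thesis by simp
  qed
  also have "(\<Sum>a<G. of_real (D (u + real a / real G)) * complex_of_real (F a))
     = (\<Sum>h<H. \<Sum>h'<H. ee (- of_int (int h - int h') * real c / real G) *
        (\<Sum>a<G. of_real (D (u + real a / real G)) * ee (of_int (int h - int h') * real a / real G))) / of_nat (H * G)"
  proof -
    have "(\<Sum>a<G. of_real (D (u + real a / real G)) * complex_of_real (F a))
      = (\<Sum>a<G. \<Sum>h<H. \<Sum>h'<H. ee (- of_int (int h - int h') * real c / real G) *
          (of_real (D (u + real a / real G)) * ee (of_int (int h - int h') * real a / real G))) / of_nat (H * G)"
      unfolding F_expand sum_divide_distrib sum_distrib_left by (simp add: mult_ac)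
    also have "(\<Sum>a<G. \<Sum>h<H. \<Sum>h'<H. ee (- of_int (int h - int h') * real c / real G) *
          (of_real (D (u + real a / real G)) * ee (of_int (int h - int h') * real a / real G)))
       = (\<Sum>h<H. \<Sum>h'<H. \<Sum>a<G. ee (- of_int (int h - int h') * real c / real G) *
          (of_real (D (u + real a / real G)) * ee (of_int (int h - int h') * real a / real G)))"
      by (rule sum_rotate3)
    finally show ?thesis unfolding sum_distrib_left .
  qed
  also have "norm \<dots> \<le> (\<Sum>h<H. \<Sum>h'<H. norm (\<Sum>a<G. of_real (D (u + real a / real G)) * ee (of_int (int h - int h') * real a / real G))) / real (H * G)"
    unfolding norm_divide norm_of_nat
    by (intro divide_right_mono sum_norm_le) (auto intro!: sum_norm_le simp: norm_mult)
  finally have lower: "A / 2 - x \<le> \<dots>" .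
  \<comment> \<open>Bounds the grid coefficient of frequency k: the mean for k = 0 by
    \<open>psi_grid_mean\<close>, the others by \<open>psi_grid_coeff\<close>. The common
    translation \<open>u\<close> changes the sum over \<open>J\<close> only by a unimodular
    factor.\<close>
  define B where "B = (\<lambda>k. if k = 0 then 2 * W else real G / (2 * real k) * (norm (\<Sum>j\<in>J. ee (real k * t j)) + 2 * pi * real k / real G * W))"
  have B0: "0 \<le> B k" for k by (simp add: B_def W_def)
  have coeff: "norm (\<Sum>a<G. of_real (D (u + real a / real G)) * ee (of_int (int h - int h') * real a / real G)) \<le> B (nat \<bar>int h - int h'\<bar>)"
    if "h < H" "h' < H" for h h'
  proof (cases "h = h'")
    case True
    have "(\<Sum>a<G. D (u + real a / real G)) = (\<Sum>j\<in>J. \<Sum>a<G. psi ((t j + u) + real a / real G))"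
      unfolding D_def add.assoc by (rule sum.swap)
    hence "\<bar>\<Sum>a<G. D (u + real a / real G)\<bar> \<le> (\<Sum>j\<in>J. 2)"
      using psi_grid_mean[OF HG(2)] by (simp only:) (rule order.trans[OF sum_abs], rule sum_mono, blast)
    hence "norm (\<Sum>a<G. complex_of_real (D (u + real a / real G))) \<le> 2 * W"
      by (simp add: W_def flip: of_real_sum)
    thus ?thesis using True by (simp add: B_def)
  next
    case False
    define k where "k = int h - int h'"
    have "32 * H \<le> G" using HG(1) by (simp add: G_def)
    hence "int (32 * H) \<le> int G" by (simp only: of_nat_le_iff)
    hence "32 * int H \<le> int G" by (simp only: of_nat_mult of_nat_numeral)
    moreover have "\<bar>int h - int h'\<bar> \<le> int H" using that by (simp add: abs_le_iff)
    ultimately have k: "k \<noteq> 0" "2 * \<bar>k\<bar> \<le> int G" using False unfolding k_def by simp_all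
    have n: "norm (\<Sum>j\<in>J. ee (of_int k * (t j + u))) = norm (\<Sum>j\<in>J. ee (real (nat \<bar>k\<bar>) * t j))"
    proof -
      have "(\<Sum>j\<in>J. ee (of_int k * (t j + u))) = (\<Sum>j\<in>J. ee (of_int k * t j)) * ee (of_int k * u)"
        by (simp add: ring_distribs ee_add sum_distrib_right)
      hence "norm (\<Sum>j\<in>J. ee (of_int k * (t j + u))) = norm (\<Sum>j\<in>J. ee (of_int k * t j))"
        by (simp add: norm_mult)
      also have "\<dots> = norm (\<Sum>j\<in>J. ee (real (nat \<bar>k\<bar>) * t j))"
      proof (cases "k \<ge> 0")
        case False
        have "(\<Sum>j\<in>J. ee (of_int k * t j)) = cnj (\<Sum>j\<in>J. ee (real (nat \<bar>k\<bar>) * t j))"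
          using False by (simp add: ee_minus[symmetric])
        thus ?thesis by (simp only: complex_mod_cnj)
      qed simp
      finally show ?thesis .
    qed
    have "norm (\<Sum>a<G. of_real (\<Sum>j\<in>J. psi ((t j + u) + real a / real G)) * ee (of_int k * real a / real G))
        \<le> real G / (2 * of_int \<bar>k\<bar>) * (norm (\<Sum>j\<in>J. ee (of_int k * (t j + u))) + 2 * pi * of_int \<bar>k\<bar> / real G * real (card J))"
      by (rule psi_grid_coeff[OF HG(2) k fin])
    moreover have "real_of_int \<bar>k\<bar> = real (nat \<bar>k\<bar>)" by simp
    ultimately show ?thesis using k unfolding n k_def[symmetric] B_def D_def W_def
      by (simp only: add.assoc) (simp add: nat_eq_iff)
  qed
  have "(\<Sum>k=1..<H. B k) \<le> (\<Sum>k=1..H. real G / 2 * (norm (\<Sum>j\<in>J. ee (real k * t j)) / real k) + pi * W)"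
  proof (rule order.trans[OF sum_mono2[of "{1..H}" "{1..<H}" B]])
    show "(\<Sum>k=1..H. B k) \<le> (\<Sum>k=1..H. real G / 2 * (norm (\<Sum>j\<in>J. ee (real k * t j)) / real k) + pi * W)"
      using HG(2) by (intro sum_mono) (auto simp: B_def field_simps)
  qed (use B0 in auto)
  also have "\<dots> = real G / 2 * \<Sigma> + real H * (pi * W)"
    by (simp add: \<Sigma>_def sum.distrib sum_distrib_left)
  finally have Bsum: "(\<Sum>k=1..<H. B k) \<le> \<dots>" .
  have "(\<Sum>h<H. \<Sum>h'<H. norm (\<Sum>a<G. of_real (D (u + real a / real G)) * ee (of_int (int h - int h') * real a / real G)))
      \<le> (\<Sum>h<H. B 0 + 2 * (\<Sum>k=1..<H. B k))"
  proof (rule sum_mono)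
    fix h assume "h \<in> {..<H}"
    hence h: "h < H" by simp
    have "(\<Sum>h'<H. norm (\<Sum>a<G. of_real (D (u + real a / real G)) * ee (of_int (int h - int h') * real a / real G)))
        \<le> (\<Sum>h'<H. B (nat \<bar>int h - int h'\<bar>))"
      by (rule sum_mono, rule coeff[OF h]) simp
    also have "\<dots> \<le> B 0 + 2 * (\<Sum>k=1..<H. B k)"
      by (rule sum_abs_difference_le[OF B0 h])
    finally show "(\<Sum>h'<H. norm (\<Sum>a<G. of_real (D (u + real a / real G)) * ee (of_int (int h - int h') * real a / real G)))
        \<le> B 0 + 2 * (\<Sum>k=1..<H. B k)" .
  qed
  also have "\<dots> = real H * (2 * W + 2 * (\<Sum>k=1..<H. B k))" by (simp add: B_def)
  also have "\<dots> \<le> real H * (2 * W + 2 * (real G / 2 * \<Sigma> + real H * (pi * W)))"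
    using Bsum by (intro mult_left_mono) auto
  finally have "(\<Sum>h<H. \<Sum>h'<H. norm (\<Sum>a<G. of_real (D (u + real a / real G)) * ee (of_int (int h - int h') * real a / real G)))
      \<le> real H * (2 * W + 2 * (real G / 2 * \<Sigma> + real H * (pi * W)))" .
  hence "(\<Sum>h<H. \<Sum>h'<H. norm (\<Sum>a<G. of_real (D (u + real a / real G)) * ee (of_int (int h - int h') * real a / real G))) / real (H * G)
      \<le> real H * (2 * W + 2 * (real G / 2 * \<Sigma> + real H * (pi * W))) / real (H * G)"
    by (rule divide_right_mono) simp
  also have "\<dots> = 2 * W / real G + \<Sigma> + 2 * pi * (W / real H)"
    using HG by (simp add: field_simps)
  also have "2 * W / real G \<le> W / real H"
  proof -
    have "W * 2 \<le> W * real H" using HG(1) by (intro mult_left_mono) (auto simp: W_def)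
    thus ?thesis using HG by (simp add: field_simps)
  qed
  also have "2 * pi * (W / real H) \<le> 8 * (W / real H)"
    using pi_less_4 by (intro mult_right_mono) (auto simp: W_def)
  finally have "A / 2 - x \<le> 9 * (W / real H) + \<Sigma>" using lower by linarith
  moreover have "x = 16 * (W / real H)" using HG by (simp add: x_def field_simps)
  ultimately have "A \<le> 50 * (W / real H) + 2 * \<Sigma>" by linarith
  moreover have "\<bar>D 0\<bar> \<le> A" using A_ge[of 0] by simp
  moreover have "0 \<le> \<Sigma>" "0 \<le> W / real H" by (auto simp: \<Sigma>_def W_def intro!: sum_nonneg)
  ultimately have "\<bar>D 0\<bar> \<le> 60 * (W / real H + \<Sigma>)" by (simp add: algebra_simps)
  thus ?thesis unfolding D_def W_def \<Sigma>_def by simp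
qed

section \<open>Divisor functions\<close>

definition divisor_count :: "nat \<Rightarrow> nat" where
  "divisor_count n = card {d. d dvd n}"

lemma finite_divisors: "0 < n \<Longrightarrow> finite {d. d dvd (n::nat)}"
  by (simp add: finite_divisors_nat)

lemma divisor_count_pos: "0 < n \<Longrightarrow> 1 \<le> divisor_count n"
  unfolding divisor_count_def using finite_divisors[of n]
  by (metis Suc_leI One_nat_def card_gt_0_iff dvd_refl empty_iff mem_Collect_eq)

lemma divisor_count_mult_le:
  assumes "0 < a" "0 < b"
  shows "divisor_count (a * b) \<le> divisor_count a * divisor_count b"
proof -
  have "{d. d dvd a * b} \<subseteq> (\<lambda>(x, y). x * y) ` ({d. d dvd a} \<times> {d. d dvd b})"
    using division_decomp[of _ a b] by fast
  hence "card {d. d dvd a * b} \<le> card ({d. d dvd a} \<times> {d. d dvd b})"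
    using assms finite_divisors by (intro surj_card_le) auto
  thus ?thesis by (simp add: divisor_count_def card_cartesian_product)
qed

lemma divisor_count_prime_power_le:
  assumes "prime (p::nat)"
  shows "divisor_count (p ^ e) \<le> e + 1"
proof -
  have "{d. d dvd p ^ e} \<subseteq> (\<lambda>i. p ^ i) ` {..e}"
    using divides_primepow_nat[OF assms] by auto
  hence "card {d. d dvd p ^ e} \<le> card {..e}" by (intro surj_card_le) auto
  thus ?thesis by (simp add: divisor_count_def)
qed

text \<open>Multiplying by a prime p at most doubles the divisor count, while it multiplies the
  right side by \<open>p powr \<epsilon>\<close>, which is at least 2.\<close>

lemma divisor_count_rough:
  fixes \<epsilon> :: real
  assumes "0 < n" and big: "\<And>p. prime p \<Longrightarrow> p dvd n \<Longrightarrow> 2 \<le> real p powr \<epsilon>"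
  shows "real (divisor_count n) \<le> real n powr \<epsilon>"
  using assms
proof (induction n rule: prime_divisors_induct)
  case (unit n)
  thus ?case by (simp add: divisor_count_def)
next
  case (factor p n)
  have n: "0 < n" using factor.prems by (auto intro: Nat.gr0I)
  have p: "0 < p" using factor by (auto intro: prime_gt_0_nat)
  have "divisor_count p \<le> 2" using divisor_count_prime_power_le[of p 1] factor by simp
  hence "real (divisor_count (p * n)) \<le> 2 * real (divisor_count n)"
    using divisor_count_mult_le[OF p n] by (metis (mono_tags) le_trans mult_le_mono1 of_nat_le_iff of_nat_mult of_nat_numeral)
  also have "\<dots> \<le> real p powr \<epsilon> * real n powr \<epsilon>"
  proof (intro mult_mono)
    show "2 \<le> real p powr \<epsilon>" using factor.prems(2)[of p] factor by simp
    show "real (divisor_count n) \<le> real n powr \<epsilon>"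
      using factor n by (intro factor.IH) (auto intro: factor.prems(2))
  qed auto
  finally show ?case by (simp add: powr_mult)
qed simp

text \<open>The local factor at a small prime: e + 1 is compared with 2^(e \<epsilon>) through 1 + z
  \<le> exp z.\<close>

lemma Suc_le_exponential:
  fixes \<epsilon> :: real
  assumes "0 < \<epsilon>" "2 \<le> p"
  shows "real (e + 1) \<le> (1 / (\<epsilon> * ln 2) + 1) * real (p ^ e) powr \<epsilon>"
proof -
  let ?c = "\<epsilon> * ln 2"
  have c: "?c > 0" using assms by simp
  have "1 + real e * ?c \<le> exp (real e * ?c)" by (rule exp_ge_add_one_self)
  also have "\<dots> = (2 ^ e) powr \<epsilon>" by (simp add: powr_def ln_realpow mult_ac)
  also have "\<dots> \<le> real (p ^ e) powr \<epsilon>"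
    using assms by (intro powr_mono2) (auto intro: power_mono)
  finally have 1: "1 + real e * ?c \<le> real (p ^ e) powr \<epsilon>" .
  have "real (e + 1) \<le> (1 / c + 1) * (1 + real e * c)" if "0 < c" for c :: real
    using that by (simp add: field_simps)
  from this[OF c] have "real (e + 1) \<le> (1 / ?c + 1) * (1 + real e * ?c)" .
  also have "\<dots> \<le> (1 / ?c + 1) * real (p ^ e) powr \<epsilon>"
    using 1 c by (intro mult_left_mono) auto
  finally show ?thesis .
qed

text \<open>Only the finitely many primes up to 2^(1/\<epsilon>) can violate the hypothesis of
  \<open>divisor_count_rough\<close>; each is split off with its full power and costs one constant
  factor K.\<close>

theorem divisor_bound:
  fixes \<epsilon> :: real
  assumes "0 < \<epsilon>"
  obtains C where "1 \<le> C" "\<And>n. 0 < n \<Longrightarrow> real (divisor_count n) \<le> C * real n powr \<epsilon>"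
proof -
  define K where "K = 1 / (\<epsilon> * ln 2) + 1"
  have K: "1 \<le> K" using assms by (simp add: K_def)
  \<comment> \<open>Induction over the set \<open>P\<close> of primes that are exempt from the
    largeness condition.\<close>
  have "\<exists>C\<ge>1. \<forall>n>0. (\<forall>q. prime q \<longrightarrow> q dvd n \<longrightarrow> q \<in> P \<or> 2 \<le> real q powr \<epsilon>)
      \<longrightarrow> real (divisor_count n) \<le> C * real n powr \<epsilon>"
    if "finite P" "\<forall>p\<in>P. prime p" for P :: "nat set"
    using that
  proof (induction P rule: finite_induct)
    case empty
    show ?case using divisor_count_rough by (intro exI[of _ 1]) auto
  next
    case (insert p P)
    then obtain C where C: "C \<ge> 1" "\<And>n. n > 0 \<Longrightarrow> (\<forall>q. prime q \<longrightarrow> q dvd n \<longrightarrow> q \<in> P \<or> 2 \<le> real q powr \<epsilon>)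
      \<Longrightarrow> real (divisor_count n) \<le> C * real n powr \<epsilon>" by auto
    have p: "prime p" using insert by auto
    show ?case
    proof (intro exI[of _ "K * C"] conjI allI impI)
      show "1 \<le> K * C" using K C(1) by (metis mult_mono' mult_1 zero_le_one)
      fix n :: nat
      assume n: "0 < n" and q: "\<forall>q. prime q \<longrightarrow> q dvd n \<longrightarrow> q \<in> insert p P \<or> 2 \<le> real q powr \<epsilon>"
      define e where "e = multiplicity p n"
      have "\<not> is_unit p" using p by auto
      then obtain m where m: "n = p ^ e * m" "\<not> p dvd m"
        using multiplicity_decompose'[of n p] n unfolding e_def by auto
      have m0: "0 < m" using n m by (auto intro: Nat.gr0I)
      have "real (divisor_count n) \<le> real (divisor_count (p ^ e)) * real (divisor_count m)"
        using divisor_count_mult_le[of "p ^ e" m] m0 p unfolding m(1)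
        by (metis of_nat_le_iff of_nat_mult prime_gt_0_nat zero_less_power)
      also have "\<dots> \<le> (K * real (p ^ e) powr \<epsilon>) * (C * real m powr \<epsilon>)"
      proof (intro mult_mono)
        have "real (divisor_count (p ^ e)) \<le> real (e + 1)"
          using divisor_count_prime_power_le[OF p, of e] by linarith
        also have "\<dots> \<le> K * real (p ^ e) powr \<epsilon>"
          unfolding K_def using Suc_le_exponential[OF assms, of p e] prime_ge_2_nat[OF p] by simp
        finally show "real (divisor_count (p ^ e)) \<le> K * real (p ^ e) powr \<epsilon>" .
        show "real (divisor_count m) \<le> C * real m powr \<epsilon>"
        proof (rule C(2)[OF m0], intro allI impI)
          fix q assume "prime q" "q dvd m"
          hence "q dvd n" "q \<noteq> p" using m by auto
          thus "q \<in> P \<or> 2 \<le> real q powr \<epsilon>" using q \<open>prime q\<close> by blast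
        qed
      qed (use K in auto)
      also have "\<dots> = K * C * real n powr \<epsilon>"
        unfolding m(1) by (simp add: powr_mult)
      finally show "real (divisor_count n) \<le> K * C * real n powr \<epsilon>" .
    qed
  qed
  note claim = this
  define P where "P = {p::nat. prime p \<and> real p \<le> 2 powr (1 / \<epsilon>)}"
  have "P \<subseteq> {..nat \<lfloor>2 powr (1 / \<epsilon>)\<rfloor>}" unfolding P_def by (auto intro: le_nat_floor)
  hence "finite P" using finite_subset by blast
  then obtain C where C: "C \<ge> 1" "\<And>n. n > 0 \<Longrightarrow> (\<forall>q. prime q \<longrightarrow> q dvd n \<longrightarrow> q \<in> P \<or> 2 \<le> real q powr \<epsilon>)
      \<Longrightarrow> real (divisor_count n) \<le> C * real n powr \<epsilon>"
    using claim[of P] unfolding P_def by blast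
  show thesis
  proof (rule that[OF C(1) C(2)])
    fix n :: nat assume "0 < n"
    show "\<forall>q. prime q \<longrightarrow> q dvd n \<longrightarrow> q \<in> P \<or> 2 \<le> real q powr \<epsilon>"
    proof (intro allI impI)
      fix q :: nat assume "prime q"
      show "q \<in> P \<or> 2 \<le> real q powr \<epsilon>"
      proof (cases "real q \<le> 2 powr (1 / \<epsilon>)")
        case False
        hence "(2 powr (1 / \<epsilon>)) powr \<epsilon> \<le> real q powr \<epsilon>"
          using assms by (intro powr_mono2) auto
        thus ?thesis using assms by (simp add: powr_powr)
      qed (use \<open>prime q\<close> in \<open>auto simp: P_def\<close>)
    qed
  qed
qed

section \<open>Ordered factorizations\<close>

lemma dvd_prod_list: "m \<in> set ns \<Longrightarrow> m dvd prod_list (ns :: nat list)"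
  by (induction ns) auto

lemma card_factorizations_le:
  assumes "0 < n"
  shows "card {ns. length ns = k \<and> prod_list ns = n} \<le> divisor_count n ^ k"
    and "finite {ns. length ns = k \<and> prod_list ns = n}"
proof -
  have sub: "{ns. length ns = k \<and> prod_list ns = n} \<subseteq> {ns. set ns \<subseteq> {d. d dvd n} \<and> length ns = k}"
    using dvd_prod_list by auto
  have fin: "finite {ns. set ns \<subseteq> {d. d dvd n} \<and> length ns = k}"
    using assms by (intro finite_lists_length_eq finite_divisors)
  show "finite {ns. length ns = k \<and> prod_list ns = n}"
    using sub fin by (rule finite_subset)
  have "card {ns. length ns = k \<and> prod_list ns = n} \<le> card {ns. set ns \<subseteq> {d. d dvd n} \<and> length ns = k}"
    using fin sub by (rule card_mono)
  also have "\<dots> = divisor_count n ^ k"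
    using assms by (simp add: card_lists_length_eq finite_divisors divisor_count_def)
  finally show "card {ns. length ns = k \<and> prod_list ns = n} \<le> divisor_count n ^ k" .
qed

section \<open>Spacing of quadratic expressions\<close>

lemma card_separated_le:
  fixes F :: "real set"
  assumes "finite F" "0 < s" "0 \<le> l"
    and sep: "\<And>x y. x \<in> F \<Longrightarrow> y \<in> F \<Longrightarrow> x \<noteq> y \<Longrightarrow> s \<le> \<bar>x - y\<bar>"
    and diam: "\<And>x y. x \<in> F \<Longrightarrow> y \<in> F \<Longrightarrow> \<bar>x - y\<bar> \<le> l"
  shows "real (card F) \<le> 1 + l / s"
proof (cases "F = {}")
  case False
  define g where "g = (\<lambda>x. nat \<lfloor>(x - Min F) / s\<rfloor>)"
  have Min: "Min F \<in> F" "\<And>x. x \<in> F \<Longrightarrow> Min F \<le> x" using assms(1) False by auto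
  have "inj_on g F"
  proof (rule inj_onI, rule ccontr)
    fix x y assume xy: "x \<in> F" "y \<in> F" "g x = g y" "x \<noteq> y"
    have "0 \<le> (x - Min F) / s" "0 \<le> (y - Min F) / s" using Min xy assms(2) by auto
    hence "\<lfloor>(x - Min F) / s\<rfloor> = \<lfloor>(y - Min F) / s\<rfloor>"
      using xy(3) unfolding g_def by (simp add: nat_eq_iff)
    hence "\<bar>(x - Min F) / s - (y - Min F) / s\<bar> < 1" by linarith
    hence "\<bar>(x - y) / s\<bar> < 1" by (simp add: diff_divide_distrib)
    hence "\<bar>x - y\<bar> < s" using assms(2) by (simp add: abs_divide field_simps)
    with sep[OF xy(1,2,4)] show False by simp
  qed
  moreover have "g ` F \<subseteq> {..nat \<lfloor>l / s\<rfloor>}"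
  proof safe
    fix x assume "x \<in> F"
    hence "(x - Min F) / s \<le> l / s" using diam[of x "Min F"] Min assms(2) by (intro divide_right_mono) auto
    thus "g x \<le> nat \<lfloor>l / s\<rfloor>" unfolding g_def by (intro nat_mono floor_mono)
  qed
  ultimately have "card F \<le> card {..nat \<lfloor>l / s\<rfloor>}" by (intro card_inj_on_le) auto
  also have "real (card {..nat \<lfloor>l / s\<rfloor>}) \<le> 1 + l / s"
    using assms(2,3) by simp
  finally show ?thesis by simp
qed (use assms in auto)

text \<open>Two distinct reduced fractions b/a and d/c differ by at least 1/(a c), hence by at least
  1/W^2. The first component of a pair is the denominator.\<close>

lemma card_fractions_le:
  fixes S :: "(nat \<times> nat) set" and W l :: real
  assumes fin: "finite S" and "0 \<le> l"
    and S: "\<And>a b. (a, b) \<in> S \<Longrightarrow> coprime a b \<and> 1 \<le> a \<and> real a \<le> W"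
    and diam: "\<And>a b c d. (a, b) \<in> S \<Longrightarrow> (c, d) \<in> S \<Longrightarrow> \<bar>real b / real a - real d / real c\<bar> \<le> l"
  shows "real (card S) \<le> 1 + l * W\<^sup>2"
proof (cases "S = {}")
  case False
  then obtain a0 b0 where "(a0, b0) \<in> S" by auto
  hence W: "1 \<le> W" using S[of a0 b0] by (metis of_nat_1 of_nat_le_iff order.trans)
  define F where "F = (\<lambda>(a, b). real b / real a) ` S"
  have sep: "1 / W\<^sup>2 \<le> \<bar>real b / real a - real d / real c\<bar>"
    if ab: "(a, b) \<in> S" "(c, d) \<in> S" "(a, b) \<noteq> (c, d)" for a b c d
  proof -
    have pos: "1 \<le> real a" "1 \<le> real c" "real a \<le> W" "real c \<le> W" using S[OF ab(1)] S[OF ab(2)] by auto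
    have "b * c \<noteq> d * a"
    proof
      assume eq: "b * c = d * a"
      have "coprime a b" "coprime c d" using S[OF ab(1)] S[OF ab(2)] by auto
      hence "a = c \<and> b = d" using coprime_crossproduct_nat[of a b c d] eq
        by (simp add: mult.commute)
      thus False using ab(3) by simp
    qed
    hence "int (b * c) \<noteq> int (d * a)" by linarith
    hence "1 \<le> \<bar>int (b * c) - int (d * a)\<bar>" by linarith
    hence "1 \<le> \<bar>real_of_int (int (b * c) - int (d * a))\<bar>" by linarith
    hence one: "1 \<le> \<bar>real b * real c - real d * real a\<bar>" by simp
    have "1 / W\<^sup>2 \<le> 1 / (real a * real c)"
      unfolding power2_eq_square using pos W by (intro divide_left_mono mult_mono mult_pos_pos) auto
    also have "\<dots> \<le> \<bar>real b * real c - real d * real a\<bar> / (real a * real c)"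
      using one pos by (intro divide_right_mono) auto
    also have "\<dots> = \<bar>real b / real a - real d / real c\<bar>"
    proof -
      have "real b / real a - real d / real c = (real b * real c - real d * real a) / (real a * real c)"
        using pos by (simp add: field_simps)
      thus ?thesis using pos by (simp add: abs_mult)
    qed
    finally show ?thesis .
  qed
  have "inj_on (\<lambda>(a, b). real b / real a) S"
  proof (rule inj_onI, clarify)
    fix a b c d assume *: "(a, b) \<in> S" "(c, d) \<in> S" "real b / real a = real d / real c"
    show "a = c \<and> b = d"
    proof (rule ccontr)
      assume "\<not> (a = c \<and> b = d)"
      hence "1 / W\<^sup>2 \<le> 0" using sep[of a b c d] * by auto
      thus False using W by (simp add: field_simps)
    qed
  qed
  hence "card S = card F" unfolding F_def by (simp add: card_image)
  also have "real (card F) \<le> 1 + l / (1 / W\<^sup>2)"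
  proof (rule card_separated_le)
    show "1 / W\<^sup>2 \<le> \<bar>x - y\<bar>" if "x \<in> F" "y \<in> F" "x \<noteq> y" for x y
      using that sep unfolding F_def by fastforce
    show "\<bar>x - y\<bar> \<le> l" if "x \<in> F" "y \<in> F" for x y
      using that diam unfolding F_def by fastforce
  qed (use fin W assms in \<open>auto simp: F_def\<close>)
  finally show ?thesis by simp
qed (use assms in auto)

lemma card_le_fibres:
  fixes K :: real
  assumes "finite Y" "finite T" "f ` Y \<subseteq> T" "0 \<le> K"
    and "\<And>t. t \<in> T \<Longrightarrow> real (card {y \<in> Y. f y = t}) \<le> K"
  shows "real (card Y) \<le> real (card T) * K"
proof -
  have "card Y = (\<Sum>t\<in>T. card {y \<in> Y. f y = t})"
    using sum.group[OF assms(1,2,3), of "\<lambda>_. 1 :: nat"] by simp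
  hence "real (card Y) = (\<Sum>t\<in>T. real (card {y \<in> Y. f y = t}))" by simp
  also have "\<dots> \<le> (\<Sum>t\<in>T. K)" using assms(5) by (rule sum_mono)
  finally show ?thesis by simp
qed

lemma card_nat_le_floor: "0 \<le> A \<Longrightarrow> real (card {n::nat. 1 \<le> n \<and> real n \<le> A}) \<le> A"
  and finite_nat_le_real: "finite {n::nat. 1 \<le> n \<and> real n \<le> A}"
proof -
  have sub: "{n::nat. 1 \<le> n \<and> real n \<le> A} \<subseteq> {1..nat \<lfloor>A\<rfloor>}" by (auto intro: le_nat_floor)
  thus "finite {n::nat. 1 \<le> n \<and> real n \<le> A}" using finite_subset by blast
  assume "0 \<le> A"
  have "card {n::nat. 1 \<le> n \<and> real n \<le> A} \<le> card {1..nat \<lfloor>A\<rfloor>}" using sub by (intro card_mono) auto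
  also have "real (card {1..nat \<lfloor>A\<rfloor>}) \<le> A" using \<open>0 \<le> A\<close> by simp
  finally show "real (card {n::nat. 1 \<le> n \<and> real n \<le> A}) \<le> A" by simp
qed

text \<open>Either pair may be fixed and the other counted by the spacing of reduced fractions. Up
  to constants this gives A^2 or W^2 besides the common term \<Delta> A^2 W^2, and the smaller of
  A^2 and W^2 is at most A W.\<close>

lemma card_coprime_quadruples:
  fixes A W \<Lambda> \<kappa> \<Delta> :: real
  assumes "0 \<le> A" "0 \<le> W" "1 \<le> \<Lambda>" "1 \<le> \<kappa>" "0 \<le> \<Delta>"
    and Y: "\<And>a b c d. (a, b, c, d) \<in> Y \<Longrightarrow> coprime a b \<and> coprime c d \<and> 1 \<le> a \<and> real a \<le> A \<and>
          1 \<le> b \<and> real b \<le> \<Lambda> * A \<and> 1 \<le> c \<and> real c \<le> W \<and> 1 \<le> d \<and> real d \<le> W \<and>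
          real c \<le> \<kappa> * real d \<and> \<bar>real b / real a - (real d / real c)\<^sup>2\<bar> \<le> \<Delta>"
  shows "real (card Y) \<le> 2 * \<Lambda> * \<kappa> * (A * W + \<Delta> * A\<^sup>2 * W\<^sup>2)"
proof -
  let ?N = "\<lambda>A::real. {n::nat. 1 \<le> n \<and> real n \<le> A}"
  let ?AB = "?N A \<times> ?N (\<Lambda> * A)" and ?CD = "?N W \<times> ?N W"
  have "Y \<subseteq> ?N A \<times> ?N (\<Lambda> * A) \<times> ?N W \<times> ?N W" using Y by auto
  hence fin: "finite Y"
    by (rule finite_subset) (intro finite_SigmaI finite_nat_le_real)
  have AB: "finite ?AB" "real (card ?AB) \<le> \<Lambda> * A\<^sup>2"
  proof -
    have "real (card (?N A)) * real (card (?N (\<Lambda> * A))) \<le> A * (\<Lambda> * A)"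
      using assms by (intro mult_mono card_nat_le_floor) auto
    thus "finite ?AB" "real (card ?AB) \<le> \<Lambda> * A\<^sup>2"
      using finite_nat_le_real by (auto simp: card_cartesian_product power2_eq_square mult_ac)
  qed
  have CD: "finite ?CD" "real (card ?CD) \<le> W\<^sup>2"
  proof -
    have "real (card (?N W)) * real (card (?N W)) \<le> W * W"
      using assms by (intro mult_mono card_nat_le_floor) auto
    thus "finite ?CD" "real (card ?CD) \<le> W\<^sup>2"
      using finite_nat_le_real by (auto simp: card_cartesian_product power2_eq_square)
  qed
  have 1: "real (card Y) \<le> (\<Lambda> * A\<^sup>2) * (1 + \<kappa> * \<Delta> * W\<^sup>2)"
  proof -
    have "real (card {y \<in> Y. (\<lambda>(a, b, c, d). (a, b)) y = t}) \<le> 1 + \<kappa> * \<Delta> * W\<^sup>2" for t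
    proof -
      obtain a b where t: "t = (a, b)" by fastforce
      define S where "S = {(c, d). (a, b, c, d) \<in> Y}"
      have "{y \<in> Y. (\<lambda>(a, b, c, d). (a, b)) y = t} = (\<lambda>(c, d). (a, b, c, d)) ` S"
        by (auto simp: S_def t)
      moreover have finS: "finite S"
        by (rule finite_subset[of _ "?CD"]) (use Y CD in \<open>auto simp: S_def\<close>)
      ultimately have "card {y \<in> Y. (\<lambda>(a, b, c, d). (a, b)) y = t} \<le> card S"
        by (simp add: card_image_le)
      also have "real (card S) \<le> 1 + (\<kappa> * \<Delta>) * W\<^sup>2"
      proof (rule card_fractions_le[OF finS])
        fix c d c' d' assume *: "(c, d) \<in> S" "(c', d') \<in> S"
        let ?\<phi> = "real d / real c" and ?\<psi> = "real d' / real c'"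
        have y: "(a, b, c, d) \<in> Y" "(a, b, c', d') \<in> Y" using * by (auto simp: S_def)
        note Y1 = Y[OF y(1)] and Y2 = Y[OF y(2)]
        \<comment> \<open>Both fractions are at least 1/\<kappa>, so closeness of the squares passes
          to the fractions themselves.\<close>
        have "1 / \<kappa> \<le> ?\<phi>" "1 / \<kappa> \<le> ?\<psi>" using Y1 Y2 assms(4) by (auto simp: field_simps)
        hence s: "2 / \<kappa> \<le> ?\<phi> + ?\<psi>" by simp
        have "\<bar>?\<phi>\<^sup>2 - ?\<psi>\<^sup>2\<bar> \<le> 2 * \<Delta>" using Y1 Y2 by linarith
        moreover have "?\<phi>\<^sup>2 - ?\<psi>\<^sup>2 = (?\<phi> - ?\<psi>) * (?\<phi> + ?\<psi>)" by (simp add: power2_eq_square algebra_simps)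
        moreover have "\<bar>?\<phi> - ?\<psi>\<bar> * (2 / \<kappa>) \<le> \<bar>?\<phi> - ?\<psi>\<bar> * (?\<phi> + ?\<psi>)"
          using s by (rule mult_left_mono) simp
        ultimately have "\<bar>?\<phi> - ?\<psi>\<bar> * (2 / \<kappa>) \<le> 2 * \<Delta>" by (simp add: abs_mult)
        thus "\<bar>?\<phi> - ?\<psi>\<bar> \<le> \<kappa> * \<Delta>" using assms(4) by (simp add: field_simps)
      qed (use Y assms in \<open>auto simp: S_def\<close>)
      finally show ?thesis by simp
    qed
    note fib = this
    have "real (card Y) \<le> real (card ?AB) * (1 + \<kappa> * \<Delta> * W\<^sup>2)"
    proof (rule card_le_fibres[OF fin AB(1)])
      show "(\<lambda>(a, b, c, d). (a, b)) ` Y \<subseteq> ?AB"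
      proof (rule image_subsetI)
        fix y assume "y \<in> Y"
        thus "(case y of (a, b, c, d) \<Rightarrow> (a, b)) \<in> ?AB" by (cases y) (auto dest!: Y)
      qed
    qed (use assms fib in auto)
    also have "\<dots> \<le> (\<Lambda> * A\<^sup>2) * (1 + \<kappa> * \<Delta> * W\<^sup>2)"
      using AB(2) assms by (intro mult_right_mono) auto
    finally show ?thesis .
  qed
  have 2: "real (card Y) \<le> W\<^sup>2 * (1 + 2 * \<Delta> * A\<^sup>2)"
  proof -
    have "real (card {y \<in> Y. (\<lambda>(a, b, c, d). (c, d)) y = t}) \<le> 1 + 2 * \<Delta> * A\<^sup>2" for t
    proof -
      obtain c d where t: "t = (c, d)" by fastforce
      define S where "S = {(a, b). (a, b, c, d) \<in> Y}"
      have "{y \<in> Y. (\<lambda>(a, b, c, d). (c, d)) y = t} = (\<lambda>(a, b). (a, b, c, d)) ` S"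
        by (auto simp: S_def t)
      moreover have finS: "finite S"
        by (rule finite_subset[of _ "?AB"]) (use Y AB in \<open>auto simp: S_def\<close>)
      ultimately have "card {y \<in> Y. (\<lambda>(a, b, c, d). (c, d)) y = t} \<le> card S"
        by (simp add: card_image_le)
      also have "real (card S) \<le> 1 + (2 * \<Delta>) * A\<^sup>2"
      proof (rule card_fractions_le[OF finS])
        fix a b a' b' assume *: "(a, b) \<in> S" "(a', b') \<in> S"
        have y: "(a, b, c, d) \<in> Y" "(a', b', c, d) \<in> Y" using * by (auto simp: S_def)
        show "\<bar>real b / real a - real b' / real a'\<bar> \<le> 2 * \<Delta>"
          using Y[OF y(1)] Y[OF y(2)] by linarith
      qed (use Y assms in \<open>auto simp: S_def\<close>)
      finally show ?thesis by simp
    qed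
    note fib = this
    have "real (card Y) \<le> real (card ?CD) * (1 + 2 * \<Delta> * A\<^sup>2)"
    proof (rule card_le_fibres[OF fin CD(1)])
      show "(\<lambda>(a, b, c, d). (c, d)) ` Y \<subseteq> ?CD"
      proof (rule image_subsetI)
        fix y assume "y \<in> Y"
        thus "(case y of (a, b, c, d) \<Rightarrow> (c, d)) \<in> ?CD" by (cases y) (auto dest!: Y)
      qed
    qed (use assms fib in auto)
    also have "\<dots> \<le> W\<^sup>2 * (1 + 2 * \<Delta> * A\<^sup>2)"
      using CD(2) assms by (intro mult_right_mono) auto
    finally show ?thesis .
  qed
  define P where "P = \<Delta> * A\<^sup>2 * W\<^sup>2"
  have P: "0 \<le> P" "0 \<le> A * W" using assms by (auto simp: P_def)
  have \<Lambda>\<kappa>: "1 \<le> \<Lambda> * \<kappa>" "\<Lambda> \<le> \<Lambda> * \<kappa>" using assms(3,4) mult_mono[of 1 \<Lambda> 1 \<kappa>] by auto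
  show ?thesis
  proof (cases "A \<le> W")
    case True
    have "A\<^sup>2 \<le> A * W" using True assms by (simp add: power2_eq_square mult_left_mono)
    hence "\<Lambda> * A\<^sup>2 \<le> (\<Lambda> * \<kappa>) * (A * W)" using \<Lambda>\<kappa> assms by (intro mult_mono) auto
    moreover have "(\<Lambda> * A\<^sup>2) * (1 + \<kappa> * \<Delta> * W\<^sup>2) = \<Lambda> * A\<^sup>2 + (\<Lambda> * \<kappa>) * P"
      by (simp add: P_def algebra_simps)
    moreover have "0 \<le> (\<Lambda> * \<kappa>) * P" "0 \<le> (\<Lambda> * \<kappa>) * (A * W)"
      using P \<Lambda>\<kappa>(1) by auto
    ultimately have "real (card Y) \<le> 2 * ((\<Lambda> * \<kappa>) * (A * W)) + 2 * ((\<Lambda> * \<kappa>) * P)" using 1 by linarith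
    thus ?thesis by (simp add: P_def algebra_simps)
  next
    case False
    have "W\<^sup>2 \<le> A * W" using False assms by (simp add: power2_eq_square mult_right_mono)
    moreover have "W\<^sup>2 * (1 + 2 * \<Delta> * A\<^sup>2) = W\<^sup>2 + 2 * P" by (simp add: P_def algebra_simps)
    ultimately have "real (card Y) \<le> 2 * (A * W) + 2 * P" using 2 P by linarith
    also have "\<dots> \<le> (\<Lambda> * \<kappa>) * (2 * (A * W) + 2 * P)"
      using mult_right_mono[OF \<Lambda>\<kappa>(1), of "2 * (A * W) + 2 * P"] P by simp
    finally show ?thesis by (simp add: P_def algebra_simps)
  qed
qed

text \<open>The dyadic size \<open>2 ^ i\<close> of \<open>q1\<close> and the gcds \<open>g\<close> of \<open>q1, q2\<close> and \<open>e\<close> of \<open>u1, u2\<close> are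
  fixed first; what remains are two reduced fractions, each from a well-spaced set.\<close>

lemma card_near_quadratic:
  fixes Q U \<kappa> \<rho> R L :: real
  assumes Q: "1 \<le> Q" and U: "1 \<le> U" and \<kappa>: "1 \<le> \<kappa>" and \<rho>: "0 \<le> \<rho>" and R: "0 \<le> R" "R \<le> \<rho> * U\<^sup>2"
    and L: "\<And>n. real n \<le> 2 * Q \<Longrightarrow> (\<Sum>g=1..n. 1 / real g) \<le> L"
           "\<And>n. real n \<le> \<kappa> * U \<Longrightarrow> (\<Sum>g=1..n. 1 / real g) \<le> L"
  defines "Z \<equiv> {(q1 :: nat, q2 :: nat, u1 :: nat, u2 :: nat).
      1 \<le> q1 \<and> real q1 \<le> Q \<and> 1 \<le> q2 \<and> real q2 \<le> Q \<and>
      U \<le> real u1 \<and> real u1 \<le> \<kappa> * U \<and> U \<le> real u2 \<and> real u2 \<le> \<kappa> * U \<and>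
      \<bar>real q1 * (real u2)\<^sup>2 - real q2 * (real u1)\<^sup>2\<bar> \<le> R}"
  shows "real (card Z) \<le> 32 * (\<kappa>\<^sup>2 + \<rho>) * \<kappa> ^ 3 * L\<^sup>2 * Q * (U + R)"
proof -
  \<comment> \<open>Closeness of q1 u2^2 and q2 u1^2 forces q2 \<le> \<Lambda> q1, so a dyadic bound
    on q1 alone controls q2 as well.\<close>
  define \<Lambda> where "\<Lambda> = \<kappa>\<^sup>2 + \<rho>"
  have "1 \<le> \<kappa>\<^sup>2" using \<kappa> by (rule one_le_power)
  hence \<Lambda>: "1 \<le> \<Lambda>" using \<rho> unfolding \<Lambda>_def by linarith
  define I where "I = {i::nat. 2 ^ i \<le> Q}"
  define Gs where "Gs = (\<lambda>i::nat. {g::nat. 1 \<le> g \<and> real g \<le> 2 ^ Suc i})"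
  define Es where "Es = {e::nat. 1 \<le> e \<and> real e \<le> \<kappa> * U}"
  define Y where "Y = (\<lambda>i g e. {(a :: nat, b :: nat, c :: nat, d :: nat). coprime a b \<and> coprime c d \<and>
      2 ^ i \<le> real (g * a) \<and> real (g * a) \<le> 2 ^ Suc i \<and> 1 \<le> a \<and> 1 \<le> b \<and> 1 \<le> c \<and> 1 \<le> d \<and>
      real (g * b) \<le> \<Lambda> * 2 ^ Suc i \<and>
      U \<le> real (e * c) \<and> real (e * c) \<le> \<kappa> * U \<and> U \<le> real (e * d) \<and> real (e * d) \<le> \<kappa> * U \<and>
      \<bar>real (g * a) * (real (e * d))\<^sup>2 - real (g * b) * (real (e * c))\<^sup>2\<bar> \<le> R})"
  have finI: "finite I"
  proof -
    have "I \<subseteq> {..nat \<lfloor>Q\<rfloor>}"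
    proof
      fix i assume "i \<in> I"
      have "real i < 2 ^ i" by simp
      also have "\<dots> \<le> Q" using \<open>i \<in> I\<close> by (simp add: I_def)
      finally show "i \<in> {..nat \<lfloor>Q\<rfloor>}" by (auto intro: le_nat_floor)
    qed
    thus ?thesis using finite_subset by blast
  qed
  have finG: "finite (Gs i)" and finE: "finite Es" for i
    unfolding Gs_def Es_def by (rule finite_nat_le_real)+
  have finY: "finite (Y i g e)" if "1 \<le> g" "1 \<le> e" for i g e
  proof (rule finite_subset)
    have le: "real n \<le> real (m * n)" if "1 \<le> m" for m n :: nat
      using mult_le_mono1[OF that, of n] by (simp only: of_nat_le_iff mult_1)
    let ?N = "\<lambda>A::real. {n::nat. 1 \<le> n \<and> real n \<le> A}"
    show "Y i g e \<subseteq> ?N (2 ^ Suc i) \<times> ?N (\<Lambda> * 2 ^ Suc i) \<times> ?N (\<kappa> * U) \<times> ?N (\<kappa> * U)"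
      unfolding Y_def using le[OF that(1)] le[OF that(2)] by (auto intro: order.trans)
    show "finite (?N (2 ^ Suc i) \<times> ?N (\<Lambda> * 2 ^ Suc i) \<times> ?N (\<kappa> * U) \<times> ?N (\<kappa> * U))"
      by (intro finite_SigmaI finite_nat_le_real)
  qed
  have cover: "Z \<subseteq> (\<Union>i\<in>I. \<Union>g\<in>Gs i. \<Union>e\<in>Es. (\<lambda>(a, b, c, d). (g * a, g * b, e * c, e * d)) ` Y i g e)"
  proof
    fix z assume "z \<in> Z"
    then obtain q1 q2 u1 u2 where z: "z = (q1, q2, u1, u2)" and
      q: "1 \<le> q1" "real q1 \<le> Q" "1 \<le> q2" "real q2 \<le> Q" and
      u: "U \<le> real u1" "real u1 \<le> \<kappa> * U" "U \<le> real u2" "real u2 \<le> \<kappa> * U" and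
      close: "\<bar>real q1 * (real u2)\<^sup>2 - real q2 * (real u1)\<^sup>2\<bar> \<le> R"
      unfolding Z_def by auto
    have u0: "1 \<le> u1" "1 \<le> u2" using u U by linarith+
    obtain i where i: "2 ^ i \<le> q1" "q1 < 2 ^ Suc i"
      using ex_power_ivl1[of 2 q1] q by auto
    have i': "2 ^ i \<le> real q1" "real q1 \<le> 2 ^ Suc i"
      using i by (metis of_nat_le_iff of_nat_numeral of_nat_power less_imp_le)+
    have "real q2 * U\<^sup>2 \<le> real q2 * (real u1)\<^sup>2" using u U by (intro mult_left_mono power_mono) auto
    also have "\<dots> \<le> real q1 * (real u2)\<^sup>2 + R" using close by linarith
    also have "\<dots> \<le> real q1 * (\<kappa> * U)\<^sup>2 + real q1 * (\<rho> * U\<^sup>2)"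
    proof (intro add_mono mult_left_mono power_mono)
      have "R \<le> 1 * (\<rho> * U\<^sup>2)" using R by simp
      also have "\<dots> \<le> real q1 * (\<rho> * U\<^sup>2)" using q \<rho> by (intro mult_right_mono) auto
      finally show "R \<le> real q1 * (\<rho> * U\<^sup>2)" .
    qed (use u in auto)
    also have "\<dots> = (\<Lambda> * real q1) * U\<^sup>2" by (simp add: \<Lambda>_def power_mult_distrib algebra_simps)
    finally have "real q2 \<le> \<Lambda> * real q1" using U by simp
    also have "\<dots> \<le> \<Lambda> * 2 ^ Suc i" using i' \<Lambda> by (intro mult_left_mono) auto
    finally have q2: "real q2 \<le> \<Lambda> * 2 ^ Suc i" .
    define g where "g = gcd q1 q2"
    define e where "e = gcd u1 u2"
    obtain a b where ab: "q1 = g * a" "q2 = g * b" "coprime a b"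
      using gcd_coprime_exists[of q1 q2] q unfolding g_def by (metis gcd_eq_0_iff mult.commute not_one_le_zero)
    obtain c d where cd: "u1 = e * c" "u2 = e * d" "coprime c d"
      using gcd_coprime_exists[of u1 u2] u0 unfolding e_def by (metis gcd_eq_0_iff mult.commute not_one_le_zero)
    have pos: "1 \<le> g" "1 \<le> a" "1 \<le> b" "1 \<le> e" "1 \<le> c" "1 \<le> d"
      using q u0 ab cd by (auto simp: Suc_le_eq intro: Nat.gr0I)
    have "i \<in> I" using order.trans[OF i'(1) q(2)] unfolding I_def by simp
    moreover have "g \<in> Gs i"
    proof -
      have "g \<le> q1" using ab pos by simp
      thus ?thesis using i' pos unfolding Gs_def by auto
    qed
    moreover have "e \<in> Es"
    proof -
      have "e \<le> u1" using cd pos by simp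
      thus ?thesis using u pos unfolding Es_def by auto
    qed
    moreover have "(a, b, c, d) \<in> Y i g e"
      using i' q2 u close pos ab(3) cd(3) unfolding Y_def ab(1,2) cd(1,2) by auto
    moreover have "z = (\<lambda>(a, b, c, d). (g * a, g * b, e * c, e * d)) (a, b, c, d)"
      by (simp add: z ab(1,2) cd(1,2))
    ultimately show "z \<in> (\<Union>i\<in>I. \<Union>g\<in>Gs i. \<Union>e\<in>Es. (\<lambda>(a, b, c, d). (g * a, g * b, e * c, e * d)) ` Y i g e)"
      by blast
  qed
  define t where "t = 2 * \<Lambda> * \<kappa> * (2 * \<kappa> * U + 4 * \<kappa>\<^sup>2 * R)"
  have t0: "0 \<le> t" unfolding t_def using \<Lambda> \<kappa> U R by (intro mult_nonneg_nonneg add_nonneg_nonneg) auto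
  have cardY: "real (card (Y i g e)) \<le> t * 2 ^ i * (1 / real g) * (1 / real e)"
    if g: "g \<in> Gs i" and e: "e \<in> Es" for i g e
  proof -
    define A where "A = 2 ^ Suc i / real g"
    define W where "W = \<kappa> * U / real e"
    \<comment> \<open>Dividing the quadratic inequality by q1 u1^2, which is at least 2^i U^2,
      removes both gcds and leaves |b/a - (d/c)^2| \<le> \<Delta>.\<close>
    define \<Delta> where "\<Delta> = R / (2 ^ i * U\<^sup>2)"
    have ge: "1 \<le> real g" "1 \<le> real e" using g e by (auto simp: Gs_def Es_def)
    have "real (card (Y i g e)) \<le> 2 * \<Lambda> * \<kappa> * (A * W + \<Delta> * A\<^sup>2 * W\<^sup>2)"
    proof (rule card_coprime_quadruples)
      fix a b c d assume "(a, b, c, d) \<in> Y i g e"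
      hence y: "coprime a b" "coprime c d" "1 \<le> a" "1 \<le> b" "1 \<le> c" "1 \<le> d"
        "2 ^ i \<le> real g * real a" "real g * real a \<le> 2 ^ Suc i" "real g * real b \<le> \<Lambda> * 2 ^ Suc i"
        "U \<le> real e * real c" "real e * real c \<le> \<kappa> * U" "U \<le> real e * real d" "real e * real d \<le> \<kappa> * U"
        "\<bar>real (g * a) * (real (e * d))\<^sup>2 - real (g * b) * (real (e * c))\<^sup>2\<bar> \<le> R"
        unfolding Y_def by auto
      have "real a \<le> A" "real b \<le> \<Lambda> * A" "real c \<le> W" "real d \<le> W"
        using y ge by (simp_all add: A_def W_def field_simps)
      moreover have "real c \<le> \<kappa> * real d"
      proof -
        have "real e * real c \<le> \<kappa> * (real e * real d)"
          using y \<kappa> by (meson dual_order.trans mult_left_mono order.trans zero_le_one)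
        hence "real e * real c \<le> real e * (\<kappa> * real d)" by (simp add: mult_ac)
        thus ?thesis using ge by simp
      qed
      moreover have "\<bar>real b / real a - (real d / real c)\<^sup>2\<bar> \<le> \<Delta>"
      proof -
        let ?D = "real (g * a) * (real (e * c))\<^sup>2"
        have D: "2 ^ i * U\<^sup>2 \<le> ?D" using y U by (intro mult_mono power_mono) auto
        have D0: "0 < 2 ^ i * U\<^sup>2" using U by simp
        have nz: "real a \<noteq> 0" "real c \<noteq> 0" "real g \<noteq> 0" "real e \<noteq> 0" using y ge by auto
        have "real b / real a - (real d / real c)\<^sup>2
            = - (real (g * a) * (real (e * d))\<^sup>2 - real (g * b) * (real (e * c))\<^sup>2) / ?D"
          using nz by (simp add: field_simps power2_eq_square)
        hence "\<bar>real b / real a - (real d / real c)\<^sup>2\<bar>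
            = \<bar>real (g * a) * (real (e * d))\<^sup>2 - real (g * b) * (real (e * c))\<^sup>2\<bar> / ?D"
          using D D0 by (simp only: abs_divide abs_minus_cancel)
        also have "\<dots> \<le> R / (2 ^ i * U\<^sup>2)"
          using y(14) D D0 R by (intro frac_le) auto
        finally show ?thesis by (simp add: \<Delta>_def)
      qed
      ultimately show "coprime a b \<and> coprime c d \<and> 1 \<le> a \<and> real a \<le> A \<and> 1 \<le> b \<and> real b \<le> \<Lambda> * A \<and> 1 \<le> c \<and>
        real c \<le> W \<and> 1 \<le> d \<and> real d \<le> W \<and> real c \<le> \<kappa> * real d \<and> \<bar>real b / real a - (real d / real c)\<^sup>2\<bar> \<le> \<Delta>"
        using y by blast
    qed (use \<Lambda> \<kappa> U R in \<open>auto simp: A_def W_def \<Delta>_def\<close>)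
    also have "A * W = 2 ^ i * (1 / real g) * (1 / real e) * (2 * \<kappa> * U)"
      by (simp add: A_def W_def)
    also have "\<Delta> * A\<^sup>2 * W\<^sup>2 = 2 ^ i * (1 / real g) * (1 / real e) * (4 * \<kappa>\<^sup>2 * R) * ((1 / real g) * (1 / real e))"
      using U by (simp add: \<Delta>_def A_def W_def power2_eq_square field_simps)
    \<comment> \<open>The second term carries 1/(g e) twice; one copy is dropped so that both terms
      sum harmonically over g and e.\<close>
    also have "\<dots> \<le> 2 ^ i * (1 / real g) * (1 / real e) * (4 * \<kappa>\<^sup>2 * R) * 1"
    proof (intro mult_left_mono)
      show "1 / real g * (1 / real e) \<le> 1" using ge mult_mono[of 1 "real g" 1 "real e"] by (simp add: field_simps)
    qed (use R in auto)
    finally have "real (card (Y i g e)) \<le> 2 * \<Lambda> * \<kappa> * (2 ^ i * (1 / real g) * (1 / real e) * (2 * \<kappa> * U)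
        + 2 ^ i * (1 / real g) * (1 / real e) * (4 * \<kappa>\<^sup>2 * R) * 1)"
      using \<Lambda> \<kappa> by (auto intro: mult_left_mono order.trans)
    thus ?thesis by (simp add: t_def algebra_simps)
  qed
  have harm: "(\<Sum>g\<in>{g::nat. 1 \<le> g \<and> real g \<le> A}. 1 / real g) \<le> L" if "A \<le> 2 * Q \<or> A \<le> \<kappa> * U" "0 \<le> A" for A
  proof -
    have "{g::nat. 1 \<le> g \<and> real g \<le> A} = {1..nat \<lfloor>A\<rfloor>}"
      using that(2) by (auto simp: le_nat_floor) (metis floor_of_nat le_floor_iff of_nat_nat nat_le_iff le_nat_iff of_int_of_nat_eq zero_le_floor le_nat_floor)
    moreover have "real (nat \<lfloor>A\<rfloor>) \<le> A" using that(2) by simp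
    ultimately show ?thesis using that(1) L by (metis (no_types, lifting) order.trans)
  qed
  have L0: "0 \<le> L" using L(1)[of 0] Q by simp
  have "card Z \<le> card (\<Union>i\<in>I. \<Union>g\<in>Gs i. \<Union>e\<in>Es. (\<lambda>(a, b, c, d). (g * a, g * b, e * c, e * d)) ` Y i g e)"
    by (intro card_mono cover finite_UN_I finite_imageI finI finG finE finY) (auto simp: Gs_def Es_def)
  also have "\<dots> \<le> (\<Sum>i\<in>I. \<Sum>g\<in>Gs i. \<Sum>e\<in>Es. card ((\<lambda>(a, b, c, d). (g * a, g * b, e * c, e * d)) ` Y i g e))"
    by (intro order.trans[OF card_UN_le] sum_mono finI finG finE)
       (auto intro!: order.trans[OF card_UN_le] sum_mono finG finE card_UN_le)
  finally have "real (card Z) \<le> (\<Sum>i\<in>I. \<Sum>g\<in>Gs i. \<Sum>e\<in>Es. real (card ((\<lambda>(a, b, c, d). (g * a, g * b, e * c, e * d)) ` Y i g e)))"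
    by (simp flip: of_nat_sum)
  also have "\<dots> \<le> (\<Sum>i\<in>I. \<Sum>g\<in>Gs i. \<Sum>e\<in>Es. t * 2 ^ i * (1 / real g) * (1 / real e))"
  proof (intro sum_mono)
    fix i g e assume *: "i \<in> I" "g \<in> Gs i" "e \<in> Es"
    have "card ((\<lambda>(a, b, c, d). (g * a, g * b, e * c, e * d)) ` Y i g e) \<le> card (Y i g e)"
      using * by (intro card_image_le finY) (auto simp: Gs_def Es_def)
    thus "real (card ((\<lambda>(a, b, c, d). (g * a, g * b, e * c, e * d)) ` Y i g e)) \<le> t * 2 ^ i * (1 / real g) * (1 / real e)"
      using cardY[OF *(2,3)] by linarith
  qed
  also have "\<dots> = (\<Sum>i\<in>I. t * 2 ^ i * (\<Sum>g\<in>Gs i. 1 / real g) * (\<Sum>e\<in>Es. 1 / real e))"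
    by (simp only: sum_distrib_left[symmetric] sum_distrib_right[symmetric])
  also have "\<dots> \<le> (\<Sum>i\<in>I. t * 2 ^ i * L * L)"
  proof (intro sum_mono mult_mono)
    fix i assume "i \<in> I"
    thus "(\<Sum>g\<in>Gs i. 1 / real g) \<le> L" unfolding Gs_def by (intro harm) (auto simp: I_def)
    show "(\<Sum>e\<in>Es. 1 / real e) \<le> L" unfolding Es_def using \<kappa> U by (intro harm) auto
  qed (use t0 L0 in \<open>auto intro!: sum_nonneg\<close>)
  also have "\<dots> = t * L * L * (\<Sum>i\<in>I. 2 ^ i)" by (simp add: sum_distrib_left mult_ac)
  \<comment> \<open>The dyadic sizes add up geometrically, so fixing the scale of q1 costs no
    logarithm.\<close>
  also have "(\<Sum>i\<in>I. 2 ^ i) \<le> 2 * Q"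
  proof -
    have "I \<noteq> {}" using Q by (auto simp: I_def intro!: exI[of _ 0])
    hence Max: "Max I \<in> I" using finI by simp
    have "(\<Sum>i\<in>I. 2 ^ i :: real) \<le> (\<Sum>i<Suc (Max I). 2 ^ i)"
      using finI by (intro sum_mono2) (auto simp: less_Suc_eq_le)
    also have "\<dots> = 2 ^ Suc (Max I) - 1" by (subst geometric_sum) auto
    also have "\<dots> \<le> 2 * Q" using Max by (simp add: I_def)
    finally show ?thesis .
  qed
  hence "t * L * L * (\<Sum>i\<in>I. 2 ^ i) \<le> t * L * L * (2 * Q)"
    using t0 L0 by (intro mult_left_mono) auto
  also have "\<dots> \<le> (16 * \<Lambda> * \<kappa> ^ 3 * (U + R)) * L * L * (2 * Q)"
  proof (intro mult_right_mono)
    have "\<kappa> ^ 2 \<le> \<kappa> ^ 3" using \<kappa> by (intro power_increasing) auto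
    hence "\<kappa> ^ 2 * U \<le> \<kappa> ^ 3 * U" using U by (intro mult_right_mono) auto
    moreover have "0 \<le> \<kappa> ^ 3 * R" "0 \<le> \<kappa> ^ 3 * U" using \<kappa> R U by auto
    ultimately have "4 * (\<kappa>\<^sup>2 * U) + 8 * (\<kappa> ^ 3 * R) \<le> 16 * (\<kappa> ^ 3 * U) + 16 * (\<kappa> ^ 3 * R)" by linarith
    hence "\<Lambda> * (4 * (\<kappa>\<^sup>2 * U) + 8 * (\<kappa> ^ 3 * R)) \<le> \<Lambda> * (16 * (\<kappa> ^ 3 * U) + 16 * (\<kappa> ^ 3 * R))"
      using \<Lambda> by (intro mult_left_mono) auto
    thus "t \<le> 16 * \<Lambda> * \<kappa> ^ 3 * (U + R)"
      by (simp add: t_def algebra_simps power2_eq_square power3_eq_cube)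
  qed (use L0 Q in auto)
  also have "\<dots> = 32 * \<Lambda> * \<kappa> ^ 3 * L\<^sup>2 * Q * (U + R)" by (simp add: power2_eq_square)
  finally show ?thesis by (simp add: \<Lambda>_def)
qed

section \<open>Type II sums with a long smooth variable\<close>

text \<open>The second forward difference of 1/t with step 1, in closed form.\<close>

definition tri :: "real \<Rightarrow> real" where
  "tri t = 2 / (t * (t + 1) * (t + 2))"

lemma second_difference_inverse:
  assumes "0 < t"
  shows "1 / (t + 2) - 2 * (1 / (t + 1)) + 1 / t = tri t"
proof -
  have nz: "t \<noteq> 0" "t + 1 \<noteq> 0" "t + 2 \<noteq> 0" using assms by auto
  have "1 / (t + 2) - 2 * (1 / (t + 1)) + 1 / t
      = (t * (t + 1) - 2 * (t * (t + 2)) + (t + 1) * (t + 2)) / (t * (t + 1) * (t + 2))"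
  proof -
    have "1 / c - 2 * (1 / b) + 1 / a = (a * b - 2 * (a * c) + b * c) / (a * b * c)"
      if "a \<noteq> 0" "b \<noteq> 0" "c \<noteq> 0" for a b c :: real
      using that by (simp add: field_simps)
    from this[OF nz] show ?thesis .
  qed
  also have "t * (t + 1) - 2 * (t * (t + 2)) + (t + 1) * (t + 2) = 2"
    by (simp add: algebra_simps)
  finally show ?thesis by (simp only: tri_def)
qed

text \<open>The range up to \<open>2 * \<kappa> * N\<close> leaves room for t = n + \<delta>/m with
  n at most \<open>\<kappa> * N\<close> and \<delta>/m at most 1.\<close>

lemma tri_bounds:
  assumes "1 \<le> N" "N \<le> t" "t \<le> 2 * \<kappa> * N" "1 \<le> \<kappa>"
  shows "1 / (32 * \<kappa> ^ 3 * N ^ 3) \<le> tri t" "tri t \<le> 2 / N ^ 3"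
proof -
  have \<kappa>N: "1 \<le> \<kappa> * N" using assms mult_mono[of 1 \<kappa> 1 N] by simp
  have t: "0 < t" "t + 2 \<le> 4 * (\<kappa> * N)" using assms \<kappa>N by auto
  have "t * (t + 1) * (t + 2) \<le> (4 * (\<kappa> * N)) * (4 * (\<kappa> * N)) * (4 * (\<kappa> * N))"
    using t \<kappa>N assms by (intro mult_mono mult_nonneg_nonneg) auto
  hence "2 / ((4 * (\<kappa> * N)) * (4 * (\<kappa> * N)) * (4 * (\<kappa> * N))) \<le> tri t"
    unfolding tri_def using t \<kappa>N assms by (intro divide_left_mono mult_pos_pos) auto
  thus "1 / (32 * \<kappa> ^ 3 * N ^ 3) \<le> tri t" by (simp add: power3_eq_cube mult_ac)
  have "N * N * N \<le> t * (t + 1) * (t + 2)"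
    using assms by (intro mult_mono mult_nonneg_nonneg) auto
  thus "tri t \<le> 2 / N ^ 3"
    unfolding tri_def power3_eq_cube using assms by (intro divide_left_mono mult_pos_pos) auto
qed

text \<open>A mean value estimate with derivative O(N^-4), done algebraically. It measures the
  effect of replacing \<delta>/m by \<delta>/m' in the argument of \<open>tri\<close>.\<close>

lemma tri_diff:
  assumes "1 \<le> N" "N \<le> s" "N \<le> t"
  shows "\<bar>tri s - tri t\<bar> \<le> 6 * \<bar>s - t\<bar> / N ^ 4"
proof -
  have *: "\<bar>tri s - tri t\<bar> \<le> 6 * \<bar>s - t\<bar> / N ^ 4" if "N \<le> s" "s \<le> t" for s t
  proof -
    let ?A = "s * (s + 1) * (s + 2)" and ?B = "t * (t + 1) * (t + 2)"
    have pos: "0 < s" "0 < t" using assms that by auto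
    have "tri s - tri t = 2 * (?B - ?A) / (?A * ?B)"
    proof -
      have "2 / A - 2 / B = 2 * (B - A) / (A * B)" if "A \<noteq> 0" "B \<noteq> 0" for A B :: real
        using that by (simp add: field_simps)
      thus ?thesis unfolding tri_def using pos by simp
    qed
    also have "?B - ?A = (t - s) * (t\<^sup>2 + t * s + s\<^sup>2 + 3 * t + 3 * s + 2)"
      by (simp add: power2_eq_square algebra_simps)
    finally have eq: "tri s - tri t = 2 * ((t - s) * (t\<^sup>2 + t * s + s\<^sup>2 + 3 * t + 3 * s + 2)) / (?A * ?B)" .
    have ss: "s\<^sup>2 \<le> t\<^sup>2" "t * s \<le> t\<^sup>2"
      using that pos by (auto simp: power2_eq_square intro: mult_mono)
    have "t\<^sup>2 + t * s + s\<^sup>2 + 3 * t + 3 * s + 2 \<le> 3 * ((t + 1) * (t + 2))"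
    proof -
      have "3 * ((t + 1) * (t + 2)) = 3 * t\<^sup>2 + 9 * t + 6"
        by (simp add: power2_eq_square algebra_simps)
      thus ?thesis using ss that pos by linarith
    qed
    hence "2 * ((t - s) * (t\<^sup>2 + t * s + s\<^sup>2 + 3 * t + 3 * s + 2)) / (?A * ?B)
        \<le> 2 * ((t - s) * (3 * ((t + 1) * (t + 2)))) / (?A * ?B)"
      using that pos by (intro divide_right_mono mult_left_mono) auto
    also have "\<dots> = 6 * (t - s) / (?A * t)"
    proof -
      have "2 * (d * (3 * P)) / (A * (t * P)) = 6 * d / (A * t)" if "P \<noteq> 0" for d P A :: real
        using that by simp
      from this[of "(t + 1) * (t + 2)" "t - s" ?A] show ?thesis
        using pos by (simp only: mult.assoc) simp
    qed
    also have "\<dots> \<le> 6 * (t - s) / N ^ 4"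
    proof (intro divide_left_mono)
      have "N * N * N * N \<le> ?A * t" using assms that by (intro mult_mono mult_nonneg_nonneg) auto
      thus "N ^ 4 \<le> ?A * t" by (simp add: power4_eq_xxxx)
    qed (use assms pos that in auto)
    finally have "tri s - tri t \<le> 6 * (t - s) / N ^ 4" unfolding eq .
    moreover have "0 \<le> tri s - tri t"
      unfolding eq using that pos by (intro divide_nonneg_nonneg mult_nonneg_nonneg) auto
    ultimately show ?thesis using that by simp
  qed
  show ?thesis
  proof (cases "s \<le> t")
    case True
    thus ?thesis using *[of s t] assms by simp
  next
    case False
    thus ?thesis using *[of t s] assms by (simp add: abs_minus_commute)
  qed
qed

text \<open>Since m n + \<delta> = m (n + \<delta>/m), the shift is only a translation of the
  argument of 1/t.\<close>

lemma second_difference_phase: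
  fixes h m n x \<delta> :: real
  assumes "0 < m" "0 < n" "0 \<le> \<delta>"
  shows "h * x / (m * (n + 2) + \<delta>) - 2 * (h * x / (m * (n + 1) + \<delta>)) + h * x / (m * n + \<delta>)
    = x * (h / m) * tri (n + \<delta> / m)"
proof -
  let ?t = "n + \<delta> / m"
  have t: "0 < ?t" using assms by (simp add: add_pos_nonneg)
  have "h * x / (m * z + \<delta>) = x * (h / m) * (1 / (z + \<delta> / m))" if "0 < z" for z
  proof -
    have "m * z + \<delta> = m * (z + \<delta> / m)" using assms by (simp add: field_simps)
    thus ?thesis by simp
  qed
  hence "h * x / (m * (n + 2) + \<delta>) - 2 * (h * x / (m * (n + 1) + \<delta>)) + h * x / (m * n + \<delta>)
     = x * (h / m) * (1 / (?t + 2) - 2 * (1 / (?t + 1)) + 1 / ?t)"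
    using assms by (simp add: algebra_simps)
  thus ?thesis by (simp only: second_difference_inverse[OF t])
qed

lemma nat_real_interval:
  fixes N \<kappa> :: real
  assumes "1 \<le> N"
  defines "Ns \<equiv> {n::nat. N \<le> real n \<and> real n \<le> \<kappa> * N}"
  obtains a b where "a \<le> b" "Ns = {a..<b}" "real (b - a) \<le> \<kappa> * N" 
    | "Ns = {}"
proof (cases "Ns = {}")
  case False
  then obtain n0 where n0: "N \<le> real n0" "real n0 \<le> \<kappa> * N" by (auto simp: Ns_def)
  define a where "a = nat \<lceil>N\<rceil>"
  define b where "b = Suc (nat \<lfloor>\<kappa> * N\<rfloor>)"
  have pos: "0 \<le> \<kappa> * N" using n0 assms by linarith
  have ab: "a \<le> b" using n0 pos unfolding a_def b_def by (simp, linarith)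
  moreover have "Ns = {a..<b}"
  proof -
    have "N \<le> real n \<longleftrightarrow> a \<le> n" for n
      unfolding a_def using assms by (simp add: nat_le_iff ceiling_le_iff)
    moreover have "real n \<le> \<kappa> * N \<longleftrightarrow> n < b" for n
      unfolding b_def less_Suc_eq_le using pos by (simp add: le_nat_iff le_floor_iff)
    ultimately show ?thesis unfolding Ns_def by auto
  qed
  moreover have "real (b - a) \<le> \<kappa> * N"
  proof -
    have "real b \<le> \<kappa> * N + 1" unfolding b_def using pos by simp
    \<comment> \<open>The left end is at least 1, which compensates for the exclusive right end in
      the bound for \<open>b - a\<close>.\<close>
    moreover have "1 \<le> a" unfolding a_def using assms by linarith
    hence "1 \<le> real a" by simp
    ultimately show ?thesis using ab by (simp add: of_nat_diff)
  qed
  ultimately show ?thesis using that by blast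
qed (use that in blast)

text \<open>The integer k = h m' - h' m is nonzero, and the second difference of the phase is x/(m
  m') times \<open>k * tri s + h' * m * (tri s - tri t)\<close>. The second part comes only from the
  difference of \<delta>/m and \<delta>/m'; as |k| \<ge> 1, the hypothesis \<open>sep\<close> makes
  it at most half of the first. So the second difference has order x|k|/(M^2 N^3), and van der
  Corput applies with |k| between 1 and \<kappa>^2 K.\<close>

lemma phase_difference_sum:
  fixes h h' m m' :: nat and x \<delta> M N \<kappa> H K :: real
  assumes \<kappa>: "1 \<le> \<kappa>" and MN: "1 \<le> M" "1 \<le> N" and \<delta>: "0 \<le> \<delta>" "\<delta> \<le> 1" and "0 < x"
    and m: "M \<le> real m" "real m \<le> \<kappa> * M" "M \<le> real m'" "real m' \<le> \<kappa> * M"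
    and h: "real h \<le> 2 * H" "real h' \<le> 2 * H"
    and sep: "768 * \<kappa> ^ 4 * H \<le> N"
    and k: "h * m' \<noteq> h' * m" "\<bar>real h * real m' - real h' * real m\<bar> \<le> \<kappa>\<^sup>2 * K"
  shows "norm (\<Sum>n | N \<le> real n \<and> real n \<le> \<kappa> * N.
      ee (real h * x / (real m * real n + \<delta>) - real h' * x / (real m' * real n + \<delta>)))
    \<le> 31000 * \<kappa> ^ 8 * N * (sqrt (x * K / (M\<^sup>2 * N ^ 3)) + sqrt (M\<^sup>2 * N / x))"
proof -
  have *: "norm (\<Sum>n | N \<le> real n \<and> real n \<le> \<kappa> * N.
      ee (real h * x / (real m * real n + \<delta>) - real h' * x / (real m' * real n + \<delta>)))
    \<le> 31000 * \<kappa> ^ 8 * N * (sqrt (x * K / (M\<^sup>2 * N ^ 3)) + sqrt (M\<^sup>2 * N / x))"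
    if m: "M \<le> real m" "real m \<le> \<kappa> * M" "M \<le> real m'" "real m' \<le> \<kappa> * M"
      and h: "real h \<le> 2 * H" "real h' \<le> 2 * H"
      and k: "h' * m < h * m'" "real h * real m' - real h' * real m \<le> \<kappa>\<^sup>2 * K"
    for h h' m m' :: nat
  proof -
    define f where "f = (\<lambda>n::nat. real h * x / (real m * real n + \<delta>) - real h' * x / (real m' * real n + \<delta>))"
    define k where "k = real h * real m' - real h' * real m"
    have "real (h' * m) + 1 \<le> real (h * m')" using that(7) by linarith
    hence k1: "1 \<le> k" by (simp add: k_def)
    have kK: "k \<le> \<kappa>\<^sup>2 * K" using that(8) by (simp add: k_def)
    have m0: "0 < real m" "0 < real m'" using m MN by auto
    have mm: "M\<^sup>2 \<le> real m * real m'" "real m * real m' \<le> \<kappa>\<^sup>2 * M\<^sup>2"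
      using m MN \<kappa> mult_mono[of M "real m" M "real m'"] mult_mono[of "real m" "\<kappa> * M" "real m'" "\<kappa> * M"]
      by (auto simp: power2_eq_square mult_ac)
    \<comment> \<open>Of the factors \<kappa>, two come from m m' \<le> \<kappa>^2 M^2 and three
      from the lower bound for \<open>tri\<close>; 64 rather than 32 leaves half of the main part
      for the error.\<close>
    define \<mu> where "\<mu> = x * k / (64 * \<kappa> ^ 5 * (M\<^sup>2 * N ^ 3))"
    have \<mu>0: "0 < \<mu>" using k1 \<kappa> MN \<open>0 < x\<close> by (simp add: \<mu>_def)
    have sd: "\<mu> \<le> f (n + 2) - 2 * f (n + 1) + f n \<and> f (n + 2) - 2 * f (n + 1) + f n \<le> 192 * \<kappa> ^ 5 * \<mu>"
      if n: "N \<le> real n" "real n \<le> \<kappa> * N" for n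
    proof -
      define s where "s = real n + \<delta> / real m"
      define t where "t = real n + \<delta> / real m'"
      have \<delta>m: "0 \<le> \<delta> / real m" "\<delta> / real m \<le> 1" "0 \<le> \<delta> / real m'" "\<delta> / real m' \<le> 1"
        using \<delta> m MN by (auto simp: field_simps)
      have \<kappa>N: "1 \<le> \<kappa> * N" using \<kappa> MN mult_mono[of 1 \<kappa> 1 N] by simp
      have st: "N \<le> s" "N \<le> t" "s \<le> 2 * \<kappa> * N" "t \<le> 2 * \<kappa> * N"
        using n \<delta>m \<kappa>N by (auto simp: s_def t_def)
      have "f (n + 2) - 2 * f (n + 1) + f n = x * (real h / real m) * tri s - x * (real h' / real m') * tri t"
        using second_difference_phase[of "real m" "real n" \<delta> "real h" x]
          second_difference_phase[of "real m'" "real n" \<delta> "real h'" x] m0 n MN \<delta>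
        by (simp add: f_def s_def t_def algebra_simps)
      also have "\<dots> = x / (real m * real m') * (k * tri s + real h' * real m * (tri s - tri t))"
        using m0 by (simp add: k_def field_simps)
      finally have eq: "f (n + 2) - 2 * f (n + 1) + f n = \<dots>" .
      \<comment> \<open>The constant 768 is 12 times 64: it makes 12 H \<kappa>/N^4 at most 1/(64
        \<kappa>^3 N^3), half of the lower bound for \<open>tri s\<close>.\<close>
      have err: "\<bar>real h' * real m * (tri s - tri t)\<bar> \<le> k * (1 / (64 * \<kappa> ^ 3 * N ^ 3))"
      proof -
        have "s - t = \<delta> * (real m' - real m) / (real m * real m')"
          using m0 by (simp add: s_def t_def field_simps)
        hence "\<bar>s - t\<bar> = \<delta> * \<bar>real m' - real m\<bar> / (real m * real m')"
          using m0 \<delta> by (simp add: abs_mult)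
        hence "real m * \<bar>s - t\<bar> = \<delta> * \<bar>real m' - real m\<bar> / real m'"
          using m0 by simp
        also have "\<dots> \<le> 1 * (\<kappa> * M) / M"
          using m \<delta> MN by (intro frac_le mult_mono) (auto simp: abs_le_iff)
        also have "\<dots> = \<kappa>" using MN by simp
        finally have ms: "real m * \<bar>s - t\<bar> \<le> \<kappa>" .
        have "\<bar>real h' * real m * (tri s - tri t)\<bar> = real h' * (real m * \<bar>tri s - tri t\<bar>)"
          by (simp add: abs_mult)
        also have "\<dots> \<le> (2 * H) * (real m * (6 * \<bar>s - t\<bar> / N ^ 4))"
          using h st MN by (intro mult_mono tri_diff) auto
        also have "\<dots> = 12 * H / N ^ 4 * (real m * \<bar>s - t\<bar>)" by simp
        also have "\<dots> \<le> 12 * H / N ^ 4 * \<kappa>"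
          using ms h MN by (intro mult_left_mono) (auto intro: order.trans[of _ "real h"])
        also have "\<dots> = (768 * \<kappa> ^ 4 * H) / (64 * \<kappa> ^ 3 * N ^ 4)"
          using \<kappa> MN by (simp add: field_simps power_numeral_reduce)
        also have "\<dots> \<le> N / (64 * \<kappa> ^ 3 * N ^ 4)"
          using sep \<kappa> MN by (intro divide_right_mono) auto
        also have "\<dots> = 1 * (1 / (64 * \<kappa> ^ 3 * N ^ 3))"
          using MN by (simp add: field_simps power_numeral_reduce)
        also have "\<dots> \<le> k * (1 / (64 * \<kappa> ^ 3 * N ^ 3))"
          using k1 \<kappa> MN by (intro mult_right_mono) auto
        finally show ?thesis .
      qed
      have tri: "1 / (32 * \<kappa> ^ 3 * N ^ 3) \<le> tri s" "tri s \<le> 2 / N ^ 3"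
        using tri_bounds[OF MN(2) st(1,3) \<kappa>] by auto
      have "k * (1 / (32 * \<kappa> ^ 3 * N ^ 3)) \<le> k * tri s" "k * tri s \<le> k * (2 / N ^ 3)"
        using tri k1 by (auto intro!: mult_left_mono simp del: times_divide_eq_right)
      moreover have "k * (1 / (32 * \<kappa> ^ 3 * N ^ 3)) = 2 * (k * (1 / (64 * \<kappa> ^ 3 * N ^ 3)))" by simp
      moreover have "k * (1 / (64 * \<kappa> ^ 3 * N ^ 3)) \<le> k * (1 / N ^ 3)"
      proof (intro mult_left_mono divide_left_mono)
        have "1 \<le> \<kappa> ^ 3" using \<kappa> by (rule one_le_power)
        hence "1 * N ^ 3 \<le> (64 * \<kappa> ^ 3) * N ^ 3" using MN by (intro mult_right_mono) auto
        thus "N ^ 3 \<le> 64 * \<kappa> ^ 3 * N ^ 3" by simp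
      qed (use k1 MN \<kappa> in auto)
      ultimately have main: "k * (1 / (64 * \<kappa> ^ 3 * N ^ 3)) \<le> k * tri s + real h' * real m * (tri s - tri t)"
        "k * tri s + real h' * real m * (tri s - tri t) \<le> 3 * (k * (1 / N ^ 3))"
        using err by (auto simp: abs_le_iff)
      have "\<mu> = x / (\<kappa>\<^sup>2 * M\<^sup>2) * (k * (1 / (64 * \<kappa> ^ 3 * N ^ 3)))"
        using \<kappa> by (simp add: \<mu>_def field_simps power_numeral_reduce)
      also have "\<dots> \<le> x / (real m * real m') * (k * tri s + real h' * real m * (tri s - tri t))"
      proof (rule mult_mono)
        show "x / (\<kappa>\<^sup>2 * M\<^sup>2) \<le> x / (real m * real m')"
          by (rule divide_left_mono) (use mm \<open>0 < x\<close> \<kappa> MN m0 in auto)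
      qed (use main(1) \<open>0 < x\<close> k1 \<kappa> MN m0 in auto)
      finally have 1: "\<mu> \<le> f (n + 2) - 2 * f (n + 1) + f n" unfolding eq .
      have "x / (real m * real m') * (k * tri s + real h' * real m * (tri s - tri t)) \<le> x / M\<^sup>2 * (3 * (k * (1 / N ^ 3)))"
      proof (rule mult_mono)
        show "x / (real m * real m') \<le> x / M\<^sup>2"
          by (rule divide_left_mono) (use mm \<open>0 < x\<close> \<kappa> MN m0 in auto)
        show "0 \<le> k * tri s + real h' * real m * (tri s - tri t)"
          using main(1) k1 \<kappa> MN by (intro order.trans[OF _ main(1)]) auto
      qed (use main(2) \<open>0 < x\<close> in auto)
      also have "\<dots> = 192 * \<kappa> ^ 5 * \<mu>" using \<kappa> by (simp add: \<mu>_def field_simps)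
      finally show ?thesis using 1 eq by simp
    qed
    have c5: "1 \<le> 192 * \<kappa> ^ 5" using one_le_power[OF \<kappa>, of 5] by linarith
    have sq1: "sqrt \<mu> \<le> sqrt (x * K / (M\<^sup>2 * N ^ 3))"
    proof (rule real_sqrt_le_mono)
      have "x * k / (64 * \<kappa> ^ 5 * (M\<^sup>2 * N ^ 3)) \<le> x * (\<kappa>\<^sup>2 * K) / (\<kappa>\<^sup>2 * (M\<^sup>2 * N ^ 3))"
      proof (intro frac_le mult_mono mult_left_mono)
        have "\<kappa>\<^sup>2 \<le> \<kappa> ^ 5" using \<kappa> by (intro power_increasing) auto
        moreover have "0 \<le> \<kappa> ^ 5" using \<kappa> by simp
        ultimately show "\<kappa>\<^sup>2 \<le> 64 * \<kappa> ^ 5" by linarith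
      qed (use kK k1 \<open>0 < x\<close> MN \<kappa> in \<open>auto intro: order.trans[of _ k]\<close>)
      thus "\<mu> \<le> x * K / (M\<^sup>2 * N ^ 3)" using \<kappa> by (simp add: \<mu>_def)
    qed
    have sq2: "1 / sqrt \<mu> \<le> 8 * \<kappa> ^ 3 * N * sqrt (M\<^sup>2 * N / x)"
    proof -
      have "1 / sqrt \<mu> = sqrt (1 / \<mu>)" by (simp add: real_sqrt_divide)
      also have "\<dots> \<le> sqrt ((8 * \<kappa> ^ 3 * N)\<^sup>2 * (M\<^sup>2 * N / x))"
      proof (rule real_sqrt_le_mono)
        have "1 / \<mu> = 64 * \<kappa> ^ 5 * (M\<^sup>2 * N ^ 3) / (x * k)" by (simp add: \<mu>_def)
        also have "\<dots> \<le> 64 * \<kappa> ^ 6 * (M\<^sup>2 * N ^ 3) / (x * 1)"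
          using k1 \<open>0 < x\<close> \<kappa> MN by (intro frac_le mult_mono power_increasing mult_left_mono) auto
        also have "\<dots> = (8 * \<kappa> ^ 3 * N)\<^sup>2 * (M\<^sup>2 * N / x)"
          by (simp add: power_mult_distrib power_numeral_reduce)
        finally show "1 / \<mu> \<le> (8 * \<kappa> ^ 3 * N)\<^sup>2 * (M\<^sup>2 * N / x)" .
      qed
      also have "\<dots> = 8 * \<kappa> ^ 3 * N * sqrt (M\<^sup>2 * N / x)"
        by (subst real_sqrt_mult) (use \<kappa> MN in simp)
      finally show ?thesis .
    qed
    let ?s1 = "sqrt (x * K / (M\<^sup>2 * N ^ 3))" and ?s2 = "sqrt (M\<^sup>2 * N / x)"
    have s0: "0 \<le> ?s1" "0 \<le> ?s2"
      using sq1 \<mu>0 MN \<open>0 < x\<close> by (auto intro: order.trans[of _ "sqrt \<mu>"])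
    show ?thesis
    proof (rule nat_real_interval[OF MN(2), of \<kappa>])
      assume emp: "{n::nat. N \<le> real n \<and> real n \<le> \<kappa> * N} = {}"
      show ?thesis unfolding emp using s0 \<kappa> MN by simp
    next
      fix a b assume ab: "a \<le> b" "{n::nat. N \<le> real n \<and> real n \<le> \<kappa> * N} = {a..<b}" "real (b - a) \<le> \<kappa> * N"
      have "norm (\<Sum>n=a..<b. ee (f n)) \<le> 20 * (192 * \<kappa> ^ 5) * (real (b - a) * sqrt \<mu> + 1 / sqrt \<mu>)"
      proof (rule vdC_second_difference[OF \<mu>0 c5 ab(1)])
        fix n assume "a \<le> n" "n < b"
        hence "n \<in> {n. N \<le> real n \<and> real n \<le> \<kappa> * N}" using ab(2) by auto
        thus "\<mu> \<le> f (n + 2) - 2 * f (n + 1) + f n" "f (n + 2) - 2 * f (n + 1) + f n \<le> 192 * \<kappa> ^ 5 * \<mu>"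
          using sd[of n] by auto
      qed
      also have "\<dots> \<le> 20 * (192 * \<kappa> ^ 5) * ((8 * \<kappa> ^ 3 * N) * ?s1 + 8 * \<kappa> ^ 3 * N * ?s2)"
      proof (intro mult_left_mono add_mono mult_mono)
        have "\<kappa> ^ 1 \<le> \<kappa> ^ 3" using \<kappa> by (intro power_increasing) auto
        hence "\<kappa> * N \<le> 8 * \<kappa> ^ 3 * N" using MN \<kappa> by (intro mult_right_mono) auto
        thus "real (b - a) \<le> 8 * \<kappa> ^ 3 * N" using ab(3) by linarith
      qed (use sq1 sq2 s0 \<mu>0 \<kappa> MN in auto)
      also have "\<dots> = 30720 * (\<kappa> ^ 8 * N * (?s1 + ?s2))"
        by (simp add: algebra_simps flip: power_add)
      also have "\<dots> \<le> 31000 * (\<kappa> ^ 8 * N * (?s1 + ?s2))"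
        using s0 \<kappa> MN by (intro mult_right_mono) auto
      finally show ?thesis unfolding ab(2) f_def by (simp add: mult.assoc)
    qed
  qed
  show ?thesis
  proof (cases "h' * m < h * m'")
    case True
    thus ?thesis using *[of m m' h h'] m h k by auto
  next
    \<comment> \<open>The opposite sign of k is reduced to the first case by complex
      conjugation.\<close>
    case False
    have "norm (\<Sum>n | N \<le> real n \<and> real n \<le> \<kappa> * N.
        ee (real h' * x / (real m' * real n + \<delta>) - real h * x / (real m * real n + \<delta>)))
      = norm (cnj (\<Sum>n | N \<le> real n \<and> real n \<le> \<kappa> * N.
        ee (real h * x / (real m * real n + \<delta>) - real h' * x / (real m' * real n + \<delta>))))"
      unfolding cnj_sum by (intro arg_cong[where f = norm] sum.cong refl) (simp flip: ee_minus)
    thus ?thesis using *[of m' m h' h] m h k False by (auto simp only: complex_mod_cnj)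
  qed
qed

section \<open>Cauchy-Schwarz over cells and the determinant equation h m' - h' m = k\<close>

lemma sum_fibre_le:
  fixes G :: "'n \<Rightarrow> real" and B :: nat
  assumes fin: "finite V" "finite Ns" and sub: "q ` V \<subseteq> Ns" and G: "\<And>n. n \<in> Ns \<Longrightarrow> 0 \<le> G n"
    and B: "\<And>n. n \<in> Ns \<Longrightarrow> card {v \<in> V. q v = n} \<le> B"
  shows "(\<Sum>v\<in>V. G (q v)) \<le> real B * (\<Sum>n\<in>Ns. G n)"
proof -
  have "(\<Sum>v\<in>V. G (q v)) = (\<Sum>n\<in>Ns. \<Sum>v | v \<in> V \<and> q v = n. G (q v))"
    by (rule sum.group[symmetric, OF fin sub])
  also have "\<dots> = (\<Sum>n\<in>Ns. real (card {v \<in> V. q v = n}) * G n)"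
    by (intro sum.cong refl) simp
  also have "\<dots> \<le> (\<Sum>n\<in>Ns. real B * G n)"
    using G B by (intro sum_mono mult_right_mono) auto
  finally show ?thesis by (simp add: sum_distrib_left)
qed

lemma card_fibre_le:
  fixes B :: nat
  assumes "finite V" "finite Ns" "q ` V \<subseteq> Ns" "\<And>n. n \<in> Ns \<Longrightarrow> card {v \<in> V. q v = n} \<le> B"
  shows "real (card V) \<le> real B * real (card Ns)"
  using sum_fibre_le[OF assms(1,2,3), of "\<lambda>_. 1" B] assms(4) by simp

lemma power2_sum_le_card:
  fixes f :: "'a \<Rightarrow> real"
  shows "(\<Sum>i\<in>I. f i)\<^sup>2 \<le> real (card I) * (\<Sum>i\<in>I. (f i)\<^sup>2)"
  using Cauchy_Schwarz_ineq_sum[of "\<lambda>_. 1" f I] by simp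

text \<open>Cauchy-Schwarz over the cells before the square is opened: only pairs in a common cell
  survive, at the price of the number of cells. Finer cells give closer pairs but raise that
  price.\<close>

lemma sum_power2_cells:
  fixes F :: "'w \<Rightarrow> 'n \<Rightarrow> complex" and cell :: "'w \<Rightarrow> 'c"
  assumes W: "finite W"
  shows "(\<Sum>n\<in>Ns. (norm (\<Sum>w\<in>W. F w n))\<^sup>2) \<le> real (card (cell ` W)) *
    (\<Sum>(w, w') \<in> {(w, w') \<in> W \<times> W. cell w = cell w'}. norm (\<Sum>n\<in>Ns. F w n * cnj (F w' n)))"
proof -
  let ?Cs = "cell ` W"
  define P where "P = (\<lambda>c. {w \<in> W. cell w = c})"
  have finP: "finite (P c)" for c using W by (simp add: P_def)
  have "(\<Sum>n\<in>Ns. (norm (\<Sum>w\<in>W. F w n))\<^sup>2) \<le> (\<Sum>n\<in>Ns. real (card ?Cs) * (\<Sum>c\<in>?Cs. (norm (\<Sum>w\<in>P c. F w n))\<^sup>2))"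
  proof (rule sum_mono)
    fix n
    have "(\<Sum>w\<in>W. F w n) = (\<Sum>c\<in>?Cs. \<Sum>w\<in>P c. F w n)"
      unfolding P_def using W by (intro sum.group[symmetric]) auto
    hence "norm (\<Sum>w\<in>W. F w n) \<le> (\<Sum>c\<in>?Cs. norm (\<Sum>w\<in>P c. F w n))"
      by (simp add: norm_sum)
    hence "(norm (\<Sum>w\<in>W. F w n))\<^sup>2 \<le> (\<Sum>c\<in>?Cs. norm (\<Sum>w\<in>P c. F w n))\<^sup>2"
      by (intro power_mono) auto
    also have "\<dots> \<le> real (card ?Cs) * (\<Sum>c\<in>?Cs. (norm (\<Sum>w\<in>P c. F w n))\<^sup>2)"
      by (rule power2_sum_le_card)
    finally show "(norm (\<Sum>w\<in>W. F w n))\<^sup>2 \<le> \<dots>" .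
  qed
  also have "\<dots> = real (card ?Cs) * (\<Sum>c\<in>?Cs. \<Sum>n\<in>Ns. (norm (\<Sum>w\<in>P c. F w n))\<^sup>2)"
    unfolding sum_distrib_left[symmetric] by (rule arg_cong[OF sum.swap])
  also have "\<dots> \<le> real (card ?Cs) * (\<Sum>c\<in>?Cs. \<Sum>w\<in>P c. \<Sum>w'\<in>P c. norm (\<Sum>n\<in>Ns. F w n * cnj (F w' n)))"
  proof (intro mult_left_mono sum_mono)
    fix c
    have "complex_of_real (\<Sum>n\<in>Ns. (norm (\<Sum>w\<in>P c. F w n))\<^sup>2)
        = (\<Sum>n\<in>Ns. \<Sum>w\<in>P c. \<Sum>w'\<in>P c. F w n * cnj (F w' n))"
      unfolding of_real_sum norm_sum_power2 ..
    also have "\<dots> = (\<Sum>w\<in>P c. \<Sum>w'\<in>P c. \<Sum>n\<in>Ns. F w n * cnj (F w' n))"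
      by (rule sum_rotate3)
    finally have eq: "complex_of_real (\<Sum>n\<in>Ns. (norm (\<Sum>w\<in>P c. F w n))\<^sup>2) = \<dots>" .
    have "(\<Sum>n\<in>Ns. (norm (\<Sum>w\<in>P c. F w n))\<^sup>2) = norm (complex_of_real (\<Sum>n\<in>Ns. (norm (\<Sum>w\<in>P c. F w n))\<^sup>2))"
      unfolding norm_of_real by (simp add: sum_nonneg)
    also have "\<dots> \<le> (\<Sum>w\<in>P c. \<Sum>w'\<in>P c. norm (\<Sum>n\<in>Ns. F w n * cnj (F w' n)))"
      unfolding eq by (intro sum_norm_le order.refl)
    finally show "(\<Sum>n\<in>Ns. (norm (\<Sum>w\<in>P c. F w n))\<^sup>2) \<le> \<dots>" .
  qed simp
  also have "(\<Sum>c\<in>?Cs. \<Sum>w\<in>P c. \<Sum>w'\<in>P c. norm (\<Sum>n\<in>Ns. F w n * cnj (F w' n)))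
     = (\<Sum>c\<in>?Cs. \<Sum>(w, w') \<in> P c \<times> P c. norm (\<Sum>n\<in>Ns. F w n * cnj (F w' n)))"
    by (simp add: sum.cartesian_product)
  also have "\<dots> = (\<Sum>(w, w') \<in> (\<Union>c\<in>?Cs. P c \<times> P c). norm (\<Sum>n\<in>Ns. F w n * cnj (F w' n)))"
    using W finP by (intro sum.UNION_disjoint[symmetric]) (auto simp: P_def)
  also have "(\<Union>c\<in>?Cs. P c \<times> P c) = {(w, w') \<in> W \<times> W. cell w = cell w'}"
    by (auto simp: P_def)
  finally show ?thesis .
qed

text \<open>Given h', u and k, the number v = h' p(u) + k equals h p(u'), so h is one of its
  divisors and p(u') is then determined; this leaves at most \<open>B\<close> choices of u'.\<close>

lemma card_determinant_le:
  fixes p :: "'u \<Rightarrow> nat" and Hs :: "nat set" and B D :: nat and k :: int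
  assumes fin: "finite Hs" "finite U"
    and Hs: "\<And>h. h \<in> Hs \<Longrightarrow> 1 \<le> h" and p: "\<And>u. u \<in> U \<Longrightarrow> 1 \<le> p u"
    and mult: "\<And>m. card {u \<in> U. p u = m} \<le> B"
    and div: "\<And>h u. h \<in> Hs \<Longrightarrow> u \<in> U \<Longrightarrow> divisor_count (h * p u) \<le> D"
  shows "card {((h, u), (h', u')) \<in> (Hs \<times> U) \<times> (Hs \<times> U). int (h * p u') - int (h' * p u) = k}
    \<le> card Hs * card U * (D * B)"
proof -
  let ?S = "{((h, u), (h', u')) \<in> (Hs \<times> U) \<times> (Hs \<times> U). int (h * p u') - int (h' * p u) = k}"
  have fib: "card {w \<in> ?S. (\<lambda>((h, u), (h', u')). (h', u)) w = t} \<le> D * B" if t: "t \<in> Hs \<times> U" for t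
  proof -
    obtain h' u where t': "t = (h', u)" "h' \<in> Hs" "u \<in> U" using t by auto
    define v where "v = nat (int (h' * p u) + k)"
    let ?T = "{w \<in> ?S. (\<lambda>((h, u), (h', u')). (h', u)) w = t}"
    let ?R = "Sigma {d. d dvd v \<and> d \<in> Hs} (\<lambda>h. {u' \<in> U. p u' = v div h})"
    show ?thesis
    proof (cases "?T = {}")
      case False
      have v: "h * p u' = v \<and> h \<in> Hs \<and> u' \<in> U" if "((h, u), (h', u')) \<in> ?S" for h u'
      proof -
        from that have e: "int (h * p u') - int (h' * p u) = k" and "h \<in> Hs" "u' \<in> U" by auto
        moreover from e have "int (h' * p u) + k = int (h * p u')" by linarith
        hence "v = h * p u'" unfolding v_def by (simp only: nat_int)
        ultimately show ?thesis by simp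
      qed
      have sub: "?T \<subseteq> (\<lambda>(h, u'). ((h, u), (h', u'))) ` ?R"
      proof
        fix w assume "w \<in> ?T"
        then obtain h u' where w: "w = ((h, u), (h', u'))" "((h, u), (h', u')) \<in> ?S"
          by (auto simp: t'(1))
        note vv = v[OF w(2)]
        have "1 \<le> h" using vv Hs by blast
        hence "v div h = p u'" using vv by (metis nonzero_mult_div_cancel_left not_one_le_zero)
        hence "(h, u') \<in> ?R" using vv by auto
        thus "w \<in> (\<lambda>(h, u'). ((h, u), (h', u'))) ` ?R" using w by force
      qed
      have finR: "finite ?R" using fin by (intro finite_SigmaI) auto
      have "card ?T \<le> card ?R" using surj_card_le[OF finR sub] .
      also have "\<dots> = (\<Sum>h\<in>{d. d dvd v \<and> d \<in> Hs}. card {u' \<in> U. p u' = v div h})"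
        using fin by (intro card_SigmaI) auto
      also have "\<dots> \<le> (\<Sum>h\<in>{d. d dvd v \<and> d \<in> Hs}. B)"
        by (intro sum_mono mult)
      also have "\<dots> = card {d. d dvd v \<and> d \<in> Hs} * B" by simp
      also have "\<dots> \<le> D * B"
      proof (rule mult_le_mono1)
        \<comment> \<open>A nonempty fibre exhibits v as a product h p(u') of permitted values, so
          the hypothesis \<open>div\<close> bounds its divisors.\<close>
        from False obtain w where "w \<in> ?T" by blast
        then obtain h u' where "((h, u), (h', u')) \<in> ?S" by (auto simp: t'(1))
        note vv = v[OF this]
        have "0 < v" using vv Hs[of h] p[of u'] by (metis gr0I mult_is_0 not_one_le_zero)
        hence "card {d. d dvd v \<and> d \<in> Hs} \<le> divisor_count v"
          unfolding divisor_count_def by (intro card_mono finite_divisors) auto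
        also have "\<dots> \<le> D" using div[of h u'] vv by metis
        finally show "card {d. d dvd v \<and> d \<in> Hs} \<le> D" .
      qed
      finally show ?thesis .
    next
      case True
      show ?thesis unfolding True by simp
    qed
  qed
  have finS: "finite ?S"
    by (rule finite_subset[of _ "(Hs \<times> U) \<times> (Hs \<times> U)"]) (use fin in auto)
  have "real (card ?S) \<le> real (card (Hs \<times> U)) * real (D * B)"
    by (rule card_le_fibres[OF finS, where f = "\<lambda>((h, u), (h', u')). (h', u)"])
       (use fin fib in \<open>auto simp del: of_nat_mult\<close>)
  thus ?thesis using fin by (simp only: card_cartesian_product of_nat_mult[symmetric] of_nat_le_iff)
qed

lemma card_determinant_le_interval:
  fixes p :: "'u \<Rightarrow> nat" and Hs :: "nat set" and B D :: nat and K :: real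
  assumes fin: "finite Hs" "finite U"
    and Hs: "\<And>h. h \<in> Hs \<Longrightarrow> 1 \<le> h" and p: "\<And>u. u \<in> U \<Longrightarrow> 1 \<le> p u"
    and mult: "\<And>m. card {u \<in> U. p u = m} \<le> B"
    and div: "\<And>h u. h \<in> Hs \<Longrightarrow> u \<in> U \<Longrightarrow> divisor_count (h * p u) \<le> D" and "0 \<le> K"
  shows "real (card {((h, u), (h', u')) \<in> (Hs \<times> U) \<times> (Hs \<times> U). \<bar>real h * real (p u') - real h' * real (p u)\<bar> \<le> K})
    \<le> (2 * K + 1) * (real (card Hs) * real (card U) * (real D * real B))"
proof -
  let ?S = "{((h, u), (h', u')) \<in> (Hs \<times> U) \<times> (Hs \<times> U). \<bar>real h * real (p u') - real h' * real (p u)\<bar> \<le> K}"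
  let ?Ks = "{- \<lfloor>K\<rfloor>..\<lfloor>K\<rfloor>}"
  let ?f = "\<lambda>((h, u), (h', u')). int (h * p u') - int (h' * p u)"
  have finS: "finite ?S"
    by (rule finite_subset[of _ "(Hs \<times> U) \<times> (Hs \<times> U)"]) (use fin in auto)
  have "real (card ?S) \<le> real (card ?Ks) * (real (card Hs) * real (card U) * (real D * real B))"
  proof (rule card_le_fibres[OF finS, where f = ?f])
    show "?f ` ?S \<subseteq> ?Ks"
    proof (rule image_subsetI)
      fix w assume "w \<in> ?S"
      then obtain h u h' u' where w: "w = ((h, u), (h', u'))" "\<bar>real h * real (p u') - real h' * real (p u)\<bar> \<le> K"
        by auto
      define z where "z = int (h * p u') - int (h' * p u)"
      have "\<bar>real_of_int z\<bar> \<le> K" using w(2) by (simp add: z_def)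
      hence "z \<in> ?Ks" by (simp add: abs_le_iff le_floor_iff) (metis add.inverse_inverse le_floor_iff neg_le_iff_le of_int_minus)
      thus "?f w \<in> ?Ks" by (simp add: w(1) z_def)
    qed
  next
    fix k assume "k \<in> ?Ks"
    have "card {y \<in> ?S. ?f y = k} \<le> card {((h, u), (h', u')) \<in> (Hs \<times> U) \<times> (Hs \<times> U). int (h * p u') - int (h' * p u) = k}"
      by (rule card_mono, rule finite_subset[of _ "(Hs \<times> U) \<times> (Hs \<times> U)"]) (use fin in auto)
    also have "\<dots> \<le> card Hs * card U * (D * B)"
      by (rule card_determinant_le) fact+
    finally have "card {y \<in> ?S. ?f y = k} \<le> card Hs * card U * (D * B)" .
    thus "real (card {y \<in> ?S. ?f y = k}) \<le> real (card Hs) * real (card U) * (real D * real B)"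
      by (simp only: of_nat_mult[symmetric] of_nat_le_iff)
  qed auto
  also have "\<dots> \<le> (2 * K + 1) * (real (card Hs) * real (card U) * (real D * real B))"
    using \<open>0 \<le> K\<close> by (intro mult_right_mono) auto
  finally show ?thesis .
qed

text \<open>An absolute value inside a sum is traded for a coefficient of modulus at most 1, so that
  the order of summation may be changed afterwards. For \<open>S = 0\<close> the coefficient is
  0.\<close>

lemma norm_eq_mult_unimodular: "\<exists>c. norm c \<le> 1 \<and> complex_of_real (norm S) = c * S"
proof (cases "S = 0")
  case False
  show ?thesis
  proof (intro exI[of _ "cnj S / of_real (norm S)"] conjI)
    show "norm (cnj S / of_real (norm S)) \<le> 1" using False by (simp add: norm_divide)
    have "cnj S * S = of_real ((norm S)\<^sup>2)" by (simp only: complex_norm_square mult.commute)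
    thus "complex_of_real (norm S) = cnj S / of_real (norm S) * S"
      using False by (simp add: power2_eq_square)
  qed
qed (auto intro: exI[of _ 0])

lemma nat_interval_card:
  fixes A \<kappa> :: real
  assumes "1 \<le> A" "1 \<le> \<kappa>"
  shows "finite {n::nat. A \<le> real n \<and> real n \<le> \<kappa> * A}"
    and "real (card {n::nat. A \<le> real n \<and> real n \<le> \<kappa> * A}) \<le> \<kappa> * A"
proof -
  have sub: "{n::nat. A \<le> real n \<and> real n \<le> \<kappa> * A} \<subseteq> {n. 1 \<le> n \<and> real n \<le> \<kappa> * A}"
  proof
    fix n assume "n \<in> {n::nat. A \<le> real n \<and> real n \<le> \<kappa> * A}"
    thus "n \<in> {n. 1 \<le> n \<and> real n \<le> \<kappa> * A}" using assms by auto
  qed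
  show "finite {n::nat. A \<le> real n \<and> real n \<le> \<kappa> * A}"
    using sub finite_nat_le_real finite_subset by blast
  have "card {n::nat. A \<le> real n \<and> real n \<le> \<kappa> * A} \<le> card {n::nat. 1 \<le> n \<and> real n \<le> \<kappa> * A}"
    by (rule card_mono[OF finite_nat_le_real sub])
  also have "real (card {n::nat. 1 \<le> n \<and> real n \<le> \<kappa> * A}) \<le> \<kappa> * A"
    using assms by (intro card_nat_le_floor) auto
  finally show "real (card {n::nat. A \<le> real n \<and> real n \<le> \<kappa> * A}) \<le> \<kappa> * A" by simp
qed

text \<open>The pairs \<open>(h, u)\<close> are sorted into cells on which \<open>h / p u\<close> is nearly constant, so that after
  Cauchy-Schwarz the phase \<open>x (h / p u - h' / p u') / n\<close> of the inner sum over \<open>n\<close> is short.\<close>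

lemma type_II_cluster:
  fixes p :: "'u \<Rightarrow> nat" and q :: "'v \<Rightarrow> nat" and x \<delta> M N \<kappa> Q :: real and H B :: nat
  assumes fin: "finite U" "finite V" and \<kappa>: "1 \<le> \<kappa>" and MN: "1 \<le> M" "1 \<le> N" and H: "1 \<le> H"
    and \<delta>: "0 \<le> \<delta>" "\<delta> \<le> 1" and x: "0 < x"
    and p: "\<And>u. u \<in> U \<Longrightarrow> M \<le> real (p u) \<and> real (p u) \<le> \<kappa> * M"
    and q: "\<And>v. v \<in> V \<Longrightarrow> N \<le> real (q v) \<and> real (q v) \<le> \<kappa> * N"
    and B: "1 \<le> B" "\<And>m. card {u \<in> U. p u = m} \<le> B" "\<And>n. card {v \<in> V. q v = n} \<le> B"
    and div: "\<And>h u. h \<in> {H..<2*H} \<Longrightarrow> u \<in> U \<Longrightarrow> divisor_count (h * p u) \<le> B"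
    and Q: "1 \<le> Q" "Q \<le> real H * M" and sep: "768 * \<kappa> ^ 4 * real H \<le> N"
  shows "(\<Sum>h\<in>{H..<2*H}. norm (\<Sum>u\<in>U. \<Sum>v\<in>V. ee (real h * x / (real (p u) * real (q v) + \<delta>))))\<^sup>2
    \<le> 300000 * \<kappa> ^ 12 * real B ^ 5 * (real H * M * N)\<^sup>2
        * (1 / Q + sqrt (x * Q / (M\<^sup>2 * N ^ 3)) + sqrt (M\<^sup>2 * N / x))"
proof -
  define Hs where "Hs = {H..<2*H}"
  define W where "W = Hs \<times> U"
  define Ns where "Ns = {n::nat. N \<le> real n \<and> real n \<le> \<kappa> * N}"
  define S where "S = (\<lambda>h. \<Sum>u\<in>U. \<Sum>v\<in>V. ee (real h * x / (real (p u) * real (q v) + \<delta>)))"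
  obtain c where c: "\<And>h. norm (c h) \<le> 1" "\<And>h. complex_of_real (norm (S h)) = c h * S h"
  proof -
    have "\<exists>c. \<forall>h. norm (c h) \<le> 1 \<and> complex_of_real (norm (S h)) = c h * S h"
      by (rule choice) (simp add: norm_eq_mult_unimodular)
    thus thesis using that by blast
  qed
  define F where "F = (\<lambda>w n. c (fst w) * ee (real (fst w) * x / (real (p (snd w)) * real n + \<delta>)))"
  have finHs: "finite Hs" "card Hs = H" by (auto simp: Hs_def)
  have finW: "finite W" using fin finHs by (simp add: W_def)
  note Ns = nat_interval_card[OF MN(2) \<kappa>, folded Ns_def]
  have cardU: "real (card U) \<le> real B * (\<kappa> * M)"
  proof -
    have "real (card U) \<le> real B * real (card {n::nat. M \<le> real n \<and> real n \<le> \<kappa> * M})"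
      by (rule card_fibre_le[OF fin(1) nat_interval_card(1)[OF MN(1) \<kappa>]]) (use p B in auto)
    also have "\<dots> \<le> real B * (\<kappa> * M)" using nat_interval_card(2)[OF MN(1) \<kappa>] by (intro mult_left_mono) auto
    finally show ?thesis .
  qed
  have qNs: "q ` V \<subseteq> Ns" using q by (auto simp: Ns_def)
  have cardV: "real (card V) \<le> real B * (\<kappa> * N)"
  proof -
    have "real (card V) \<le> real B * real (card Ns)"
      by (rule card_fibre_le[OF fin(2) Ns(1) qNs B(3)])
    also have "\<dots> \<le> real B * (\<kappa> * N)" using Ns(2) by (intro mult_left_mono) auto
    finally show ?thesis .
  qed
  \<comment> \<open>Cells of width Q/M^2 for h/p(u): there are about H M/Q of them, and two pairs in
    a common cell have determinant at most \<kappa>^2 Q.\<close>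
  define cell where "cell = (\<lambda>w. \<lfloor>real (fst w) / real (p (snd w)) * (M\<^sup>2 / Q)\<rfloor>)"
  have W: "1 \<le> p u" "H \<le> h" "h < 2 * H" "u \<in> U" "h \<in> Hs" if "(h, u) \<in> W" for h u
    using that p[of u] MN by (auto simp: W_def Hs_def)
  have cells: "real (card (cell ` W)) \<le> 3 * (real H * M / Q)"
  proof -
    have "cell ` W \<subseteq> {0..\<lfloor>2 * real H * M / Q\<rfloor>}"
    proof (rule image_subsetI)
      fix w assume w: "w \<in> W"
      obtain h u where hu: "w = (h, u)" by fastforce
      note Wf = W[OF w[unfolded hu]]
      have "real h / real (p u) * (M\<^sup>2 / Q) \<le> 2 * real H / M * (M\<^sup>2 / Q)"
        using Wf p[of u] MN Q by (intro mult_right_mono frac_le) auto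
      also have "\<dots> = 2 * real H * M / Q" using MN by (simp add: power2_eq_square)
      finally have "real h / real (p u) * (M\<^sup>2 / Q) \<le> 2 * real H * M / Q" .
      moreover have "0 \<le> real h / real (p u) * (M\<^sup>2 / Q)" using Q by simp
      ultimately show "cell w \<in> {0..\<lfloor>2 * real H * M / Q\<rfloor>}"
        unfolding cell_def hu by (auto intro: floor_mono)
    qed
    hence "card (cell ` W) \<le> card {0..\<lfloor>2 * real H * M / Q\<rfloor>}" by (intro card_mono) auto
    also have "real (card {0..\<lfloor>2 * real H * M / Q\<rfloor>}) \<le> 2 * real H * M / Q + 1"
      using Q MN by simp
    also have "\<dots> \<le> 3 * (real H * M / Q)"
    proof -
      define r where "r = real H * M / Q"
      have "1 \<le> r" "2 * real H * M / Q = 2 * r" using Q by (simp_all add: r_def)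
      thus ?thesis unfolding r_def[symmetric] by simp
    qed
    finally show ?thesis by simp
  qed
  define E where "E = 31000 * \<kappa> ^ 8 * N * (sqrt (x * Q / (M\<^sup>2 * N ^ 3)) + sqrt (M\<^sup>2 * N / x))"
  have E0: "0 \<le> E" unfolding E_def using \<kappa> MN x Q by (intro mult_nonneg_nonneg add_nonneg_nonneg) auto
  define k where "k = (\<lambda>w w'. real (fst w) * real (p (snd w')) - real (fst w') * real (p (snd w)))"
  \<comment> \<open>The diagonal k = 0 is bounded by the length of the inner sum, every other pair
    by \<open>phase_difference_sum\<close> with K = Q.\<close>
  have pair: "norm (\<Sum>n\<in>Ns. F w n * cnj (F w' n)) \<le> (if k w w' = 0 then \<kappa> * N else E) \<and> \<bar>k w w'\<bar> \<le> \<kappa>\<^sup>2 * Q"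
    if w: "w \<in> W" "w' \<in> W" "cell w = cell w'" for w w'
  proof -
    obtain h u h' u' where hu: "w = (h, u)" "w' = (h', u')" by fastforce
    note Wf = W[OF w(1)[unfolded hu]] W[OF w(2)[unfolded hu]]
    note pp = p[OF Wf(4)] p[OF Wf(9)]
    have p0: "0 < real (p u)" "0 < real (p u')" using Wf by auto
    have kb: "\<bar>k w w'\<bar> \<le> \<kappa>\<^sup>2 * Q"
    proof -
      have "\<bar>real h / real (p u) * (M\<^sup>2 / Q) - real h' / real (p u') * (M\<^sup>2 / Q)\<bar> \<le> 1"
        using w(3) unfolding cell_def hu by (simp only: fst_conv snd_conv) linarith
      moreover have "real h / real (p u) * (M\<^sup>2 / Q) - real h' / real (p u') * (M\<^sup>2 / Q)
          = k w w' * (M\<^sup>2 / Q) / (real (p u) * real (p u'))"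
      proof -
        have "a / m * t - b / m' * t = (a * m' - b * m) * t / (m * m')" if "m \<noteq> 0" "m' \<noteq> 0" for a b t m m' :: real
          using that by (simp add: field_simps)
        note gen = this
        show ?thesis unfolding k_def hu fst_conv snd_conv by (rule gen) (use p0 in auto)
      qed
      ultimately have "\<bar>k w w'\<bar> * (M\<^sup>2 / Q) / (real (p u) * real (p u')) \<le> 1"
        using p0 Q by (simp add: abs_mult)
      hence "\<bar>k w w'\<bar> * (M\<^sup>2 / Q) \<le> real (p u) * real (p u')"
        by (simp only: pos_divide_le_eq[OF mult_pos_pos[OF p0]] mult_1)
      also have "\<dots> \<le> (\<kappa> * M) * (\<kappa> * M)" using pp p0 by (intro mult_mono) auto
      also have "\<dots> = (\<kappa>\<^sup>2 * Q) * (M\<^sup>2 / Q)" using Q by (simp add: power2_eq_square)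
      finally show ?thesis using MN Q by (simp only: mult_le_cancel_right_pos divide_pos_pos zero_less_power)
    qed
    have "(\<Sum>n\<in>Ns. F w n * cnj (F w' n)) = c h * cnj (c h') *
        (\<Sum>n\<in>Ns. ee (real h * x / (real (p u) * real n + \<delta>) - real h' * x / (real (p u') * real n + \<delta>)))"
      by (simp add: F_def hu ee_diff sum_distrib_left mult_ac)
    hence "norm (\<Sum>n\<in>Ns. F w n * cnj (F w' n)) = norm (c h) * norm (c h') *
        norm (\<Sum>n\<in>Ns. ee (real h * x / (real (p u) * real n + \<delta>) - real h' * x / (real (p u') * real n + \<delta>)))"
      by (simp add: norm_mult)
    also have "\<dots> \<le> 1 * 1 * norm (\<Sum>n\<in>Ns. ee (real h * x / (real (p u) * real n + \<delta>) - real h' * x / (real (p u') * real n + \<delta>)))"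
      using c(1) by (intro mult_right_mono mult_mono) auto
    finally have le: "norm (\<Sum>n\<in>Ns. F w n * cnj (F w' n)) \<le>
        norm (\<Sum>n\<in>Ns. ee (real h * x / (real (p u) * real n + \<delta>) - real h' * x / (real (p u') * real n + \<delta>)))" by simp
    show ?thesis
    proof (cases "k w w' = 0")
      case True
      have "norm (\<Sum>n\<in>Ns. ee (real h * x / (real (p u) * real n + \<delta>) - real h' * x / (real (p u') * real n + \<delta>))) \<le> real (card Ns)"
        by (rule norm_sum_le_card) simp
      thus ?thesis using True le kb Ns(2) by auto
    next
      case False
      have "real (h * p u') \<noteq> real (h' * p u)" using False by (simp add: k_def hu)
      hence "h * p u' \<noteq> h' * p u" by (simp only: of_nat_eq_iff not_False_eq_True)
      hence "norm (\<Sum>n\<in>Ns. ee (real h * x / (real (p u) * real n + \<delta>) - real h' * x / (real (p u') * real n + \<delta>))) \<le> E"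
        unfolding Ns_def E_def
        by (intro phase_difference_sum[where H = "real H"]) (use \<kappa> MN \<delta> x pp Wf sep kb in \<open>auto simp: k_def hu\<close>)
      thus ?thesis using False le kb by auto
    qed
  qed
  define P where "P = {(w, w') \<in> W \<times> W. cell w = cell w'}"
  have finP: "finite P" by (rule finite_subset[of _ "W \<times> W"]) (use finW in \<open>auto simp: P_def\<close>)
  \<comment> \<open>The count for a single determinant value: H choices of h', at most B \<kappa> M
    of u, and B^2 for the divisor and the multiplicity.\<close>
  define D0 where "D0 = real H * (real B * (\<kappa> * M)) * (real B * real B)"
  have D0: "0 \<le> D0" using \<kappa> MN by (simp add: D0_def)
  have count: "real (card {(w, w') \<in> W \<times> W. \<bar>k w w'\<bar> \<le> K}) \<le> (2 * K + 1) * D0" if "0 \<le> K" for K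
  proof -
    have eq: "{(w, w') \<in> W \<times> W. \<bar>k w w'\<bar> \<le> K}
        = {((h, u), (h', u')) \<in> (Hs \<times> U) \<times> (Hs \<times> U). \<bar>real h * real (p u') - real h' * real (p u)\<bar> \<le> K}"
      by (auto simp: W_def k_def)
    have "real (card {(w, w') \<in> W \<times> W. \<bar>k w w'\<bar> \<le> K})
        \<le> (2 * K + 1) * (real (card Hs) * real (card U) * (real B * real B))"
      unfolding eq
    proof (rule card_determinant_le_interval[OF finHs(1) fin(1) _ _ B(2) _ that])
      show "1 \<le> h" if "h \<in> Hs" for h using that H by (simp add: Hs_def)
      show "1 \<le> p u" if "u \<in> U" for u using p[OF that] MN by linarith
      show "divisor_count (h * p u) \<le> B" if "h \<in> Hs" "u \<in> U" for h u
        using div that by (simp add: Hs_def)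
    qed
    also have "\<dots> \<le> (2 * K + 1) * D0"
      unfolding D0_def finHs(2) using cardU that by (intro mult_left_mono mult_right_mono) auto
    finally show ?thesis .
  qed
  have "(\<Sum>(w, w') \<in> P. norm (\<Sum>n\<in>Ns. F w n * cnj (F w' n)))
      \<le> (\<Sum>(w, w') \<in> P. (if k w w' = 0 then \<kappa> * N else 0) + E)"
  proof (rule sum_mono)
    fix z assume "z \<in> P"
    thus "(case z of (w, w') \<Rightarrow> norm (\<Sum>n\<in>Ns. F w n * cnj (F w' n)))
      \<le> (case z of (w, w') \<Rightarrow> (if k w w' = 0 then \<kappa> * N else 0) + E)"
      using pair E0 by (force simp: P_def)
  qed
  also have "\<dots> = (\<Sum>(w, w') \<in> P. (if k w w' = 0 then \<kappa> * N else 0)) + real (card P) * E"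
    by (simp add: case_prod_unfold sum.distrib)
  also have "(\<Sum>(w, w') \<in> P. (if k w w' = 0 then \<kappa> * N else 0))
      = real (card {z \<in> P. k (fst z) (snd z) = 0}) * (\<kappa> * N)"
    using finP by (simp add: case_prod_unfold sum.If_cases Int_def)
  also have "\<dots> \<le> D0 * (\<kappa> * N)"
  proof (intro mult_right_mono)
    have "card {z \<in> P. k (fst z) (snd z) = 0} \<le> card {(w, w') \<in> W \<times> W. \<bar>k w w'\<bar> \<le> 0}"
      by (rule card_mono, rule finite_subset[of _ "W \<times> W"]) (use finW in \<open>auto simp: P_def\<close>)
    thus "real (card {z \<in> P. k (fst z) (snd z) = 0}) \<le> D0" using count[of 0] by simp
  qed (use \<kappa> MN in auto)
  also have "real (card P) * E \<le> (3 * \<kappa>\<^sup>2 * Q) * D0 * E"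
  proof (intro mult_right_mono[OF _ E0])
    have \<kappa>Q: "1 \<le> \<kappa>\<^sup>2 * Q" using \<kappa> Q mult_mono[of 1 "\<kappa>\<^sup>2" 1 Q] one_le_power[OF \<kappa>, of 2] by simp
    have "card P \<le> card {(w, w') \<in> W \<times> W. \<bar>k w w'\<bar> \<le> \<kappa>\<^sup>2 * Q}"
      by (rule card_mono, rule finite_subset[of _ "W \<times> W"]) (use finW pair in \<open>auto simp: P_def\<close>)
    hence "real (card P) \<le> (2 * (\<kappa>\<^sup>2 * Q) + 1) * D0" using count[of "\<kappa>\<^sup>2 * Q"] \<kappa>Q by simp
    also have "\<dots> \<le> (3 * \<kappa>\<^sup>2 * Q) * D0"
    proof (rule mult_right_mono[OF _ D0])
      show "2 * (\<kappa>\<^sup>2 * Q) + 1 \<le> 3 * \<kappa>\<^sup>2 * Q" using \<kappa>Q unfolding mult.assoc by linarith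
    qed
    finally show "real (card P) \<le> (3 * \<kappa>\<^sup>2 * Q) * D0" .
  qed
  finally have Psum: "(\<Sum>(w, w') \<in> P. norm (\<Sum>n\<in>Ns. F w n * cnj (F w' n))) \<le> D0 * (\<kappa> * N + 3 * \<kappa>\<^sup>2 * Q * E)"
    by (simp add: algebra_simps)
  define T where "T = (\<Sum>h\<in>Hs. norm (S h))"
  have T0: "0 \<le> T" by (auto simp: T_def intro: sum_nonneg)
  have "complex_of_real T = (\<Sum>v\<in>V. \<Sum>w\<in>W. F w (q v))"
  proof -
    have "complex_of_real T = (\<Sum>h\<in>Hs. \<Sum>u\<in>U. \<Sum>v\<in>V. F (h, u) (q v))"
      unfolding T_def of_real_sum c(2) by (simp add: S_def F_def sum_distrib_left)
    also have "\<dots> = (\<Sum>w\<in>W. \<Sum>v\<in>V. F w (q v))"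
      unfolding W_def sum.cartesian_product[of "\<lambda>h u. \<Sum>v\<in>V. F (h, u) (q v)"] by (simp add: case_prod_unfold)
    also have "\<dots> = (\<Sum>v\<in>V. \<Sum>w\<in>W. F w (q v))" by (rule sum.swap)
    finally show ?thesis .
  qed
  hence "T = norm (\<Sum>v\<in>V. \<Sum>w\<in>W. F w (q v))"
    using T0 by (metis abs_of_nonneg norm_of_real)
  also have "\<dots> \<le> (\<Sum>v\<in>V. norm (\<Sum>w\<in>W. F w (q v)))" by (rule norm_sum)
  finally have "T\<^sup>2 \<le> (\<Sum>v\<in>V. norm (\<Sum>w\<in>W. F w (q v)))\<^sup>2" using T0 by (rule power_mono)
  also have "\<dots> \<le> real (card V) * (\<Sum>v\<in>V. (norm (\<Sum>w\<in>W. F w (q v)))\<^sup>2)"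
    by (rule power2_sum_le_card)
  also have "\<dots> \<le> (real B * (\<kappa> * N)) * (real B * (\<Sum>n\<in>Ns. (norm (\<Sum>w\<in>W. F w n))\<^sup>2))"
    by (intro mult_mono cardV sum_fibre_le fin Ns qNs B(3)) (use \<kappa> MN in \<open>auto intro: sum_nonneg\<close>)
  also have "\<dots> \<le> (real B * (\<kappa> * N)) * (real B * (3 * (real H * M / Q) * (D0 * (\<kappa> * N + 3 * \<kappa>\<^sup>2 * Q * E))))"
  proof (intro mult_left_mono)
    have "(\<Sum>n\<in>Ns. (norm (\<Sum>w\<in>W. F w n))\<^sup>2) \<le> real (card (cell ` W)) * (\<Sum>(w, w') \<in> P. norm (\<Sum>n\<in>Ns. F w n * cnj (F w' n)))"
      unfolding P_def by (rule sum_power2_cells[OF finW])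
    also have "\<dots> \<le> (3 * (real H * M / Q)) * (D0 * (\<kappa> * N + 3 * \<kappa>\<^sup>2 * Q * E))"
      using Psum cells MN Q by (intro mult_mono) (auto intro!: sum_nonneg)
    finally show "(\<Sum>n\<in>Ns. (norm (\<Sum>w\<in>W. F w n))\<^sup>2) \<le> \<dots>" .
  qed (use \<kappa> MN in auto)
  \<comment> \<open>With about H M/Q cells the diagonal yields the term 1/Q; off the diagonal the Q
    determinant values cancel this 1/Q and leave E/N.\<close>
  also have "\<dots> = real B ^ 5 * (real H * M * N)\<^sup>2 * (3 * \<kappa> ^ 3 * (1 / Q) + 279000 * \<kappa> ^ 12 * (E / (31000 * \<kappa> ^ 8 * N)))"
    using \<kappa> MN Q by (simp add: D0_def field_simps power_numeral_reduce)
  also have "E / (31000 * \<kappa> ^ 8 * N) = sqrt (x * Q / (M\<^sup>2 * N ^ 3)) + sqrt (M\<^sup>2 * N / x)" (is "_ = ?s")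
    using \<kappa> MN by (simp add: E_def)
  also have "real B ^ 5 * (real H * M * N)\<^sup>2 * (3 * \<kappa> ^ 3 * (1 / Q) + 279000 * \<kappa> ^ 12 * ?s)
      \<le> real B ^ 5 * (real H * M * N)\<^sup>2 * (300000 * \<kappa> ^ 12 * (1 / Q) + 300000 * \<kappa> ^ 12 * ?s)"
  proof (rule mult_left_mono[OF add_mono[OF mult_right_mono mult_right_mono]])
    have "\<kappa> ^ 3 \<le> \<kappa> ^ 12" using \<kappa> by (intro power_increasing) auto
    moreover have "0 \<le> \<kappa> ^ 12" using \<kappa> by simp
    ultimately show "3 * \<kappa> ^ 3 \<le> 300000 * \<kappa> ^ 12" "279000 * \<kappa> ^ 12 \<le> 300000 * \<kappa> ^ 12" by linarith+
  qed (use Q x MN in auto)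
  finally show ?thesis unfolding T_def Hs_def S_def by (simp add: algebra_simps)
qed

section \<open>Type I sums\<close>

text \<open>For a single smooth variable the second difference is exactly \<open>r * tri t\<close>
  with r = x h/m and t = n + \<delta>/m: the shift is absorbed into the argument, and van der Corput
  applies directly.\<close>

lemma type_I_sum:
  fixes h m a b :: nat and x \<delta> N \<kappa> :: real
  assumes \<kappa>: "1 \<le> \<kappa>" and N: "1 \<le> N" and m: "1 \<le> m" and h: "1 \<le> h" and \<delta>: "0 \<le> \<delta>" "\<delta> \<le> 1" and x: "0 < x"
    and ab: "a \<le> b" "real (b - a) \<le> \<kappa> * N"
    and range: "\<And>n. n \<in> {a..<b} \<Longrightarrow> N \<le> real n \<and> real n \<le> \<kappa> * N"
  shows "norm (\<Sum>n=a..<b. ee (real h * x / (real m * real n + \<delta>)))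
    \<le> 8000 * \<kappa> ^ 5 * N * (sqrt (x * real h / (real m * N ^ 3)) + sqrt (real m * N / (x * real h)))"
proof -
  define f where "f = (\<lambda>n::nat. real h * x / (real m * real n + \<delta>))"
  define r where "r = x * (real h / real m)"
  have r: "0 < r" using x h m by (simp add: r_def)
  define \<mu> where "\<mu> = r / (32 * \<kappa> ^ 3 * N ^ 3)"
  have \<mu>0: "0 < \<mu>" using r \<kappa> N by (simp add: \<mu>_def)
  have \<kappa>3: "1 \<le> \<kappa> ^ 3" using \<kappa> by (rule one_le_power)
  have "norm (\<Sum>n=a..<b. ee (f n)) \<le> 20 * (64 * \<kappa> ^ 3) * (real (b - a) * sqrt \<mu> + 1 / sqrt \<mu>)"
  proof (rule vdC_second_difference[OF \<mu>0 _ ab(1)])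
    show "1 \<le> 64 * \<kappa> ^ 3" using \<kappa>3 by linarith
    fix n assume n: "a \<le> n" "n < b"
    have Nn: "N \<le> real n" "real n \<le> \<kappa> * N" using range[of n] n by auto
    define t where "t = real n + \<delta> / real m"
    have \<delta>m: "0 \<le> \<delta> / real m" "\<delta> / real m \<le> 1" using \<delta> m by (auto simp: field_simps)
    have \<kappa>N: "1 \<le> \<kappa> * N" using \<kappa> N mult_mono[of 1 \<kappa> 1 N] by simp
    have t: "N \<le> t" "t \<le> 2 * \<kappa> * N" using Nn \<delta>m \<kappa>N by (auto simp: t_def)
    have eq: "f (n + 2) - 2 * f (n + 1) + f n = r * tri t"
      using second_difference_phase[of "real m" "real n" \<delta> "real h" x] m n Nn N \<delta>
      by (simp add: f_def t_def r_def algebra_simps)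
    note tri = tri_bounds[OF N t \<kappa>]
    show "\<mu> \<le> f (n + 2) - 2 * f (n + 1) + f n"
      unfolding eq using mult_left_mono[OF tri(1), of r] r by (simp add: \<mu>_def)
    have "64 * \<kappa> ^ 3 * \<mu> = r * (2 / N ^ 3)" using \<kappa> by (simp add: \<mu>_def)
    thus "f (n + 2) - 2 * f (n + 1) + f n \<le> 64 * \<kappa> ^ 3 * \<mu>"
      unfolding eq using mult_left_mono[OF tri(2), of r] r by simp
  qed
  also have "\<dots> \<le> 20 * (64 * \<kappa> ^ 3) * ((6 * \<kappa>\<^sup>2 * N) * sqrt (x * real h / (real m * N ^ 3)) + 6 * \<kappa>\<^sup>2 * N * sqrt (real m * N / (x * real h)))"
  proof (intro mult_left_mono add_mono mult_mono real_sqrt_le_mono)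
    have "\<kappa> ^ 1 \<le> \<kappa> ^ 2" using \<kappa> by (intro power_increasing) auto
    hence "\<kappa> * N \<le> \<kappa>\<^sup>2 * N" using N by (intro mult_right_mono) auto
    moreover have "0 \<le> \<kappa>\<^sup>2 * N" using N by simp
    ultimately have "\<kappa> * N \<le> 6 * (\<kappa>\<^sup>2 * N)" by linarith
    thus "real (b - a) \<le> 6 * \<kappa>\<^sup>2 * N" using ab(2) by simp
    have "1 \<le> 32 * \<kappa> ^ 3" using \<kappa>3 by linarith
    hence "1 * N ^ 3 \<le> 32 * \<kappa> ^ 3 * N ^ 3" using N by (intro mult_right_mono) auto
    hence "\<mu> \<le> r / (1 * N ^ 3)"
      unfolding \<mu>_def using r N \<kappa> by (intro divide_left_mono) auto
    thus "\<mu> \<le> x * real h / (real m * N ^ 3)" by (simp add: r_def)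
    have "1 / sqrt \<mu> = sqrt (1 / \<mu>)" by (simp add: real_sqrt_divide)
    also have "\<dots> \<le> sqrt ((6 * \<kappa>\<^sup>2 * N)\<^sup>2 * (real m * N / (x * real h)))"
    proof (rule real_sqrt_le_mono)
      have "1 / \<mu> = 32 * \<kappa> ^ 3 * (N ^ 3 / r)" by (simp add: \<mu>_def)
      also have "\<dots> \<le> 36 * \<kappa> ^ 4 * (N ^ 3 / r)"
        using \<kappa> N r by (intro mult_right_mono mult_mono power_increasing) auto
      also have "\<dots> = (6 * \<kappa>\<^sup>2 * N)\<^sup>2 * (real m * N / (x * real h))"
        by (simp add: r_def power_mult_distrib power_numeral_reduce)
      finally show "1 / \<mu> \<le> \<dots>" .
    qed
    also have "\<dots> = 6 * \<kappa>\<^sup>2 * N * sqrt (real m * N / (x * real h))"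
      by (subst real_sqrt_mult) (use \<kappa> N in simp)
    finally show "1 / sqrt \<mu> \<le> \<dots>" .
  qed (use \<mu>0 \<kappa> N in auto)
  also have "\<dots> = 7680 * (\<kappa> ^ 5 * N * (sqrt (x * real h / (real m * N ^ 3)) + sqrt (real m * N / (x * real h))))"
    by (simp add: algebra_simps power_numeral_reduce)
  also have "\<dots> \<le> 8000 * (\<kappa> ^ 5 * N * (sqrt (x * real h / (real m * N ^ 3)) + sqrt (real m * N / (x * real h))))"
    using \<kappa> N x by (intro mult_right_mono) auto
  finally show ?thesis by (simp add: f_def mult.assoc)
qed

section \<open>Type II sums by the double large sieve\<close>

text \<open>A common shift preserves a - b, so the change is a - b times the change of 1/(a b), and
  the latter is O(1/c^3). This strips \<delta> from the phase before the double large sieve.\<close>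

lemma inverse_shift_difference:
  fixes a b \<delta> :: real
  assumes "0 < a" "0 < b" "0 \<le> \<delta>" "\<delta> \<le> 1" "c \<le> a" "c \<le> b" "0 < c"
  shows "\<bar>(1 / (a + \<delta>) - 1 / (b + \<delta>)) - (1 / a - 1 / b)\<bar> \<le> 2 * \<bar>a - b\<bar> / c ^ 3"
proof -
  have pos: "0 < a + \<delta>" "0 < b + \<delta>" using assms by auto
  have "(1 / A' - 1 / B') - (1 / A - 1 / B) = (A - B) * (1 / (A * B) - 1 / (A' * B'))"
    if "A \<noteq> 0" "B \<noteq> 0" "A' \<noteq> 0" "B' \<noteq> 0" "A - B = A' - B'" for A B A' B' :: real
  proof -
    have "1 / A' - 1 / B' = - (A' - B') * (1 / (A' * B'))" using that(1-4) by (auto simp: field_simps)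
    hence e: "1 / A' - 1 / B' = - (A - B) * (1 / (A' * B'))" by (simp only: that(5))
    have e': "1 / A - 1 / B = - (A - B) * (1 / (A * B))" using that(1-4) by (auto simp: field_simps)
    show ?thesis unfolding e e' by (simp only: minus_mult_left[symmetric] right_diff_distrib)
  qed
  hence eq: "(1 / (a + \<delta>) - 1 / (b + \<delta>)) - (1 / a - 1 / b) = (a - b) * (1 / (a * b) - 1 / ((a + \<delta>) * (b + \<delta>)))"
    using assms pos by simp
  have "1 / (a * b) - 1 / ((a + \<delta>) * (b + \<delta>)) = (\<delta> * (a + b + \<delta>)) / ((a * b) * ((a + \<delta>) * (b + \<delta>)))"
  proof -
    have "1 / P - 1 / R = (R - P) / (P * R)" if "P \<noteq> 0" "R \<noteq> 0" for P R :: real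
      using that by (simp add: field_simps)
    moreover have "(a + \<delta>) * (b + \<delta>) - a * b = \<delta> * (a + b + \<delta>)" by (simp add: algebra_simps)
    ultimately show ?thesis using assms pos by simp
  qed
  also have "\<dots> \<le> (1 * ((a + \<delta>) + (b + \<delta>))) / ((a * b) * ((a + \<delta>) * (b + \<delta>)))"
    using assms pos by (intro divide_right_mono mult_mono) auto
  also have "\<dots> = 1 / (a * b * (b + \<delta>)) + 1 / (a * b * (a + \<delta>))"
  proof -
    have "(1 * (P + R)) / (S * (P * R)) = 1 / (S * R) + 1 / (S * P)" if "P \<noteq> 0" "R \<noteq> 0" "S \<noteq> 0" for P R S :: real
      using that by (simp add: field_simps)
    note gen = this
    show ?thesis by (rule gen) (use assms pos in auto)
  qed
  also have "\<dots> \<le> 1 / (c * c * c) + 1 / (c * c * c)"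
    using assms by (intro add_mono divide_left_mono mult_mono mult_pos_pos mult_nonneg_nonneg) auto
  also have "\<dots> = 2 / c ^ 3" by (simp add: power3_eq_cube)
  finally have "1 / (a * b) - 1 / ((a + \<delta>) * (b + \<delta>)) \<le> 2 / c ^ 3" .
  moreover have "0 \<le> 1 / (a * b) - 1 / ((a + \<delta>) * (b + \<delta>))"
    using assms by (simp add: frac_le mult_mono)
  ultimately have "\<bar>a - b\<bar> * (1 / (a * b) - 1 / ((a + \<delta>) * (b + \<delta>))) \<le> \<bar>a - b\<bar> * (2 / c ^ 3)"
    by (intro mult_left_mono) auto
  thus ?thesis unfolding eq abs_mult
    using \<open>0 \<le> 1 / (a * b) - 1 / ((a + \<delta>) * (b + \<delta>))\<close> by (simp add: mult.commute)
qed

text \<open>The differences \<open>1/m - 1/m'\<close> with \<open>|m - m'| \<le> Q\<close> are spaced like random numbers: with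
  \<open>v = |m - m'|\<close> and \<open>w = m + m'\<close> they equal \<open>\<plusminus> 4 v / (w\<^sup>2 - v\<^sup>2)\<close>, which is close
  to the monomial \<open>4 v / w\<^sup>2\<close>.\<close>

lemma card_close_inverse_differences:
  fixes p :: "'u \<Rightarrow> nat" and M \<kappa> Q \<Delta> L :: real and B :: nat
  assumes fin: "finite U" and \<kappa>: "1 \<le> \<kappa>" and M: "1 \<le> M" and Q: "1 \<le> Q" "Q ^ 3 \<le> M\<^sup>2"
    and \<Delta>: "0 \<le> \<Delta>" "M\<^sup>2 * \<Delta> \<le> 1"
    and p: "\<And>u. u \<in> U \<Longrightarrow> M \<le> real (p u) \<and> real (p u) \<le> \<kappa> * M"
    and B: "\<And>m. card {u \<in> U. p u = m} \<le> B"
    and L: "\<And>n. real n \<le> 2 * Q \<Longrightarrow> (\<Sum>g=1..n. 1 / real g) \<le> L"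
           "\<And>n. real n \<le> 2 * \<kappa> * M \<Longrightarrow> (\<Sum>g=1..n. 1 / real g) \<le> L"
  defines "P \<equiv> {(u, u') \<in> U \<times> U. p u \<noteq> p u' \<and> \<bar>real (p u) - real (p u')\<bar> \<le> Q}"
    and "Y \<equiv> \<lambda>(u, u'). 1 / real (p u) - 1 / real (p u')"
  shows "real (card {(i, i') \<in> P \<times> P. \<bar>Y i - Y i'\<bar> \<le> \<Delta>})
    \<le> 1536 * \<kappa> ^ 11 * real B ^ 4 * L\<^sup>2 * Q * (M + M ^ 4 * \<Delta> + Q ^ 3)"
proof -
  define v where "v = (\<lambda>(u, u'). nat \<bar>int (p u) - int (p u')\<bar>)"
  define w where "w = (\<lambda>(u, u'). p u + p u')"
  have vr: "real (v (u, u')) = \<bar>real (p u) - real (p u')\<bar>" for u u'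
    by (simp add: v_def)
  \<comment> \<open>The first term is the tolerance \<Delta> multiplied by four times the
    denominators; \<open>Q ^ 3\<close> is the error of replacing w^2 - v^2 by w^2.\<close>
  define R where "R = 4 * \<kappa> ^ 4 * (M ^ 4 * \<Delta>) + Q ^ 3"
  have R0: "0 \<le> R" unfolding R_def using \<kappa> M \<Delta> Q by auto
  define Z where "Z = {(q1 :: nat, q2 :: nat, u1 :: nat, u2 :: nat).
      1 \<le> q1 \<and> real q1 \<le> Q \<and> 1 \<le> q2 \<and> real q2 \<le> Q \<and>
      2 * M \<le> real u1 \<and> real u1 \<le> \<kappa> * (2 * M) \<and> 2 * M \<le> real u2 \<and> real u2 \<le> \<kappa> * (2 * M) \<and>
      \<bar>real q1 * (real u2)\<^sup>2 - real q2 * (real u1)\<^sup>2\<bar> \<le> R}"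
  define C where "C = {(i, i') \<in> P \<times> P. \<bar>Y i - Y i'\<bar> \<le> \<Delta>}"
  have finP: "finite P" by (rule finite_subset[of _ "U \<times> U"]) (use fin in \<open>auto simp: P_def\<close>)
  have finC: "finite C" by (rule finite_subset[of _ "P \<times> P"]) (use finP in \<open>auto simp: C_def\<close>)
  have finZ: "finite Z"
  proof (rule finite_subset)
    let ?N = "\<lambda>A::real. {n::nat. 1 \<le> n \<and> real n \<le> A}"
    show "Z \<subseteq> ?N Q \<times> ?N Q \<times> ?N (\<kappa> * (2 * M)) \<times> ?N (\<kappa> * (2 * M))"
    proof
      fix z assume "z \<in> Z"
      then obtain q1 q2 u1 u2 where z: "z = (q1, q2, u1, u2)" "1 \<le> q1" "real q1 \<le> Q" "1 \<le> q2" "real q2 \<le> Q"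
        "2 * M \<le> real u1" "real u1 \<le> \<kappa> * (2 * M)" "2 * M \<le> real u2" "real u2 \<le> \<kappa> * (2 * M)"
        unfolding Z_def by auto
      have "1 \<le> u1" "1 \<le> u2" using z M by linarith+
      thus "z \<in> ?N Q \<times> ?N Q \<times> ?N (\<kappa> * (2 * M)) \<times> ?N (\<kappa> * (2 * M))" using z by simp
    qed
    show "finite (?N Q \<times> ?N Q \<times> ?N (\<kappa> * (2 * M)) \<times> ?N (\<kappa> * (2 * M)))"
      by (intro finite_SigmaI finite_nat_le_real)
  qed
  have iden: "\<bar>Y (a, b)\<bar> * (real (p a) * real (p b)) = real (v (a, b))"
    "4 * (real (p a) * real (p b)) = (real (w (a, b)))\<^sup>2 - (real (v (a, b)))\<^sup>2"
    if "a \<in> U" "b \<in> U" for a b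
  proof -
    have pos: "0 < real (p a)" "0 < real (p b)" using p[OF that(1)] p[OF that(2)] M by auto
    have "Y (a, b) = (real (p b) - real (p a)) / (real (p a) * real (p b))"
      using pos by (simp add: Y_def field_simps)
    thus "\<bar>Y (a, b)\<bar> * (real (p a) * real (p b)) = real (v (a, b))"
      using pos by (simp add: vr abs_mult abs_minus_commute)
    show "4 * (real (p a) * real (p b)) = (real (w (a, b)))\<^sup>2 - (real (v (a, b)))\<^sup>2"
      by (simp add: vr w_def power2_eq_square algebra_simps)
  qed
  let ?f = "\<lambda>(i, i'). (v i, v i', w i, w i')"
  have "real (card C) \<le> real (card Z) * (4 * real B ^ 4)"
  proof (rule card_le_fibres[OF finC finZ, where f = ?f])
    show "?f ` C \<subseteq> Z"
    proof (rule image_subsetI)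
      fix c assume "c \<in> C"
      then obtain a b a' b' where c: "c = ((a, b), (a', b'))" "(a, b) \<in> P" "(a', b') \<in> P"
        "\<bar>Y (a, b) - Y (a', b')\<bar> \<le> \<Delta>" by (auto simp: C_def)
      have U: "a \<in> U" "b \<in> U" "a' \<in> U" "b' \<in> U" using c by (auto simp: P_def)
      note pp = p[OF U(1)] p[OF U(2)] p[OF U(3)] p[OF U(4)]
      have v1: "1 \<le> v (a, b)" "1 \<le> v (a', b')" using c by (auto simp: P_def v_def)
      have vQ: "real (v (a, b)) \<le> Q" "real (v (a', b')) \<le> Q" using c by (auto simp: P_def vr)
      have wM: "2 * M \<le> real (w (a, b))" "real (w (a, b)) \<le> \<kappa> * (2 * M)"
        "2 * M \<le> real (w (a', b'))" "real (w (a', b')) \<le> \<kappa> * (2 * M)"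
        using pp by (auto simp: w_def)
      define X1 where "X1 = real (p a) * real (p b)"
      define X2 where "X2 = real (p a') * real (p b')"
      have X: "0 \<le> X1" "X1 \<le> \<kappa>\<^sup>2 * M\<^sup>2" "0 \<le> X2" "X2 \<le> \<kappa>\<^sup>2 * M\<^sup>2"
        using pp M mult_mono[of "real (p a)" "\<kappa> * M" "real (p b)" "\<kappa> * M"]
          mult_mono[of "real (p a')" "\<kappa> * M" "real (p b')" "\<kappa> * M"]
        by (auto simp: X1_def X2_def power2_eq_square mult_ac)
      have "real (v (a, b)) * X2 - real (v (a', b')) * X1 = (\<bar>Y (a, b)\<bar> - \<bar>Y (a', b')\<bar>) * (X1 * X2)"
        unfolding iden(1)[OF U(1,2), symmetric] iden(1)[OF U(3,4), symmetric] X1_def X2_def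
        by (simp add: algebra_simps)
      hence "\<bar>real (v (a, b)) * X2 - real (v (a', b')) * X1\<bar> = \<bar>\<bar>Y (a, b)\<bar> - \<bar>Y (a', b')\<bar>\<bar> * (X1 * X2)"
        using X by (simp add: abs_mult)
      also have "\<dots> \<le> \<Delta> * ((\<kappa>\<^sup>2 * M\<^sup>2) * (\<kappa>\<^sup>2 * M\<^sup>2))"
      proof (intro mult_mono X)
        show "\<bar>\<bar>Y (a, b)\<bar> - \<bar>Y (a', b')\<bar>\<bar> \<le> \<Delta>" using c(4) by linarith
      qed (use \<Delta> X in auto)
      also have "\<dots> = \<kappa> ^ 4 * (M ^ 4 * \<Delta>)" by (simp add: power_numeral_reduce)
      finally have 1: "\<bar>real (v (a, b)) * (4 * X2) - real (v (a', b')) * (4 * X1)\<bar> \<le> 4 * \<kappa> ^ 4 * (M ^ 4 * \<Delta>)"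
        by (simp add: abs_le_iff)
      have 2: "\<bar>real (v (a, b)) * real (v (a', b')) * (real (v (a', b')) - real (v (a, b)))\<bar> \<le> Q ^ 3"
      proof -
        have "\<bar>real (v (a', b')) - real (v (a, b))\<bar> \<le> Q" using vQ by (simp add: abs_le_iff)
        hence "\<bar>real (v (a, b)) * real (v (a', b')) * (real (v (a', b')) - real (v (a, b)))\<bar> \<le> Q * Q * Q"
          unfolding abs_mult using vQ Q by (intro mult_mono) auto
        thus ?thesis by (simp add: power3_eq_cube)
      qed
      have "real (v (a, b)) * (real (w (a', b')))\<^sup>2 - real (v (a', b')) * (real (w (a, b)))\<^sup>2
         = (real (v (a, b)) * (4 * X2) - real (v (a', b')) * (4 * X1))
           + real (v (a, b)) * real (v (a', b')) * (real (v (a', b')) - real (v (a, b)))"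
        unfolding X1_def X2_def iden(2)[OF U(1,2)] iden(2)[OF U(3,4)]
        by (simp add: power2_eq_square algebra_simps)
      hence "\<bar>real (v (a, b)) * (real (w (a', b')))\<^sup>2 - real (v (a', b')) * (real (w (a, b)))\<^sup>2\<bar> \<le> R"
        using 1 2 unfolding R_def by linarith
      thus "?f c \<in> Z" using v1 vQ wM unfolding c(1) Z_def by simp
    qed
  next
    fix z assume "z \<in> Z"
    then obtain q1 q2 u1 u2 where z: "z = (q1, q2, u1, u2)" by (cases z)
    let ?F = "\<lambda>m. {u \<in> U. p u = m}"
    \<comment> \<open>The numbers v and w recover the two values (w + v)/2 and (w - v)/2 up to
      order. Two orders and at most B^2 preimages for each of the two pairs give the factor 4
      B^4.\<close>
    define T where "T = (\<lambda>q u. (?F ((u + q) div 2) \<times> ?F ((u - q) div 2)) \<union> (?F ((u - q) div 2) \<times> ?F ((u + q) div 2)))"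
    have T: "card (T q u) \<le> 2 * (B * B)" "finite (T q u)" for q u
    proof -
      have "card (T q u) \<le> card (?F ((u + q) div 2) \<times> ?F ((u - q) div 2)) + card (?F ((u - q) div 2) \<times> ?F ((u + q) div 2))"
        unfolding T_def by (rule card_Un_le)
      also have "\<dots> \<le> B * B + B * B"
        unfolding card_cartesian_product by (intro add_mono mult_mono B) auto
      finally show "card (T q u) \<le> 2 * (B * B)" by simp
      show "finite (T q u)" unfolding T_def using fin by auto
    qed
    have inT: "(a, b) \<in> T q u" if "(a, b) \<in> P" "v (a, b) = q" "w (a, b) = u" for a b q u
    proof -
      have U: "a \<in> U" "b \<in> U" using that by (auto simp: P_def)
      show ?thesis
      proof (cases "p a \<ge> p b")
        case True
        hence "v (a, b) = p a - p b" by (simp add: v_def nat_diff_distrib)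
        hence "(u + q) div 2 = p a" "(u - q) div 2 = p b" using that True by (auto simp: w_def)
        thus ?thesis using U by (simp add: T_def)
      next
        case False
        hence "v (a, b) = p b - p a" by (simp add: v_def nat_diff_distrib)
        hence "(u + q) div 2 = p b" "(u - q) div 2 = p a" using that False by (auto simp: w_def)
        thus ?thesis using U by (simp add: T_def)
      qed
    qed
    have "{y \<in> C. ?f y = z} \<subseteq> T q1 u1 \<times> T q2 u2"
      unfolding z C_def using inT by force
    hence "card {y \<in> C. ?f y = z} \<le> card (T q1 u1 \<times> T q2 u2)"
      using T(2) by (intro card_mono finite_cartesian_product) auto
    also have "\<dots> \<le> (2 * (B * B)) * (2 * (B * B))"
      unfolding card_cartesian_product by (intro mult_mono T) auto
    finally have "real (card {y \<in> C. ?f y = z}) \<le> real ((2 * (B * B)) * (2 * (B * B)))"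
      by (simp only: of_nat_le_iff)
    thus "real (card {y \<in> C. ?f y = z}) \<le> 4 * real B ^ 4" by (simp add: power4_eq_xxxx mult_ac)
  qed auto
  note CZ = this
  have cardZ: "real (card Z) \<le> 32 * (\<kappa>\<^sup>2 + 2 * \<kappa> ^ 4) * \<kappa> ^ 3 * L\<^sup>2 * Q * (2 * M + R)"
    unfolding Z_def
  proof (rule card_near_quadratic[OF Q(1) _ \<kappa> _ R0])
    \<comment> \<open>The hypotheses M^2 \<Delta> \<le> 1 and Q^3 \<le> M^2 keep \<open>R\<close>
      below a multiple of the square of the scale 2 M, as \<open>card_near_quadratic\<close>
      demands.\<close>
    have "\<kappa> ^ 4 * (M\<^sup>2 * (M\<^sup>2 * \<Delta>)) \<le> \<kappa> ^ 4 * (M\<^sup>2 * 1)"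
      using \<Delta> by (intro mult_left_mono) auto
    moreover have "1 \<le> \<kappa> ^ 4" using \<kappa> by (rule one_le_power)
    hence "1 * M\<^sup>2 \<le> \<kappa> ^ 4 * M\<^sup>2" by (intro mult_right_mono) auto
    moreover have "4 * \<kappa> ^ 4 * (M ^ 4 * \<Delta>) = 4 * (\<kappa> ^ 4 * (M\<^sup>2 * (M\<^sup>2 * \<Delta>)))" by (simp add: power_numeral_reduce)
    moreover have "2 * \<kappa> ^ 4 * (2 * M)\<^sup>2 = 8 * (\<kappa> ^ 4 * M\<^sup>2)" by (simp add: power2_eq_square)
    ultimately show "R \<le> 2 * \<kappa> ^ 4 * (2 * M)\<^sup>2" unfolding R_def using Q(2) zero_le_power2[of M] by linarith
    show "(\<Sum>g=1..n. 1 / real g) \<le> L" if "real n \<le> \<kappa> * (2 * M)" for n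
      using that by (intro L(2)) (simp add: mult_ac)
  qed (use M \<kappa> L(1) in auto)
  have "real (card C) \<le> (32 * (\<kappa>\<^sup>2 + 2 * \<kappa> ^ 4) * \<kappa> ^ 3 * L\<^sup>2 * Q * (2 * M + R)) * (4 * real B ^ 4)"
    by (rule order.trans[OF CZ mult_right_mono[OF cardZ]]) simp
  also have "\<dots> = 128 * real B ^ 4 * L\<^sup>2 * Q * ((\<kappa>\<^sup>2 + 2 * \<kappa> ^ 4) * \<kappa> ^ 3 * (2 * M + R))" by (simp add: mult_ac)
  also have "\<dots> \<le> 128 * real B ^ 4 * L\<^sup>2 * Q * ((\<kappa> ^ 4 + 2 * \<kappa> ^ 4) * \<kappa> ^ 3 * (2 * \<kappa> ^ 4 * (M + M ^ 4 * \<Delta> + Q ^ 3) + 2 * \<kappa> ^ 4 * (M ^ 4 * \<Delta>)))"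
  proof (rule mult_left_mono[OF mult_mono[OF mult_right_mono]])
    show "\<kappa>\<^sup>2 + 2 * \<kappa> ^ 4 \<le> \<kappa> ^ 4 + 2 * \<kappa> ^ 4" using \<kappa> by (auto intro: power_increasing)
    have k4: "1 \<le> \<kappa> ^ 4" using \<kappa> by (rule one_le_power)
    have "1 * M \<le> \<kappa> ^ 4 * M" "1 * Q ^ 3 \<le> \<kappa> ^ 4 * Q ^ 3" using k4 M Q by (auto intro!: mult_right_mono)
    moreover have "0 \<le> \<kappa> ^ 4 * Q ^ 3" using \<kappa> Q by simp
    ultimately have "2 * M + R \<le> 2 * (\<kappa> ^ 4 * M) + 2 * (\<kappa> ^ 4 * (M ^ 4 * \<Delta>)) + 2 * (\<kappa> ^ 4 * Q ^ 3) + 2 * (\<kappa> ^ 4 * (M ^ 4 * \<Delta>))"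
      unfolding R_def by linarith
    thus "2 * M + R \<le> 2 * \<kappa> ^ 4 * (M + M ^ 4 * \<Delta> + Q ^ 3) + 2 * \<kappa> ^ 4 * (M ^ 4 * \<Delta>)"
      by (simp add: distrib_left)
  qed (use \<kappa> Q M R0 in auto)
  also have "\<dots> \<le> 128 * real B ^ 4 * L\<^sup>2 * Q * ((\<kappa> ^ 4 + 2 * \<kappa> ^ 4) * \<kappa> ^ 3 * (4 * \<kappa> ^ 4 * (M + M ^ 4 * \<Delta> + Q ^ 3)))"
    using \<kappa> Q M \<Delta> by (intro mult_left_mono) (auto simp: distrib_left)
  also have "\<dots> = 1536 * (\<kappa> ^ 11 * real B ^ 4 * L\<^sup>2 * Q * (M + M ^ 4 * \<Delta> + Q ^ 3))"
    by (simp add: power_numeral_reduce)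
  finally show ?thesis unfolding C_def by (simp add: mult_ac)
qed

lemma card_close_pairs_le:
  fixes p :: "'u \<Rightarrow> nat" and Q :: real and B :: nat
  assumes fin: "finite U" and B: "\<And>m. card {u \<in> U. p u = m} \<le> B" and Q: "1 \<le> Q"
  shows "real (card {(u, u') \<in> U \<times> U. \<bar>real (p u) - real (p u')\<bar> \<le> Q}) \<le> 3 * Q * (real (card U) * real B)"
proof -
  have finP: "finite {(u, u') \<in> U \<times> U. \<bar>real (p u) - real (p u')\<bar> \<le> Q}"
    by (rule finite_subset[of _ "U \<times> U"]) (use fin in auto)
  have "real (card {(u, u') \<in> U \<times> U. \<bar>real (p u) - real (p u')\<bar> \<le> Q}) \<le> real (card U) * (3 * Q * real B)"
  proof (rule card_le_fibres[OF finP fin, where f = fst])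
    fix u assume "u \<in> U"
    let ?I = "{int (p u) - \<lfloor>Q\<rfloor>..int (p u) + \<lfloor>Q\<rfloor>}"
    have "card {y \<in> {(u, u') \<in> U \<times> U. \<bar>real (p u) - real (p u')\<bar> \<le> Q}. fst y = u}
        \<le> card {u' \<in> U. \<bar>real (p u) - real (p u')\<bar> \<le> Q}"
      by (rule card_inj_on_le[of snd]) (use fin in \<open>auto simp: inj_on_def\<close>)
    also have "real \<dots> \<le> real (card ?I) * real B"
    proof (rule card_le_fibres[where f = "\<lambda>u'. int (p u')"])
      show "(\<lambda>u'. int (p u')) ` {u' \<in> U. \<bar>real (p u) - real (p u')\<bar> \<le> Q} \<subseteq> ?I"
      proof (rule image_subsetI)
        fix u' assume "u' \<in> {u' \<in> U. \<bar>real (p u) - real (p u')\<bar> \<le> Q}"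
        hence "\<bar>real_of_int (int (p u) - int (p u'))\<bar> \<le> Q" by simp
        hence "\<bar>int (p u) - int (p u')\<bar> \<le> \<lfloor>Q\<rfloor>" by (simp add: le_floor_iff)
        thus "int (p u') \<in> ?I" by (auto simp: abs_le_iff)
      qed
      fix k assume "k \<in> ?I"
      have "card {y \<in> {u' \<in> U. \<bar>real (p u) - real (p u')\<bar> \<le> Q}. int (p y) = k} \<le> card {u' \<in> U. p u' = nat k}"
        using fin by (intro card_mono) auto
      also have "\<dots> \<le> B" by (rule B)
      finally show "real (card {y \<in> {u' \<in> U. \<bar>real (p u) - real (p u')\<bar> \<le> Q}. int (p y) = k}) \<le> real B" by simp
    qed (use fin in auto)
    also have "real (card ?I) * real B \<le> (3 * Q) * real B"
    proof (rule mult_right_mono)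
      have "real (card ?I) = 2 * of_int \<lfloor>Q\<rfloor> + 1" using Q by simp
      also have "\<dots> \<le> 3 * Q" using Q by linarith
      finally show "real (card ?I) \<le> 3 * Q" .
    qed simp
    finally show "real (card {y \<in> {(u, u') \<in> U \<times> U. \<bar>real (p u) - real (p u')\<bar> \<le> Q}. fst y = u}) \<le> 3 * Q * real B"
      by simp
  qed (use Q in auto)
  thus ?thesis by (simp add: mult_ac)
qed

text \<open>With \<delta> removed, the differenced phase is a function of (u, u') times a function
  of (h, n), the shape required by the double large sieve. The spacing of the first factor is
  \<open>card_close_inverse_differences\<close>, that of the second is the determinant
  equation.\<close>

lemma large_sieve_differences:
  fixes p :: "'u \<Rightarrow> nat" and x M N \<kappa> Q :: real and H B :: nat
  assumes fin: "finite U" and \<kappa>: "1 \<le> \<kappa>" and MN: "1 \<le> M" "1 \<le> N" and H: "1 \<le> H" and x: "0 < x"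
    and p: "\<And>u. u \<in> U \<Longrightarrow> M \<le> real (p u) \<and> real (p u) \<le> \<kappa> * M"
    and B: "1 \<le> B" "\<And>m. card {u \<in> U. p u = m} \<le> B"
    and div: "\<And>h n. h \<in> {H..<2*H} \<Longrightarrow> N \<le> real n \<Longrightarrow> real n \<le> \<kappa> * N \<Longrightarrow> divisor_count (h * n) \<le> B"
    and L: "\<And>n. real n \<le> 2 * Q \<Longrightarrow> (\<Sum>g=1..n. 1 / real g) \<le> real B"
           "\<And>n. real n \<le> 2 * \<kappa> * M \<Longrightarrow> (\<Sum>g=1..n. 1 / real g) \<le> real B"
    and Q: "1 \<le> Q" "Q ^ 3 \<le> M\<^sup>2" and MNx: "(M * N)\<^sup>2 \<le> x * Q" "M\<^sup>2 * N \<le> x"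
  defines "P \<equiv> {(u, u') \<in> U \<times> U. p u \<noteq> p u' \<and> \<bar>real (p u) - real (p u')\<bar> \<le> Q}"
    and "Ns \<equiv> {n::nat. N \<le> real n \<and> real n \<le> \<kappa> * N}"
  shows "(\<Sum>(u, u')\<in>P. norm (\<Sum>(h, n)\<in>{H..<2*H} \<times> Ns. ee (x * (1 / real (p u) - 1 / real (p u')) * (real h / real n))))
    \<le> exp (4 * pi) * (600 * \<kappa> ^ 7 * real B ^ 4 * (real H * M * N * Q)
        * sqrt (x / (M ^ 3 * N\<^sup>2) + 1 / (real H * N) + x * Q ^ 3 / (M ^ 4 * N\<^sup>2)))"
proof -
  define Hs where "Hs = {H..<2*H}"
  define Y where "Y = (\<lambda>(u, u'). 1 / real (p u) - 1 / real (p u'))"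
  define X where "X = (\<lambda>i. x * Y i)"
  define Z where "Z = (\<lambda>(h::nat, n::nat). real h / real n)"
  \<comment> \<open>Sizes of the two factors: |1/p(u) - 1/p(u')| \<le> Q/M^2 and h/n \<le> 2
    H/N.\<close>
  define X0 where "X0 = x * Q / M\<^sup>2"
  define Z0 where "Z0 = 2 * real H / N"
  have H1: "1 \<le> real H" using H by simp
  have X0: "0 < X0" "0 < Z0" using x Q MN H1 by (auto simp: X0_def Z0_def)
  have Ns: "finite Ns" "real (card Ns) \<le> \<kappa> * N"
    unfolding Ns_def by (rule nat_interval_card[OF MN(2) \<kappa>])+
  have finP: "finite P" by (rule finite_subset[of _ "U \<times> U"]) (use fin in \<open>auto simp: P_def\<close>)
  have finJ: "finite (Hs \<times> Ns)" using Ns by (simp add: Hs_def)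
  define S where "S = (\<lambda>i. \<Sum>j\<in>Hs \<times> Ns. ee (X i * Z j))"
  have "\<exists>c. \<forall>i. norm (c i) \<le> 1 \<and> complex_of_real (norm (S i)) = c i * S i"
    by (rule choice) (simp add: norm_eq_mult_unimodular)
  then obtain c where c: "\<And>i. norm (c i) \<le> 1" "\<And>i. complex_of_real (norm (S i)) = c i * S i" by blast
  have "(\<Sum>i\<in>P. norm (S i)) = norm (complex_of_real (\<Sum>i\<in>P. norm (S i)))"
    unfolding norm_of_real by (simp add: sum_nonneg)
  also have "complex_of_real (\<Sum>i\<in>P. norm (S i)) = (\<Sum>i\<in>P. \<Sum>j\<in>Hs \<times> Ns. c i * 1 * ee (X i * Z j))"
    unfolding of_real_sum c(2) by (simp add: S_def sum_distrib_left)
  also have "norm \<dots> \<le> exp (4 * pi) * sqrt (32 * (X0 * Z0) * real (card {(i, i') \<in> P \<times> P. \<bar>X i - X i'\<bar> \<le> 1 / Z0})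
        * real (card {(j, j') \<in> (Hs \<times> Ns) \<times> (Hs \<times> Ns). \<bar>Z j - Z j'\<bar> \<le> 1 / X0}))"
  proof (rule double_large_sieve[OF finP finJ X0])
    have "1 * (M * N)\<^sup>2 \<le> (2 * real H * N) * (M * N)\<^sup>2"
      using H1 MN mult_mono[of 1 "2 * real H" 1 N] by (intro mult_right_mono) auto
    also have "\<dots> \<le> (2 * real H * N) * (x * Q)" using MNx MN by (intro mult_left_mono) auto
    finally show "1 \<le> X0 * Z0"
      using MN by (simp add: X0_def Z0_def field_simps power2_eq_square)
    show "\<bar>X i\<bar> \<le> X0" if "i \<in> P" for i
    proof -
      obtain u u' where i: "i = (u, u')" by fastforce
      have U: "u \<in> U" "u' \<in> U" "\<bar>real (p u) - real (p u')\<bar> \<le> Q" using that by (auto simp: P_def i)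
      have pos: "0 < real (p u)" "0 < real (p u')" using p[OF U(1)] p[OF U(2)] MN by auto
      have "Y i = (real (p u') - real (p u)) / (real (p u) * real (p u'))"
        using pos by (simp add: Y_def i field_simps)
      hence "\<bar>Y i\<bar> = \<bar>real (p u) - real (p u')\<bar> / (real (p u) * real (p u'))"
        using pos by (simp add: abs_mult abs_minus_commute)
      also have "\<dots> \<le> Q / (M * M)"
        using U(3) p[OF U(1)] p[OF U(2)] MN by (intro frac_le mult_mono) auto
      finally have "x * \<bar>Y i\<bar> \<le> x * (Q / (M * M))" using x by (intro mult_left_mono) auto
      thus ?thesis using x by (simp add: X_def X0_def abs_mult power2_eq_square)
    qed
    show "\<bar>Z j\<bar> \<le> Z0" if "j \<in> Hs \<times> Ns" for j
    proof -
      obtain h n where j: "j = (h, n)" by fastforce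
      have "real h / real n \<le> 2 * real H / N"
        using that MN by (intro frac_le) (auto simp: j Hs_def Ns_def)
      thus ?thesis by (simp add: Z_def Z0_def j)
    qed
  qed (use c in auto)
  also have "\<dots> \<le> exp (4 * pi) * sqrt (32 * (X0 * Z0)
      * (1536 * \<kappa> ^ 11 * real B ^ 6 * Q * (M + M ^ 4 * (N / (2 * real H * x)) + Q ^ 3)) * (3 * \<kappa> ^ 3 * real H * N * real B))"
  proof (intro mult_left_mono real_sqrt_le_mono mult_mono)
    have eq: "{(i, i') \<in> P \<times> P. \<bar>X i - X i'\<bar> \<le> 1 / Z0} = {(i, i') \<in> P \<times> P. \<bar>Y i - Y i'\<bar> \<le> N / (2 * real H * x)}"
    proof -
      have "\<bar>X i - X i'\<bar> \<le> 1 / Z0 \<longleftrightarrow> \<bar>Y i - Y i'\<bar> \<le> N / (2 * real H * x)" for i i'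
      proof -
        have "\<bar>X i - X i'\<bar> = x * \<bar>Y i - Y i'\<bar>"
          using x by (simp add: X_def abs_mult right_diff_distrib[symmetric])
        thus ?thesis using x H1 MN by (simp add: Z0_def field_simps)
      qed
      thus ?thesis by simp
    qed
    have "real (card {(i, i') \<in> P \<times> P. \<bar>Y i - Y i'\<bar> \<le> N / (2 * real H * x)})
       \<le> 1536 * \<kappa> ^ 11 * real B ^ 4 * (real B)\<^sup>2 * Q * (M + M ^ 4 * (N / (2 * real H * x)) + Q ^ 3)"
      unfolding P_def Y_def
    proof (rule card_close_inverse_differences[OF fin \<kappa> MN(1) Q _ _ p B(2) L])
      have "M\<^sup>2 * N \<le> 1 * x" using MNx by simp
      also have "\<dots> \<le> (2 * real H) * x" using H1 x by (intro mult_right_mono) auto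
      finally have "M\<^sup>2 * N \<le> 2 * real H * x" .
      thus "M\<^sup>2 * (N / (2 * real H * x)) \<le> 1" using x H1 by (simp add: field_simps)
      show "0 \<le> N / (2 * real H * x)" using MN H1 x by simp
    qed
    also have "1536 * \<kappa> ^ 11 * real B ^ 4 * (real B)\<^sup>2 = 1536 * \<kappa> ^ 11 * real B ^ 6"
      by (simp add: power_numeral_reduce)
    finally show "real (card {(i, i') \<in> P \<times> P. \<bar>X i - X i'\<bar> \<le> 1 / Z0})
      \<le> 1536 * \<kappa> ^ 11 * real B ^ 6 * Q * (M + M ^ 4 * (N / (2 * real H * x)) + Q ^ 3)"
      unfolding eq .
  next
    \<comment> \<open>The hypothesis (M N)^2 \<le> x Q makes the tolerance 1/X0 so small that |h n'
      - h' n| \<le> \<kappa>^2; the number of determinants is bounded in terms of \<kappa>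
      alone.\<close>
    have sub: "{(j, j') \<in> (Hs \<times> Ns) \<times> (Hs \<times> Ns). \<bar>Z j - Z j'\<bar> \<le> 1 / X0}
      \<subseteq> {((h, n), (h', n')) \<in> (Hs \<times> Ns) \<times> (Hs \<times> Ns). \<bar>real h * real (id n') - real h' * real (id n)\<bar> \<le> \<kappa>\<^sup>2}"
    proof
      fix z assume "z \<in> {(j, j') \<in> (Hs \<times> Ns) \<times> (Hs \<times> Ns). \<bar>Z j - Z j'\<bar> \<le> 1 / X0}"
      then obtain h n h' n' where z: "z = ((h, n), (h', n'))" "h \<in> Hs" "n \<in> Ns" "h' \<in> Hs" "n' \<in> Ns"
        and le: "\<bar>real h / real n - real h' / real n'\<bar> \<le> 1 / X0" by (auto simp: Z_def)
      have n0: "0 < real n" "0 < real n'" "real n \<le> \<kappa> * N" "real n' \<le> \<kappa> * N"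
        using z MN by (auto simp: Ns_def)
      have "real h * real n' - real h' * real n = (real h / real n - real h' / real n') * (real n * real n')"
        using n0 by (simp add: field_simps)
      hence "\<bar>real h * real n' - real h' * real n\<bar> = \<bar>real h / real n - real h' / real n'\<bar> * (real n * real n')"
        using n0 by (simp add: abs_mult)
      also have "\<dots> \<le> (1 / X0) * ((\<kappa> * N) * (\<kappa> * N))"
        using le n0 X0 by (intro mult_mono) auto
      also have "\<dots> = \<kappa>\<^sup>2 * ((M * N)\<^sup>2 / (x * Q))" by (simp add: X0_def power2_eq_square)
      also have "\<dots> \<le> \<kappa>\<^sup>2 * 1" using MNx x Q by (intro mult_left_mono) auto
      finally show "z \<in> {((h, n), (h', n')) \<in> (Hs \<times> Ns) \<times> (Hs \<times> Ns). \<bar>real h * real (id n') - real h' * real (id n)\<bar> \<le> \<kappa>\<^sup>2}"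
        using z by simp
    qed
    have "card {(j, j') \<in> (Hs \<times> Ns) \<times> (Hs \<times> Ns). \<bar>Z j - Z j'\<bar> \<le> 1 / X0}
      \<le> card {((h, n), (h', n')) \<in> (Hs \<times> Ns) \<times> (Hs \<times> Ns). \<bar>real h * real (id n') - real h' * real (id n)\<bar> \<le> \<kappa>\<^sup>2}"
      by (rule card_mono[OF _ sub], rule finite_subset[of _ "(Hs \<times> Ns) \<times> (Hs \<times> Ns)"]) (use finJ in auto)
    also have "real \<dots> \<le> (2 * \<kappa>\<^sup>2 + 1) * (real (card Hs) * real (card Ns) * (real B * real 1))"
    proof (rule card_determinant_le_interval)
      show "1 \<le> h" if "h \<in> Hs" for h using that H by (simp add: Hs_def)
      show "1 \<le> id n" if "n \<in> Ns" for n using that MN by (auto simp: Ns_def)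
      show "card {u \<in> Ns. id u = m} \<le> 1" for m
        using card_mono[of "{m}" "{u \<in> Ns. id u = m}"] by auto
      show "divisor_count (h * id n) \<le> B" if "h \<in> Hs" "n \<in> Ns" for h n
        using that div by (simp add: Hs_def Ns_def)
    qed (use Ns in \<open>auto simp: Hs_def\<close>)
    also have "\<dots> \<le> (3 * \<kappa>\<^sup>2) * (real H * (\<kappa> * N) * (real B * real 1))"
      using Ns(2) one_le_power[OF \<kappa>, of 2] by (intro mult_mono) (auto simp: Hs_def)
    also have "\<dots> = 3 * \<kappa> ^ 3 * real H * N * real B" by (simp add: power_numeral_reduce)
    finally show "real (card {(j, j') \<in> (Hs \<times> Ns) \<times> (Hs \<times> Ns). \<bar>Z j - Z j'\<bar> \<le> 1 / X0}) \<le> \<dots>" by simp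
  qed (use X0 \<kappa> MN x Q in auto)
  also have "\<dots> \<le> exp (4 * pi) * (600 * \<kappa> ^ 7 * real B ^ 4 * (real H * M * N * Q)
      * sqrt (x / (M ^ 3 * N\<^sup>2) + 1 / (real H * N) + x * Q ^ 3 / (M ^ 4 * N\<^sup>2)))"
  proof (rule mult_left_mono)
    define s where "s = x / (M ^ 3 * N\<^sup>2) + 1 / (real H * N) + x * Q ^ 3 / (M ^ 4 * N\<^sup>2)"
    \<comment> \<open>The three summands under the root come, in this order, from the terms M, M^4
      \<Delta> and Q^3 of the spacing count.\<close>
    have "32 * (X0 * Z0) * (1536 * \<kappa> ^ 11 * real B ^ 6 * Q * (M + M ^ 4 * (N / (2 * real H * x)) + Q ^ 3)) * (3 * \<kappa> ^ 3 * real H * N * real B)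
      = 294912 * (\<kappa> ^ 14 * real B ^ 7) * ((real H * M * N * Q)\<^sup>2 * (x / (M ^ 3 * N\<^sup>2) + 1 / (2 * (real H * N)) + x * Q ^ 3 / (M ^ 4 * N\<^sup>2)))"
      unfolding X0_def Z0_def using x MN H1 Q by (simp add: field_simps power_numeral_reduce)
    also have "\<dots> \<le> 360000 * (\<kappa> ^ 14 * real B ^ 8) * ((real H * M * N * Q)\<^sup>2 * s)"
    proof (rule mult_mono[OF _ mult_left_mono])
      show "294912 * (\<kappa> ^ 14 * real B ^ 7) \<le> 360000 * (\<kappa> ^ 14 * real B ^ 8)"
        using B \<kappa> by (intro mult_mono power_increasing order.refl) auto
      have "1 / (2 * (real H * N)) \<le> 1 / (real H * N)"
        using H1 MN by (intro divide_left_mono) auto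
      thus "x / (M ^ 3 * N\<^sup>2) + 1 / (2 * (real H * N)) + x * Q ^ 3 / (M ^ 4 * N\<^sup>2) \<le> s" by (simp add: s_def)
    qed (use x MN H1 Q B \<kappa> in auto)
    also have "\<dots> = (600 * \<kappa> ^ 7 * real B ^ 4 * (real H * M * N * Q))\<^sup>2 * s"
      by (simp add: power_mult_distrib flip: power_mult)
    finally have "sqrt (32 * (X0 * Z0) * (1536 * \<kappa> ^ 11 * real B ^ 6 * Q * (M + M ^ 4 * (N / (2 * real H * x)) + Q ^ 3)) * (3 * \<kappa> ^ 3 * real H * N * real B))
      \<le> sqrt ((600 * \<kappa> ^ 7 * real B ^ 4 * (real H * M * N * Q))\<^sup>2 * s)"
      by (rule real_sqrt_le_mono)
    also have "\<dots> = 600 * \<kappa> ^ 7 * real B ^ 4 * (real H * M * N * Q) * sqrt s"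
      by (subst real_sqrt_mult) (use \<kappa> MN Q in simp)
    finally show "sqrt (32 * (X0 * Z0) * (1536 * \<kappa> ^ 11 * real B ^ 6 * Q * (M + M ^ 4 * (N / (2 * real H * x)) + Q ^ 3)) * (3 * \<kappa> ^ 3 * real H * N * real B))
      \<le> 600 * \<kappa> ^ 7 * real B ^ 4 * (real H * M * N * Q) * sqrt (x / (M ^ 3 * N\<^sup>2) + 1 / (real H * N) + x * Q ^ 3 / (M ^ 4 * N\<^sup>2))"
      unfolding s_def .
  qed simp
  finally show ?thesis
    unfolding S_def X_def Y_def Z_def Hs_def by (simp add: case_prod_unfold)
qed

text \<open>Fouvry and Iwaniec: Cauchy-Schwarz, differencing in \<open>m\<close> by at most \<open>Q\<close>, then the double large sieve.\<close>

lemma type_II_large_sieve: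
  fixes p :: "'u \<Rightarrow> nat" and q :: "'v \<Rightarrow> nat" and x \<delta> M N \<kappa> Q :: real and H B :: nat
  assumes fin: "finite U" "finite V" and \<kappa>: "1 \<le> \<kappa>" and MN: "1 \<le> M" "1 \<le> N" and H: "1 \<le> H"
    and \<delta>: "0 \<le> \<delta>" "\<delta> \<le> 1" and x: "0 < x"
    and p: "\<And>u. u \<in> U \<Longrightarrow> M \<le> real (p u) \<and> real (p u) \<le> \<kappa> * M"
    and q: "\<And>v. v \<in> V \<Longrightarrow> N \<le> real (q v) \<and> real (q v) \<le> \<kappa> * N"
    and B: "1 \<le> B" "\<And>m. card {u \<in> U. p u = m} \<le> B" "\<And>n. card {v \<in> V. q v = n} \<le> B"
    and div: "\<And>h n. h \<in> {H..<2*H} \<Longrightarrow> N \<le> real n \<Longrightarrow> real n \<le> \<kappa> * N \<Longrightarrow> divisor_count (h * n) \<le> B"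
    and L: "\<And>n. real n \<le> 2 * Q \<Longrightarrow> (\<Sum>g=1..n. 1 / real g) \<le> real B"
           "\<And>n. real n \<le> 2 * \<kappa> * M \<Longrightarrow> (\<Sum>g=1..n. 1 / real g) \<le> real B"
    and Q: "1 \<le> Q" "Q \<le> M" "Q ^ 3 \<le> M\<^sup>2" and MNx: "(M * N)\<^sup>2 \<le> x * Q" "M\<^sup>2 * N \<le> x"
  shows "(\<Sum>h\<in>{H..<2*H}. norm (\<Sum>u\<in>U. \<Sum>v\<in>V. ee (real h * x / (real (p u) * real (q v) + \<delta>))))\<^sup>2
    \<le> 1200 * exp (4 * pi) * \<kappa> ^ 9 * real B ^ 6 * (real H * M * N)\<^sup>2
        * (1 / Q + sqrt (x / (M ^ 3 * N\<^sup>2) + 1 / (real H * N) + x * Q ^ 3 / (M ^ 4 * N\<^sup>2))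
           + x * real H * Q / (M ^ 3 * N\<^sup>2))"
proof -
  define Hs where "Hs = {H..<2*H}"
  define Ns where "Ns = {n::nat. N \<le> real n \<and> real n \<le> \<kappa> * N}"
  define J where "J = Hs \<times> Ns"
  define F where "F = (\<lambda>u (h::nat, n::nat). ee (real h * x / (real (p u) * real n + \<delta>)))"
  define T where "T = (\<Sum>h\<in>Hs. norm (\<Sum>u\<in>U. \<Sum>v\<in>V. F u (h, q v)))"
  have H1: "1 \<le> real H" using H by simp
  have cHs: "real (card Hs) = real H" "finite Hs" by (auto simp: Hs_def)
  note Ns = nat_interval_card[OF MN(2) \<kappa>, folded Ns_def]
  have cardJ: "finite J" "real (card J) \<le> real H * (\<kappa> * N)"
    using Ns cHs by (auto simp: J_def card_cartesian_product mult_left_mono)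
  have qNs: "q ` V \<subseteq> Ns" using q by (auto simp: Ns_def)
  have cardV: "real (card V) \<le> real B * (\<kappa> * N)"
    using card_fibre_le[OF fin(2) Ns(1) qNs B(3)] Ns(2)
    by (meson mult_left_mono of_nat_0_le_iff order.trans)
  have cardU: "real (card U) \<le> real B * (\<kappa> * M)"
  proof -
    have "p ` U \<subseteq> {n::nat. M \<le> real n \<and> real n \<le> \<kappa> * M}" using p by auto
    from card_fibre_le[OF fin(1) nat_interval_card(1)[OF MN(1) \<kappa>] this B(2)]
    show ?thesis using nat_interval_card(2)[OF MN(1) \<kappa>]
      by (meson mult_left_mono of_nat_0_le_iff order.trans)
  qed
  have T0: "0 \<le> T" by (auto simp: T_def intro: sum_nonneg)
  have "T \<le> (\<Sum>h\<in>Hs. \<Sum>v\<in>V. norm (\<Sum>u\<in>U. F u (h, q v)))"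
    unfolding T_def by (intro sum_mono) (subst sum.swap, rule norm_sum)
  also have "\<dots> = (\<Sum>j\<in>Hs \<times> V. norm (\<Sum>u\<in>U. F u (fst j, q (snd j))))"
    by (simp add: sum.cartesian_product case_prod_unfold)
  finally have "T\<^sup>2 \<le> (\<Sum>j\<in>Hs \<times> V. norm (\<Sum>u\<in>U. F u (fst j, q (snd j))))\<^sup>2"
    using T0 by (rule power_mono)
  also have "\<dots> \<le> real (card (Hs \<times> V)) * (\<Sum>j\<in>Hs \<times> V. (norm (\<Sum>u\<in>U. F u (fst j, q (snd j))))\<^sup>2)"
    by (rule power2_sum_le_card)
  also have "\<dots> \<le> (real H * (real B * (\<kappa> * N))) * (real B * (\<Sum>j\<in>J. (norm (\<Sum>u\<in>U. F u j))\<^sup>2))"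
  proof (rule mult_mono)
    show "real (card (Hs \<times> V)) \<le> real H * (real B * (\<kappa> * N))"
      using cHs cardV by (simp add: card_cartesian_product mult_left_mono)
    have "(\<Sum>j\<in>Hs \<times> V. (norm (\<Sum>u\<in>U. F u (fst j, q (snd j))))\<^sup>2)
        = (\<Sum>h\<in>Hs. \<Sum>v\<in>V. (norm (\<Sum>u\<in>U. F u (h, q v)))\<^sup>2)"
      by (simp add: sum.cartesian_product case_prod_unfold)
    also have "\<dots> \<le> (\<Sum>h\<in>Hs. real B * (\<Sum>n\<in>Ns. (norm (\<Sum>u\<in>U. F u (h, n)))\<^sup>2))"
      by (intro sum_mono sum_fibre_le[OF fin(2) Ns(1) qNs _ B(3)]) auto
    also have "\<dots> = real B * (\<Sum>j\<in>J. (norm (\<Sum>u\<in>U. F u j))\<^sup>2)"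
      unfolding J_def by (simp add: sum_distrib_left[symmetric] sum.cartesian_product case_prod_unfold)
    finally show "(\<Sum>j\<in>Hs \<times> V. (norm (\<Sum>u\<in>U. F u (fst j, q (snd j))))\<^sup>2) \<le> \<dots>" .
  qed (use MN \<kappa> in \<open>auto intro: sum_nonneg\<close>)
  finally have T2: "T\<^sup>2 \<le> (real H * (real B * (\<kappa> * N))) * (real B * (\<Sum>j\<in>J. (norm (\<Sum>u\<in>U. F u j))\<^sup>2))" .
  \<comment> \<open>Blocks of length Q in m: there are about M/Q of them, and values in one block
    differ by at most Q.\<close>
  define cell where "cell = (\<lambda>u. \<lfloor>real (p u) / Q\<rfloor>)"
  have cells: "real (card (cell ` U)) \<le> 2 * \<kappa> * M / Q"
  proof -
    have "cell ` U \<subseteq> {0..\<lfloor>\<kappa> * M / Q\<rfloor>}"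
    proof (rule image_subsetI)
      fix u assume "u \<in> U"
      hence "real (p u) / Q \<le> \<kappa> * M / Q" using p Q by (intro divide_right_mono) auto
      moreover have "0 \<le> real (p u) / Q" using Q by simp
      ultimately show "cell u \<in> {0..\<lfloor>\<kappa> * M / Q\<rfloor>}" unfolding cell_def by (auto intro: floor_mono)
    qed
    hence "card (cell ` U) \<le> card {0..\<lfloor>\<kappa> * M / Q\<rfloor>}" by (intro card_mono) auto
    also have "real (card {0..\<lfloor>\<kappa> * M / Q\<rfloor>}) \<le> \<kappa> * M / Q + 1" using Q MN \<kappa> by simp
    also have "\<dots> \<le> \<kappa> * M / Q + \<kappa> * M / Q"
      using Q \<kappa> MN mult_mono[of 1 \<kappa> Q M] by (simp add: field_simps)
    finally show ?thesis by (simp add: mult_ac)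
  qed
  define P where "P = {(u, u') \<in> U \<times> U. p u \<noteq> p u' \<and> \<bar>real (p u) - real (p u')\<bar> \<le> Q}"
  \<comment> \<open>The diagonal consists of equal products rather than equal tuples, since already
    p u = p u' removes all oscillation.\<close>
  define D where "D = {(u, u') \<in> U \<times> U. p u = p u'}"
  define G where "G = (\<lambda>u u'. norm (\<Sum>j\<in>J. F u j * cnj (F u' j)))"
  \<comment> \<open>The cost per term of dropping \<delta> from the differenced phase, by
    \<open>inverse_shift_difference\<close>; it becomes the last summand of the bound.\<close>
  define err where "err = 16 * pi * (x * real H * Q / (M ^ 3 * N\<^sup>2))"
  have err0: "0 \<le> err" unfolding err_def using x MN Q by simp
  have fins: "finite P" "finite D"
    by (rule finite_subset[of _ "U \<times> U"]; use fin in \<open>auto simp: P_def D_def\<close>)+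
  have G0: "0 \<le> G u u'" for u u' by (simp add: G_def)
  have Gtriv: "G u u' \<le> real H * (\<kappa> * N)" for u u'
  proof -
    have "G u u' \<le> real (card J)" unfolding G_def
      by (rule norm_sum_le_card) (auto simp: F_def norm_mult)
    thus ?thesis using cardJ by linarith
  qed
  have Gphase: "G u u' \<le> norm (\<Sum>(h, n)\<in>{H..<2*H} \<times> Ns. ee (x * (1 / real (p u) - 1 / real (p u')) * (real h / real n)))
      + real H * (\<kappa> * N) * err" if "(u, u') \<in> P" for u u'
  proof -
    have U: "u \<in> U" "u' \<in> U" "\<bar>real (p u) - real (p u')\<bar> \<le> Q" using that by (auto simp: P_def)
    let ?E = "\<lambda>j. ee (x * (1 / real (p u) - 1 / real (p u')) * (real (fst j) / real (snd j)))"
    have each: "norm (F u j * cnj (F u' j) - ?E j) \<le> err" if "j \<in> J" for j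
    proof -
      obtain h n where j: "j = (h, n)" by fastforce
      have hn: "real h \<le> 2 * real H" "N \<le> real n" using that by (auto simp: J_def Hs_def Ns_def j)
      let ?a = "real (p u) * real n" and ?b = "real (p u') * real n"
      have n0: "0 < real n" using hn MN by linarith
      have ge: "M * real n \<le> ?a" "M * real n \<le> ?b" "0 < M * real n"
        using p[OF U(1)] p[OF U(2)] n0 MN by (auto intro: mult_right_mono)
      have pos: "0 < ?a" "0 < ?b" using ge by linarith+
      have "F u j * cnj (F u' j) = ee (real h * x * (1 / (?a + \<delta>) - 1 / (?b + \<delta>)))"
        by (simp add: F_def j ee_diff[symmetric] right_diff_distrib)
      moreover have "x * (1 / real (p u) - 1 / real (p u')) * (real h / real n) = real h * x * (1 / ?a - 1 / ?b)"
        by (simp add: algebra_simps)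
      ultimately have "norm (F u j * cnj (F u' j) - ?E j)
          \<le> 2 * pi * \<bar>real h * x * (1 / (?a + \<delta>) - 1 / (?b + \<delta>)) - real h * x * (1 / ?a - 1 / ?b)\<bar>"
        using norm_ee_diff by (simp add: j)
      also have "\<dots> = 2 * pi * (real h * x * \<bar>(1 / (?a + \<delta>) - 1 / (?b + \<delta>)) - (1 / ?a - 1 / ?b)\<bar>)"
        using x by (simp only: right_diff_distrib[symmetric] abs_mult abs_of_pos abs_of_nat)
      also have "\<dots> \<le> 2 * pi * ((2 * real H) * x * (2 * \<bar>?a - ?b\<bar> / (M * real n) ^ 3))"
      proof (intro mult_left_mono mult_mono inverse_shift_difference pos \<delta> ge)
      qed (use hn x p[OF U(1)] p[OF U(2)] in auto)
      also have "\<dots> \<le> 2 * pi * ((2 * real H) * x * (4 * Q / (M ^ 3 * N\<^sup>2)))"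
      proof (intro mult_left_mono)
        have "\<bar>?a - ?b\<bar> = \<bar>real (p u) - real (p u')\<bar> * real n"
          by (simp add: left_diff_distrib[symmetric] abs_mult)
        also have "\<dots> \<le> Q * real n" using U(3) by (intro mult_right_mono) auto
        finally have "2 * \<bar>?a - ?b\<bar> / (M * real n) ^ 3 \<le> 2 * (Q * real n) / (M * real n) ^ 3"
          using ge by (intro divide_right_mono mult_left_mono) auto
        also have "\<dots> = 2 * Q / (M ^ 3 * (real n)\<^sup>2)"
          using n0 MN by (simp add: field_simps power_numeral_reduce)
        also have "\<dots> \<le> 2 * Q / (M ^ 3 * N\<^sup>2)"
          using hn MN Q n0 by (intro divide_left_mono mult_left_mono power_mono) auto
        also have "\<dots> \<le> 4 * Q / (M ^ 3 * N\<^sup>2)" using MN Q by (intro divide_right_mono) auto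
        finally show "2 * \<bar>?a - ?b\<bar> / (M * real n) ^ 3 \<le> 4 * Q / (M ^ 3 * N\<^sup>2)" .
      qed (use x in auto)
      also have "\<dots> = err" by (simp add: err_def)
      finally show ?thesis .
    qed
    have "(\<Sum>j\<in>J. F u j * cnj (F u' j)) = (\<Sum>j\<in>J. ?E j) + (\<Sum>j\<in>J. F u j * cnj (F u' j) - ?E j)"
      by (simp add: sum_subtractf)
    hence "G u u' \<le> norm (\<Sum>j\<in>J. ?E j) + norm (\<Sum>j\<in>J. F u j * cnj (F u' j) - ?E j)"
      unfolding G_def by (simp only: norm_triangle_ineq)
    also have "norm (\<Sum>j\<in>J. F u j * cnj (F u' j) - ?E j) \<le> (\<Sum>j\<in>J. err)"
      by (rule sum_norm_le[OF each])
    also have "\<dots> \<le> real H * (\<kappa> * N) * err"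
      using mult_right_mono[OF cardJ(2) err0] by simp
    finally show ?thesis by (simp add: J_def Hs_def case_prod_unfold)
  qed
  have cardD: "real (card D) \<le> real B * (\<kappa> * M) * real B"
  proof -
    have "real (card D) \<le> real (card U) * real B"
    proof (rule card_le_fibres[OF fins(2) fin(1), where f = fst])
      fix u assume "u \<in> U"
      have "card {y \<in> D. fst y = u} \<le> card {u' \<in> U. p u' = p u}"
        by (rule card_inj_on_le[of snd]) (use fin in \<open>auto simp: inj_on_def D_def\<close>)
      also have "\<dots> \<le> B" by (rule B)
      finally show "real (card {y \<in> D. fst y = u}) \<le> real B" by simp
    qed (auto simp: D_def)
    thus ?thesis using cardU by (meson mult_right_mono of_nat_0_le_iff order.trans)
  qed
  have cardP: "real (card P) \<le> 3 * Q * (real B * (\<kappa> * M) * real B)"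
  proof -
    have "card P \<le> card {(u, u') \<in> U \<times> U. \<bar>real (p u) - real (p u')\<bar> \<le> Q}"
      by (rule card_mono, rule finite_subset[of _ "U \<times> U"]) (use fin in \<open>auto simp: P_def\<close>)
    hence "real (card P) \<le> 3 * Q * (real (card U) * real B)"
      using card_close_pairs_le[OF fin(1) B(2) Q(1)] by linarith
    also have "\<dots> \<le> 3 * Q * (real B * (\<kappa> * M) * real B)"
      using cardU Q by (intro mult_left_mono mult_right_mono) auto
    finally show ?thesis .
  qed
  define s where "s = sqrt (x / (M ^ 3 * N\<^sup>2) + 1 / (real H * N) + x * Q ^ 3 / (M ^ 4 * N\<^sup>2))"
  have "(\<Sum>j\<in>J. (norm (\<Sum>u\<in>U. F u j))\<^sup>2) \<le> real (card (cell ` U)) *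
      (\<Sum>(u, u') \<in> {(u, u') \<in> U \<times> U. cell u = cell u'}. G u u')"
    unfolding G_def by (rule sum_power2_cells[OF fin(1)])
  also have "\<dots> \<le> (2 * \<kappa> * M / Q) * ((\<Sum>(u, u')\<in>D. G u u') + (\<Sum>(u, u')\<in>P. G u u'))"
  proof (rule mult_mono[OF cells])
    have "\<bar>real (p u) - real (p u')\<bar> \<le> Q" if "cell u = cell u'" for u u'
    proof -
      have "\<bar>real (p u) / Q - real (p u') / Q\<bar> \<le> 1" using that unfolding cell_def by linarith
      hence "\<bar>real (p u) - real (p u')\<bar> / Q \<le> 1" using Q by (simp add: diff_divide_distrib[symmetric])
      thus ?thesis using Q by (simp add: field_simps)
    qed
    hence "{(u, u') \<in> U \<times> U. cell u = cell u'} \<subseteq> D \<union> P" by (auto simp: D_def P_def)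
    hence "(\<Sum>(u, u') \<in> {(u, u') \<in> U \<times> U. cell u = cell u'}. G u u') \<le> (\<Sum>(u, u')\<in>D \<union> P. G u u')"
      using fins G0 by (intro sum_mono2) auto
    also have "\<dots> = (\<Sum>(u, u')\<in>D. G u u') + (\<Sum>(u, u')\<in>P. G u u')"
      using fins by (intro sum.union_disjoint) (auto simp: D_def P_def)
    finally show "(\<Sum>(u, u') \<in> {(u, u') \<in> U \<times> U. cell u = cell u'}. G u u') \<le> \<dots>" .
  qed (use MN Q \<kappa> G0 in \<open>auto intro!: sum_nonneg\<close>)
  also have "\<dots> \<le> (2 * \<kappa> * M / Q) * ((real B * (\<kappa> * M) * real B) * (real H * (\<kappa> * N))
      + (exp (4 * pi) * (600 * \<kappa> ^ 7 * real B ^ 4 * (real H * M * N * Q) * s)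
         + (3 * Q * (real B * (\<kappa> * M) * real B)) * (real H * (\<kappa> * N) * err)))"
  proof (rule mult_left_mono, rule add_mono)
    have "(\<Sum>(u, u')\<in>D. G u u') \<le> (\<Sum>(u, u')\<in>D. real H * (\<kappa> * N))"
      using Gtriv by (intro sum_mono) auto
    also have "\<dots> = real (card D) * (real H * (\<kappa> * N))" by (simp add: case_prod_unfold)
    also have "\<dots> \<le> (real B * (\<kappa> * M) * real B) * (real H * (\<kappa> * N))"
      using cardD MN \<kappa> by (intro mult_right_mono) auto
    finally show "(\<Sum>(u, u')\<in>D. G u u') \<le> \<dots>" .
    have "(\<Sum>(u, u')\<in>P. G u u') \<le> (\<Sum>(u, u')\<in>P. norm (\<Sum>(h, n)\<in>{H..<2*H} \<times> Ns. ee (x * (1 / real (p u) - 1 / real (p u')) * (real h / real n)))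
        + real H * (\<kappa> * N) * err)"
    proof (rule sum_mono)
      fix i assume "i \<in> P"
      thus "(case i of (u, u') \<Rightarrow> G u u') \<le> (case i of (u, u') \<Rightarrow> norm (\<Sum>(h, n)\<in>{H..<2*H} \<times> Ns. ee (x * (1 / real (p u) - 1 / real (p u')) * (real h / real n)))
        + real H * (\<kappa> * N) * err)"
        by (cases i) (simp only: prod.case Gphase)
    qed
    also have "\<dots> = (\<Sum>(u, u')\<in>P. norm (\<Sum>(h, n)\<in>{H..<2*H} \<times> Ns. ee (x * (1 / real (p u) - 1 / real (p u')) * (real h / real n))))
        + real (card P) * (real H * (\<kappa> * N) * err)"
      unfolding case_prod_unfold sum.distrib by simp
    also have "\<dots> \<le> exp (4 * pi) * (600 * \<kappa> ^ 7 * real B ^ 4 * (real H * M * N * Q) * s)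
        + (3 * Q * (real B * (\<kappa> * M) * real B)) * (real H * (\<kappa> * N) * err)"
    proof (rule add_mono)
      show "(\<Sum>(u, u')\<in>P. norm (\<Sum>(h, n)\<in>{H..<2*H} \<times> Ns. ee (x * (1 / real (p u) - 1 / real (p u')) * (real h / real n))))
         \<le> exp (4 * pi) * (600 * \<kappa> ^ 7 * real B ^ 4 * (real H * M * N * Q) * s)"
        unfolding P_def Ns_def s_def
        by (rule large_sieve_differences[OF fin(1) \<kappa> MN H x p B(1,2) div L Q(1,3) MNx])
      show "real (card P) * (real H * (\<kappa> * N) * err) \<le> (3 * Q * (real B * (\<kappa> * M) * real B)) * (real H * (\<kappa> * N) * err)"
        using cardP err0 MN \<kappa> by (intro mult_right_mono) auto
    qed
    finally show "(\<Sum>(u, u')\<in>P. G u u') \<le> \<dots>" .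
  qed (use MN Q \<kappa> in auto)
  finally have "T\<^sup>2 \<le> (real H * (real B * (\<kappa> * N))) * (real B * ((2 * \<kappa> * M / Q) * ((real B * (\<kappa> * M) * real B) * (real H * (\<kappa> * N))
      + (exp (4 * pi) * (600 * \<kappa> ^ 7 * real B ^ 4 * (real H * M * N * Q) * s)
         + (3 * Q * (real B * (\<kappa> * M) * real B)) * (real H * (\<kappa> * N) * err)))))"
    using MN \<kappa> by (intro order.trans[OF T2] mult_left_mono) auto
  also have "\<dots> = (real H * M * N)\<^sup>2 * (2 * \<kappa> ^ 4 * real B ^ 4 * (1 / Q) + 1200 * exp (4 * pi) * \<kappa> ^ 9 * real B ^ 6 * s
      + 6 * \<kappa> ^ 4 * real B ^ 4 * err)"
    using Q by (simp add: field_simps power_numeral_reduce)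
  also have "\<dots> \<le> (real H * M * N)\<^sup>2 * (1200 * exp (4 * pi) * \<kappa> ^ 9 * real B ^ 6 * (1 / Q) + 1200 * exp (4 * pi) * \<kappa> ^ 9 * real B ^ 6 * s
      + 1200 * exp (4 * pi) * \<kappa> ^ 9 * real B ^ 6 * (x * real H * Q / (M ^ 3 * N\<^sup>2)))"
  proof (intro mult_left_mono add_mono)
    have B1: "1 \<le> real B" using B by simp
    have e1: "1 \<le> exp (4 * pi)" by simp
    have kb: "\<kappa> ^ 4 * real B ^ 4 \<le> exp (4 * pi) * (\<kappa> ^ 9 * real B ^ 6)"
    proof -
      have "\<kappa> ^ 4 * real B ^ 4 \<le> \<kappa> ^ 9 * real B ^ 6"
        using \<kappa> B1 by (intro mult_mono power_increasing) auto
      also have "\<dots> \<le> exp (4 * pi) * (\<kappa> ^ 9 * real B ^ 6)"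
        using mult_right_mono[OF e1, of "\<kappa> ^ 9 * real B ^ 6"] \<kappa> by simp
      finally show ?thesis .
    qed
    have k0: "0 \<le> \<kappa> ^ 4 * real B ^ 4" using \<kappa> by simp
    have "2 * (\<kappa> ^ 4 * real B ^ 4) \<le> 1200 * (exp (4 * pi) * (\<kappa> ^ 9 * real B ^ 6))" using kb k0 by linarith
    from mult_right_mono[OF this, of "1 / Q"]
    show "2 * \<kappa> ^ 4 * real B ^ 4 * (1 / Q) \<le> 1200 * exp (4 * pi) * \<kappa> ^ 9 * real B ^ 6 * (1 / Q)"
      using Q by (simp add: mult.assoc)
    have "6 * (\<kappa> ^ 4 * real B ^ 4) * (16 * pi) \<le> 6 * (\<kappa> ^ 4 * real B ^ 4) * (16 * 4)"
      using pi_less_4 k0 by (intro mult_left_mono) auto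
    also have "\<dots> \<le> 1200 * (exp (4 * pi) * (\<kappa> ^ 9 * real B ^ 6))" using kb k0 by linarith
    finally have "6 * (\<kappa> ^ 4 * real B ^ 4) * (16 * pi) \<le> 1200 * (exp (4 * pi) * (\<kappa> ^ 9 * real B ^ 6))" .
    from mult_right_mono[OF this, of "x * real H * Q / (M ^ 3 * N\<^sup>2)"]
    show "6 * \<kappa> ^ 4 * real B ^ 4 * err \<le> 1200 * exp (4 * pi) * \<kappa> ^ 9 * real B ^ 6 * (x * real H * Q / (M ^ 3 * N\<^sup>2))"
      using x MN Q by (simp add: err_def mult.assoc)
  qed (use \<kappa> in auto)
  also have "\<dots> = 1200 * exp (4 * pi) * \<kappa> ^ 9 * real B ^ 6 * (real H * M * N)\<^sup>2 * (1 / Q + s + x * real H * Q / (M ^ 3 * N\<^sup>2))"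
  proof -
    have "P\<^sup>2 * (K * a + K * b + K * c) = K * P\<^sup>2 * (a + b + c)" for P K a b c :: real
      by (simp add: algebra_simps)
    thus ?thesis by (simp only:)
  qed
  finally show ?thesis unfolding T_def Hs_def F_def s_def prod.case .
qed

section \<open>Balancing the type II estimates\<close>

text \<open>Both estimates are used with Q = \<sigma>^2, and every summand must be O(\<sigma>^-2);
  the square root then gives the saving \<sigma>. The bound y^22 \<le> M ensures \<sigma>^2 \<le> H
  M, so that this Q is permitted in \<open>type_II_cluster\<close>.\<close>

lemma type_II_balanced:
  fixes p :: "'u \<Rightarrow> nat" and q :: "'v \<Rightarrow> nat" and y \<delta> M N \<kappa> :: real and H B :: nat
  assumes fin: "finite U" "finite V" and \<kappa>: "1 \<le> \<kappa>" and y: "768 * \<kappa> ^ 4 \<le> y" and H: "1 \<le> H"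
    and \<delta>: "0 \<le> \<delta>" "\<delta> \<le> 1"
    and p: "\<And>u. u \<in> U \<Longrightarrow> M \<le> real (p u) \<and> real (p u) \<le> \<kappa> * M"
    and q: "\<And>v. v \<in> V \<Longrightarrow> N \<le> real (q v) \<and> real (q v) \<le> \<kappa> * N"
    and B: "1 \<le> B" "\<And>m. card {u \<in> U. p u = m} \<le> B" "\<And>n. card {v \<in> V. q v = n} \<le> B"
    and div: "\<And>n. 0 < n \<Longrightarrow> real n \<le> y ^ 400 \<Longrightarrow> divisor_count n \<le> B"
    and harm: "\<And>n. real n \<le> y ^ 400 \<Longrightarrow> (\<Sum>g=1..n. 1 / real g) \<le> real B"
    and MN: "y ^ 22 \<le> M" "M \<le> N" "y ^ 92 \<le> M * N" "M * N \<le> y ^ 103"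
    and H': "real H \<le> M * N / y ^ 92"
  shows "(\<Sum>h\<in>{H..<2*H}. norm (\<Sum>u\<in>U. \<Sum>v\<in>V. ee (real h * y ^ 195 / (real (p u) * real (q v) + \<delta>))))
    \<le> 1000 * exp (2 * pi) * \<kappa> ^ 6 * real B ^ 3 * (real H * y ^ 92)"
proof -
  define D where "D = M * N"
  define \<sigma> where "\<sigma> = D / y ^ 92"
  define x where "x = y ^ 195"
  define S where "S = (\<Sum>h\<in>{H..<2*H}. norm (\<Sum>u\<in>U. \<Sum>v\<in>V. ee (real h * x / (real (p u) * real (q v) + \<delta>))))"
  have \<kappa>4: "1 \<le> \<kappa> ^ 4" using \<kappa> by (rule one_le_power)
  have y1: "768 \<le> y" "1 \<le> y" "0 < y" using y \<kappa>4 by auto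
  have ypow: "y ^ a \<le> y ^ b" if "a \<le> b" for a b using y1 that by (intro power_increasing) auto
  have ypos: "0 < y ^ a" "1 \<le> y ^ a" for a using y1 by (auto intro: one_le_power)
  have M1: "1 \<le> M" "1 \<le> N" using MN ypos(2)[of 22] by linarith+
  have D: "y ^ 92 \<le> D" "D \<le> y ^ 103" "0 < D" using MN ypos(1)[of 92] unfolding D_def by linarith+
  have D\<sigma>: "D = \<sigma> * y ^ 92" using ypos(1)[of 92] by (simp add: \<sigma>_def)
  have \<sigma>: "1 \<le> \<sigma>" "\<sigma> \<le> y ^ 11"
  proof -
    show "1 \<le> \<sigma>" using D ypos(1)[of 92] by (simp add: \<sigma>_def)
    have "\<sigma> * y ^ 92 \<le> y ^ 11 * y ^ 92" using D D\<sigma> by (simp flip: power_add)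
    from mult_right_le_imp_le[OF this ypos(1)] show "\<sigma> \<le> y ^ 11" .
  qed
  have \<sigma>pow: "\<sigma> ^ a \<le> y ^ (11 * a)" for a
    using power_mono[OF \<sigma>(2), of a] \<sigma>(1) by (simp add: power_mult)
  have \<sigma>2: "1 \<le> \<sigma>\<^sup>2" using \<sigma> by (intro one_le_power)
  have x0: "0 < x" using ypos(1)[of 195] by (simp only: x_def)
  have H\<sigma>: "real H \<le> \<sigma>" "1 \<le> real H" using H' H by (auto simp: \<sigma>_def D_def)
  have DN2: "D \<le> N\<^sup>2" using MN M1 by (simp add: D_def power2_eq_square mult_right_mono)
  have N46: "y ^ 46 \<le> N"
  proof (rule power2_le_imp_le)
    show "(y ^ 46)\<^sup>2 \<le> N\<^sup>2" using D DN2 by (simp flip: power_mult)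
  qed (use M1 in simp)
  have finish: "S \<le> 1000 * exp (2 * pi) * \<kappa> ^ 6 * real B ^ 3 * (real H * y ^ 92)"
    if "S\<^sup>2 \<le> 1000000 * exp (4 * pi) * \<kappa> ^ 12 * real B ^ 6 * (real H * D)\<^sup>2 * (1 / \<sigma>\<^sup>2)"
  proof (rule power2_le_imp_le)
    have "(exp (2 * pi))\<^sup>2 = exp (4 * pi)" by (simp flip: exp_of_nat_mult)
    hence "(1000 * exp (2 * pi) * \<kappa> ^ 6 * real B ^ 3 * (real H * y ^ 92))\<^sup>2
        = 1000000 * exp (4 * pi) * \<kappa> ^ 12 * real B ^ 6 * (real H * D)\<^sup>2 * (1 / \<sigma>\<^sup>2)"
      using \<sigma> unfolding D\<sigma> by (simp add: power_mult_distrib flip: power_mult)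
    thus "S\<^sup>2 \<le> (1000 * exp (2 * pi) * \<kappa> ^ 6 * real B ^ 3 * (real H * y ^ 92))\<^sup>2" using that by simp
  qed (use \<kappa> y1 in auto)
  \<comment> \<open>Three summands of size \<sigma>^-4 stand under the root, and sqrt 3 < 2.\<close>
  have sqrt_le: "sqrt t \<le> 2 / \<sigma>\<^sup>2" if "t \<le> 3 * (1 / \<sigma> ^ 4)" for t
  proof -
    have "(2 / \<sigma>\<^sup>2)\<^sup>2 = 4 * (1 / \<sigma> ^ 4)" by (simp add: power_divide flip: power_mult)
    moreover have "0 \<le> 1 / \<sigma> ^ 4" using \<sigma> by simp
    ultimately have "t \<le> (2 / \<sigma>\<^sup>2)\<^sup>2" using that by linarith
    thus ?thesis using \<sigma> by (intro real_le_lsqrt) auto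
  qed
  show ?thesis
  proof (cases "D \<le> y ^ 102 \<or> y ^ 55 \<le> N")
    case True
    \<comment> \<open>What clustering requires. The threshold 55 is 4 * 103 - 357 and also 6 * 103 -
      563; the threshold 102 comes from N \<ge> sqrt D, which turns the first condition into D^7
      \<le> y^714.\<close>
    have 1: "D ^ 4 \<le> y ^ 357 * N" and 2: "D ^ 6 \<le> y ^ 563 * N"
    proof -
      show "D ^ 4 \<le> y ^ 357 * N"
      proof (cases "y ^ 55 \<le> N")
        case True
        have "D ^ 4 \<le> (y ^ 103) ^ 4" using D by (intro power_mono) auto
        also have "\<dots> = y ^ 357 * y ^ 55" by (simp flip: power_mult power_add)
        also have "\<dots> \<le> y ^ 357 * N" using True y1 by (intro mult_left_mono) auto
        finally show ?thesis .
      next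
        case False
        hence D102: "D \<le> y ^ 102" using \<open>D \<le> y ^ 102 \<or> y ^ 55 \<le> N\<close> by simp
        show ?thesis
        proof (rule power2_le_imp_le)
          have "(D ^ 4)\<^sup>2 = D ^ 7 * D" by (simp flip: power_mult power_Suc2)
          also have "\<dots> \<le> (y ^ 102) ^ 7 * N\<^sup>2" using D D102 DN2 by (intro mult_mono power_mono) auto
          also have "\<dots> = (y ^ 357 * N)\<^sup>2" by (simp add: power_mult_distrib flip: power_mult)
          finally show "(D ^ 4)\<^sup>2 \<le> (y ^ 357 * N)\<^sup>2" .
        qed (use y1 M1 in auto)
      qed
      show "D ^ 6 \<le> y ^ 563 * N"
      proof (cases "y ^ 55 \<le> N")
        case True
        have "D ^ 6 \<le> (y ^ 103) ^ 6" using D by (intro power_mono) auto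
        also have "\<dots> = y ^ 563 * y ^ 55" by (simp flip: power_mult power_add)
        also have "\<dots> \<le> y ^ 563 * N" using True y1 by (intro mult_left_mono) auto
        finally show ?thesis .
      next
        case False
        hence D102: "D \<le> y ^ 102" using \<open>D \<le> y ^ 102 \<or> y ^ 55 \<le> N\<close> by simp
        show ?thesis
        proof (rule power2_le_imp_le)
          have "(D ^ 6)\<^sup>2 = D ^ 11 * D" by (simp flip: power_mult power_Suc2)
          also have "\<dots> \<le> (y ^ 102) ^ 11 * N\<^sup>2" using D D102 DN2 by (intro mult_mono power_mono) auto
          also have "\<dots> \<le> y ^ 1126 * N\<^sup>2"
            unfolding power_mult[symmetric] by (intro mult_right_mono ypow) auto
          also have "\<dots> = (y ^ 563 * N)\<^sup>2" by (simp add: power_mult_distrib flip: power_mult)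
          finally show "(D ^ 6)\<^sup>2 \<le> (y ^ 563 * N)\<^sup>2" .
        qed (use y1 M1 in auto)
      qed
    qed
    \<comment> \<open>The claim is x \<sigma>^6 \<le> D^2 N, which becomes
      \<open>D ^ 4 \<le> y ^ 357 * N\<close> on inserting \<sigma> = D/y^92. Likewise
      \<open>s2\<close> below is \<open>D ^ 6 \<le> y ^ 563 * N\<close>, with 563 = 195 + 4 *
      92.\<close>
    have s1: "x * \<sigma>\<^sup>2 / (M\<^sup>2 * N ^ 3) \<le> 1 / \<sigma> ^ 4"
    proof -
      have "x * \<sigma> ^ 6 * y ^ 552 = D ^ 6 * y ^ 195"
        unfolding D\<sigma> x_def by (simp add: power_mult_distrib flip: power_mult)
      also have "\<dots> = D\<^sup>2 * D ^ 4 * y ^ 195" by (simp flip: power_add)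
      also have "\<dots> \<le> D\<^sup>2 * (y ^ 357 * N) * y ^ 195"
        using 1 y1 by (intro mult_right_mono mult_left_mono) auto
      also have "\<dots> = (D\<^sup>2 * N) * y ^ 552" by (simp flip: power_add mult.assoc)
      finally have "x * \<sigma> ^ 6 \<le> D\<^sup>2 * N" by (rule mult_right_le_imp_le[OF _ ypos(1)])
      hence "x * \<sigma>\<^sup>2 * \<sigma> ^ 4 \<le> M\<^sup>2 * N ^ 3"
        by (simp add: D_def power_mult_distrib power_numeral_reduce mult_ac)
      thus ?thesis using \<sigma> M1 by (simp add: field_simps)
    qed
    have s2: "M\<^sup>2 * N / x \<le> 1 / \<sigma> ^ 4"
    proof -
      have s4: "\<sigma> ^ 4 * y ^ 368 = D ^ 4" unfolding D\<sigma> by (simp add: power_mult_distrib flip: power_mult)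
      have "(M\<^sup>2 * N * \<sigma> ^ 4) * (N * y ^ 368) = D\<^sup>2 * (\<sigma> ^ 4 * y ^ 368)"
        by (simp add: D_def power2_eq_square mult_ac)
      also have "\<dots> = D ^ 6" unfolding s4 by (simp flip: power_add)
      also have "\<dots> \<le> y ^ 563 * N" by (rule 2)
      also have "\<dots> = x * (N * y ^ 368)" by (simp add: x_def flip: power_add)
      finally have "M\<^sup>2 * N * \<sigma> ^ 4 \<le> x"
        by (rule mult_right_le_imp_le) (use y1 M1 in simp)
      thus ?thesis using x0 \<sigma> by (simp add: field_simps)
    qed
    have "S\<^sup>2 \<le> 300000 * \<kappa> ^ 12 * real B ^ 5 * (real H * M * N)\<^sup>2
        * (1 / \<sigma>\<^sup>2 + sqrt (x * \<sigma>\<^sup>2 / (M\<^sup>2 * N ^ 3)) + sqrt (M\<^sup>2 * N / x))"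
      unfolding S_def
    proof (rule type_II_cluster[OF fin \<kappa> M1 H \<delta> x0 p q B _ \<sigma>2])
      show "\<sigma>\<^sup>2 \<le> real H * M"
      proof -
        have "\<sigma>\<^sup>2 \<le> y ^ 22" using \<sigma>pow[of 2] by simp
        also have "\<dots> \<le> 1 * M" using MN by simp
        also have "\<dots> \<le> real H * M" using H\<sigma> M1 by (intro mult_right_mono) auto
        finally show ?thesis .
      qed
      have "768 * \<kappa> ^ 4 * real H \<le> y * y ^ 11" using y H\<sigma> \<sigma> y1 by (intro mult_mono) auto
      also have "\<dots> = y ^ 12" by (simp flip: power_Suc)
      also have "\<dots> \<le> N" using ypow[of 12 46] N46 by linarith
      finally show "768 * \<kappa> ^ 4 * real H \<le> N" .
    next
      fix h u assume hu: "h \<in> {H..<2*H}" "u \<in> U"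
      show "divisor_count (h * p u) \<le> B"
      proof (rule div)
        show "0 < h * p u" using hu H p[OF hu(2)] M1 by (auto intro: Nat.gr0I)
        have "real (h * p u) \<le> (2 * real H) * (\<kappa> * M)"
          unfolding of_nat_mult using hu p[OF hu(2)] by (intro mult_mono) auto
        also have "\<dots> \<le> (2 * y ^ 11) * (y * y ^ 103)"
        proof (intro mult_mono)
          show "\<kappa> \<le> y" using y \<kappa> power_increasing[of 1 4 \<kappa>] by simp
          have "M * 1 \<le> M * N" using M1 by (intro mult_left_mono) auto
          thus "M \<le> y ^ 103" using MN by simp
        qed (use H\<sigma> \<sigma> y1 M1 \<kappa> in auto)
        also have "\<dots> \<le> (y * y ^ 11) * (y * y ^ 103)" using y1 by (intro mult_right_mono) auto
        also have "\<dots> \<le> y ^ 400" using ypow[of 116 400] by (simp flip: power_Suc power_add)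
        finally show "real (h * p u) \<le> y ^ 400" .
      qed
    qed
    also have "\<dots> \<le> 300000 * \<kappa> ^ 12 * real B ^ 5 * (real H * M * N)\<^sup>2 * (1 / \<sigma>\<^sup>2 + 1 / \<sigma>\<^sup>2 + 1 / \<sigma>\<^sup>2)"
    proof (intro mult_left_mono add_mono order.refl)
      have "sqrt (1 / \<sigma> ^ 4) = 1 / \<sigma>\<^sup>2"
        using \<sigma> by (intro real_sqrt_unique) (auto simp: power_divide simp flip: power_mult)
      thus "sqrt (x * \<sigma>\<^sup>2 / (M\<^sup>2 * N ^ 3)) \<le> 1 / \<sigma>\<^sup>2" "sqrt (M\<^sup>2 * N / x) \<le> 1 / \<sigma>\<^sup>2"
        using real_sqrt_le_mono[OF s1] real_sqrt_le_mono[OF s2] by simp_all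
    qed (use \<kappa> in auto)
    also have "\<dots> = 900000 * (\<kappa> ^ 12 * real B ^ 5) * ((real H * D)\<^sup>2 * (1 / \<sigma>\<^sup>2))"
      by (simp add: D_def mult.assoc)
    also have "\<dots> \<le> (1000000 * exp (4 * pi)) * (\<kappa> ^ 12 * real B ^ 6) * ((real H * D)\<^sup>2 * (1 / \<sigma>\<^sup>2))"
    proof (rule mult_right_mono[OF mult_mono])
      have "1 \<le> exp (4 * pi)" by simp
      thus "900000 \<le> 1000000 * exp (4 * pi)" by linarith
      show "\<kappa> ^ 12 * real B ^ 5 \<le> \<kappa> ^ 12 * real B ^ 6"
        using B(1) \<kappa> by (intro mult_left_mono power_increasing) auto
    qed (use \<kappa> in auto)
    finally show ?thesis using finish unfolding S_def x_def by (simp add: mult.assoc)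
  next
    case False
    \<comment> \<open>Now N lies between y^51 and y^55 and M is at least y^47, so the summands are
      settled by comparing exponents; the closest comparison is 305 against 306.\<close>
    hence F: "y ^ 102 < D" "N < y ^ 55" by auto
    have N51: "y ^ 51 \<le> N"
    proof (rule power2_le_imp_le)
      show "(y ^ 51)\<^sup>2 \<le> N\<^sup>2" using F DN2 by (simp flip: power_mult)
    qed (use M1 in simp)
    have M47: "y ^ 47 \<le> M"
    proof -
      have "y ^ 47 * y ^ 55 \<le> D" using F by (simp flip: power_add)
      also have "\<dots> \<le> M * y ^ 55" unfolding D_def using F M1 by (intro mult_left_mono) auto
      finally show ?thesis by (rule mult_right_le_imp_le[OF _ ypos(1)])
    qed
    have D2: "(y ^ 102)\<^sup>2 \<le> D\<^sup>2" using F ypos(1)[of 102] by (intro power_mono) auto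
    have \<sigma>p: "0 < \<sigma>" using \<sigma> by simp
    \<comment> \<open>The roles are exchanged: the differencing takes place in the longer variable,
      so \<open>type_II_large_sieve\<close> is applied with N as its M.\<close>
    have swap: "S = (\<Sum>h\<in>{H..<2*H}. norm (\<Sum>v\<in>V. \<Sum>u\<in>U. ee (real h * x / (real (q v) * real (p u) + \<delta>))))"
      unfolding S_def by (intro sum.cong refl arg_cong[where f = norm]) (subst sum.swap, simp add: mult.commute)
    have a: "x / (N ^ 3 * M\<^sup>2) \<le> 1 / \<sigma> ^ 4"
    proof -
      have "x * \<sigma> ^ 4 \<le> y ^ 195 * y ^ 44" unfolding x_def using \<sigma>pow[of 4] y1 by (intro mult_left_mono) auto
      also have "\<dots> \<le> (y ^ 102)\<^sup>2 * y ^ 51" using ypow[of 239 255] by (simp flip: power_add power_mult)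
      also have "\<dots> \<le> D\<^sup>2 * N" using D2 N51 y1 by (intro mult_mono) auto
      also have "\<dots> = N ^ 3 * M\<^sup>2" by (simp add: D_def power_mult_distrib power_numeral_reduce)
      finally show ?thesis using M1 \<sigma>p by (simp add: field_simps)
    qed
    have b: "1 / (real H * M) \<le> 1 / \<sigma> ^ 4"
    proof -
      have "\<sigma> ^ 4 \<le> y ^ 47" using \<sigma>pow[of 4] ypow[of 44 47] by simp
      also have "\<dots> \<le> 1 * M" using M47 by simp
      also have "\<dots> \<le> real H * M" using H\<sigma> M1 by (intro mult_right_mono) auto
      finally show ?thesis using \<sigma>p by (intro divide_left_mono mult_pos_pos) (use M1 H\<sigma> in auto)
    qed
    have c: "x * (\<sigma>\<^sup>2) ^ 3 / (N ^ 4 * M\<^sup>2) \<le> 1 / \<sigma> ^ 4"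
    proof -
      have "x * (\<sigma>\<^sup>2) ^ 3 * \<sigma> ^ 4 = x * \<sigma> ^ 10" by (simp flip: power_mult power_add)
      also have "\<dots> \<le> y ^ 195 * y ^ 110" unfolding x_def using \<sigma>pow[of 10] y1 by (intro mult_left_mono) auto
      also have "\<dots> \<le> (y ^ 102)\<^sup>2 * (y ^ 51)\<^sup>2" using ypow[of 305 306] by (simp flip: power_add power_mult)
      also have "\<dots> \<le> D\<^sup>2 * N\<^sup>2" using F N51 y1 by (intro mult_mono power_mono) auto
      also have "\<dots> = N ^ 4 * M\<^sup>2" by (simp add: D_def power_mult_distrib power_numeral_reduce)
      finally show ?thesis using M1 \<sigma>p by (simp add: field_simps)
    qed
    have d: "x * real H * \<sigma>\<^sup>2 / (N ^ 3 * M\<^sup>2) \<le> 1 / \<sigma>\<^sup>2"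
    proof -
      have "x * real H * \<sigma>\<^sup>2 * \<sigma>\<^sup>2 \<le> x * \<sigma> * \<sigma>\<^sup>2 * \<sigma>\<^sup>2"
        using H\<sigma> x0 by (intro mult_right_mono mult_left_mono) auto
      also have "\<dots> = x * \<sigma> ^ 5" by (simp add: power_numeral_reduce)
      also have "\<dots> \<le> y ^ 195 * y ^ 55" unfolding x_def using \<sigma>pow[of 5] y1 by (intro mult_left_mono) auto
      also have "\<dots> \<le> (y ^ 102)\<^sup>2 * y ^ 51" using ypow[of 250 255] by (simp flip: power_add power_mult)
      also have "\<dots> \<le> D\<^sup>2 * N" using D2 N51 y1 by (intro mult_mono) auto
      also have "\<dots> = N ^ 3 * M\<^sup>2" by (simp add: D_def power_mult_distrib power_numeral_reduce)
      finally show ?thesis using M1 \<sigma>p by (simp add: field_simps)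
    qed
    have \<kappa>y: "\<kappa> \<le> y" using y \<kappa> power_increasing[of 1 4 \<kappa>] by simp
    have "S\<^sup>2 \<le> 1200 * exp (4 * pi) * \<kappa> ^ 9 * real B ^ 6 * (real H * N * M)\<^sup>2
        * (1 / \<sigma>\<^sup>2 + sqrt (x / (N ^ 3 * M\<^sup>2) + 1 / (real H * M) + x * (\<sigma>\<^sup>2) ^ 3 / (N ^ 4 * M\<^sup>2))
           + x * real H * \<sigma>\<^sup>2 / (N ^ 3 * M\<^sup>2))"
      unfolding swap
    proof (rule type_II_large_sieve[OF fin(2,1) \<kappa> M1(2,1) H \<delta> x0 q p B(1,3,2) _ _ _ \<sigma>2])
      show "divisor_count (h * n) \<le> B" if "h \<in> {H..<2*H}" "M \<le> real n" "real n \<le> \<kappa> * M" for h n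
      proof (rule div)
        show "0 < h * n" using that H M1 by (auto intro: Nat.gr0I)
        have "real (h * n) \<le> (2 * real H) * (\<kappa> * M)"
          unfolding of_nat_mult using that by (intro mult_mono) auto
        also have "\<dots> \<le> (2 * y ^ 11) * (y * y ^ 103)"
        proof (intro mult_mono \<kappa>y)
          have "M * 1 \<le> M * N" using M1 by (intro mult_left_mono) auto
          thus "M \<le> y ^ 103" using MN by simp
        qed (use H\<sigma> \<sigma> y1 M1 \<kappa> in auto)
        also have "\<dots> \<le> (y * y ^ 11) * (y * y ^ 103)" using y1 by (intro mult_right_mono) auto
        also have "\<dots> \<le> y ^ 400" using ypow[of 116 400] by (simp flip: power_Suc power_add)
        finally show "real (h * n) \<le> y ^ 400" .
      qed
      have "2 * \<sigma>\<^sup>2 \<le> y * y ^ 22" using \<sigma>pow[of 2] y1 by (intro mult_mono) auto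
      also have "\<dots> \<le> y ^ 400" using ypow[of 23 400] by (simp flip: power_Suc)
      finally have le1: "2 * \<sigma>\<^sup>2 \<le> y ^ 400" .
      show "(\<Sum>g=1..n. 1 / real g) \<le> real B" if "real n \<le> 2 * \<sigma>\<^sup>2" for n
        using that le1 by (intro harm) linarith
      have "2 * \<kappa> * N \<le> y * y * y ^ 55" using \<kappa>y F y1 M1 \<kappa> by (intro mult_mono) auto
      also have "\<dots> \<le> y ^ 400" using ypow[of 57 400] by (simp add: mult.assoc flip: power_Suc)
      finally have le2: "2 * \<kappa> * N \<le> y ^ 400" .
      show "(\<Sum>g=1..n. 1 / real g) \<le> real B" if "real n \<le> 2 * \<kappa> * N" for n
        using that le2 by (intro harm) linarith
      show "\<sigma>\<^sup>2 \<le> N" using \<sigma>pow[of 2] ypow[of 22 51] N51 by simp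
      have "(\<sigma>\<^sup>2) ^ 3 \<le> (y ^ 51)\<^sup>2" using \<sigma>pow[of 6] ypow[of 66 102] by (simp flip: power_mult)
      also have "\<dots> \<le> N\<^sup>2" using N51 y1 by (intro power_mono) auto
      finally show "(\<sigma>\<^sup>2) ^ 3 \<le> N\<^sup>2" .
      have "(N * M)\<^sup>2 = y ^ 184 * \<sigma>\<^sup>2"
        using D\<sigma> by (simp add: D_def power_mult_distrib mult.commute flip: power_mult)
      also have "\<dots> \<le> x * \<sigma>\<^sup>2" unfolding x_def by (intro mult_right_mono ypow) auto
      finally show "(N * M)\<^sup>2 \<le> x * \<sigma>\<^sup>2" .
      have "N\<^sup>2 * M = D * N" by (simp add: D_def power2_eq_square)
      also have "\<dots> \<le> y ^ 103 * y ^ 55" using D F M1 y1 by (intro mult_mono) auto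
      also have "\<dots> \<le> x" unfolding x_def power_add[symmetric] by (rule ypow) simp
      finally show "N\<^sup>2 * M \<le> x" .
    qed
    also have "\<dots> \<le> 1200 * exp (4 * pi) * \<kappa> ^ 9 * real B ^ 6 * (real H * N * M)\<^sup>2 * (1 / \<sigma>\<^sup>2 + 2 / \<sigma>\<^sup>2 + 1 / \<sigma>\<^sup>2)"
    proof (intro mult_left_mono add_mono order.refl d)
      show "sqrt (x / (N ^ 3 * M\<^sup>2) + 1 / (real H * M) + x * (\<sigma>\<^sup>2) ^ 3 / (N ^ 4 * M\<^sup>2)) \<le> 2 / \<sigma>\<^sup>2"
        using a b c by (intro sqrt_le) linarith
    qed (use \<kappa> in auto)
    also have "\<dots> = (4800 * exp (4 * pi)) * (\<kappa> ^ 9 * real B ^ 6) * ((real H * D)\<^sup>2 * (1 / \<sigma>\<^sup>2))"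
      by (simp add: D_def mult_ac)
    also have "\<dots> \<le> (1000000 * exp (4 * pi)) * (\<kappa> ^ 12 * real B ^ 6) * ((real H * D)\<^sup>2 * (1 / \<sigma>\<^sup>2))"
      using \<kappa> by (intro mult_right_mono mult_mono power_increasing) auto
    finally show ?thesis using finish unfolding S_def x_def by (simp add: mult.assoc)
  qed
qed

section \<open>Dyadic boxes\<close>

definition box :: "nat list \<Rightarrow> nat list set" where
  "box js = {ns. list_all2 (\<lambda>j n. 2 ^ j \<le> n \<and> n < 2 ^ Suc j) js ns}"

lemma box_Nil [simp]: "box [] = {[]}"
  by (auto simp: box_def)

lemma box_Cons: "box (j # js) = (\<lambda>(n, ns). n # ns) ` ({2 ^ j..<2 ^ Suc j} \<times> box js)"
  by (auto simp: box_def list_all2_Cons1 image_iff)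

lemma inj_on_Cons_pair: "inj_on (\<lambda>(n, ns). n # ns) A"
  by (auto simp: inj_on_def)

lemma finite_box: "finite (box js)"
  by (induction js) (auto simp: box_Cons)

lemma card_box: "card (box js) = 2 ^ sum_list js"
proof (induction js)
  case (Cons j js)
  thus ?case
    unfolding box_Cons card_image[OF inj_on_Cons_pair]
    by (simp add: card_cartesian_product power_add)
qed simp

lemma length_box: "ns \<in> box js \<Longrightarrow> length ns = length js"
  by (auto simp: box_def dest: list_all2_lengthD)

lemma prod_list_box:
  assumes "ns \<in> box js"
  shows "2 ^ sum_list js \<le> prod_list ns" "prod_list ns \<le> 2 ^ length js * 2 ^ sum_list js"
proof -
  have "2 ^ sum_list js \<le> prod_list ns \<and> prod_list ns \<le> 2 ^ length js * 2 ^ sum_list js"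
    using assms
  proof (induction js arbitrary: ns)
    case (Cons j js)
    then obtain n ms where n: "ns = n # ms" "2 ^ j \<le> n" "n < 2 ^ Suc j" "ms \<in> box js"
      unfolding box_Cons by auto
    note IH = Cons.IH[OF n(4)]
    have "2 ^ j * 2 ^ sum_list js \<le> n * prod_list ms" using n IH by (intro mult_le_mono) auto
    moreover have "n * prod_list ms \<le> 2 ^ Suc j * (2 ^ length js * 2 ^ sum_list js)"
      using n IH by (intro mult_le_mono) auto
    ultimately show ?case by (simp add: n(1) power_add mult_ac)
  qed simp
  thus "2 ^ sum_list js \<le> prod_list ns" "prod_list ns \<le> 2 ^ length js * 2 ^ sum_list js" by auto
qed

lemma prod_list_box_pos: "ns \<in> box js \<Longrightarrow> 0 < prod_list ns"
  using prod_list_box(1)[of ns js] by (metis gr0I le_zero_eq power_eq_0_iff zero_neq_numeral)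

lemma sum_box_Cons:
  "(\<Sum>ns\<in>box (j # js). F (prod_list ns)) = (\<Sum>n\<in>{2 ^ j..<2 ^ Suc j}. \<Sum>ns\<in>box js. F (n * prod_list ns))"
  unfolding box_Cons sum.reindex[OF inj_on_Cons_pair]
  by (simp add: sum.cartesian_product case_prod_unfold)

lemma sum_box_append:
  "(\<Sum>ns\<in>box (js @ ks). F (prod_list ns)) = (\<Sum>u\<in>box js. \<Sum>v\<in>box ks. F (prod_list u * prod_list v))"
proof (induction js arbitrary: F)
  case (Cons j js)
  have "(\<Sum>ns\<in>box ((j # js) @ ks). F (prod_list ns)) = (\<Sum>n\<in>{2 ^ j..<2 ^ Suc j}. \<Sum>ns\<in>box (js @ ks). F (n * prod_list ns))"
    by (simp only: append_Cons sum_box_Cons)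
  also have "\<dots> = (\<Sum>n\<in>{2 ^ j..<2 ^ Suc j}. \<Sum>u\<in>box js. \<Sum>v\<in>box ks. F (n * (prod_list u * prod_list v)))"
    by (intro sum.cong refl Cons.IH)
  also have "\<dots> = (\<Sum>u\<in>box (j # js). \<Sum>v\<in>box ks. F (prod_list u * prod_list v))"
    unfolding sum_box_Cons[of "\<lambda>m. \<Sum>v\<in>box ks. F (m * prod_list v)"] by (simp add: mult.assoc)
  finally show ?case .
qed simp

text \<open>Brings a chosen variable to the front, where it can be split off as the smooth variable
  or as one factor of a type II sum.\<close>

lemma sum_box_rotate:
  "(\<Sum>ns\<in>box (js @ j # ks). F (prod_list ns)) = (\<Sum>ns\<in>box (j # js @ ks). F (prod_list ns))"
proof -
  have "(\<Sum>ns\<in>box (js @ j # ks). F (prod_list ns))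
      = (\<Sum>u\<in>box js. \<Sum>n\<in>{2 ^ j..<2 ^ Suc j}. \<Sum>v\<in>box ks. F (prod_list u * (n * prod_list v)))"
    unfolding sum_box_append by (intro sum.cong refl) (rule sum_box_Cons)
  also have "\<dots> = (\<Sum>n\<in>{2 ^ j..<2 ^ Suc j}. \<Sum>u\<in>box js. \<Sum>v\<in>box ks. F (n * (prod_list u * prod_list v)))"
    by (subst sum.swap) (simp add: mult_ac)
  also have "\<dots> = (\<Sum>n\<in>{2 ^ j..<2 ^ Suc j}. \<Sum>ns\<in>box (js @ ks). F (n * prod_list ns))"
    by (rule sum.cong[OF refl], rule sum_box_append[symmetric])
  also have "\<dots> = (\<Sum>ns\<in>box (j # js @ ks). F (prod_list ns))" by (rule sum_box_Cons[symmetric])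
  finally show ?thesis .
qed

lemma card_box_fibre_le: "card {ns \<in> box js. prod_list ns = m} \<le> divisor_count m ^ length js"
proof (cases "m = 0")
  case True
  have "{ns \<in> box js. prod_list ns = m} = {}" using prod_list_box_pos True by fastforce
  thus ?thesis by (simp only: card.empty)
next
  case False
  have "card {ns \<in> box js. prod_list ns = m} \<le> card {ns. length ns = length js \<and> prod_list ns = m}"
    using False by (intro card_mono card_factorizations_le) (auto dest: length_box)
  also have "\<dots> \<le> divisor_count m ^ length js" using False by (intro card_factorizations_le) simp
  finally show ?thesis .
qed

section \<open>Grouping the variables of a box into a type I or a type II sum\<close>

lemma first_large_prefix:
  fixes Y :: real
  assumes "1 < Y" "Y \<le> 2 ^ sum_list js"
  obtains js1 j js2 where "js = js1 @ j # js2" "2 ^ sum_list js1 < Y" "Y \<le> 2 ^ (sum_list js1 + j)"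
  using assms
proof (induction js arbitrary: thesis rule: rev_induct)
  case (snoc j js)
  show ?case
  proof (cases "Y \<le> 2 ^ sum_list js")
    case True
    obtain js1 i js2 where "js = js1 @ i # js2" "2 ^ sum_list js1 < Y" "Y \<le> 2 ^ (sum_list js1 + i)"
      using snoc.IH[OF _ snoc.prems(2) True] by blast
    thus ?thesis using snoc.prems(1)[of js1 i "js2 @ [j]"] by simp
  next
    case False
    thus ?thesis using snoc.prems(1)[of js j "[]"] snoc.prems(3) by simp
  qed
qed simp

text \<open>The hypotheses on \<open>y\<close>, \<open>k\<close> and \<open>B\<close> that hold with \<open>B = O(y\<^sup>\<epsilon>)\<close> once \<open>y\<close> is large.\<close>

definition admissible :: "nat \<Rightarrow> real \<Rightarrow> nat \<Rightarrow> bool" where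
  "admissible k y B \<longleftrightarrow> 1 \<le> k \<and> 768 * (2 ^ k) ^ 4 \<le> y \<and> log 2 (y ^ 400) + 1 \<le> real B \<and>
     (\<forall>n. 0 < n \<longrightarrow> real n \<le> y ^ 400 \<longrightarrow> divisor_count n ^ k \<le> B) \<and>
     (\<forall>n. real n \<le> y ^ 400 \<longrightarrow> (\<Sum>g=1..n. 1 / real g) \<le> real B)"

lemma admissible_basic:
  assumes "admissible k y B"
  shows "1 \<le> k" "768 \<le> y" "1 \<le> B" "\<And>n i. 0 < n \<Longrightarrow> real n \<le> y ^ 400 \<Longrightarrow> i \<le> k \<Longrightarrow> divisor_count n ^ i \<le> B"
proof -
  show "1 \<le> k" using assms by (simp add: admissible_def)
  have "1 \<le> ((2::real) ^ k) ^ 4" by (intro one_le_power) simp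
  moreover have "768 * (2 ^ k) ^ 4 \<le> y" using assms by (simp only: admissible_def)
  ultimately show y: "768 \<le> y" by linarith
  show d: "divisor_count n ^ i \<le> B" if "0 < n" "real n \<le> y ^ 400" "i \<le> k" for n i
  proof -
    have "divisor_count n ^ i \<le> divisor_count n ^ k"
      using divisor_count_pos[OF that(1)] that(3) by (intro power_increasing) auto
    thus ?thesis using assms that by (auto simp: admissible_def intro: order.trans)
  qed
  have "1 \<le> y ^ 400" using y by (intro one_le_power) simp
  thus "1 \<le> B" using d[of 1 1] \<open>1 \<le> k\<close> by (simp add: divisor_count_def)
qed

text \<open>The products over the two groups play the parts of m and n. A group of at most k
  variables has products within a ratio \<open>2 ^ k\<close>, which is the \<kappa> of the earlier
  estimates, and each value has at most \<open>B\<close> representations by the divisor bound. By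
  symmetry the smaller group is taken as m.\<close>

lemma type_II_boxes:
  fixes y \<delta> :: real and js ks :: "nat list" and H B k :: nat
  assumes adm: "admissible k y B" and len: "length js + length ks \<le> k" and H: "1 \<le> H"
    and \<delta>: "0 \<le> \<delta>" "\<delta> \<le> 1"
    and large: "y ^ 22 \<le> 2 ^ sum_list js" "y ^ 22 \<le> 2 ^ sum_list ks"
    and D: "y ^ 92 \<le> 2 ^ (sum_list js + sum_list ks)" "2 ^ (sum_list js + sum_list ks) \<le> y ^ 103"
    and H': "real H \<le> 2 ^ (sum_list js + sum_list ks) / y ^ 92"
  shows "(\<Sum>h\<in>{H..<2*H}. norm (\<Sum>u\<in>box js. \<Sum>v\<in>box ks. ee (real h * y ^ 195 / (real (prod_list u * prod_list v) + \<delta>))))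
    \<le> 1000 * exp (2 * pi) * (2 ^ k) ^ 6 * real B ^ 3 * (real H * y ^ 92)"
proof -
  have *: "(\<Sum>h\<in>{H..<2*H}. norm (\<Sum>u\<in>box js. \<Sum>v\<in>box ks. ee (real h * y ^ 195 / (real (prod_list u) * real (prod_list v) + \<delta>))))
    \<le> 1000 * exp (2 * pi) * (2 ^ k) ^ 6 * real B ^ 3 * (real H * y ^ 92)"
    if len: "length js + length ks \<le> k" and
      large: "y ^ 22 \<le> 2 ^ sum_list js" "(2::real) ^ sum_list js \<le> 2 ^ sum_list ks"
    and D: "y ^ 92 \<le> 2 ^ (sum_list js + sum_list ks)" "2 ^ (sum_list js + sum_list ks) \<le> y ^ 103"
    and H': "real H \<le> 2 ^ (sum_list js + sum_list ks) / y ^ 92" for js ks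
  proof (rule type_II_balanced[where M = "2 ^ sum_list js" and N = "2 ^ sum_list ks" and B = B])
    have y1: "1 \<le> y" using admissible_basic(2)[OF adm] by simp
    show "finite (box js)" "finite (box ks)" by (rule finite_box)+
    show "768 * (2 ^ k) ^ 4 \<le> y" "1 \<le> B"
      using adm admissible_basic(3)[OF adm] by (auto simp: admissible_def)
    have bnd: "2 ^ sum_list js \<le> real (prod_list u) \<and> real (prod_list u) \<le> 2 ^ k * 2 ^ sum_list js"
      if "u \<in> box js" "length js \<le> k" for u js
    proof -
      have "real (2 ^ sum_list js) \<le> real (prod_list u)" "real (prod_list u) \<le> real (2 ^ length js * 2 ^ sum_list js)"
        using prod_list_box[OF that(1)] by (simp_all only: of_nat_le_iff)
      moreover have "real (2 ^ length js * 2 ^ sum_list js) \<le> 2 ^ k * 2 ^ sum_list js"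
        using that(2) by (simp add: power_increasing)
      ultimately show ?thesis by (simp add: order.trans)
    qed
    show "2 ^ sum_list js \<le> real (prod_list u) \<and> real (prod_list u) \<le> 2 ^ k * 2 ^ sum_list js" if "u \<in> box js" for u
      using bnd[OF that] len by simp
    show "2 ^ sum_list ks \<le> real (prod_list v) \<and> real (prod_list v) \<le> 2 ^ k * 2 ^ sum_list ks" if "v \<in> box ks" for v
      using bnd[OF that] len by simp
    have fib: "card {u \<in> box js. prod_list u = m} \<le> B"
      if "length js \<le> k" "2 ^ k * 2 ^ sum_list js \<le> y ^ 400" for js m
    proof (cases "{u \<in> box js. prod_list u = m} = {}")
      case True
      show ?thesis unfolding True by simp
    next
      case False
      then obtain u where u: "u \<in> box js" "prod_list u = m" by auto
      have "0 < m" using prod_list_box_pos[OF u(1)] u(2) by simp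
      moreover have "real m \<le> y ^ 400" using bnd[OF u(1) that(1)] that(2) u(2) by linarith
      ultimately have "divisor_count m ^ length js \<le> B"
        using admissible_basic(4)[OF adm _ _ that(1)] by blast
      thus ?thesis using card_box_fibre_le[of js m] by linarith
    qed
    have ky: "2 ^ k \<le> y"
    proof -
      have "((2::real) ^ k) ^ 1 \<le> (2 ^ k) ^ 4" by (intro power_increasing) auto
      also have "\<dots> \<le> 768 * (2 ^ k) ^ 4" by simp
      finally show ?thesis using adm by (simp add: admissible_def)
    qed
    \<comment> \<open>The products of either group stay below \<open>y ^ 400\<close>, the range in
      which \<open>admissible\<close> controls divisor counts.\<close>
    have le: "2 ^ k * z \<le> y ^ 400" if "z \<le> y ^ 103" "0 \<le> z" for z
    proof -
      have "2 ^ k * z \<le> y * y ^ 103" using ky that y1 by (intro mult_mono) auto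
      also have "\<dots> = y ^ 104" by (simp flip: power_Suc)
      also have "\<dots> \<le> y ^ 400" using y1 by (intro power_increasing) auto
      finally show ?thesis .
    qed
    have "(2::real) ^ sum_list js \<le> 2 ^ (sum_list js + sum_list ks)" "(2::real) ^ sum_list ks \<le> 2 ^ (sum_list js + sum_list ks)"
      by (intro power_increasing; simp)+
    hence "(2::real) ^ sum_list js \<le> y ^ 103" "(2::real) ^ sum_list ks \<le> y ^ 103" using D(2) by linarith+
    thus "card {u \<in> box js. prod_list u = m} \<le> B" "card {u \<in> box ks. prod_list u = m} \<le> B" for m
      using len by (auto intro!: fib le)
    show "divisor_count n \<le> B" if "0 < n" "real n \<le> y ^ 400" for n
      using admissible_basic(4)[OF adm that, of 1] admissible_basic(1)[OF adm] by simp
    show "(\<Sum>g=1..n. 1 / real g) \<le> real B" if "real n \<le> y ^ 400" for n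
      using adm that by (simp add: admissible_def)
  qed (use \<delta> large D H H' in \<open>auto simp: power_add\<close>)
  show ?thesis
  proof (cases "(2::real) ^ sum_list js \<le> 2 ^ sum_list ks")
    case True
    thus ?thesis using *[OF len large(1) True D H'] by simp
  next
    case False
    have "(\<Sum>h\<in>{H..<2*H}. norm (\<Sum>u\<in>box js. \<Sum>v\<in>box ks. ee (real h * y ^ 195 / (real (prod_list u * prod_list v) + \<delta>))))
      = (\<Sum>h\<in>{H..<2*H}. norm (\<Sum>u\<in>box ks. \<Sum>v\<in>box js. ee (real h * y ^ 195 / (real (prod_list u) * real (prod_list v) + \<delta>))))"
      by (rule sum.cong[OF refl], rule arg_cong[where f = norm], rule trans[OF sum.swap]) (simp add: mult.commute)
    also have "\<dots> \<le> 1000 * exp (2 * pi) * (2 ^ k) ^ 6 * real B ^ 3 * (real H * y ^ 92)"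
      using False len large D H' by (intro *) (auto simp: add.commute)
    finally show ?thesis .
  qed
qed

text \<open>For each product m of the other variables, van der Corput must save \<sigma>. Up to
  constants the two conditions are x \<sigma>^3 \<le> D N^2, settled by 195 + 33 \<le> 92 + 140, and
  D \<sigma>^2 \<le> x, settled by 1 + 33 + 92 \<le> 195.\<close>

lemma type_I_box:
  fixes y \<delta> :: real and js :: "nat list" and h B k j :: nat and \<sigma> :: real
  assumes adm: "admissible k y B" and len: "length js \<le> k" and h: "1 \<le> h" "real h \<le> 2 * \<sigma>"
    and \<delta>: "0 \<le> \<delta>" "\<delta> \<le> 1"
    and large: "y ^ 70 \<le> 2 ^ j" and D: "2 ^ (j + sum_list js) = \<sigma> * y ^ 92" and \<sigma>: "1 \<le> \<sigma>" "\<sigma> \<le> y ^ 11"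
  shows "norm (\<Sum>n\<in>{2 ^ j..<2 ^ Suc j}. \<Sum>v\<in>box js. ee (real h * y ^ 195 / (real (n * prod_list v) + \<delta>)))
    \<le> 1000000 * y ^ 92"
proof -
  have y1: "1 \<le> y" using admissible_basic(2)[OF adm] by simp
  have ypow: "y ^ a \<le> y ^ b" if "a \<le> b" for a b using y1 that by (intro power_increasing) auto
  have \<sigma>pow: "\<sigma> ^ a \<le> y ^ (11 * a)" for a
    using power_mono[OF \<sigma>(2), of a] \<sigma>(1) by (simp add: power_mult)
  have ky: "2 ^ k \<le> y"
  proof -
    have "((2::real) ^ k) ^ 1 \<le> (2 ^ k) ^ 4" by (intro power_increasing) auto
    also have "\<dots> \<le> 768 * (2 ^ k) ^ 4" by simp
    finally show ?thesis using adm by (simp add: admissible_def)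
  qed
  define N where "N = (2::real) ^ j"
  define M where "M = (2::real) ^ sum_list js"
  have MN: "1 \<le> N" "1 \<le> M" "M * N = \<sigma> * y ^ 92" "y ^ 70 \<le> N"
    using D large by (auto simp: N_def M_def power_add mult.commute)
  define x where "x = y ^ 195"
  have x0: "0 < x" using y1 by (simp add: x_def)
  have each: "norm (\<Sum>n\<in>{2 ^ j..<2 ^ Suc j}. ee (real h * x / (real (prod_list v) * real n + \<delta>))) \<le> 256000 * N * (3 / \<sigma>)"
    if v: "v \<in> box js" for v
  proof -
    define m where "m = prod_list v"
    have m: "1 \<le> m" using prod_list_box_pos[OF v] by (simp add: m_def)
    have mM: "M \<le> real m" "real m \<le> 2 ^ k * M"
    proof -
      have "real (2 ^ sum_list js) \<le> real (prod_list v)" "real (prod_list v) \<le> real (2 ^ length js * 2 ^ sum_list js)"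
        using prod_list_box[OF v] by (simp_all only: of_nat_le_iff)
      moreover have "real (2 ^ length js * 2 ^ sum_list js) \<le> 2 ^ k * 2 ^ sum_list js"
        using len by (simp add: power_increasing)
      ultimately show "M \<le> real m" "real m \<le> 2 ^ k * M"
        unfolding m_def M_def by (simp_all only: of_nat_power of_nat_numeral order.trans)
    qed
    have "norm (\<Sum>n=2 ^ j..<2 ^ Suc j. ee (real h * x / (real m * real n + \<delta>)))
      \<le> 8000 * 2 ^ 5 * N * (sqrt (x * real h / (real m * N ^ 3)) + sqrt (real m * N / (x * real h)))"
    proof (rule type_I_sum[OF _ MN(1) m h(1) \<delta> x0])
      show "N \<le> real n \<and> real n \<le> 2 * N" if "n \<in> {2 ^ j..<2 ^ Suc j}" for n
      proof -
        have "real (2 ^ j) \<le> real n" "real n \<le> real (2 ^ Suc j)" using that by (simp_all only: of_nat_le_iff) auto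
        thus ?thesis by (simp add: N_def)
      qed
    qed (auto simp: N_def)
    also have "\<dots> \<le> 8000 * 2 ^ 5 * N * (2 / \<sigma> + 1 / \<sigma>)"
    proof (intro mult_left_mono add_mono)
      have "x * real h * \<sigma>\<^sup>2 \<le> x * (2 * \<sigma>) * \<sigma>\<^sup>2" using h x0 by (intro mult_right_mono mult_left_mono) auto
      also have "\<dots> = 2 * (x * \<sigma> ^ 3)" by (simp add: power_numeral_reduce)
      also have "\<dots> \<le> 2 * (y ^ 195 * y ^ 33)"
        unfolding x_def using \<sigma>pow[of 3] y1 by (intro mult_left_mono) auto
      also have "\<dots> \<le> 2 * (1 * y ^ 92 * (y ^ 70)\<^sup>2)" using ypow[of 228 232] by (simp flip: power_add power_mult)
      also have "\<dots> \<le> 2 * (\<sigma> * y ^ 92 * N\<^sup>2)"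
        using \<sigma> MN y1 by (intro mult_left_mono mult_mono power_mono) auto
      also have "\<dots> = 2 * (M * N ^ 3)" by (simp add: MN(3)[symmetric] power2_eq_square power3_eq_cube)
      also have "\<dots> \<le> 4 * (real m * N ^ 3)" using mM MN by (intro mult_mono mult_right_mono) auto
      finally have "x * real h / (real m * N ^ 3) \<le> (2 / \<sigma>)\<^sup>2"
        using \<sigma> m MN by (simp add: field_simps power2_eq_square)
      thus "sqrt (x * real h / (real m * N ^ 3)) \<le> 2 / \<sigma>" using \<sigma> by (intro real_le_lsqrt) auto
      have "real m * N * \<sigma>\<^sup>2 \<le> (2 ^ k * M) * N * \<sigma>\<^sup>2" using mM MN by (intro mult_right_mono) auto
      also have "\<dots> = 2 ^ k * (\<sigma> ^ 3 * y ^ 92)" using MN(3) by (simp add: power_numeral_reduce mult.assoc)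
      also have "\<dots> \<le> y * (y ^ 33 * y ^ 92)" using ky \<sigma>pow[of 3] y1 \<sigma> by (intro mult_mono) auto
      also have "\<dots> \<le> x * 1" unfolding x_def using ypow[of 126 195] by (simp flip: power_add power_Suc)
      also have "\<dots> \<le> x * real h" using h x0 by (intro mult_left_mono) auto
      finally have "real m * N / (x * real h) \<le> (1 / \<sigma>)\<^sup>2"
        using \<sigma> x0 h by (simp add: field_simps power2_eq_square)
      thus "sqrt (real m * N / (x * real h)) \<le> 1 / \<sigma>" using \<sigma> by (intro real_le_lsqrt) auto
    qed (use MN in auto)
    finally show ?thesis by (simp add: m_def add_divide_distrib[symmetric])
  qed
  have "norm (\<Sum>n\<in>{2 ^ j..<2 ^ Suc j}. \<Sum>v\<in>box js. ee (real h * x / (real (n * prod_list v) + \<delta>)))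
      = norm (\<Sum>v\<in>box js. \<Sum>n\<in>{2 ^ j..<2 ^ Suc j}. ee (real h * x / (real (prod_list v) * real n + \<delta>)))"
    by (subst sum.swap) (simp add: mult.commute)
  also have "\<dots> \<le> (\<Sum>v\<in>box js. 256000 * N * (3 / \<sigma>))"
    by (intro sum_norm_le each)
  also have "\<dots> = 768000 * (M * N) / \<sigma>" by (simp add: card_box M_def)
  also have "\<dots> = 768000 * y ^ 92" using \<sigma> by (simp add: MN(3))
  also have "\<dots> \<le> 1000000 * y ^ 92" using y1 by (intro mult_right_mono) auto
  finally show ?thesis by (simp add: x_def)
qed

text \<open>Take the shortest prefix whose size reaches y^22 and let j be its last exponent. If the
  part after j also reaches y^22, cutting there gives a type II sum. Otherwise the parts before and
  after j are both below y^22, so the variable of exponent j has size at least y^48 and is split off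
  against all the others: type II if these together reach y^22, and type I if not, since then 2^j
  \<ge> y^70.\<close>

lemma box_exponential_sum:
  fixes y \<delta> :: real and js :: "nat list" and H B k :: nat
  assumes adm: "admissible k y B" and len: "length js \<le> k" and H: "1 \<le> H"
    and \<delta>: "0 \<le> \<delta>" "\<delta> \<le> 1"
    and D: "y ^ 92 \<le> 2 ^ sum_list js" "2 ^ sum_list js \<le> y ^ 103"
    and H': "real H \<le> 2 ^ sum_list js / y ^ 92"
  shows "(\<Sum>h\<in>{H..<2*H}. norm (\<Sum>ns\<in>box js. ee (real h * y ^ 195 / (real (prod_list ns) + \<delta>))))
    \<le> 1000000 * exp (2 * pi) * (2 ^ k) ^ 6 * real B ^ 3 * (real H * y ^ 92)"
proof -
  let ?F = "\<lambda>h m. ee (real h * y ^ 195 / (real m + \<delta>))"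
  have y1: "768 \<le> y" "1 \<le> y" using admissible_basic(2)[OF adm] by auto
  have ypos: "0 < y ^ a" for a using y1 by simp
  have less: "1000 * exp (2 * pi) * (2 ^ k) ^ 6 * real B ^ 3 * (real H * y ^ 92)
      \<le> 1000000 * exp (2 * pi) * (2 ^ k) ^ 6 * real B ^ 3 * (real H * y ^ 92)"
    using y1 by (intro mult_right_mono) auto
  have "1 < y ^ 22" using y1 by (intro one_less_power) auto
  moreover have "y ^ 22 \<le> 2 ^ sum_list js"
    by (rule order.trans[OF _ D(1)]) (use y1 in \<open>intro power_increasing; simp\<close>)
  ultimately obtain js1 j js2 where js: "js = js1 @ j # js2" "2 ^ sum_list js1 < y ^ 22" "y ^ 22 \<le> 2 ^ (sum_list js1 + j)"
    by (rule first_large_prefix)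
  have sum_js: "sum_list js = sum_list js1 + j + sum_list js2" by (simp add: js(1))
  have sum_js1: "sum_list (js1 @ [j]) + sum_list js2 = sum_list js"
    and sum_js2: "sum_list [j] + sum_list (js1 @ js2) = sum_list js"
    by (simp_all add: sum_js)
  show ?thesis
  proof (cases "y ^ 22 \<le> 2 ^ sum_list js2")
    case True
    have e: "(\<Sum>ns\<in>box js. ?F h (prod_list ns)) = (\<Sum>u\<in>box (js1 @ [j]). \<Sum>v\<in>box js2. ?F h (prod_list u * prod_list v))" for h
      unfolding js(1) using sum_box_append[of "?F h" "js1 @ [j]" js2] by simp
    have "(\<Sum>h\<in>{H..<2*H}. norm (\<Sum>u\<in>box (js1 @ [j]). \<Sum>v\<in>box js2. ?F h (prod_list u * prod_list v)))
        \<le> 1000 * exp (2 * pi) * (2 ^ k) ^ 6 * real B ^ 3 * (real H * y ^ 92)"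
      by (rule type_II_boxes[OF adm _ H \<delta>]) (unfold sum_js1, use js len True D H' in auto)
    thus ?thesis unfolding e using less by linarith
  next
    case False
    have e: "(\<Sum>ns\<in>box js. ?F h (prod_list ns)) = (\<Sum>ns\<in>box ([j] @ (js1 @ js2)). ?F h (prod_list ns))" for h
      unfolding js(1) using sum_box_rotate[of "?F h" js1 j js2] by simp
    have j22: "y ^ 22 \<le> 2 ^ j"
    proof -
      have "y ^ 92 \<le> (2 ^ sum_list js1 * 2 ^ j) * 2 ^ sum_list js2" using D(1) by (simp add: sum_js power_add)
      also have "\<dots> \<le> (y ^ 22 * 2 ^ j) * y ^ 22" using js(2) False y1 by (intro mult_mono) auto
      finally have "y ^ 48 * y ^ 44 \<le> 2 ^ j * y ^ 44" by (simp add: mult_ac flip: power_add mult.assoc)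
      hence "y ^ 48 \<le> 2 ^ j" by (rule mult_right_le_imp_le[OF _ ypos])
      thus ?thesis by (rule order.trans[rotated]) (use y1 in \<open>intro power_increasing; simp\<close>)
    qed
    show ?thesis
    proof (cases "y ^ 22 \<le> 2 ^ sum_list (js1 @ js2)")
      case True
      have "(\<Sum>h\<in>{H..<2*H}. norm (\<Sum>u\<in>box [j]. \<Sum>v\<in>box (js1 @ js2). ?F h (prod_list u * prod_list v)))
          \<le> 1000 * exp (2 * pi) * (2 ^ k) ^ 6 * real B ^ 3 * (real H * y ^ 92)"
        by (rule type_II_boxes[OF adm _ H \<delta>]) (unfold sum_js2, use js len True j22 D H' in auto)
      moreover have e': "(\<Sum>ns\<in>box js. ?F h (prod_list ns)) = (\<Sum>u\<in>box [j]. \<Sum>v\<in>box (js1 @ js2). ?F h (prod_list u * prod_list v))" for h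
        unfolding e by (rule sum_box_append)
      ultimately show ?thesis unfolding e' using less by linarith
    next
      case False
      define \<sigma> where "\<sigma> = 2 ^ sum_list js / y ^ 92"
      have Ds: "2 ^ (j + sum_list (js1 @ js2)) = \<sigma> * y ^ 92"
        using ypos[of 92] by (simp add: \<sigma>_def sum_js add_ac)
      have \<sigma>: "1 \<le> \<sigma>" "\<sigma> \<le> y ^ 11"
      proof -
        show "1 \<le> \<sigma>" using D ypos[of 92] by (simp add: \<sigma>_def)
        have "\<sigma> * y ^ 92 \<le> y ^ 11 * y ^ 92" using D ypos[of 92] by (simp add: \<sigma>_def flip: power_add)
        thus "\<sigma> \<le> y ^ 11" by (rule mult_right_le_imp_le[OF _ ypos])
      qed
      have "y ^ 70 * y ^ 22 \<le> 2 ^ j * 2 ^ sum_list (js1 @ js2)"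
        using D(1) by (simp add: sum_js add_ac flip: power_add)
      also have "\<dots> \<le> 2 ^ j * y ^ 22" using False by (intro mult_left_mono) auto
      finally have j70: "y ^ 70 \<le> 2 ^ j" by (rule mult_right_le_imp_le[OF _ ypos])
      have "(\<Sum>h\<in>{H..<2*H}. norm (\<Sum>ns\<in>box (j # js1 @ js2). ?F h (prod_list ns)))
          \<le> (\<Sum>h\<in>{H..<2*H}. 1000000 * y ^ 92)"
      proof (rule sum_mono)
        fix h assume h: "h \<in> {H..<2*H}"
        have "real h \<le> 2 * real H" using h by auto
        also have "\<dots> \<le> 2 * \<sigma>" using H' by (simp add: \<sigma>_def)
        finally show "norm (\<Sum>ns\<in>box (j # js1 @ js2). ?F h (prod_list ns)) \<le> 1000000 * y ^ 92"
          unfolding sum_box_Cons[of "?F h"]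
          by (intro type_I_box[OF adm _ _ _ \<delta> j70 Ds \<sigma>]) (use h H len js(1) in auto)
      qed
      also have "\<dots> = 1000000 * (1 * 1 * 1) * (real H * y ^ 92)" by simp
      also have "\<dots> \<le> 1000000 * (exp (2 * pi) * (2 ^ k) ^ 6 * real B ^ 3) * (real H * y ^ 92)"
        using y1 admissible_basic(3)[OF adm]
        by (intro mult_right_mono mult_left_mono mult_mono one_le_power) auto
      finally show ?thesis unfolding e by (simp add: mult.assoc)
    qed
  qed
qed

section \<open>From exponential sums over a box to the sawtooth\<close>

lemma sum_dyadic_blocks:
  fixes f :: "nat \<Rightarrow> 'a::comm_monoid_add"
  shows "(\<Sum>h\<in>{1..<2 ^ n}. f h) = (\<Sum>i<n. \<Sum>h\<in>{2 ^ i..<2 * 2 ^ i}. f h)"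
proof (induction n)
  case (Suc n)
  have "(\<Sum>h\<in>{1..<2 ^ Suc n}. f h) = (\<Sum>h\<in>{1..<2 ^ n}. f h) + (\<Sum>h\<in>{2 ^ n..<2 ^ Suc n}. f h)"
    by (rule sum.atLeastLessThan_concat[symmetric]) auto
  thus ?case unfolding Suc by simp
qed simp

text \<open>Bounds for full dyadic blocks are converted to the weights 1/h at the cost of one
  logarithm. The last block may overshoot m, which is why the bound is assumed for every block that
  begins at or below m.\<close>

lemma sum_harmonic_weights_le:
  fixes a :: "nat \<Rightarrow> real"
  assumes nn: "\<And>h. 0 \<le> a h" and m: "1 \<le> m"
    and blk: "\<And>i. 2 ^ i \<le> m \<Longrightarrow> (\<Sum>h\<in>{2 ^ i..<2 * 2 ^ i}. a h) \<le> A * 2 ^ i"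
  shows "(\<Sum>h=1..m. a h / real h) \<le> (log 2 (real m) + 1) * A"
proof -
  obtain n where n: "2 ^ n \<le> m" "m < 2 ^ (n + 1)" using ex_power_ivl1[of 2 m] m by auto
  have A0: "0 \<le> A" using blk[of 0] m nn[of 1] by (simp add: atLeastLessThan_nat_numeral)
  have "(\<Sum>h=1..m. a h / real h) \<le> (\<Sum>h\<in>{1..<2 ^ (n + 1)}. a h / real h)"
    using n nn by (intro sum_mono2) auto
  also have "\<dots> = (\<Sum>i<n + 1. \<Sum>h\<in>{2 ^ i..<2 * 2 ^ i}. a h / real h)" by (rule sum_dyadic_blocks)
  also have "\<dots> \<le> (\<Sum>i<n + 1. A)"
  proof (rule sum_mono)
    fix i assume "i \<in> {..<n + 1}"
    hence "(2::nat) ^ i \<le> 2 ^ n" by (intro power_increasing) auto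
    hence i: "2 ^ i \<le> m" using n(1) by (rule order.trans)
    have "(\<Sum>h\<in>{2 ^ i..<2 * 2 ^ i}. a h / real h) \<le> (\<Sum>h\<in>{2 ^ i..<2 * 2 ^ i}. a h / 2 ^ i)"
    proof (rule sum_mono)
      fix h :: nat assume h: "h \<in> {2 ^ i..<2 * 2 ^ i}"
      hence "real (2 ^ i) \<le> real h" by (simp only: of_nat_le_iff) simp
      moreover from this have "0 < real h" by (rule order.strict_trans2[rotated]) simp
      ultimately show "a h / real h \<le> a h / 2 ^ i" using nn by (intro divide_left_mono) auto
    qed
    also have "\<dots> = (\<Sum>h\<in>{2 ^ i..<2 * 2 ^ i}. a h) / 2 ^ i" by (simp add: sum_divide_distrib)
    also have "\<dots> \<le> A" using blk[OF i] by (simp add: divide_le_eq)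
    finally show "(\<Sum>h\<in>{2 ^ i..<2 * 2 ^ i}. a h / real h) \<le> A" .
  qed
  also have "\<dots> = (real n + 1) * A" by simp
  also have "\<dots> \<le> (log 2 (real m) + 1) * A"
  proof (rule mult_right_mono[OF _ A0])
    have "real (2 ^ n) \<le> real m" using n(1) by (simp only: of_nat_le_iff)
    hence "2 powr real n \<le> real m" by (simp add: powr_realpow)
    thus "real n + 1 \<le> log 2 (real m) + 1" using m by (simp add: le_log_iff)
  qed
  finally show ?thesis .
qed

text \<open>With m = \<lfloor>\<sigma>\<rfloor> frequencies the first Erdos-Turan term is about
  D/\<sigma> = y^92, and the blocks with 2^i \<le> m are within the range of
  \<open>box_exponential_sum\<close>. For D < y^92 the trivial bound is already enough.\<close>

lemma box_psi_sum:
  fixes y \<delta> :: real and js :: "nat list" and B k :: nat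
  assumes adm: "admissible k y B" and len: "length js \<le> k" and \<delta>: "0 \<le> \<delta>" "\<delta> \<le> 1"
    and D: "2 ^ sum_list js \<le> y ^ 103"
  shows "\<bar>\<Sum>ns\<in>box js. psi (y ^ 195 / (real (prod_list ns) + \<delta>))\<bar>
    \<le> 60 * (2 + 1000000 * exp (2 * pi) * (2 ^ k) ^ 6) * (real B ^ 4 * y ^ 92)"
proof -
  define K where "K = 1000000 * exp (2 * pi) * (2 ^ k) ^ 6"
  have K0: "0 \<le> K" by (simp add: K_def)
  have y1: "1 \<le> y" using admissible_basic(2)[OF adm] by simp
  have y0: "0 < y ^ 92" using y1 by simp
  have B1: "1 \<le> real B" using admissible_basic(3)[OF adm] by simp
  have By: "y ^ 92 \<le> real B ^ 4 * y ^ 92"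
    using mult_right_mono[OF one_le_power[OF B1, of 4], of "y ^ 92"] y0 by simp
  have "\<bar>\<Sum>ns\<in>box js. psi (y ^ 195 / (real (prod_list ns) + \<delta>))\<bar> \<le> 60 * ((2 + K) * (real B ^ 4 * y ^ 92))"
  proof (cases "2 ^ sum_list js < y ^ 92")
    case True
    have "\<bar>\<Sum>ns\<in>box js. psi (y ^ 195 / (real (prod_list ns) + \<delta>))\<bar> \<le> (\<Sum>ns\<in>box js. 1 / 2)"
      by (rule order.trans[OF sum_abs], rule sum_mono, rule abs_psi_le)
    also have "\<dots> = 2 ^ sum_list js / 2" by (simp add: card_box)
    also have "\<dots> \<le> 1 * (real B ^ 4 * y ^ 92)" using True By y0 by linarith
    also have "\<dots> \<le> (60 * (2 + K)) * (real B ^ 4 * y ^ 92)" using K0 y0 by (intro mult_right_mono) auto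
    finally show ?thesis by (simp only: mult.assoc)
  next
    case False
    define \<sigma> where "\<sigma> = 2 ^ sum_list js / y ^ 92"
    define m where "m = nat \<lfloor>\<sigma>\<rfloor>"
    have \<sigma>1: "1 \<le> \<sigma>" using False y0 by (simp add: \<sigma>_def)
    have \<sigma>D: "2 ^ sum_list js = \<sigma> * y ^ 92" using y0 by (simp add: \<sigma>_def)
    have m1: "1 \<le> m" using \<sigma>1 by (simp add: m_def le_nat_iff le_floor_iff)
    have m\<sigma>: "real m \<le> \<sigma>" "\<sigma> \<le> 2 * real m" using \<sigma>1 m1 unfolding m_def by linarith+
    have m400: "real m \<le> y ^ 400"
    proof -
      have "\<sigma> * 1 \<le> \<sigma> * y ^ 92" using one_le_power[OF y1, of 92] \<sigma>1 by (intro mult_left_mono) auto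
      also have "\<dots> \<le> y ^ 103" using D \<sigma>D by simp
      also have "\<dots> \<le> y ^ 400" using y1 by (intro power_increasing) auto
      finally show ?thesis using m\<sigma> by linarith
    qed
    let ?S = "\<lambda>h. norm (\<Sum>ns\<in>box js. ee (real h * (y ^ 195 / (real (prod_list ns) + \<delta>))))"
    have "(\<Sum>h=1..m. ?S h / real h) \<le> (log 2 (real m) + 1) * (K * real B ^ 3 * y ^ 92)"
    proof (rule sum_harmonic_weights_le[OF _ m1])
      fix i assume i: "(2::nat) ^ i \<le> m"
      have "real (2 ^ i) \<le> \<sigma>" using i m\<sigma>(1) by (meson of_nat_le_iff order.trans)
      hence "(\<Sum>h\<in>{2 ^ i..<2 * 2 ^ i}. norm (\<Sum>ns\<in>box js. ee (real h * y ^ 195 / (real (prod_list ns) + \<delta>))))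
        \<le> 1000000 * exp (2 * pi) * (2 ^ k) ^ 6 * real B ^ 3 * (real (2 ^ i) * y ^ 92)"
        using False D unfolding \<sigma>_def by (intro box_exponential_sum[OF adm len _ \<delta>]) auto
      thus "(\<Sum>h\<in>{2 ^ i..<2 * 2 ^ i}. ?S h) \<le> K * real B ^ 3 * y ^ 92 * 2 ^ i"
        by (simp add: K_def mult_ac)
    qed simp
    also have "\<dots> \<le> real B * (K * real B ^ 3 * y ^ 92)"
    proof (rule mult_right_mono)
      have "log 2 (real m) \<le> log 2 (y ^ 400)" using m400 m1 by (intro log_mono) auto
      thus "log 2 (real m) + 1 \<le> real B" using adm by (simp add: admissible_def)
    qed (use K0 y0 in simp)
    also have "\<dots> = K * (real B ^ 4 * y ^ 92)" by (simp add: power_eq_if)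
    finally have hs: "(\<Sum>h=1..m. ?S h / real h) \<le> K * (real B ^ 4 * y ^ 92)" .
    have "\<sigma> * y ^ 92 / real m \<le> 2 * y ^ 92"
      using mult_right_mono[OF m\<sigma>(2), of "y ^ 92"] y0 m1 by (simp add: divide_le_eq mult_ac)
    hence cs: "real (card (box js)) / real m \<le> 2 * (real B ^ 4 * y ^ 92)"
      using By by (simp add: card_box \<sigma>D)
    have "\<bar>\<Sum>ns\<in>box js. psi (y ^ 195 / (real (prod_list ns) + \<delta>))\<bar>
      \<le> 60 * (real (card (box js)) / real m + (\<Sum>h=1..m. ?S h / real h))"
      by (rule Erdos_Turan_psi[OF finite_box m1])
    also have "\<dots> \<le> 60 * ((2 + K) * (real B ^ 4 * y ^ 92))"
      using add_mono[OF cs hs] by (simp only: distrib_right) simp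
    finally show ?thesis .
  qed
  thus ?thesis by (simp only: K_def mult.assoc)
qed

definition small_boxes :: "nat \<Rightarrow> real \<Rightarrow> nat list set" where
  "small_boxes k y = {js. length js = k \<and> 2 ^ sum_list js \<le> y ^ 103}"

text \<open>A union of whole boxes rather than the set of tuples with product at most
  \<open>y ^ 103\<close>, so that no box is cut by a hyperbolic condition. It contains all those
  tuples and possibly some with product up to 2^k times larger.\<close>

definition small_tuples :: "nat \<Rightarrow> real \<Rightarrow> nat list set" where
  "small_tuples k y = (\<Union>js\<in>small_boxes k y. box js)"

text \<open>Every exponent is at most the binary logarithm of y^400, hence less than
  \<open>B\<close>; this yields the bound \<open>B ^ k\<close> for the number of boxes.\<close>

lemma small_boxes_subset:
  assumes "admissible k y B"
  shows "small_boxes k y \<subseteq> {js. set js \<subseteq> {..<B} \<and> length js = k}"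
proof
  fix js assume js: "js \<in> small_boxes k y"
  have y1: "1 \<le> y" using admissible_basic(2)[OF assms] by simp
  have "j < B" if "j \<in> set js" for j
  proof -
    have "(2::real) ^ j \<le> 2 ^ sum_list js" using member_le_sum_list[OF that] by (intro power_increasing) auto
    also have "\<dots> \<le> y ^ 103" using js by (simp add: small_boxes_def)
    also have "\<dots> \<le> y ^ 400" using y1 by (intro power_increasing) auto
    finally have "2 powr real j \<le> y ^ 400" by (simp only: powr_realpow)
    hence "real j \<le> log 2 (y ^ 400)" using y1 by (simp add: le_log_iff)
    thus ?thesis using assms by (simp add: admissible_def)
  qed
  thus "js \<in> {js. set js \<subseteq> {..<B} \<and> length js = k}" using js by (auto simp: small_boxes_def)
qed

lemma card_small_boxes:
  assumes "admissible k y B"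
  shows "finite (small_boxes k y)" "card (small_boxes k y) \<le> B ^ k"
proof -
  have f: "finite {js. set js \<subseteq> {..<B} \<and> length js = k}" by (rule finite_lists_length_eq) simp
  show "finite (small_boxes k y)" by (rule finite_subset[OF small_boxes_subset[OF assms] f])
  have "card (small_boxes k y) \<le> card {js. set js \<subseteq> {..<B} \<and> length js = k}"
    by (rule card_mono[OF f small_boxes_subset[OF assms]])
  thus "card (small_boxes k y) \<le> B ^ k" by (simp add: card_lists_length_eq)
qed

lemma box_unique: "ns \<in> box js \<Longrightarrow> ns \<in> box is \<Longrightarrow> js = is"
proof (induction js arbitrary: ns "is")
  case Nil
  thus ?case by (auto simp: box_def)
next
  case (Cons j js)
  from Cons.prems obtain n ms i is' where *: "ns = n # ms" "is = i # is'"
      "2 ^ j \<le> n" "n < 2 ^ Suc j" "ms \<in> box js" "2 ^ i \<le> n" "n < 2 ^ Suc i" "ms \<in> box is'"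
    unfolding box_def by (auto simp: list_all2_Cons1 list_all2_Cons2)
  have "(2::nat) ^ j < 2 ^ Suc i" "(2::nat) ^ i < 2 ^ Suc j" using * by linarith+
  hence "j < Suc i" "i < Suc j" by (simp_all only: power_strict_increasing_iff[of "2::nat"] numeral_One)
  thus ?case using * Cons.IH[of ms is'] by simp
qed

lemma ex_box:
  assumes "\<forall>m\<in>set ns. 1 \<le> m"
  shows "\<exists>js. ns \<in> box js"
  using assms
proof (induction ns)
  case Nil
  have "[] \<in> box []" by simp
  thus ?case by blast
next
  case (Cons n ns)
  then obtain js where "ns \<in> box js" by auto
  moreover obtain j where "2 ^ j \<le> n" "n < 2 ^ (j + 1)" using ex_power_ivl1[of 2 n] Cons.prems by auto
  ultimately have "n # ns \<in> box (j # js)" by (simp add: box_def)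
  thus ?case by blast
qed

lemma small_tuples_length: "ns \<in> small_tuples k y \<Longrightarrow> length ns = k"
  by (auto simp: small_tuples_def small_boxes_def dest: length_box)

lemma small_tuples_pos: "ns \<in> small_tuples k y \<Longrightarrow> 0 < prod_list ns"
  by (auto simp: small_tuples_def dest: prod_list_box_pos)

lemma sum_small_tuples:
  assumes "admissible k y B"
  shows "(\<Sum>ns\<in>small_tuples k y. F ns) = (\<Sum>js\<in>small_boxes k y. \<Sum>ns\<in>box js. F ns)"
  unfolding small_tuples_def using card_small_boxes[OF assms]
  by (intro sum.UNION_disjoint) (auto simp: finite_box dest: box_unique)

lemma finite_small_tuples: "admissible k y B \<Longrightarrow> finite (small_tuples k y)"
  using card_small_boxes by (auto simp: small_tuples_def finite_box)

definition factorizations :: "nat \<Rightarrow> nat \<Rightarrow> nat list set" where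
  "factorizations k n = {ns. length ns = k \<and> (\<forall>m\<in>set ns. 1 \<le> m) \<and> prod_list ns = n}"

lemma tau_eq: "tau k n = card (factorizations k n)"
  by (simp add: tau_def factorizations_def)

lemma factorizations_bound:
  assumes "0 < n"
  shows "finite (factorizations k n)" "tau k n \<le> divisor_count n ^ k"
proof -
  have s: "factorizations k n \<subseteq> {ns. length ns = k \<and> prod_list ns = n}" by (auto simp: factorizations_def)
  show "finite (factorizations k n)" by (rule finite_subset[OF s card_factorizations_le(2)[OF assms]])
  have "tau k n \<le> card {ns. length ns = k \<and> prod_list ns = n}"
    unfolding tau_eq by (rule card_mono[OF card_factorizations_le(2)[OF assms] s])
  thus "tau k n \<le> divisor_count n ^ k" using card_factorizations_le(1)[OF assms, of k] by linarith
qed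

text \<open>The size of the box of a tuple is at most the product of the tuple, so all
  factorizations of n \<le> y^103 lie in small boxes. For larger n only some may be covered, and the
  inclusion serves as an upper bound.\<close>

lemma small_fibre:
  assumes "0 < n"
  shows "{ns \<in> small_tuples k y. prod_list ns = n} \<subseteq> factorizations k n"
    and "real n \<le> y ^ 103 \<Longrightarrow> {ns \<in> small_tuples k y. prod_list ns = n} = factorizations k n"
proof -
  show s: "{ns \<in> small_tuples k y. prod_list ns = n} \<subseteq> factorizations k n"
    using assms by (auto simp: factorizations_def dest: small_tuples_length)
      (metis less_numeral_extra(3) not_less_eq_eq le_zero_eq prod_list_zero_iff)
  assume n: "real n \<le> y ^ 103"
  have "factorizations k n \<subseteq> {ns \<in> small_tuples k y. prod_list ns = n}"
  proof
    fix ns assume ns: "ns \<in> factorizations k n"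
    then obtain js where js: "ns \<in> box js" using ex_box by (auto simp: factorizations_def)
    have "real (2 ^ sum_list js) \<le> real (prod_list ns)" using prod_list_box(1)[OF js] by (simp only: of_nat_le_iff)
    also have "\<dots> \<le> y ^ 103" using n ns by (simp add: factorizations_def)
    finally have "2 ^ sum_list js \<le> y ^ 103" by simp
    hence "js \<in> small_boxes k y" using ns length_box[OF js] by (simp add: small_boxes_def factorizations_def)
    thus "ns \<in> {ns \<in> small_tuples k y. prod_list ns = n}" using js ns by (auto simp: small_tuples_def factorizations_def)
  qed
  thus "{ns \<in> small_tuples k y. prod_list ns = n} = factorizations k n" using s by blast
qed

text \<open>[x/n] = d means x/(d+1) < n \<le> x/d, and d \<ge> 1 forces n \<le> x.\<close>

lemma card_floor_quotient:
  fixes x :: real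
  assumes "0 < x" "1 \<le> d"
  shows "real (card {n. 1 \<le> n \<and> real n \<le> x \<and> nat \<lfloor>x / real n\<rfloor> = d}) = of_int \<lfloor>x / real d\<rfloor> - of_int \<lfloor>x / (real d + 1)\<rfloor>"
proof -
  have "{n. 1 \<le> n \<and> real n \<le> x \<and> nat \<lfloor>x / real n\<rfloor> = d} = {nat \<lfloor>x / (real d + 1)\<rfloor><..nat \<lfloor>x / real d\<rfloor>}"
  proof (intro set_eqI)
    fix n
    show "n \<in> {n. 1 \<le> n \<and> real n \<le> x \<and> nat \<lfloor>x / real n\<rfloor> = d} \<longleftrightarrow> n \<in> {nat \<lfloor>x / (real d + 1)\<rfloor><..nat \<lfloor>x / real d\<rfloor>}"
    proof (cases "n = 0")
      case False
      have "nat \<lfloor>x / real n\<rfloor> = d \<longleftrightarrow> \<lfloor>x / real n\<rfloor> = int d" using assms by auto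
      also have "\<dots> \<longleftrightarrow> real d * real n \<le> x \<and> x < (real d + 1) * real n"
        using False by (simp add: floor_eq_iff pos_le_divide_eq pos_divide_less_eq)
      also have "real d * real n \<le> x \<longleftrightarrow> n \<le> nat \<lfloor>x / real d\<rfloor>"
        using assms by (simp add: le_nat_iff le_floor_iff pos_le_divide_eq mult.commute)
      also have "x < (real d + 1) * real n \<longleftrightarrow> nat \<lfloor>x / (real d + 1)\<rfloor> < n"
      proof -
        have "nat \<lfloor>x / (real d + 1)\<rfloor> < n \<longleftrightarrow> \<lfloor>x / (real d + 1)\<rfloor> < int n" using False by linarith
        also have "\<dots> \<longleftrightarrow> x / (real d + 1) < real n" by (simp add: floor_less_iff)
        also have "\<dots> \<longleftrightarrow> x < (real d + 1) * real n" by (simp add: pos_divide_less_eq mult.commute add_pos_nonneg)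
        finally show ?thesis by simp
      qed
      finally have *: "nat \<lfloor>x / real n\<rfloor> = d \<longleftrightarrow> n \<le> nat \<lfloor>x / real d\<rfloor> \<and> nat \<lfloor>x / (real d + 1)\<rfloor> < n" .
      have "real n \<le> x" if "nat \<lfloor>x / real n\<rfloor> = d"
      proof -
        have "1 \<le> \<lfloor>x / real n\<rfloor>" using that assms by linarith
        thus ?thesis using False by (simp add: le_floor_iff pos_le_divide_eq)
      qed
      thus ?thesis using * False by auto
    qed simp
  qed
  moreover have "\<lfloor>x / (real d + 1)\<rfloor> \<le> \<lfloor>x / real d\<rfloor>" using assms by (intro floor_mono divide_left_mono) auto
  moreover have "0 \<le> \<lfloor>x / (real d + 1)\<rfloor>" using assms by simp
  ultimately show ?thesis by (simp only: card_greaterThanAtMost)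
qed

text \<open>Both sides become sums over n of numbers of factorizations of q(n) = [x/n]: all of them,
  or those in \<open>small_tuples\<close>. They can differ only if q(n) > y^103; then n \<le> y^92,
  and each such n costs at most \<open>B\<close>.\<close>

lemma floor_sum_small_tuples:
  fixes y :: real
  assumes adm: "admissible k y B"
  shows "\<bar>floor_sum (\<lambda>n. real (tau k n)) (y ^ 195)
    - (\<Sum>ns\<in>small_tuples k y. of_int \<lfloor>y ^ 195 / real (prod_list ns)\<rfloor> - of_int \<lfloor>y ^ 195 / (real (prod_list ns) + 1)\<rfloor>)\<bar>
    \<le> real B * y ^ 92"
proof -
  define x where "x = y ^ 195"
  define N where "N = {n::nat. 1 \<le> n \<and> real n \<le> x}"
  define q where "q = (\<lambda>n::nat. nat \<lfloor>x / real n\<rfloor>)"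
  define T where "T = small_tuples k y"
  have y1: "1 \<le> y" using admissible_basic(2)[OF adm] by simp
  have x0: "0 < x" using y1 by (simp add: x_def)
  have finN: "finite N"
    by (rule finite_subset[of _ "{..nat \<lfloor>x\<rfloor>}"]) (auto simp: N_def le_nat_iff le_floor_iff)
  have finT: "finite T" unfolding T_def by (rule finite_small_tuples[OF adm])
  have q: "1 \<le> q n" "real (q n) \<le> x / real n" if "n \<in> N" for n
  proof -
    have "1 \<le> x / real n" using that by (simp add: N_def pos_le_divide_eq)
    thus "1 \<le> q n" "real (q n) \<le> x / real n" by (auto simp: q_def le_nat_iff le_floor_iff)
  qed
  have "(\<Sum>ns\<in>T. of_int \<lfloor>x / real (prod_list ns)\<rfloor> - of_int \<lfloor>x / (real (prod_list ns) + 1)\<rfloor>)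
      = (\<Sum>ns\<in>T. real (card {n \<in> N. q n = prod_list ns}))"
    using small_tuples_pos[of _ k y] unfolding T_def N_def q_def
    by (intro sum.cong[OF refl], subst card_floor_quotient[symmetric]) (auto simp: x0 Suc_le_eq)
  also have "\<dots> = (\<Sum>ns\<in>T. \<Sum>n\<in>N. if q n = prod_list ns then 1 else 0)"
    using finN by (simp add: sum.If_cases Int_def)
  also have "\<dots> = (\<Sum>n\<in>N. \<Sum>ns\<in>T. if prod_list ns = q n then 1 else 0)"
    by (rule trans[OF sum.swap]) (simp add: eq_commute)
  also have "\<dots> = (\<Sum>n\<in>N. real (card {ns \<in> T. prod_list ns = q n}))"
    using finT by (simp add: sum.If_cases Int_def)
  finally have main: "(\<Sum>ns\<in>T. of_int \<lfloor>x / real (prod_list ns)\<rfloor> - of_int \<lfloor>x / (real (prod_list ns) + 1)\<rfloor>)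
      = (\<Sum>n\<in>N. real (card {ns \<in> T. prod_list ns = q n}))" .
  have "\<bar>(\<Sum>n\<in>N. real (tau k (q n))) - (\<Sum>n\<in>N. real (card {ns \<in> T. prod_list ns = q n}))\<bar>
      \<le> (\<Sum>n\<in>N. \<bar>real (tau k (q n)) - real (card {ns \<in> T. prod_list ns = q n})\<bar>)"
    by (simp only: sum_subtractf[symmetric] sum_abs)
  also have "\<dots> \<le> (\<Sum>n\<in>N. if n \<in> {1..nat \<lfloor>y ^ 92\<rfloor>} then real B else 0)"
  proof (rule sum_mono)
    fix n assume n: "n \<in> N"
    have qn: "0 < q n" using q(1)[OF n] by simp
    show "\<bar>real (tau k (q n)) - real (card {ns \<in> T. prod_list ns = q n})\<bar> \<le> (if n \<in> {1..nat \<lfloor>y ^ 92\<rfloor>} then real B else 0)"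
    proof (cases "real (q n) \<le> y ^ 103")
      case True
      show ?thesis using small_fibre(2)[OF qn True, of k] by (simp add: T_def tau_eq)
    next
      case False
      have n0: "0 < real n" using n by (simp add: N_def)
      have "y ^ 103 * real n \<le> x" 
      proof -
        have "y ^ 103 * real n \<le> real (q n) * real n" using False by (intro mult_right_mono) auto
        also have "\<dots> \<le> x" using q(2)[OF n] n0 by (simp add: pos_le_divide_eq)
        finally show ?thesis .
      qed
      also have "x = y ^ 103 * y ^ 92" by (simp add: x_def flip: power_add)
      finally have "real n \<le> y ^ 92" by (rule mult_left_le_imp_le) (use y1 in simp)
      hence nn: "n \<in> {1..nat \<lfloor>y ^ 92\<rfloor>}" using n by (auto simp: N_def le_nat_iff le_floor_iff)
      have "card {ns \<in> T. prod_list ns = q n} \<le> tau k (q n)"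
        unfolding tau_eq T_def by (rule card_mono[OF factorizations_bound(1)[OF qn] small_fibre(1)[OF qn]])
      moreover have "real (tau k (q n)) \<le> real B"
      proof -
        have "x / real n \<le> x / 1" using n x0 by (intro divide_left_mono) (auto simp: N_def)
        hence "real (q n) \<le> x" using q(2)[OF n] by simp
        also have "x \<le> y ^ 400" unfolding x_def using y1 by (intro power_increasing) auto
        finally have "divisor_count (q n) ^ k \<le> B" using admissible_basic(4)[OF adm qn] by simp
        thus ?thesis using factorizations_bound(2)[OF qn, of k] by linarith
      qed
      ultimately show ?thesis using nn by auto
    qed
  qed
  also have "\<dots> \<le> (\<Sum>n\<in>{1..nat \<lfloor>y ^ 92\<rfloor>}. real B)"
    unfolding sum.inter_filter[OF finN, symmetric] by (intro sum_mono2) auto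
  also have "\<dots> = real (nat \<lfloor>y ^ 92\<rfloor>) * real B" by simp
  also have "\<dots> \<le> y ^ 92 * real B"
    by (intro mult_right_mono of_nat_floor) (use y1 in auto)
  finally show ?thesis using main
    unfolding floor_sum_def T_def N_def q_def x_def by (simp add: mult.commute)
qed

text \<open>In [t] = t - psi t - 1/2 the halves cancel between d and d + 1, and the linear parts
  combine to x/(d (d + 1)). The power of \<open>B\<close> is 4 from each box plus k from the number
  of boxes.\<close>

lemma small_tuples_error:
  fixes y :: real
  assumes adm: "admissible k y B"
  shows "\<bar>floor_sum (\<lambda>n. real (tau k n)) (y ^ 195)
    - y ^ 195 * (\<Sum>ns\<in>small_tuples k y. 1 / (real (prod_list ns) * (real (prod_list ns) + 1)))\<bar>
    \<le> 121 * (2 + 1000000 * exp (2 * pi) * (2 ^ k) ^ 6) * (real B ^ (k + 4) * y ^ 92)"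
proof -
  define x where "x = y ^ 195"
  define K where "K = 60 * (2 + 1000000 * exp (2 * pi) * (2 ^ k) ^ 6)"
  define T where "T = small_tuples k y"
  have K: "60 \<le> K" by (simp add: K_def)
  have y1: "1 \<le> y" using admissible_basic(2)[OF adm] by simp
  have y0: "0 < y ^ 92" using y1 by simp
  have B1: "1 \<le> real B" using admissible_basic(3)[OF adm] by simp
  have P: "\<bar>\<Sum>ns\<in>T. psi (x / (real (prod_list ns) + \<delta>))\<bar> \<le> K * (real B ^ (k + 4) * y ^ 92)" if \<delta>: "0 \<le> \<delta>" "\<delta> \<le> 1" for \<delta>
  proof -
    have "\<bar>\<Sum>ns\<in>T. psi (x / (real (prod_list ns) + \<delta>))\<bar>
        \<le> (\<Sum>js\<in>small_boxes k y. \<bar>\<Sum>ns\<in>box js. psi (x / (real (prod_list ns) + \<delta>))\<bar>)"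
      unfolding T_def sum_small_tuples[OF adm] by (rule sum_abs)
    also have "\<dots> \<le> (\<Sum>js\<in>small_boxes k y. K * (real B ^ 4 * y ^ 92))"
      unfolding x_def K_def by (intro sum_mono box_psi_sum[OF adm _ \<delta>]) (auto simp: small_boxes_def)
    also have "\<dots> = real (card (small_boxes k y)) * (K * (real B ^ 4 * y ^ 92))" by simp
    also have "\<dots> \<le> real (B ^ k) * (K * (real B ^ 4 * y ^ 92))"
      using card_small_boxes(2)[OF adm] K y0 by (intro mult_right_mono) (simp only: of_nat_le_iff, simp)
    also have "\<dots> = K * (real B ^ (k + 4) * y ^ 92)" by (simp add: power_add)
    finally show ?thesis .
  qed
  have "(\<Sum>ns\<in>T. of_int \<lfloor>x / real (prod_list ns)\<rfloor> - of_int \<lfloor>x / (real (prod_list ns) + 1)\<rfloor>)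
      = (\<Sum>ns\<in>T. x * (1 / (real (prod_list ns) * (real (prod_list ns) + 1)))
          - psi (x / (real (prod_list ns) + 0)) + psi (x / (real (prod_list ns) + 1)))"
  proof (rule sum.cong[OF refl])
    fix ns assume "ns \<in> T"
    hence d: "0 < real (prod_list ns)" using small_tuples_pos by (simp add: T_def)
    have "x / real (prod_list ns) - x / (real (prod_list ns) + 1) = x * (1 / (real (prod_list ns) * (real (prod_list ns) + 1)))"
      using d by (simp add: divide_simps) (simp add: algebra_simps)
    thus "of_int \<lfloor>x / real (prod_list ns)\<rfloor> - of_int \<lfloor>x / (real (prod_list ns) + 1)\<rfloor>
      = x * (1 / (real (prod_list ns) * (real (prod_list ns) + 1)))
          - psi (x / (real (prod_list ns) + 0)) + psi (x / (real (prod_list ns) + 1))"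
      unfolding psi_def frac_def by simp
  qed
  also have "\<dots> = x * (\<Sum>ns\<in>T. 1 / (real (prod_list ns) * (real (prod_list ns) + 1)))
      - (\<Sum>ns\<in>T. psi (x / (real (prod_list ns) + 0))) + (\<Sum>ns\<in>T. psi (x / (real (prod_list ns) + 1)))"
    by (simp only: sum.distrib sum_subtractf sum_distrib_left)
  finally have e: "(\<Sum>ns\<in>T. of_int \<lfloor>x / real (prod_list ns)\<rfloor> - of_int \<lfloor>x / (real (prod_list ns) + 1)\<rfloor>)
      = x * (\<Sum>ns\<in>T. 1 / (real (prod_list ns) * (real (prod_list ns) + 1)))
      - (\<Sum>ns\<in>T. psi (x / (real (prod_list ns) + 0))) + (\<Sum>ns\<in>T. psi (x / (real (prod_list ns) + 1)))" .
  have "real B ^ 1 * y ^ 92 \<le> real B ^ (k + 4) * y ^ 92"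
    using B1 y0 by (intro mult_right_mono power_increasing) auto
  hence "\<bar>floor_sum (\<lambda>n. real (tau k n)) x - x * (\<Sum>ns\<in>T. 1 / (real (prod_list ns) * (real (prod_list ns) + 1)))\<bar>
      \<le> 1 * (real B ^ (k + 4) * y ^ 92) + 2 * (K * (real B ^ (k + 4) * y ^ 92))"
    using floor_sum_small_tuples[OF adm] P[of 0] P[of 1] e unfolding x_def T_def by simp
  also have "\<dots> = (1 + 2 * K) * (real B ^ (k + 4) * y ^ 92)" by (simp only: distrib_right mult.assoc)
  also have "\<dots> \<le> 121 * (2 + 1000000 * exp (2 * pi) * (2 ^ k) ^ 6) * (real B ^ (k + 4) * y ^ 92)"
    using y0 by (intro mult_right_mono) (auto simp: K_def)
  finally show ?thesis by (simp only: x_def T_def)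
qed

section \<open>The series and the final estimate\<close>

lemma harmonic_le_ln:
  assumes "1 \<le> n"
  shows "(\<Sum>g=1..n. 1 / real g) \<le> 1 + ln (real n)"
  using assms
proof (induction n rule: dec_induct)
  case (step n)
  have "ln (real n / real (Suc n)) \<le> real n / real (Suc n) - 1"
    using step by (intro ln_le_minus_one) auto
  also have "\<dots> = - 1 / real (Suc n)" by (simp add: field_simps)
  finally have "1 / real (Suc n) \<le> ln (real (Suc n)) - ln (real n)"
    using step by (simp add: ln_div)
  thus ?case using step.IH by simp
qed simp

text \<open>The mean value theorem for z^(-u) dominates terms of order d^(-u-1) by telescoping
  differences.\<close>

lemma powr_telescope:
  fixes u :: real and d :: nat
  assumes u: "0 < u" and d: "1 \<le> d"
  shows "u * (real d + 1) powr (- u - 1) \<le> real d powr (- u) - real (Suc d) powr (- u)"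
proof -
  have "\<exists>z. real d < z \<and> z < real d + 1 \<and>
      (real d + 1) powr (- u) - real d powr (- u) = (real d + 1 - real d) * (- u * z powr (- u - 1))"
  proof (rule MVT2)
    fix z assume "real d \<le> z" "z \<le> real d + 1"
    thus "((\<lambda>z. z powr (- u)) has_real_derivative - u * z powr (- u - 1)) (at z)"
      using d by (intro has_real_derivative_powr) auto
  qed simp
  then obtain z where z: "real d < z" "z < real d + 1"
      "(real d + 1) powr (- u) - real d powr (- u) = - u * z powr (- u - 1)" by auto
  have "(real d + 1) powr (- u - 1) \<le> z powr (- u - 1)" using z u by (intro powr_mono2') auto
  hence "u * (real d + 1) powr (- u - 1) \<le> u * z powr (- u - 1)" using u by (intro mult_left_mono) auto
  thus ?thesis using z(3) by (simp add: add.commute)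
qed

lemma tau_bound:
  assumes "1 \<le> k" "0 < e"
  obtains C where "0 \<le> C" "\<And>n. 0 < n \<Longrightarrow> real (divisor_count n ^ k) \<le> C * real n powr e"
proof -
  obtain C where C: "1 \<le> C" "\<And>n. 0 < n \<Longrightarrow> real (divisor_count n) \<le> C * real n powr (e / real k)"
    using divisor_bound[of "e / real k"] assms by auto
  have "real (divisor_count n ^ k) \<le> C ^ k * real n powr e" if "0 < n" for n
  proof -
    have "real (divisor_count n) ^ k \<le> (C * real n powr (e / real k)) ^ k"
      using C(2)[OF that] by (intro power_mono) auto
    also have "\<dots> = C ^ k * real n powr e" using that assms by (simp add: power_mult_distrib powr_power)
    finally show ?thesis by simp
  qed
  thus ?thesis using C(1) by (intro that[of "C ^ k"]) auto
qed

text \<open>The divisor bound makes the terms O(n^(e-2)), and \<open>powr_telescope\<close> sums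
  them. Stated for finite sets with one constant c, the bound serves both summability, with Y = 1,
  and the tail beyond y^103.\<close>

lemma tau_tail_bound:
  assumes k: "1 \<le> k" and e: "0 < e" "e \<le> 1 / 2"
  obtains c where "0 \<le> c"
    "\<And>Y F. 0 < Y \<Longrightarrow> finite F \<Longrightarrow> F \<subseteq> {n. 1 \<le> n \<and> Y \<le> real n} \<Longrightarrow>
      (\<Sum>n\<in>F. real (tau k n) / (real n * (real n + 1))) \<le> c * Y powr (e - 1)"
proof -
  obtain C where C: "0 \<le> C" "\<And>n. 0 < n \<Longrightarrow> real (divisor_count n ^ k) \<le> C * real n powr e"
    using tau_bound[OF k e(1)] by blast
  define u where "u = 1 - e"
  have u: "1 / 2 \<le> u" "0 < u" using e by (auto simp: u_def)
  have term_le: "real (tau k n) / (real n * (real n + 1)) \<le> 4 * C * (real n powr (- u) - real (Suc n) powr (- u))"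
    if n: "1 \<le> n" for n
  proof -
    have "real (tau k n) \<le> real (divisor_count n ^ k)"
      using factorizations_bound(2)[of n k] n by (simp only: of_nat_le_iff)
    also have "\<dots> \<le> C * real n powr e" using C(2) n by simp
    also have "\<dots> \<le> C * (real n + 1) powr e" using C(1) e by (intro mult_left_mono powr_mono2) auto
    finally have "real (tau k n) / (real n * (real n + 1)) \<le> C * (real n + 1) powr e / (real n * (real n + 1))"
      using n by (intro divide_right_mono) auto
    also have "\<dots> \<le> C * (real n + 1) powr e / ((real n + 1) * (real n + 1) / 2)"
    proof (intro divide_left_mono)
      have "(real n + 1) / 2 * (real n + 1) \<le> real n * (real n + 1)" using n by (intro mult_right_mono) auto
      thus "(real n + 1) * (real n + 1) / 2 \<le> real n * (real n + 1)" by simp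
    qed (use n C(1) in \<open>auto intro!: mult_pos_pos\<close>)
    also have "\<dots> = 2 * C * (real n + 1) powr (- u - 1)"
    proof -
      have "- u - 1 = e - 2" by (simp add: u_def)
      hence "(real n + 1) powr (- u - 1) = (real n + 1) powr e / ((real n + 1) * (real n + 1))"
        by (simp only: powr_diff) (simp add: power2_eq_square)
      thus ?thesis by simp
    qed
    \<comment> \<open>As u \<ge> 1/2, the factor 4 u is at least 2; this supplies the u of the
      telescoping bound.\<close>
    also have "\<dots> \<le> (4 * C * u) * (real n + 1) powr (- u - 1)"
      using mult_left_mono[OF u(1) C(1)] by (intro mult_right_mono) auto
    also have "\<dots> = 4 * C * (u * (real n + 1) powr (- u - 1))" by simp
    also have "\<dots> \<le> 4 * C * (real n powr (- u) - real (Suc n) powr (- u))"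
      using powr_telescope[OF u(2) n] C(1) by (intro mult_left_mono) auto
    finally show ?thesis .
  qed
  have "(\<Sum>n\<in>F. real (tau k n) / (real n * (real n + 1))) \<le> (4 * C) * Y powr (e - 1)"
    if Y: "0 < Y" and F: "finite F" "F \<subseteq> {n. 1 \<le> n \<and> Y \<le> real n}" for Y F
  proof (cases "F = {}")
    case True
    thus ?thesis using C(1) by simp
  next
    case False
    define a where "a = Min F"
    define b where "b = Suc (Max F)"
    have a: "1 \<le> a" "Y \<le> real a" using Min_in[OF F(1) False] F(2) unfolding a_def by auto
    have ab: "a \<le> b" using F(1) False by (auto simp: a_def b_def le_Suc_eq)
    have Fab: "F \<subseteq> {a..<b}" using F(1) by (auto simp: a_def b_def less_Suc_eq_le)
    have "(\<Sum>n\<in>F. real (tau k n) / (real n * (real n + 1))) \<le> (\<Sum>n\<in>{a..<b}. real (tau k n) / (real n * (real n + 1)))"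
      using Fab by (intro sum_mono2) auto
    also have "\<dots> \<le> (\<Sum>n\<in>{a..<b}. 4 * C * (real n powr (- u) - real (Suc n) powr (- u)))"
      using a(1) by (intro sum_mono term_le) auto
    also have "\<dots> = 4 * C * (\<Sum>n\<in>{a..<b}. real n powr (- u) - real (Suc n) powr (- u))"
      by (rule sum_distrib_left[symmetric])
    also have "(\<Sum>n\<in>{a..<b}. real n powr (- u) - real (Suc n) powr (- u)) = real a powr (- u) - real b powr (- u)"
      using sum_Suc_diff'[OF ab, of "\<lambda>n. - (real n powr (- u))"] by simp
    also have "4 * C * (real a powr (- u) - real b powr (- u)) \<le> 4 * C * Y powr (- u)"
    proof (intro mult_left_mono)
      have "real a powr (- u) \<le> Y powr (- u)" using a Y u by (intro powr_mono2') auto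
      thus "real a powr (- u) - real b powr (- u) \<le> Y powr (- u)" using powr_ge_zero[of "real b" "- u"] by linarith
    qed (use C in simp)
    finally show ?thesis by (simp add: u_def)
  qed
  thus ?thesis using C(1) by (intro that[of "4 * C"]) auto
qed

lemma tau_series_summable:
  assumes "1 \<le> k"
  shows "(\<lambda>n. real (tau k n) / (real n * (real n + 1))) summable_on {1..}"
proof -
  obtain c where c: "0 \<le> c" "\<And>Y F. 0 < Y \<Longrightarrow> finite F \<Longrightarrow> F \<subseteq> {n. 1 \<le> n \<and> Y \<le> real n} \<Longrightarrow>
      (\<Sum>n\<in>F. real (tau k n) / (real n * (real n + 1))) \<le> c * Y powr (1 / 2 - 1)"
    using tau_tail_bound[OF assms, of "1 / 2"] by auto
  show ?thesis
  proof (rule nonneg_bdd_above_summable_on)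
    show "bdd_above (sum (\<lambda>n. real (tau k n) / (real n * (real n + 1))) ` {F. F \<subseteq> {1..} \<and> finite F})"
      using c(2)[of 1] by (intro bdd_aboveI2[where M = c]) auto
  qed simp
qed

text \<open>Counting only the factorizations in small boxes gives weights between 0 and
  \<open>tau\<close>, equal to \<open>tau\<close> up to y^103. The sum over tuples is therefore at
  most the series, and short of it by no more than the tail.\<close>

lemma tau_series_small_tuples:
  fixes y c e :: real
  assumes adm: "admissible k y B"
    and c: "\<And>Y F. 0 < Y \<Longrightarrow> finite F \<Longrightarrow> F \<subseteq> {n. 1 \<le> n \<and> Y \<le> real n} \<Longrightarrow>
      (\<Sum>n\<in>F. real (tau k n) / (real n * (real n + 1))) \<le> c * Y powr (e - 1)"
  shows "\<bar>(\<Sum>ns\<in>small_tuples k y. 1 / (real (prod_list ns) * (real (prod_list ns) + 1)))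
    - (\<Sum>\<^sub>\<infinity>n\<in>{1..}. real (tau k n) / (real n * (real n + 1)))\<bar> \<le> c * (y ^ 103) powr (e - 1)"
proof -
  define T where "T = small_tuples k y"
  define f where "f = (\<lambda>n. real (tau k n) / (real n * (real n + 1)))"
  define g where "g = (\<lambda>n. real (card {ns \<in> T. prod_list ns = n}) / (real n * (real n + 1)))"
  have y1: "1 \<le> y" using admissible_basic(2)[OF adm] by simp
  have finT: "finite T" unfolding T_def by (rule finite_small_tuples[OF adm])
  have summ: "f summable_on {1..}" unfolding f_def by (rule tau_series_summable[OF admissible_basic(1)[OF adm]])
  have gf: "g n \<le> f n" if "1 \<le> n" for n
  proof -
    have "card {ns \<in> T. prod_list ns = n} \<le> tau k n"
      unfolding tau_eq T_def using that by (intro card_mono factorizations_bound(1) small_fibre(1)) auto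
    thus ?thesis unfolding f_def g_def by (intro divide_right_mono) auto
  qed
  have P: "finite (prod_list ` T)" "prod_list ` T \<subseteq> {1..}"
    using finT small_tuples_pos by (auto simp: T_def Suc_le_eq)
  have "(\<Sum>ns\<in>T. 1 / (real (prod_list ns) * (real (prod_list ns) + 1)))
      = (\<Sum>n\<in>prod_list ` T. \<Sum>ns\<in>{ns \<in> T. prod_list ns = n}. 1 / (real (prod_list ns) * (real (prod_list ns) + 1)))"
    by (rule sum.image_gen[OF finT])
  also have "\<dots> = (\<Sum>n\<in>prod_list ` T. g n)"
    by (rule sum.cong[OF refl]) (simp add: g_def)
  finally have e: "(\<Sum>ns\<in>T. 1 / (real (prod_list ns) * (real (prod_list ns) + 1))) = sum g (prod_list ` T)" .
  have "sum g (prod_list ` T) \<le> sum f (prod_list ` T)" using P(2) by (intro sum_mono gf) auto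
  also have "\<dots> \<le> infsum f {1..}" by (rule finite_sum_le_infsum[OF summ P]) (simp add: f_def)
  finally have lower: "sum g (prod_list ` T) \<le> infsum f {1..}" .
  have "infsum f {1..} \<le> sum g (prod_list ` T) + c * (y ^ 103) powr (e - 1)"
  proof (rule infsum_le_finite_sums[OF summ])
    fix F :: "nat set" assume F: "finite F" "F \<subseteq> {1..}"
    define F1 where "F1 = {n \<in> F. real n \<le> y ^ 103}"
    define F2 where "F2 = {n \<in> F. \<not> real n \<le> y ^ 103}"
    have "sum f F1 = sum g F1"
    proof (rule sum.cong[OF refl])
      fix n assume "n \<in> F1"
      hence n: "0 < n" "real n \<le> y ^ 103" using F by (auto simp: F1_def)
      show "f n = g n" using small_fibre(2)[OF n, of k] by (simp add: f_def g_def T_def tau_eq)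
    qed
    also have "\<dots> = sum g (F1 \<inter> prod_list ` T)"
    proof (rule sum.mono_neutral_right)
      show "\<forall>n\<in>F1 - F1 \<inter> prod_list ` T. g n = 0"
      proof
        fix n assume "n \<in> F1 - F1 \<inter> prod_list ` T"
        hence em: "{ns \<in> T. prod_list ns = n} = {}" by auto
        show "g n = 0" unfolding g_def em by simp
      qed
    qed (use F in \<open>auto simp: F1_def\<close>)
    also have "\<dots> \<le> sum g (prod_list ` T)" using P(1) by (intro sum_mono2) (auto simp: g_def)
    finally have 1: "sum f F1 \<le> sum g (prod_list ` T)" .
    have 2: "sum f F2 \<le> c * (y ^ 103) powr (e - 1)"
      unfolding f_def using F y1 by (intro c) (auto simp: F2_def)
    have "sum f F = sum f F1 + sum f F2"
      unfolding F1_def F2_def using F(1) by (rule sum.Int_Diff[of F f "{n. real n \<le> y ^ 103}", THEN trans]) (auto intro!: arg_cong2[where f = "(+)"] sum.cong)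
    thus "sum f F \<le> sum g (prod_list ` T) + c * (y ^ 103) powr (e - 1)" using 1 2 by linarith
  qed
  thus ?thesis using lower e unfolding T_def f_def by linarith
qed

text \<open>B is the ceiling of A x^\<eta>, where A adds the constants required by the divisor bound
  and by the logarithmic conditions. The divisor bound is invoked with \<eta>/3 because 400/195 < 3;
  the logarithms are at most 6 ln x by the same inequality and ln 2 \<ge> 1/2.\<close>

lemma ex_admissible:
  assumes k: "1 \<le> k" and \<eta>: "0 < \<eta>"
  obtains C where "0 \<le> C"
    "\<And>x::real. 1 \<le> x \<Longrightarrow> 768 * (2 ^ k) ^ 4 \<le> x powr (1 / 195) \<Longrightarrow>
      \<exists>B. admissible k (x powr (1 / 195)) B \<and> real B \<le> C * x powr \<eta>"
proof -
  obtain C where C: "0 \<le> C" "\<And>n. 0 < n \<Longrightarrow> real (divisor_count n ^ k) \<le> C * real n powr (\<eta> / 3)"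
    using tau_bound[OF k, of "\<eta> / 3"] \<eta> by auto
  define A where "A = C + 6 / \<eta> + 1"
  have A: "0 \<le> A" using C \<eta> by (simp add: A_def)
  have "\<exists>B. admissible k (x powr (1 / 195)) B \<and> real B \<le> (A + 1) * x powr \<eta>"
    if x: "1 \<le> x" and large: "768 * (2 ^ k) ^ 4 \<le> x powr (1 / 195)" for x :: real
  proof (intro exI conjI)
    define B where "B = nat \<lceil>A * x powr \<eta>\<rceil>"
    have x\<eta>: "1 \<le> x powr \<eta>" using x \<eta> by (simp add: ge_one_powr_ge_zero)
    have AB: "A * x powr \<eta> \<le> real B" unfolding B_def by linarith
    show "real B \<le> (A + 1) * x powr \<eta>"
    proof -
      have "0 \<le> A * x powr \<eta>" using A by simp
      hence "real B \<le> A * x powr \<eta> + 1" unfolding B_def by linarith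
      thus ?thesis using x\<eta> by (simp only: distrib_right mult_1)
    qed
    have y400: "(x powr (1 / 195)) ^ 400 = x powr (400 / 195)" using x by (simp add: powr_power)
    have lnx: "6 * ln x + 1 \<le> (6 / \<eta> + 1) * x powr \<eta>"
      using ln_powr_bound[OF x \<eta>] x\<eta> by (simp add: distrib_right)
    have lnx0: "0 \<le> ln x" using x by simp
    have lnB: "6 * ln x + 1 \<le> real B"
    proof -
      have "(6 / \<eta> + 1) * x powr \<eta> \<le> A * x powr \<eta>" using C(1) by (intro mult_right_mono) (auto simp: A_def)
      thus ?thesis using lnx AB by linarith
    qed
    show "admissible k (x powr (1 / 195)) B"
      unfolding admissible_def y400
    proof (intro conjI allI impI)
      have "log 2 (x powr (400 / 195)) = 400 / 195 * ln x / ln 2" using x by (simp add: log_def ln_powr)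
      also have "\<dots> \<le> 3 * ln x / (1 / 2)"
        using ln2_ge_two_thirds lnx0 by (intro frac_le mult_right_mono) auto
      also have "\<dots> = 6 * ln x" by simp
      finally show "log 2 (x powr (400 / 195)) + 1 \<le> real B" using lnB by linarith
      show "divisor_count n ^ k \<le> B" if n: "0 < n" "real n \<le> x powr (400 / 195)" for n
      proof -
        have "real n powr (\<eta> / 3) \<le> (x powr (400 / 195)) powr (\<eta> / 3)" using n \<eta> by (intro powr_mono2) auto
        also have "\<dots> = x powr (400 / 195 * (\<eta> / 3))" by (simp only: powr_powr)
        also have "\<dots> \<le> x powr \<eta>" using x \<eta> by (intro powr_mono) auto
        finally have "C * real n powr (\<eta> / 3) \<le> C * x powr \<eta>" using C(1) by (rule mult_left_mono)
        also have "\<dots> \<le> A * x powr \<eta>" using \<eta> by (intro mult_right_mono) (auto simp: A_def)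
        finally have "real (divisor_count n ^ k) \<le> real B" using C(2)[OF n(1)] AB by linarith
        thus ?thesis by (simp only: of_nat_le_iff)
      qed
      show "(\<Sum>g=1..n. 1 / real g) \<le> real B" if n: "real n \<le> x powr (400 / 195)" for n
      proof (cases "n = 0")
        case False
        have "ln (real n) \<le> ln (x powr (400 / 195))" using n False x by (subst ln_le_cancel_iff) auto
        also have "\<dots> = 400 / 195 * ln x" using x by (simp add: ln_powr)
        also have "\<dots> \<le> 6 * ln x" using lnx0 by (intro mult_right_mono) auto
        finally show ?thesis using harmonic_le_ln[of n] False lnB by simp
      qed simp
    qed (use k large in auto)
  qed
  thus ?thesis using A by (intro that[of "A + 1"]) auto
qed

theorem theorem1p2:
  fixes k :: nat and \<epsilon> :: real
  assumes "k \<ge> 2" and "\<epsilon> > 0"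
  shows "(\<lambda>n. real (tau k n) / (real n * (real n + 1))) summable_on {1..} \<and>
    (\<lambda>x :: real. floor_sum (\<lambda>n. real (tau k n)) x
        - (\<Sum>\<^sub>\<infinity>n\<in>{1..}. real (tau k n) / (real n * (real n + 1))) * x)
      \<in> O[at_top](\<lambda>x. x powr (7/15 + 1/195 + \<epsilon>))"
proof
  have k: "1 \<le> k" using assms by simp
  show "(\<lambda>n. real (tau k n) / (real n * (real n + 1))) summable_on {1..}"
    by (rule tau_series_summable[OF k])
  define S where "S = (\<Sum>\<^sub>\<infinity>n\<in>{1..}. real (tau k n) / (real n * (real n + 1)))"
  \<comment> \<open>\<open>tau_tail_bound\<close> wants an exponent of at most 1/2, so \<epsilon> is
    capped.\<close>
  define e where "e = min \<epsilon> (1 / 2)"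
  have e: "0 < e" "e \<le> 1 / 2" "e \<le> \<epsilon>" using assms by (auto simp: e_def)
  obtain c where c: "0 \<le> c" "\<And>Y F. 0 < Y \<Longrightarrow> finite F \<Longrightarrow> F \<subseteq> {n. 1 \<le> n \<and> Y \<le> real n} \<Longrightarrow>
      (\<Sum>n\<in>F. real (tau k n) / (real n * (real n + 1))) \<le> c * Y powr (e - 1)"
    using tau_tail_bound[OF k e(1,2)] by blast
  \<comment> \<open>Chosen so that the factor \<open>B ^ (k + 4)\<close> costs x^\<epsilon>.\<close>
  define \<eta> where "\<eta> = \<epsilon> / real (k + 4)"
  have \<eta>: "0 < \<eta>" using assms by (simp add: \<eta>_def)
  obtain C where C: "0 \<le> C" "\<And>x::real. 1 \<le> x \<Longrightarrow> 768 * (2 ^ k) ^ 4 \<le> x powr (1 / 195) \<Longrightarrow>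
      \<exists>B. admissible k (x powr (1 / 195)) B \<and> real B \<le> C * x powr \<eta>"
    using ex_admissible[OF k \<eta>] by blast
  define K where "K = 121 * (2 + 1000000 * exp (2 * pi) * (2 ^ k) ^ 6)"
  have K: "0 \<le> K" by (simp add: K_def)
  have bound: "\<bar>floor_sum (\<lambda>n. real (tau k n)) x - S * x\<bar> \<le> (K * C ^ (k + 4) + c) * x powr (7/15 + 1/195 + \<epsilon>)"
    if x: "1 \<le> x" and large: "768 * (2 ^ k) ^ 4 \<le> x powr (1 / 195)" for x :: real
  proof -
    define y where "y = x powr (1 / 195)"
    obtain B where B: "admissible k y B" "real B \<le> C * x powr \<eta>" using C(2)[OF x large] by (auto simp: y_def)
    have yp: "y ^ n = x powr (real n / 195)" for n using x by (simp add: y_def powr_power)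
    have xy: "y ^ 195 = x" using x by (simp add: yp)
    define s where "s = (\<Sum>ns\<in>small_tuples k y. 1 / (real (prod_list ns) * (real (prod_list ns) + 1)))"
    have "\<bar>floor_sum (\<lambda>n. real (tau k n)) x - x * s\<bar> \<le> K * (real B ^ (k + 4) * y ^ 92)"
      using small_tuples_error[OF B(1)] by (simp only: xy K_def s_def)
    also have "\<dots> \<le> K * ((C ^ (k + 4) * x powr \<epsilon>) * y ^ 92)"
    proof (intro mult_left_mono mult_right_mono)
      have "real B ^ (k + 4) \<le> (C * x powr \<eta>) ^ (k + 4)" using B(2) by (intro power_mono) auto
      also have "\<dots> = C ^ (k + 4) * x powr \<epsilon>"
        using x unfolding power_mult_distrib by (subst powr_power) (auto simp: \<eta>_def)
      finally show "real B ^ (k + 4) \<le> C ^ (k + 4) * x powr \<epsilon>" .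
    qed (use K in \<open>auto simp: yp\<close>)
    also have "\<dots> = K * C ^ (k + 4) * x powr (7/15 + 1/195 + \<epsilon>)"
      by (simp add: yp powr_add[symmetric] mult.assoc add.commute)
    finally have 1: "\<bar>floor_sum (\<lambda>n. real (tau k n)) x - x * s\<bar> \<le> K * C ^ (k + 4) * x powr (7/15 + 1/195 + \<epsilon>)" .
    \<comment> \<open>Completing the series costs x (y^103)^(e-1), which is again y^92 up to a small
      power since 103 + 92 = 195.\<close>
    have "\<bar>s - S\<bar> \<le> c * (y ^ 103) powr (e - 1)"
      unfolding s_def S_def by (rule tau_series_small_tuples[OF B(1) c(2)])
    hence "x * \<bar>s - S\<bar> \<le> x * (c * (y ^ 103) powr (e - 1))" using x by (intro mult_left_mono) auto
    also have "\<dots> = c * (x powr 1 * x powr (103 / 195 * (e - 1)))" using x by (simp add: yp powr_powr)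
    also have "\<dots> = c * x powr (92 / 195 + 103 / 195 * e)" 
    proof -
      have "1 + 103 / 195 * (e - 1) = 92 / 195 + 103 / 195 * e" by (simp add: field_simps)
      thus ?thesis by (simp only: powr_add[symmetric])
    qed
    also have "\<dots> \<le> c * x powr (7/15 + 1/195 + \<epsilon>)"
      using x c(1) e by (intro mult_left_mono powr_mono) auto
    finally have 2: "\<bar>x * s - S * x\<bar> \<le> c * x powr (7/15 + 1/195 + \<epsilon>)"
      using x by (simp add: abs_mult right_diff_distrib[symmetric] mult.commute[of S])
    show ?thesis using 1 2 by (simp only: distrib_right)
  qed
  define A where "A = (768 * (2 ^ k) ^ 4 :: real)"
  have "eventually (\<lambda>x::real. A powr 195 \<le> x) at_top" by (rule eventually_ge_at_top)
  hence "eventually (\<lambda>x::real. 768 * (2 ^ k) ^ 4 \<le> x powr (1 / 195)) at_top"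
  proof eventually_elim
    case (elim x)
    have "0 < A" by (simp add: A_def)
    hence "A = (A powr 195) powr (1 / 195)" by (subst powr_powr) simp
    also have "\<dots> \<le> x powr (1 / 195)" using elim by (intro powr_mono2) auto
    finally show ?case unfolding A_def .
  qed
  hence "eventually (\<lambda>x::real. norm (floor_sum (\<lambda>n. real (tau k n)) x - S * x)
      \<le> (K * C ^ (k + 4) + c) * norm (x powr (7/15 + 1/195 + \<epsilon>))) at_top"
    using eventually_ge_at_top[of 1] by eventually_elim (use bound in simp)
  thus "(\<lambda>x. floor_sum (\<lambda>n. real (tau k n)) x - S * x) \<in> O[at_top](\<lambda>x. x powr (7/15 + 1/195 + \<epsilon>))"
    by (rule bigoI)
qed

end
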